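(* Suppose that either Hypothesis I or Hypothesis II (both written out in the context) holds. Let $\alpha>0$, and if $p=1$ assume in addition $\alpha\in(0,\frac{a\lambda_1}{2}]$. Then there is a function $p_2^{(\alpha)}:\mathbb{R}\times\Omega\to\mathbb{R}$ such that $p_2^{(\alpha)}(t,\cdot)$ is $\mathcal{F}$-measurable for each $t\in\mathbb{R}$, $p_2^{(\alpha)}(\cdot,\omega)$ is continuous and of at most polynomial growth as $|t|\to\infty$ for each $\omega\in\Omega$, and for all $x\in L^2(\Lambda)$, $\omega\in\Omega_0$, $s\in\mathbb{R}$: $$\|Z(t_2,s,x,\omega)\|_2^2\le\|Z(t_1,s,x,\omega)\|_2^2-\alpha\int_{t_1}^{t_2}\|Z(r,s,x,\omega)\|_2^2\,dr+\int_{t_1}^{t_2}p_2^{(\alpha)}(r,\omega)\,dr\quad\text{for all } s\le t_1\le t_2 .$$ In particular, $t\mapsto Z(t,s,x,\omega)$ is strongly right continuous in $L^2(\Lambda)$.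
   Context: Setting. $\Lambda\subset\mathbb{R}^d$ is a bounded open set; $\|\cdot\|_q$ is the norm of $L^q(\Lambda)$. $H_0^1(\Lambda)$ carries the norm $\|u\|_{H_0^1}^2=\int_\Lambda|\nabla u|^2d\xi$, $H:=H_0^1(\Lambda)^*$ carries the dual norm $\|\cdot\|_H$. $\lambda_1>0$ is the constant in Poincaré's inequality $\lambda_1\int_\Lambda f^2\,dx\le\int_\Lambda|\nabla f|^2dx$, $f\in H_0^1(\Lambda)$. $C_0^k(\Lambda)$ denotes $C^k$ functions with compact support in $\Lambda$. Nonlinearity. $\Phi:\mathbb{R}\to\mathbb{R}$ is continuous, $\Phi(0)=0$, and there are $p\in[1,\infty)$, $a\in(0,\infty)$, $c,c_1,c_2\in[0,\infty)$ such that for all $s,t\in\mathbb{R}$: (A1) $(\Phi(t)-\Phi(s))(t-s)\ge0$; (A2) $\Phi(s)s\ge a|s|^{p+1}-c$; (A3) $|\Phi(s)|\le c_1|s|^p+c_2$. Put $V:=L^{p+1}(\Lambda)\subset H$. Noise. $\Omega=C_0(\mathbb{R},\mathbb{R}^m)$ is the space of continuous paths $\omega:\mathbb{R}\to\mathbb{R}^m$ with $\omega(0)=0$, $\mathbb{P}$ is two-sided Wiener measure on $\Omega$ with completed $\sigma$-algebra $\mathcal{F}$, and $W_t(\omega)=\omega(t)$. For fixed $\varphi_1,\dots,\varphi_m\in C_0^1(\Lambda)$ put $QW_t(\omega)=\sum_{j=1}^m\omega_j(t)\varphi_j$. $\Omega_0\subset\Omega$ is a fixed set of full measure such that for every $\omega\in\Omega_0$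 and every $q\ge1$, $\|QW_t(\omega)\|_q^q$, $\|\nabla QW_t(\omega)\|_q^q$ and (if all $\varphi_j\in C_0^2(\Lambda)$) $\|\Delta QW_t(\omega)\|_q^q$ are of at most polynomial growth as $|t|\to\infty$. Pathwise equation. For $x\in H$, $s\in\mathbb{R}$, $\omega\in\Omega$, $Z(\cdot,s,x,\omega)\in L^{p+1}_{loc}([s,\infty);V)\cap C([s,\infty);H)$ is the unique solution of $Z_t=x-QW_s(\omega)+\int_s^t\Delta\Phi(Z_r+QW_r(\omega))\,dr$, $t\ge s$, i.e. for all $v\in V$ and $t\ge s$: $\langle Z_t,v\rangle_H=\langle x-QW_s(\omega),v\rangle_H-\int_s^t\int_\Lambda\Phi(Z_r+QW_r(\omega))\,v\,d\xi\,dr$. Hypothesis I. $\varphi_j\in C_0^2(\Lambda)$ for $1\le j\le m$, and there is a function $\zeta:\mathbb{R}\to\mathbb{R}$ with $\zeta(0)=0$ such that for all $s,t\in\mathbb{R}$: (A1)' $(\Phi(t)-\Phi(s))(t-s)\ge(\zeta(t)-\zeta(s))^2$; (A2)' $\zeta(s)^2\ge a|s|^{p+1}-c$, with $p,a,c$ as in (A2). Hypothesis II. $\varphi_j\in C_0^1(\Lambda)$ for $1\le j\le m$, $\Phi\in C^1(\mathbb{R})$, $\Phi'(r)>0$ for almost all $r\in\mathbb{R}$, $\big(\int_0^s\sqrt{\Phi'(r)}\,dr\big)^2\ge a|s|^{p+1}-c$ for all $s\in\mathbb{R}$, and for some $\tilde c_1\in[0,\infty)$, $\Phi'(s)\le\tilde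 c_1(|s|^{p-1}+1)$ for all $s\in\mathbb{R}$ (with the same $p,a,c$). *)

theory Defs
  imports "HOL-Probability.Probability" "HOL-Library.Landau_Symbols"
begin

section \<open>Classical derivatives and compactly supported functions\<close>

definition gradient :: "('a::euclidean_space \<Rightarrow> real) \<Rightarrow> 'a \<Rightarrow> 'a" where
  "gradient f x = (\<Sum>b\<in>Basis. frechet_derivative f (at x) b *\<^sub>R b)"

definition laplacian :: "('a::euclidean_space \<Rightarrow> real) \<Rightarrow> 'a \<Rightarrow> real" where
  "laplacian f x = (\<Sum>b\<in>Basis. frechet_derivative (\<lambda>y. frechet_derivative f (at y) b) (at x) b)"

fun Ck :: "nat \<Rightarrow> ('a::euclidean_space \<Rightarrow> real) \<Rightarrow> bool" where
  "Ck 0 f \<longleftrightarrow> continuous_on UNIV f"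
| "Ck (Suc k) f \<longleftrightarrow> (\<forall>x. f differentiable (at x)) \<and>
     (\<forall>b\<in>Basis. Ck k (\<lambda>x. frechet_derivative f (at x) b))"

text \<open>A compactly supported function on the open set \<open>\<Lambda>\<close> is identified with its extension by
  zero to the whole space, so that smoothness can be required on \<open>UNIV\<close>.\<close>

definition compactly_supported_in :: "'a::euclidean_space set \<Rightarrow> ('a \<Rightarrow> real) \<Rightarrow> bool" where
  "compactly_supported_in \<Lambda> f \<longleftrightarrow>
     compact (closure {x. f x \<noteq> 0}) \<and> closure {x. f x \<noteq> 0} \<subseteq> \<Lambda>"

definition C0k :: "nat \<Rightarrow> 'a::euclidean_space set \<Rightarrow> ('a \<Rightarrow> real) set" where
  "C0k k \<Lambda> = {f. Ck k f \<and> compactly_supported_in \<Lambda> f}"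

definition C0inf :: "'a::euclidean_space set \<Rightarrow> ('a \<Rightarrow> real) set" where
  "C0inf \<Lambda> = {f. (\<forall>k. Ck k f) \<and> compactly_supported_in \<Lambda> f}"


section \<open>The spaces \<open>L\<^sup>q\<close>, \<open>H\<^sub>0\<^sup>1\<close> and its dual\<close>

text \<open>Elements of \<open>L\<^sup>q(\<Lambda>)\<close> are represented by functions; their values outside \<open>\<Lambda>\<close> and on null
  sets are irrelevant.\<close>

definition Lq :: "real \<Rightarrow> 'a::euclidean_space set \<Rightarrow> ('a \<Rightarrow> 'b::euclidean_space) set" where
  "Lq q \<Lambda> = {f \<in> borel_measurable (lebesgue_on \<Lambda>).
               integrable (lebesgue_on \<Lambda>) (\<lambda>\<xi>. norm (f \<xi>) powr q)}"

definition Lq_norm :: "real \<Rightarrow> 'a::euclidean_space set \<Rightarrow> ('a \<Rightarrow> 'b::euclidean_space) \<Rightarrow> real" where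
  "Lq_norm q \<Lambda> f = (LINT \<xi>|lebesgue_on \<Lambda>. norm (f \<xi>) powr q) powr (1 / q)"

definition weak_gradient :: "'a::euclidean_space set \<Rightarrow> ('a \<Rightarrow> real) \<Rightarrow> ('a \<Rightarrow> 'a) \<Rightarrow> bool" where
  "weak_gradient \<Lambda> u G \<longleftrightarrow> G \<in> Lq 2 \<Lambda> \<and>
     (\<forall>\<psi>\<in>C0inf \<Lambda>. \<forall>b\<in>Basis.
        (LINT \<xi>|lebesgue_on \<Lambda>. u \<xi> * frechet_derivative \<psi> (at \<xi>) b)
        = - (LINT \<xi>|lebesgue_on \<Lambda>. (G \<xi> \<bullet> b) * \<psi> \<xi>))"

definition wgrad :: "'a::euclidean_space set \<Rightarrow> ('a \<Rightarrow> real) \<Rightarrow> 'a \<Rightarrow> 'a" where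
  "wgrad \<Lambda> u = (SOME G. weak_gradient \<Lambda> u G)"

text \<open>\<open>H\<^sub>0\<^sup>1(\<Lambda>)\<close> is the closure of the test functions in \<open>H\<^sup>1(\<Lambda>)\<close>.\<close>

definition H01 :: "'a::euclidean_space set \<Rightarrow> ('a \<Rightarrow> real) set" where
  "H01 \<Lambda> = {u \<in> Lq 2 \<Lambda>. (\<exists>G. weak_gradient \<Lambda> u G) \<and>
     (\<exists>\<psi>::nat \<Rightarrow> 'a \<Rightarrow> real. (\<forall>n. \<psi> n \<in> C0inf \<Lambda>) \<and>
        (\<lambda>n. Lq_norm 2 \<Lambda> (\<lambda>\<xi>. \<psi> n \<xi> - u \<xi>)) \<longlonglongrightarrow> 0 \<and>
        (\<lambda>n. Lq_norm 2 \<Lambda> (\<lambda>\<xi>. gradient (\<psi> n) \<xi> - wgrad \<Lambda> u \<xi>)) \<longlonglongrightarrow> 0)}"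

definition H01_norm :: "'a::euclidean_space set \<Rightarrow> ('a \<Rightarrow> real) \<Rightarrow> real" where
  "H01_norm \<Lambda> u = sqrt (LINT \<xi>|lebesgue_on \<Lambda>. (norm (wgrad \<Lambda> u \<xi>))\<^sup>2)"

text \<open>Functionals are total HOL functions, of which only the values on \<open>H01 \<Lambda>\<close> matter; equality
  in \<open>H\<close> is therefore agreement on \<open>H01 \<Lambda>\<close>.  Boundedness forces elements of \<open>H\<close> to respect
  equality almost everywhere.\<close>

type_synonym 'a functional = "('a \<Rightarrow> real) \<Rightarrow> real"

definition Hdual :: "'a::euclidean_space set \<Rightarrow> 'a functional set" where
  "Hdual \<Lambda> = {F.
     (\<forall>u\<in>H01 \<Lambda>. \<forall>v\<in>H01 \<Lambda>. F (\<lambda>\<xi>. u \<xi> + v \<xi>) = F u + F v) \<and>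
     (\<forall>u\<in>H01 \<Lambda>. \<forall>k. F (\<lambda>\<xi>. k * u \<xi>) = k * F u) \<and>
     (\<exists>B. \<forall>u\<in>H01 \<Lambda>. \<bar>F u\<bar> \<le> B * H01_norm \<Lambda> u)}"

definition Heq :: "'a::euclidean_space set \<Rightarrow> 'a functional \<Rightarrow> 'a functional \<Rightarrow> bool" where
  "Heq \<Lambda> F G \<longleftrightarrow> (\<forall>u\<in>H01 \<Lambda>. F u = G u)"

definition Hnorm :: "'a::euclidean_space set \<Rightarrow> 'a functional \<Rightarrow> real" where
  "Hnorm \<Lambda> F = (SUP u\<in>{u \<in> H01 \<Lambda>. H01_norm \<Lambda> u \<le> 1}. \<bar>F u\<bar>)"

text \<open>The dual norm comes from an inner product, which is recovered by polarization.\<close>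

definition Hinner :: "'a::euclidean_space set \<Rightarrow> 'a functional \<Rightarrow> 'a functional \<Rightarrow> real" where
  "Hinner \<Lambda> F G =
     ((Hnorm \<Lambda> (\<lambda>u. F u + G u))\<^sup>2 - (Hnorm \<Lambda> (\<lambda>u. F u - G u))\<^sup>2) / 4"

text \<open>The embedding of \<open>L\<^sup>2(\<Lambda>)\<close>, and hence of \<open>L\<^sup>q(\<Lambda>)\<close> for \<open>q \<ge> 2\<close> and bounded \<open>\<Lambda>\<close>, into \<open>H\<close>.\<close>

definition embH :: "'a::euclidean_space set \<Rightarrow> ('a \<Rightarrow> real) \<Rightarrow> 'a functional" where
  "embH \<Lambda> f = (\<lambda>u. LINT \<xi>|lebesgue_on \<Lambda>. f \<xi> * u \<xi>)"

definition poincare_constant :: "'a::euclidean_space set \<Rightarrow> real \<Rightarrow> bool" where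
  "poincare_constant \<Lambda> lam \<longleftrightarrow> lam > 0 \<and>
     (\<forall>f\<in>H01 \<Lambda>. lam * (LINT \<xi>|lebesgue_on \<Lambda>. (f \<xi>)\<^sup>2)
        \<le> (LINT \<xi>|lebesgue_on \<Lambda>. (norm (wgrad \<Lambda> f \<xi>))\<^sup>2))"

text \<open>The Bochner space \<open>L\<^sup>q\<^sub>l\<^sub>o\<^sub>c([s,\<infinity>); L\<^sup>q(\<Lambda>))\<close>: strong measurability is almost everywhere
  approximability by simple functions.\<close>

definition Lq_loc_Lq :: "real \<Rightarrow> 'a::euclidean_space set \<Rightarrow> real \<Rightarrow> (real \<Rightarrow> 'a \<Rightarrow> real) set" where
  "Lq_loc_Lq q \<Lambda> s = {z. (\<forall>t\<ge>s. z t \<in> Lq q \<Lambda>) \<and>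
     (\<exists>S::nat \<Rightarrow> real \<Rightarrow> 'a \<Rightarrow> real.
        (\<forall>n. simple_function (lebesgue_on {s..}) (S n) \<and> (\<forall>t\<ge>s. S n t \<in> Lq q \<Lambda>)) \<and>
        (AE t in lebesgue_on {s..}. (\<lambda>n. Lq_norm q \<Lambda> (\<lambda>\<xi>. S n t \<xi> - z t \<xi>)) \<longlonglongrightarrow> 0)) \<and>
     (\<forall>T\<ge>s. integrable (lebesgue_on {s..T}) (\<lambda>t. Lq_norm q \<Lambda> (z t) powr q))}"


section \<open>The nonlinearity\<close>

definition nonlinearity ::
  "real \<Rightarrow> real \<Rightarrow> real \<Rightarrow> real \<Rightarrow> real \<Rightarrow> (real \<Rightarrow> real) \<Rightarrow> bool" where
  "nonlinearity p a c c1 c2 \<Phi> \<longleftrightarrow>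
     1 \<le> p \<and> 0 < a \<and> 0 \<le> c \<and> 0 \<le> c1 \<and> 0 \<le> c2 \<and>
     continuous_on UNIV \<Phi> \<and> \<Phi> 0 = 0 \<and>
     (\<forall>s t. (\<Phi> t - \<Phi> s) * (t - s) \<ge> 0) \<and>
     (\<forall>s. \<Phi> s * s \<ge> a * \<bar>s\<bar> powr (p + 1) - c) \<and>
     (\<forall>s. \<bar>\<Phi> s\<bar> \<le> c1 * \<bar>s\<bar> powr p + c2)"

definition hypothesis_I ::
  "'a::euclidean_space set \<Rightarrow> ('m \<Rightarrow> 'a \<Rightarrow> real) \<Rightarrow> real \<Rightarrow> real \<Rightarrow> real \<Rightarrow> (real \<Rightarrow> real) \<Rightarrow> bool" where
  "hypothesis_I \<Lambda> \<phi> p a c \<Phi> \<longleftrightarrow>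
     (\<forall>j. \<phi> j \<in> C0k 2 \<Lambda>) \<and>
     (\<exists>\<zeta>::real \<Rightarrow> real. \<zeta> 0 = 0 \<and>
        (\<forall>s t. (\<Phi> t - \<Phi> s) * (t - s) \<ge> (\<zeta> t - \<zeta> s)\<^sup>2) \<and>
        (\<forall>s. (\<zeta> s)\<^sup>2 \<ge> a * \<bar>s\<bar> powr (p + 1) - c))"

text \<open>In HOL \<open>0 powr 0 = 0\<close>.  For \<open>p = 1\<close> this affects the last bound only at \<open>s = 0\<close>, and
  there only by a factor 2, which is absorbed in the existentially quantified constant.\<close>

definition hypothesis_II ::
  "'a::euclidean_space set \<Rightarrow> ('m \<Rightarrow> 'a \<Rightarrow> real) \<Rightarrow> real \<Rightarrow> real \<Rightarrow> real \<Rightarrow> (real \<Rightarrow> real) \<Rightarrow> bool" where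
  "hypothesis_II \<Lambda> \<phi> p a c \<Phi> \<longleftrightarrow>
     (\<forall>j. \<phi> j \<in> C0k 1 \<Lambda>) \<and>
     (\<forall>r. \<Phi> differentiable (at r)) \<and> continuous_on UNIV (deriv \<Phi>) \<and>
     (AE r in lebesgue. deriv \<Phi> r > 0) \<and>
     (\<forall>s. (LBINT r=ereal 0..ereal s. sqrt (deriv \<Phi> r))\<^sup>2 \<ge> a * \<bar>s\<bar> powr (p + 1) - c) \<and>
     (\<exists>c1'\<ge>0. \<forall>s. deriv \<Phi> s \<le> c1' * (\<bar>s\<bar> powr (p - 1) + 1))"


section \<open>The noise\<close>

definition path_space :: "(real \<Rightarrow> real ^ 'm) set" where
  "path_space = {\<omega>. continuous_on UNIV \<omega> \<and> \<omega> 0 = 0}"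

text \<open>The law on path space of a two-sided \<open>m\<close>-dimensional Brownian motion started at 0, on the
  \<open>\<sigma>\<close>-algebra generated by the evaluations (the Borel \<open>\<sigma>\<close>-algebra of locally uniform convergence):
  the increments over successive intervals and all their components are independent centred
  Gaussians.\<close>

definition two_sided_wiener_measure :: "(real \<Rightarrow> real ^ 'm) measure \<Rightarrow> bool" where
  "two_sided_wiener_measure P \<longleftrightarrow>
     prob_space P \<and>
     space P = path_space \<and>
     sets P = sigma_sets path_space {{\<omega> \<in> path_space. \<omega> t \<in> B} | t B. B \<in> sets borel} \<and>
     (\<forall>s t j. s < t \<longrightarrow>
        distributed P lborel (\<lambda>\<omega>. \<omega> t $ j - \<omega> s $ j) (normal_density 0 (sqrt (t - s)))) \<and>
     (\<forall>n (t::nat \<Rightarrow> real). strict_mono_on {..n} t \<longrightarrow>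
        prob_space.indep_vars P (\<lambda>_. borel)
          (\<lambda>(i, j) \<omega>. \<omega> (t (Suc i)) $ j - \<omega> (t i) $ j) ({..<n} \<times> (UNIV :: 'm set)))"

definition QW ::
  "('m::finite \<Rightarrow> 'a \<Rightarrow> real) \<Rightarrow> (real \<Rightarrow> real ^ 'm) \<Rightarrow> real \<Rightarrow> 'a \<Rightarrow> real" where
  "QW \<phi> \<omega> t = (\<lambda>\<xi>. \<Sum>j\<in>UNIV. \<omega> t $ j * \<phi> j \<xi>)"

definition poly_growth :: "(real \<Rightarrow> real) \<Rightarrow> bool" where
  "poly_growth f \<longleftrightarrow> (\<exists>n::nat. f \<in> O[at_infinity](\<lambda>t. t ^ n))"

definition good_noise_set ::
  "'a::euclidean_space set \<Rightarrow> ('m::finite \<Rightarrow> 'a \<Rightarrow> real) \<Rightarrow> (real \<Rightarrow> real ^ 'm) measure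
     \<Rightarrow> (real \<Rightarrow> real ^ 'm) set \<Rightarrow> bool" where
  "good_noise_set \<Lambda> \<phi> P \<Omega>0 \<longleftrightarrow>
     \<Omega>0 \<in> sets (completion P) \<and> emeasure (completion P) \<Omega>0 = 1 \<and>
     (\<forall>\<omega>\<in>\<Omega>0. \<forall>q\<ge>1.
        poly_growth (\<lambda>t. Lq_norm q \<Lambda> (QW \<phi> \<omega> t) powr q) \<and>
        poly_growth (\<lambda>t. Lq_norm q \<Lambda> (gradient (QW \<phi> \<omega> t)) powr q) \<and>
        ((\<forall>j. \<phi> j \<in> C0k 2 \<Lambda>) \<longrightarrow>
           poly_growth (\<lambda>t. Lq_norm q \<Lambda> (laplacian (QW \<phi> \<omega> t)) powr q)))"


section \<open>The pathwise equation\<close>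

text \<open>\<open>Z\<close> is \<open>H\<close>-valued; \<open>z\<close> is its \<open>V\<close>-valued version with \<open>V = L\<^sup>p\<^sup>+\<^sup>1(\<Lambda>)\<close>.  The double integral does
  not depend on the choice of \<open>z\<close>.\<close>

definition pathwise_solution ::
  "'a::euclidean_space set \<Rightarrow> real \<Rightarrow> (real \<Rightarrow> real) \<Rightarrow> ('m::finite \<Rightarrow> 'a \<Rightarrow> real)
     \<Rightarrow> real \<Rightarrow> 'a functional \<Rightarrow> (real \<Rightarrow> real ^ 'm) \<Rightarrow> (real \<Rightarrow> 'a functional) \<Rightarrow> bool" where
  "pathwise_solution \<Lambda> p \<Phi> \<phi> s x \<omega> Z \<longleftrightarrow>
     (\<forall>t\<ge>s. Z t \<in> Hdual \<Lambda>) \<and>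
     (\<forall>t\<ge>s. ((\<lambda>r. Hnorm \<Lambda> (\<lambda>u. Z r u - Z t u)) \<longlongrightarrow> 0) (at t within {s..})) \<and>
     (\<exists>z \<in> Lq_loc_Lq (p + 1) \<Lambda> s.
        (AE t in lebesgue_on {s..}. Heq \<Lambda> (Z t) (embH \<Lambda> (z t))) \<and>
        (\<forall>v \<in> Lq (p + 1) \<Lambda>. \<forall>t\<ge>s.
           Hinner \<Lambda> (Z t) (embH \<Lambda> v)
           = Hinner \<Lambda> (\<lambda>u. x u - embH \<Lambda> (QW \<phi> \<omega> s) u) (embH \<Lambda> v)
             - (LINT r|lebesgue_on {s..t}. LINT \<xi>|lebesgue_on \<Lambda>.
                  \<Phi> (z r \<xi> + QW \<phi> \<omega> r \<xi>) * v \<xi>)))"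

end

theory Submission
  imports Defs
begin

text \<open>Let \<open>J n\<close> be the resolvent of the Dirichlet Laplacian, \<open>J n f - \<Delta> (J n f) / n = f\<close>. The forms
  \<open>e n F = F (J n F)\<close> are finite on the dual of \<open>H\<^sub>0\<^sup>1\<close>, convex, and increase to the squared \<open>L\<^sup>2\<close> norm as
  \<open>n \<rightarrow> \<infinity>\<close>. Testing the equation with \<open>n (z - J n z)\<close>, whose potential is \<open>J n z\<close>, bounds the increments of
  \<open>e n (Z t)\<close> by the time integral of \<open>- 2 n \<langle>\<Phi>(Y), z - J n z\<rangle>\<close> with \<open>Y = z + QW\<close>. Since \<open>J n\<close> is symmetric, positive
  and sub-Markovian, this pairing inherits the pointwise inequality \<open>(\<zeta> t - \<zeta> s)\<^sup>2 \<le> (\<Phi> t - \<Phi> s) (t - s)\<close> (under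
  Hypothesis II, \<open>\<zeta>\<close> is the primitive of \<open>\<surd>\<Phi>'\<close>), so that Poincare's inequality and coercivity give a bound by
  \<open>- \<alpha> \<parallel>z\<parallel>\<^sup>2\<close> plus a power of \<open>1 + \<parallel>QW\<parallel>\<^sup>2\<close> uniformly in \<open>n\<close>. Letting \<open>n \<rightarrow> \<infinity>\<close> first shows that \<open>Z t\<close> is in \<open>L\<^sup>2\<close>, then the
  inequality; right continuity follows from weak continuity and the upper bound for the norm.\<close>

text \<open>The obstacle is regularity in time: \<open>Z\<close> is continuous only in the dual
  space, and \<open>z\<close> is only an L^{p+1} function of time, so no chain rule applies to the
  L^2 norm. The forms \<open>e n\<close> are continuous in time, and convexity bounds their
  increment over [r - h, r]; but the test function is then frozen at the base time r while the
  equation is integrated over [r - h, r]. Simple functions of time and an average over r bring the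
  two times together. In space the kernel of \<open>J n\<close> replaces the chain rule for
  gradients. Under Hypothesis I the noise is split off, since n (\<phi> - J n \<phi>) stays bounded
  for C^2 functions. Under Hypothesis II it stays inside the kernel, and a quarter of the dissipated
  energy pays for its increments. For n \<ge> 5 lam the spectral gap is at least 5/6 lam; 3/4 * 5/6
  minus 1/8 for the noise leaves lam a / 2 in front of |Y|^{p+1}, doubled in the final estimate. As
  (Y - QW)^2 \<le> 2 Y^2 + 2 QW^2, this pays for \<alpha> if 2 \<alpha> \<le> a lam, the restriction
  made for p = 1. The noise moves in a finite-dimensional space, where the L^2 norm controls suprema
  and Lipschitz constants.\<close>

abbreviation lb :: "real \<Rightarrow> real \<Rightarrow> real measure" where
  "lb a b \<equiv> lebesgue_on {a..b}"

abbreviation seq_tendsto :: "(nat \<Rightarrow> 'a::topological_space) \<Rightarrow> 'a \<Rightarrow> bool" (infixr "\<leadsto>" 60) where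
  "X \<leadsto> l \<equiv> (X \<longlongrightarrow> l) sequentially"

lemmas lb_integral_combine = Equivalence_Measurable_On_Borel.integral_combine

section \<open>Smooth functions with compact support\<close>

lemma has_derivative_frechet:
  "f differentiable (at x) \<Longrightarrow> (f has_derivative frechet_derivative f (at x)) (at x)"
  by (simp add: frechet_derivative_works)

text \<open>\<open>Ck\<close> recurses through \<open>frechet_derivative\<close>, which is a choice
  operator. A derivative that is known explicitly may take its place, and constants, sums, products
  and flat compositions enter the recursion this way.\<close>

lemma Ck_SucI:
  assumes "\<And>x. (f has_derivative D x) (at x)" "\<And>b. b \<in> Basis \<Longrightarrow> Ck k (\<lambda>x. D x b)"
  shows "Ck (Suc k) f"
proof -
  have "frechet_derivative f (at x) = D x" for x
    using frechet_derivative_at[OF assms(1)] by simp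
  then show ?thesis using assms by (auto simp: differentiable_def)
qed

lemma Ck_Suc_imp: "Ck (Suc k) f \<Longrightarrow> Ck k f"
proof (induction k arbitrary: f)
  case 0
  then show ?case
    by (auto intro!: continuous_at_imp_continuous_on differentiable_imp_continuous_within)
next
  case (Suc k)
  show ?case unfolding Ck.simps(2)[of k f]
  proof (intro conjI ballI)
    show "\<forall>x. f differentiable at x" using Suc.prems by simp
    fix b :: 'a assume "b \<in> Basis"
    then show "Ck k (\<lambda>x. frechet_derivative f (at x) b)"
      using Suc.prems Suc.IH by (metis Ck.simps(2))
  qed
qed

lemma Ck_le: "Ck n f \<Longrightarrow> k \<le> n \<Longrightarrow> Ck k f"
  by (induction n) (auto simp: le_Suc_eq simp del: Ck.simps(2) dest: Ck_Suc_imp)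

lemma Ck_imp_continuous: "Ck k f \<Longrightarrow> continuous_on S f"
  using Ck_le[of k f 0] by (auto intro: continuous_on_subset)

lemma Ck_Suc_has_derivative:
  "Ck (Suc k) f \<Longrightarrow> (f has_derivative frechet_derivative f (at x)) (at x)"
  by (simp add: has_derivative_frechet)

lemma Ck_const [simp]: "Ck k (\<lambda>x. c)"
proof (induction k arbitrary: c)
  case (Suc k)
  show ?case by (rule Ck_SucI[where D = "\<lambda>x h. 0"]) (use Suc in auto)
qed simp

lemma Ck_add: "Ck k f \<Longrightarrow> Ck k g \<Longrightarrow> Ck k (\<lambda>x. f x + g x)"
proof (induction k arbitrary: f g)
  case (Suc k)
  show ?case
    by (rule Ck_SucI[where D = "\<lambda>x h. frechet_derivative f (at x) h + frechet_derivative g (at x) h"])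
      (use Suc in \<open>auto intro!: derivative_eq_intros has_derivative_frechet\<close>)
qed (auto intro: continuous_intros)

lemma Ck_mult: "Ck k f \<Longrightarrow> Ck k g \<Longrightarrow> Ck k (\<lambda>x. f x * g x)"
proof (induction k arbitrary: f g)
  case (Suc k)
  have "Ck k (\<lambda>x. f x)" "Ck k (\<lambda>x. g x)" using Suc.prems by (auto dest: Ck_Suc_imp simp del: Ck.simps)
  then show ?case
    by (intro Ck_SucI[where D = "\<lambda>x h. f x * frechet_derivative g (at x) h + frechet_derivative f (at x) h * g x"])
      (use Suc in \<open>auto intro!: Suc.IH Ck_add has_derivative_mult has_derivative_frechet\<close>)
qed (auto intro: continuous_intros)

lemma Ck_cmult: "Ck k f \<Longrightarrow> Ck k (\<lambda>x. c * f x)"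
  by (intro Ck_mult Ck_const)

lemma Ck_minus: "Ck k f \<Longrightarrow> Ck k (\<lambda>x. - f x)"
  using Ck_cmult[of k f "-1"] by simp

lemma Ck_diff: "Ck k f \<Longrightarrow> Ck k g \<Longrightarrow> Ck k (\<lambda>x. f x - g x)"
  using Ck_add[OF _ Ck_minus] by fastforce

lemma Ck_sum: "(\<And>i. i \<in> I \<Longrightarrow> Ck k (f i)) \<Longrightarrow> Ck k (\<lambda>x. \<Sum>i\<in>I. f i x)"
  by (induction I rule: infinite_finite_induct) (auto intro: Ck_add)

lemma Ck_prod: "(\<And>i. i \<in> I \<Longrightarrow> Ck k (f i)) \<Longrightarrow> Ck k (\<lambda>x. \<Prod>i\<in>I. f i x)"
  by (induction I rule: infinite_finite_induct) (auto intro: Ck_mult)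

lemma Ck_inner: "Ck k (\<lambda>x. x \<bullet> c)"
proof (cases k)
  case (Suc j)
  then show ?thesis
    by (auto simp del: Ck.simps intro!: Ck_SucI[where D = "\<lambda>x h. h \<bullet> c"] derivative_eq_intros)
qed (auto intro: continuous_intros)

text \<open>The functions \<open>x\<^sup>-\<^sup>m exp(-1/x)\<close> for \<open>x > 0\<close>, extended by zero, are closed under
  differentiation up to linear combinations.\<close>

definition exp_flat :: "nat \<Rightarrow> real \<Rightarrow> real" where
  "exp_flat m x = (if x > 0 then inverse x ^ m * exp (- inverse x) else 0)"

text \<open>A single term of the exponential series is at most its sum.\<close>

lemma power_exp_bound:
  assumes "(y::real) \<ge> 0" shows "y ^ m * exp (- y) \<le> fact m"
proof -
  have "(\<Sum>n\<in>{m}. y ^ n /\<^sub>R fact n) \<le> (\<Sum>n. y ^ n /\<^sub>R fact n)"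
    by (rule sum_le_suminf[OF summable_exp_generic]) (use assms in auto)
  then have "y ^ m / fact m \<le> exp y" by (simp add: exp_def divide_inverse mult.commute)
  then show ?thesis by (simp add: exp_minus field_simps)
qed

lemma flat_nonneg: "0 \<le> exp_flat m x"
  by (auto simp: exp_flat_def)

lemma flat_pos: "0 < exp_flat m x \<longleftrightarrow> 0 < x"
  by (auto simp: exp_flat_def)

lemma flat_bound: "exp_flat m x \<le> fact m"
  using power_exp_bound[of "inverse x" m] by (auto simp: exp_flat_def)

text \<open>For positive arguments \<open>exp_flat m x\<close> is
  \<open>x * exp_flat (Suc m) x\<close>, and the second factor is bounded. This linear decay at the
  origin gives the derivative there.\<close>

lemma flat_bound_linear: "exp_flat m x \<le> fact (Suc m) * \<bar>x\<bar>"
proof (cases "x > 0")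
  case True
  have "exp_flat m x = x * exp_flat (Suc m) x" using True by (simp add: exp_flat_def)
  also have "\<dots> \<le> x * fact (Suc m)" using True by (intro mult_left_mono flat_bound) auto
  finally show ?thesis using True by (simp add: mult.commute)
next
  case False
  have "0 \<le> fact (Suc m) * \<bar>x\<bar>" by (intro mult_nonneg_nonneg) auto
  then show ?thesis using False by (simp add: exp_flat_def del: fact_Suc)
qed

lemma flat_deriv: "(exp_flat m has_real_derivative (exp_flat (m + 2) x - m * exp_flat (Suc m) x)) (at x)"
proof -
  consider "x > 0" | "x < 0" | "x = 0" by linarith
  then show ?thesis
  proof cases
    case 1
    have "((\<lambda>x. inverse x ^ m * exp (- inverse x)) has_real_derivative
      (exp_flat (m + 2) x - m * exp_flat (Suc m) x)) (at x)"
    proof -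
      have "((\<lambda>x. inverse x ^ m * exp (- inverse x)) has_real_derivative
        (m * (- (inverse x * 1 * inverse x)) * inverse x ^ (m - 1)) * exp (- inverse x) +
        (exp (- inverse x) * - (- (inverse x * 1 * inverse x))) * inverse x ^ m) (at x)"
        using 1 by (auto intro!: derivative_eq_intros)
      moreover have "(m * (- (inverse x * 1 * inverse x)) * inverse x ^ (m - 1)) * exp (- inverse x) +
        (exp (- inverse x) * - (- (inverse x * 1 * inverse x))) * inverse x ^ m =
        exp_flat (m + 2) x - m * exp_flat (Suc m) x"
        using 1 by (cases m) (simp_all add: exp_flat_def algebra_simps)
      ultimately show ?thesis by simp
    qed
    then show ?thesis
      by (rule has_field_derivative_transform_within_open[where S = "{0<..}"])
        (use 1 in \<open>auto simp: exp_flat_def\<close>)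
  next
    case 2
    have "((\<lambda>x. 0) has_real_derivative (exp_flat (m + 2) x - m * exp_flat (Suc m) x)) (at x)"
      using 2 by (simp add: exp_flat_def)
    then show ?thesis
      by (rule has_field_derivative_transform_within_open[where S = "{..<0}"])
        (use 2 in \<open>auto simp: exp_flat_def\<close>)
  next
    case 3
    \<comment> \<open>The difference quotient of \<open>exp_flat m\<close> at the origin is
      \<open>exp_flat (Suc m)\<close> itself, so its limit is all that is needed.\<close>
    have "(\<lambda>h. exp_flat (Suc m) h) \<midarrow>0\<rightarrow> 0"
    proof (rule Lim_null_comparison[where g = "\<lambda>h. fact (Suc (Suc m)) * \<bar>h\<bar>"])
      show "\<forall>\<^sub>F h in at 0. norm (exp_flat (Suc m) h) \<le> fact (Suc (Suc m)) * \<bar>h\<bar>"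
        using flat_nonneg flat_bound_linear by (auto intro!: always_eventually simp del: fact_Suc)
      show "(\<lambda>h. fact (Suc (Suc m)) * \<bar>h\<bar>) \<midarrow>0\<rightarrow> (0::real)"
        by (rule tendsto_eq_intros refl)+ simp
    qed
    moreover have "(exp_flat m (0 + h) - exp_flat m 0) / h = exp_flat (Suc m) h" for h
      by (auto simp: exp_flat_def field_simps)
    ultimately show ?thesis using 3 by (simp add: DERIV_def) (simp add: exp_flat_def)
  qed
qed

lemma flat_continuous: "continuous_on S (exp_flat m)"
  by (rule continuous_on_subset[OF DERIV_continuous_on[OF DERIV_subset[OF flat_deriv]]]) auto

text \<open>The derivative is \<open>exp_flat 2\<close>, which is bounded by \<open>fact 2\<close>;
  hence the constant 2. The maximum principle uses this bound to pass to the limit in its test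
  functions.\<close>

lemma flat0_lipschitz: "\<bar>exp_flat 0 x - exp_flat 0 y\<bar> \<le> 2 * \<bar>x - y\<bar>"
proof -
  have "norm (exp_flat 0 x - exp_flat 0 y) \<le> 2 * norm (x - y)"
  proof (rule field_differentiable_bound[where S = UNIV and f' = "exp_flat 2"])
    show "(exp_flat 0 has_field_derivative exp_flat 2 z) (at z within UNIV)" for z
      using flat_deriv[of 0 z] by (simp add: numeral_2_eq_2)
    show "norm (exp_flat 2 z) \<le> 2" for z using flat_bound[of 2 z] flat_nonneg[of 2 z] by simp
  qed auto
  then show ?thesis by simp
qed

lemma flat_comp_has_derivative:
  assumes "(h has_derivative D) (at x)"
  shows "((\<lambda>x. exp_flat m (h x)) has_derivative
    (\<lambda>v. (exp_flat (m + 2) (h x) - m * exp_flat (Suc m) (h x)) * D v)) (at x)"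
  using has_derivative_compose[OF assms, of "exp_flat m"
      "\<lambda>v. (exp_flat (m + 2) (h x) - m * exp_flat (Suc m) (h x)) * v"] flat_deriv[of m "h x"]
  by (simp add: has_field_derivative_def)

text \<open>The chain rule produces other members of the family, so the induction runs over all
  \<open>m\<close> at once.\<close>

lemma Ck_flat: "Ck k h \<Longrightarrow> Ck k (\<lambda>x. exp_flat m (h x))"
proof (induction k arbitrary: m)
  case 0
  then show ?case
    using continuous_on_compose2[OF flat_continuous[of UNIV m], of UNIV h] by simp
next
  case (Suc k)
  have "Ck k h" using Suc.prems by (rule Ck_Suc_imp)
  then show ?case
    by (intro Ck_SucI[OF flat_comp_has_derivative[OF Ck_Suc_has_derivative[OF Suc.prems]]])
      (use Suc in \<open>auto intro!: Ck_mult Ck_diff Ck_cmult Suc.IH\<close>)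
qed

section \<open>Compact support, gradients and integration by parts\<close>

lemma compactly_supported_inI:
  assumes "compact C" "C \<subseteq> \<Lambda>" "\<And>x. x \<notin> C \<Longrightarrow> f x = 0"
  shows "compactly_supported_in \<Lambda> f"
proof -
  have "closure {x. f x \<noteq> 0} \<subseteq> C"
    using assms by (intro closure_minimal) (auto simp: compact_imp_closed)
  then show ?thesis using assms unfolding compactly_supported_in_def
    by (metis closed_closure compact_Int_closed inf.absorb_iff2 subset_trans)
qed

lemma compactly_supported_inE:
  assumes "compactly_supported_in \<Lambda> f"
  obtains C where "compact C" "C \<subseteq> \<Lambda>" "\<And>x. x \<notin> C \<Longrightarrow> f x = 0"
  using that[of "closure {x. f x \<noteq> 0}"] assms closure_subset[of "{x. f x \<noteq> 0}"]
  unfolding compactly_supported_in_def by blast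

lemma frechet_derivative_zero_off:
  assumes "compact C" "\<And>x. x \<notin> C \<Longrightarrow> f x = 0" "x \<notin> C"
  shows "frechet_derivative f (at x) h = 0"
proof -
  have "(f has_derivative (\<lambda>h. 0)) (at x)"
    by (rule has_derivative_transform_within_open[of "\<lambda>x. 0" _ _ _ "- C"])
      (use assms compact_imp_closed in auto)
  then show ?thesis using frechet_derivative_at by metis
qed

lemma gradient_inner: "b \<in> Basis \<Longrightarrow> gradient f x \<bullet> b = frechet_derivative f (at x) b"
  unfolding gradient_def by (rule inner_sum_left_Basis)

lemma frechet_derivative_gradient:
  assumes "f differentiable (at x)"
  shows "frechet_derivative f (at x) v = gradient f x \<bullet> v"
proof -
  interpret linear "frechet_derivative f (at x)"
    using assms by (rule linear_frechet_derivative)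
  have "frechet_derivative f (at x) v = frechet_derivative f (at x) (\<Sum>b\<in>Basis. (v \<bullet> b) *\<^sub>R b)"
    by (simp only: euclidean_representation)
  also have "\<dots> = (\<Sum>b\<in>Basis. (v \<bullet> b) * frechet_derivative f (at x) b)"
    by (simp add: sum scale)
  also have "\<dots> = gradient f x \<bullet> v"
    by (subst (2) euclidean_representation[of v, symmetric])
      (simp add: inner_sum_right gradient_inner del: euclidean_representation)
  finally show ?thesis .
qed

lemma gradient_unique:
  assumes "(f has_derivative D) (at x)"
  shows "gradient f x = (\<Sum>b\<in>Basis. D b *\<^sub>R b)"
  unfolding gradient_def using frechet_derivative_at[OF assms] by simp

lemma gradient_eqI:
  assumes "(f has_derivative (\<lambda>v. g \<bullet> v)) (at x)"
  shows "gradient f x = g"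
  using gradient_unique[OF assms] euclidean_representation[of g] by simp

lemma gradient_has_derivative:
  "f differentiable (at x) \<Longrightarrow> (f has_derivative (\<lambda>v. gradient f x \<bullet> v)) (at x)"
  using frechet_derivative_gradient[of f x] has_derivative_frechet[of f x] by presburger

lemma gradient_add:
  "f differentiable (at x) \<Longrightarrow> g differentiable (at x) \<Longrightarrow>
    gradient (\<lambda>x. f x + g x) x = gradient f x + gradient g x"
  by (intro gradient_eqI) (auto intro!: derivative_eq_intros gradient_has_derivative simp: inner_add_left)

lemma gradient_diff:
  "f differentiable (at x) \<Longrightarrow> g differentiable (at x) \<Longrightarrow>
    gradient (\<lambda>x. f x - g x) x = gradient f x - gradient g x"
  by (intro gradient_eqI) (auto intro!: derivative_eq_intros gradient_has_derivative simp: inner_diff_left)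

lemma gradient_cmult:
  "f differentiable (at x) \<Longrightarrow> gradient (\<lambda>x. c * f x) x = c *\<^sub>R gradient f x"
  by (intro gradient_eqI) (auto intro!: derivative_eq_intros gradient_has_derivative)

lemma gradient_flat:
  "h differentiable (at x) \<Longrightarrow>
    gradient (\<lambda>x. exp_flat m (h x)) x = (exp_flat (m + 2) (h x) - m * exp_flat (Suc m) (h x)) *\<^sub>R gradient h x"
  using flat_comp_has_derivative[OF gradient_has_derivative] by (intro gradient_eqI) simp

lemma Ck1_continuous_gradient: "Ck (Suc k) f \<Longrightarrow> continuous_on S (gradient f)"
  unfolding gradient_def
  by (intro continuous_intros) (auto intro!: Ck_imp_continuous)

lemma continuous_on_laplacian: "Ck 2 f \<Longrightarrow> continuous_on S (laplacian f)"
  unfolding laplacian_def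
  by (intro continuous_intros Ck_imp_continuous[of 0]) (auto simp: numeral_2_eq_2 simp del: Ck.simps(1))

lemma C0k_le: "f \<in> C0k n \<Lambda> \<Longrightarrow> k \<le> n \<Longrightarrow> f \<in> C0k k \<Lambda>"
  by (auto simp: C0k_def intro: Ck_le)

lemma C0inf_C0k: "f \<in> C0inf \<Lambda> \<Longrightarrow> f \<in> C0k k \<Lambda>"
  by (auto simp: C0k_def C0inf_def)

lemma Ck1_differentiable: "Ck (Suc k) f \<Longrightarrow> f differentiable (at x)"
  by simp

lemma C0k1_differentiable: "f \<in> C0k (Suc 0) \<Lambda> \<Longrightarrow> f differentiable (at x)"
  by (simp add: C0k_def)

lemma C0inf_differentiable: "f \<in> C0inf \<Lambda> \<Longrightarrow> f differentiable (at x)"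
  unfolding C0inf_def by (auto dest: spec[of _ "Suc 0"])

lemma C0inf_continuous: "f \<in> C0inf \<Lambda> \<Longrightarrow> continuous_on S f"
  by (auto simp: C0inf_def intro: Ck_imp_continuous)

lemma C0inf_zero: "(\<lambda>x. 0) \<in> C0inf \<Lambda>"
  by (auto simp: C0inf_def compactly_supported_in_def)

lemma compactly_supported_in_add:
  assumes "compactly_supported_in \<Lambda> f" "compactly_supported_in \<Lambda> g"
  shows "compactly_supported_in \<Lambda> (\<lambda>x. f x + g x)"
proof -
  obtain C D where "compact C" "C \<subseteq> \<Lambda>" "\<And>x. x \<notin> C \<Longrightarrow> f x = 0"
    "compact D" "D \<subseteq> \<Lambda>" "\<And>x. x \<notin> D \<Longrightarrow> g x = 0"
    using assms by (metis compactly_supported_inE)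
  then show ?thesis by (intro compactly_supported_inI[of "C \<union> D"]) auto
qed

lemma C0inf_add: "f \<in> C0inf \<Lambda> \<Longrightarrow> g \<in> C0inf \<Lambda> \<Longrightarrow> (\<lambda>x. f x + g x) \<in> C0inf \<Lambda>"
  unfolding C0inf_def by (auto intro: Ck_add compactly_supported_in_add)

lemma C0inf_cmult: "f \<in> C0inf \<Lambda> \<Longrightarrow> (\<lambda>x. c * f x) \<in> C0inf \<Lambda>"
  unfolding C0inf_def
  by (auto intro: Ck_cmult elim!: compactly_supported_inE intro!: compactly_supported_inI)

text \<open>Extension by zero from a compact subset identifies the integral over \<Lambda> with the
  one over the whole space, where translations are available.\<close>

lemma integral_compact_support:
  fixes g :: "'a::euclidean_space \<Rightarrow> real"
  assumes "open \<Lambda>" "compact C" "C \<subseteq> \<Lambda>" "\<And>x. x \<notin> C \<Longrightarrow> g x = 0" "continuous_on UNIV g"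
  shows "integrable (lebesgue_on \<Lambda>) g" "integrable lborel g"
    "integral\<^sup>L (lebesgue_on \<Lambda>) g = integral\<^sup>L lborel g"
proof -
  have [measurable]: "g \<in> borel_measurable borel"
    using assms(5) by (rule borel_measurable_continuous_onI)
  have eq: "indicator C x *\<^sub>R g x = g x" "indicator \<Lambda> x *\<^sub>R g x = g x" for x
    using assms(3) assms(4)[of x] by (auto simp: indicator_def)
  have "integrable lborel (\<lambda>x. indicator C x *\<^sub>R g x)"
    by (rule borel_integrable_compact[OF assms(2) continuous_on_subset[OF assms(5)]]) simp
  then show int: "integrable lborel g" by (simp add: eq del: real_scaleR_def)
  have *: "\<Lambda> \<inter> space lebesgue \<in> sets lebesgue"
    using assms(1) by auto
  have "integrable lebesgue g" using int by (simp add: integrable_completion)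
  then show "integrable (lebesgue_on \<Lambda>) g"
    by (simp add: integrable_restrict_space[OF *] eq del: real_scaleR_def)
  show "integral\<^sup>L (lebesgue_on \<Lambda>) g = integral\<^sup>L lborel g"
    by (simp add: integral_restrict_space[OF *] eq integral_completion del: real_scaleR_def)
qed

lemma lipschitz_gradient:
  assumes "\<And>x. f differentiable (at x)" "\<And>x. norm (gradient f x) \<le> B"
  shows "\<bar>f x - f y\<bar> \<le> B * norm (x - y)"
proof -
  have "norm (f x - f y) \<le> B * norm (x - y)"
  proof (rule differentiable_bound[OF convex_UNIV])
    show "(f has_derivative (\<lambda>v. gradient f z \<bullet> v)) (at z within UNIV)" for z
      using gradient_has_derivative[OF assms(1)] by simp
    show "onorm (\<lambda>v. gradient f z \<bullet> v) \<le> B" for z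
    proof (rule onorm_le)
      fix v
      have "\<bar>gradient f z \<bullet> v\<bar> \<le> norm (gradient f z) * norm v" by (rule Cauchy_Schwarz_ineq2)
      also have "\<dots> \<le> B * norm v" by (intro mult_right_mono assms) auto
      finally show "norm (gradient f z \<bullet> v) \<le> B * norm v" by simp
    qed
  qed auto
  then show ?thesis by simp
qed

lemma compact_support_bounded:
  fixes g :: "'a::topological_space \<Rightarrow> 'b::real_normed_vector"
  assumes "compact C" "\<And>x. x \<notin> C \<Longrightarrow> g x = 0" "continuous_on UNIV g"
  obtains B where "B \<ge> 0" "\<And>x. norm (g x) \<le> B"
proof -
  have "bounded (g ` C)"
    by (intro compact_imp_bounded compact_continuous_image continuous_on_subset[OF assms(3)] assms) simp
  then obtain B where "B > 0" "\<And>x. x \<in> C \<Longrightarrow> norm (g x) \<le> B"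
    unfolding bounded_pos by auto
  then show ?thesis using assms(2) that[of B] by (metis less_eq_real_def norm_zero)
qed

lemma C0k1_gradient_zero_off:
  assumes "compact C" "\<And>x. x \<notin> C \<Longrightarrow> f x = 0" "x \<notin> C"
  shows "gradient f x = 0"
  using frechet_derivative_zero_off[OF assms] by (simp add: gradient_def)

lemma C0k1_bounded:
  assumes "f \<in> C0k (Suc 0) \<Lambda>"
  obtains B where "B \<ge> 0" "\<And>x. \<bar>f x\<bar> \<le> B" "\<And>x. norm (gradient f x) \<le> B"
    "\<And>x y. \<bar>f x - f y\<bar> \<le> B * norm (x - y)"
proof -
  have f: "Ck (Suc 0) f" "compactly_supported_in \<Lambda> f" using assms by (auto simp: C0k_def)
  obtain C where C: "compact C" "\<And>x. x \<notin> C \<Longrightarrow> f x = 0"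
    using compactly_supported_inE[OF f(2)] by metis
  obtain B1 where B1: "B1 \<ge> 0" "\<And>x. norm (f x) \<le> B1"
    using compact_support_bounded[OF C Ck_imp_continuous[OF f(1)]] by metis
  obtain B2 where B2: "B2 \<ge> 0" "\<And>x. norm (gradient f x) \<le> B2"
    using compact_support_bounded[OF C(1) C0k1_gradient_zero_off[OF C] Ck1_continuous_gradient[OF f(1)]]
    by metis
  show ?thesis
  proof (rule that[of "max B1 B2"])
    show *: "norm (gradient f x) \<le> max B1 B2" for x using B2(2)[of x] by auto
    show "\<bar>f x - f y\<bar> \<le> max B1 B2 * norm (x - y)" for x y
      by (rule lipschitz_gradient[OF Ck1_differentiable[OF f(1)] *])
  qed (use B1 in \<open>auto simp: le_max_iff_disj\<close>)
qed

text \<open>Translation invariance makes all difference quotients have integral zero.\<close>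

lemma integral_derivative_zero:
  fixes f :: "'a::euclidean_space \<Rightarrow> real"
  assumes f: "f \<in> C0k (Suc 0) \<Lambda>" and b: "b \<in> Basis"
  shows "(LINT x|lborel. frechet_derivative f (at x) b) = 0"
proof -
  have f': "Ck (Suc 0) f" "compactly_supported_in \<Lambda> f" using f by (auto simp: C0k_def)
  have cont: "continuous_on UNIV f" by (rule Ck_imp_continuous[OF f'(1)])
  have [measurable]: "f \<in> borel_measurable borel"
    using cont by (rule borel_measurable_continuous_onI)
  have [measurable]: "(\<lambda>x. frechet_derivative f (at x) b) \<in> borel_measurable borel"
    using f'(1) b by (intro borel_measurable_continuous_onI) simp
  obtain C where C: "compact C" "C \<subseteq> \<Lambda>" "\<And>x. x \<notin> C \<Longrightarrow> f x = 0"
    using compactly_supported_inE[OF f'(2)] by metis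
  obtain B where B: "B \<ge> 0" "\<And>x y. \<bar>f x - f y\<bar> \<le> B * norm (x - y)"
    using C0k1_bounded[OF f] by metis
  obtain R where R: "\<And>x. x \<in> C \<Longrightarrow> norm x \<le> R"
    using compact_imp_bounded[OF C(1)] unfolding bounded_iff by auto
  define h where "h = (\<lambda>k::nat. inverse (real (Suc k)))"
  have h: "h k > 0" "h k \<le> 1" for k by (auto simp: h_def inverse_le_1_iff)
  define d where "d = (\<lambda>k x. (f (h k *\<^sub>R b + x) - f x) / h k)"
  have intf: "integrable lborel f"
    by (rule integral_compact_support(2)[OF open_UNIV C(1) _ C(3) cont]) auto
  have shift: "integrable lborel (\<lambda>x. f (c + x))" "(LINT x|lborel. f (c + x)) = (LINT x|lborel. f x)" for c
  proof -
    have "integral\<^sup>L (distr lborel borel ((+) c)) f = (LINT x|lborel. f (c + x))"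
      by (rule integral_distr) auto
    then show "(LINT x|lborel. f (c + x)) = (LINT x|lborel. f x)"
      by (simp add: lborel_distr_plus)
    have "integrable (distr lborel borel ((+) c)) f \<longleftrightarrow> integrable lborel (\<lambda>x. f (c + x))"
      by (rule integrable_distr_eq) auto
    then show "integrable lborel (\<lambda>x. f (c + x))" using intf by (simp add: lborel_distr_plus)
  qed
  have d0: "(LINT x|lborel. d k x) = 0" for k
    unfolding d_def using intf shift by simp
  \<comment> \<open>The steps have length at most 1, so every quotient vanishes outside the ball of
    radius \<open>R + 1\<close>; inside, the Lipschitz constant \<open>B\<close> dominates
    it.\<close>
  have "(\<lambda>k. LINT x|lborel. d k x) \<leadsto> (LINT x|lborel. frechet_derivative f (at x) b)"
  proof (rule integral_dominated_convergence[where w = "\<lambda>x. indicator (cball 0 (R + 1)) x *\<^sub>R B"])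
    show "integrable lborel (\<lambda>x. indicator (cball 0 (R + 1)) x *\<^sub>R B)"
      by (rule borel_integrable_compact) auto
    show "AE x in lborel. norm (d k x) \<le> indicator (cball 0 (R + 1)) x *\<^sub>R B" for k
    proof (rule AE_I2)
      fix x
      show "norm (d k x) \<le> indicator (cball 0 (R + 1)) x *\<^sub>R B"
      proof (cases "x \<in> cball 0 (R + 1)")
        case True
        have "\<bar>f (h k *\<^sub>R b + x) - f x\<bar> \<le> B * h k"
          using B(2)[of "h k *\<^sub>R b + x" x] h[of k] b by simp
        then show ?thesis using True h[of k] by (simp add: d_def field_simps)
      next
        case False
        then have "norm x > R + 1" by simp
        moreover have "norm x \<le> norm (h k *\<^sub>R b + x) + norm (h k *\<^sub>R b)"
          by (metis add.commute add_diff_cancel norm_triangle_ineq4)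
        moreover have "norm (h k *\<^sub>R b) \<le> 1" using b h[of k] by simp
        ultimately have "h k *\<^sub>R b + x \<notin> C" "x \<notin> C" using R by fastforce+
        then show ?thesis using B(1) by (simp add: d_def C)
      qed
    qed
    show "AE x in lborel. (\<lambda>k. d k x) \<leadsto> frechet_derivative f (at x) b"
    proof (rule AE_I2)
      fix x
      have "(f has_derivative frechet_derivative f (at x)) (at x)"
        using f'(1) by (rule Ck_Suc_has_derivative)
      moreover have "((\<lambda>t. x + t *\<^sub>R b) has_derivative (\<lambda>t. t *\<^sub>R b)) (at 0)"
        by (auto intro!: derivative_eq_intros)
      ultimately have "((\<lambda>t. f (x + t *\<^sub>R b)) has_real_derivative frechet_derivative f (at x) b) (at 0)"
        using has_derivative_compose[of "\<lambda>t. x + t *\<^sub>R b" "\<lambda>t. t *\<^sub>R b" 0 UNIV f "frechet_derivative f (at x)"]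
        by (auto intro!: derivative_eq_intros simp: has_field_derivative_def
            linear_cmul[OF linear_frechet_derivative[OF Ck1_differentiable[OF f'(1)]]]
            mult.commute[of _ "frechet_derivative f (at x) b"] elim: has_derivative_eq_rhs)
      then have "(\<lambda>t. (f (x + t *\<^sub>R b) - f x) / t) \<midarrow>0\<rightarrow> frechet_derivative f (at x) b"
        by (simp add: DERIV_def)
      moreover have "filterlim h (at 0) sequentially"
        using h LIMSEQ_inverse_real_of_nat
        by (auto simp: filterlim_at h_def intro!: always_eventually)
      ultimately have "(\<lambda>k. (f (x + h k *\<^sub>R b) - f x) / h k) \<leadsto> frechet_derivative f (at x) b"
        by (rule filterlim_compose)
      then show "(\<lambda>k. d k x) \<leadsto> frechet_derivative f (at x) b"
        by (simp add: d_def add.commute)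
    qed
  qed (auto simp: d_def)
  then show ?thesis using d0 by (simp add: LIMSEQ_const_iff)
qed

lemma C0k1_mult:
  assumes "Ck (Suc 0) f" "\<psi> \<in> C0k (Suc 0) \<Lambda>"
  shows "(\<lambda>x. f x * \<psi> x) \<in> C0k (Suc 0) \<Lambda>"
  using assms unfolding C0k_def
  by (auto simp del: Ck.simps intro: Ck_mult elim!: compactly_supported_inE intro!: compactly_supported_inI)

lemma frechet_derivative_mult:
  assumes "f differentiable (at x)" "g differentiable (at x)"
  shows "frechet_derivative (\<lambda>x. f x * g x) (at x) b
    = f x * frechet_derivative g (at x) b + frechet_derivative f (at x) b * (g x :: real)"
proof -
  have "((\<lambda>x. f x * g x) has_derivative
    (\<lambda>b. f x * frechet_derivative g (at x) b + frechet_derivative f (at x) b * g x)) (at x)"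
    using assms by (intro has_derivative_mult has_derivative_frechet)
  from frechet_derivative_at[OF this] show ?thesis by metis
qed

text \<open>The product of \<open>f\<close> and \<open>\<psi>\<close> has compact support even if
  \<open>f\<close> has not, so its partial derivative integrates to zero, and the product rule
  splits that integral.\<close>

lemma integration_by_parts_C1:
  fixes f \<psi> :: "'a::euclidean_space \<Rightarrow> real"
  assumes \<Lambda>: "open \<Lambda>" and f: "Ck (Suc 0) f" and \<psi>: "\<psi> \<in> C0k (Suc 0) \<Lambda>" and b: "b \<in> Basis"
  shows "integrable (lebesgue_on \<Lambda>) (\<lambda>x. f x * frechet_derivative \<psi> (at x) b)"
    "integrable (lebesgue_on \<Lambda>) (\<lambda>x. frechet_derivative f (at x) b * \<psi> x)"
    "(LINT x|lebesgue_on \<Lambda>. f x * frechet_derivative \<psi> (at x) b)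
      = - (LINT x|lebesgue_on \<Lambda>. frechet_derivative f (at x) b * \<psi> x)"
proof -
  have \<psi>': "Ck (Suc 0) \<psi>" "compactly_supported_in \<Lambda> \<psi>" using \<psi> by (auto simp: C0k_def)
  obtain C where C: "compact C" "C \<subseteq> \<Lambda>" "\<And>x. x \<notin> C \<Longrightarrow> \<psi> x = 0"
    using compactly_supported_inE[OF \<psi>'(2)] by metis
  have c1: "continuous_on UNIV (\<lambda>x. f x * frechet_derivative \<psi> (at x) b)"
    using Ck_imp_continuous[OF f] \<psi>'(1) b by (intro continuous_intros) auto
  have c2: "continuous_on UNIV (\<lambda>x. frechet_derivative f (at x) b * \<psi> x)"
    using Ck_imp_continuous[OF \<psi>'(1)] f b by (intro continuous_intros) auto
  note i1 = integral_compact_support[OF \<Lambda> C(1,2) _ c1] integral_compact_support[OF \<Lambda> C(1,2) _ c2]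
  have z: "f x * frechet_derivative \<psi> (at x) b = 0" "frechet_derivative f (at x) b * \<psi> x = 0" if "x \<notin> C" for x
    using C frechet_derivative_zero_off[OF C(1,3) that] that by auto
  show "integrable (lebesgue_on \<Lambda>) (\<lambda>x. f x * frechet_derivative \<psi> (at x) b)"
    "integrable (lebesgue_on \<Lambda>) (\<lambda>x. frechet_derivative f (at x) b * \<psi> x)"
    using i1 z by auto
  have "0 = (LINT x|lborel. frechet_derivative (\<lambda>x. f x * \<psi> x) (at x) b)"
    using integral_derivative_zero[OF C0k1_mult[OF f \<psi>] b] by simp
  also have "\<dots> = (LINT x|lborel. f x * frechet_derivative \<psi> (at x) b + frechet_derivative f (at x) b * \<psi> x)"
    using f \<psi>'(1) by (simp add: frechet_derivative_mult)
  also have "\<dots> = (LINT x|lborel. f x * frechet_derivative \<psi> (at x) b) + (LINT x|lborel. frechet_derivative f (at x) b * \<psi> x)"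
    by (intro Bochner_Integration.integral_add i1) (use z in auto)
  finally show "(LINT x|lebesgue_on \<Lambda>. f x * frechet_derivative \<psi> (at x) b)
      = - (LINT x|lebesgue_on \<Lambda>. frechet_derivative f (at x) b * \<psi> x)"
    using i1 z by simp
qed

lemma laplacian_integration_by_parts:
  fixes v \<psi> :: "'a::euclidean_space \<Rightarrow> real"
  assumes \<Lambda>: "open \<Lambda>" and v: "Ck 2 v" and \<psi>: "\<psi> \<in> C0k (Suc 0) \<Lambda>"
  shows "integrable (lebesgue_on \<Lambda>) (\<lambda>x. gradient v x \<bullet> gradient \<psi> x)"
    "integrable (lebesgue_on \<Lambda>) (\<lambda>x. laplacian v x * \<psi> x)"
    "(LINT x|lebesgue_on \<Lambda>. gradient v x \<bullet> gradient \<psi> x) = - (LINT x|lebesgue_on \<Lambda>. laplacian v x * \<psi> x)"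
proof -
  have *: "Ck (Suc 0) (\<lambda>x. frechet_derivative v (at x) b)" if "b \<in> Basis" for b
    using v that by (simp add: numeral_2_eq_2)
  note I = integration_by_parts_C1[OF \<Lambda> *  \<psi>]
  have eq: "gradient v x \<bullet> gradient \<psi> x = (\<Sum>b\<in>Basis. frechet_derivative v (at x) b * frechet_derivative \<psi> (at x) b)" for x
    by (subst euclidean_inner) (simp add: gradient_inner)
  show "integrable (lebesgue_on \<Lambda>) (\<lambda>x. gradient v x \<bullet> gradient \<psi> x)"
    unfolding eq by (intro Bochner_Integration.integrable_sum I)
  have eq2: "laplacian v x * \<psi> x = (\<Sum>b\<in>Basis. frechet_derivative (\<lambda>x. frechet_derivative v (at x) b) (at x) b * \<psi> x)" for x
    by (simp add: laplacian_def sum_distrib_right)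
  show "integrable (lebesgue_on \<Lambda>) (\<lambda>x. laplacian v x * \<psi> x)"
    unfolding eq2 by (intro Bochner_Integration.integrable_sum I)
  show "(LINT x|lebesgue_on \<Lambda>. gradient v x \<bullet> gradient \<psi> x) = - (LINT x|lebesgue_on \<Lambda>. laplacian v x * \<psi> x)"
    unfolding eq eq2 by (simp add: I Bochner_Integration.integral_sum sum_negf)
qed

section \<open>Bump functions of boxes and the fundamental lemma of the calculus of
  variations\<close>

lemma exp_flat0_le_1: "exp_flat 0 x \<le> 1"
  using exp_flat_def[of 0 x] by (simp add: exp_flat_def)

text \<open>The shift by 1 keeps the argument nonpositive up to t = 1 / (k + 1), so these
  approximants of the indicator of the positive half line vanish near the origin.\<close>

lemma exp_flat0_tendsto:
  "(\<lambda>k. exp_flat 0 (real (Suc k) * t - 1)) \<leadsto> (if t > 0 then 1 else 0)"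
proof (cases "t > 0")
  case True
  have lim: "filterlim (\<lambda>k. real (Suc k) * t - 1) at_top sequentially"
    unfolding filterlim_at_top_dense
  proof
    fix Z :: real
    obtain N :: nat where N: "Z + 1 < real N * t" using True reals_Archimedean3 by blast
    show "\<forall>\<^sub>F k in sequentially. Z < real (Suc k) * t - 1"
      using eventually_ge_at_top[of N]
    proof eventually_elim
      case (elim k)
      then have "real N * t \<le> real (Suc k) * t" using True by (intro mult_right_mono) auto
      with N show ?case by linarith
    qed
  qed
  have "(\<lambda>k. exp (- inverse (real (Suc k) * t - 1))) \<leadsto> exp (- 0)"
    by (intro tendsto_intros tendsto_inverse_0_at_top lim)
  moreover have "\<forall>\<^sub>F k in sequentially. exp (- inverse (real (Suc k) * t - 1)) = exp_flat 0 (real (Suc k) * t - 1)"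
    using filterlim_at_top_dense[THEN iffD1, OF lim, rule_format, of 0]
    by eventually_elim (simp add: exp_flat_def)
  ultimately show ?thesis using True by (simp add: tendsto_cong)
next
  case False
  then have "real (Suc k) * t - 1 \<le> 0" for k
    by (smt (verit) mult_nonneg_nonpos of_nat_0_le_iff)
  then have "exp_flat 0 (real (Suc k) * t - 1) = 0" for k
    by (simp add: exp_flat_def not_less del: of_nat_Suc)
  then show ?thesis using False by simp
qed

text \<open>Each factor vanishes within 1 / (k + 1) of a face, so the support is a compact subset of
  the open box, while the functions tend to the indicator of the whole open box.\<close>

definition box_bump :: "'a::euclidean_space \<Rightarrow> 'a \<Rightarrow> nat \<Rightarrow> 'a \<Rightarrow> real" where
  "box_bump a b k x = (\<Prod>i\<in>Basis. exp_flat 0 (real (Suc k) * (x \<bullet> i - a \<bullet> i) - 1)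
     * exp_flat 0 (real (Suc k) * (b \<bullet> i - x \<bullet> i) - 1))"

lemma box_bump_C0inf:
  assumes "box a b \<subseteq> \<Lambda>"
  shows "box_bump a b k \<in> C0inf \<Lambda>"
proof -
  have "Ck n (box_bump a b k)" for n
    unfolding box_bump_def
    by (intro Ck_prod Ck_mult Ck_flat Ck_diff Ck_const Ck_inner)
  moreover have "compactly_supported_in \<Lambda> (box_bump a b k)"
  proof (rule compactly_supported_inI[of "cbox (a + (\<Sum>i\<in>Basis. inverse (real (Suc k)) *\<^sub>R i)) (b - (\<Sum>i\<in>Basis. inverse (real (Suc k)) *\<^sub>R i))"])
    define e where "e = inverse (real (Suc k))"
    have e: "0 < e" by (simp add: e_def)
    define d :: 'a where "d = (\<Sum>i\<in>Basis. e *\<^sub>R i)"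
    have d: "d \<bullet> j = e" if "j \<in> Basis" for j :: 'a
      unfolding d_def using that by (rule inner_sum_left_Basis)
    have "cbox (a + d) (b - d) \<subseteq> box a b"
      using d e by (fastforce simp: mem_box inner_add_left inner_diff_left)
    then show "cbox (a + (\<Sum>i\<in>Basis. inverse (real (Suc k)) *\<^sub>R i)) (b - (\<Sum>i\<in>Basis. inverse (real (Suc k)) *\<^sub>R i)) \<subseteq> \<Lambda>"
      using assms unfolding d_def e_def by blast
    fix x assume "x \<notin> cbox (a + (\<Sum>i\<in>Basis. inverse (real (Suc k)) *\<^sub>R i)) (b - (\<Sum>i\<in>Basis. inverse (real (Suc k)) *\<^sub>R i))"
    then have "x \<notin> cbox (a + d) (b - d)" unfolding d_def e_def .
    then obtain i where i: "i \<in> Basis" "x \<bullet> i < a \<bullet> i + e \<or> x \<bullet> i > b \<bullet> i - e"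
      using d by (fastforce simp: mem_box inner_add_left inner_diff_left)
    then have "x \<bullet> i < a \<bullet> i + inverse (real (Suc k)) \<or> x \<bullet> i > b \<bullet> i - inverse (real (Suc k))"
      by (simp only: e_def)
    then have "real (Suc k) * (x \<bullet> i - a \<bullet> i) - 1 \<le> 0 \<or> real (Suc k) * (b \<bullet> i - x \<bullet> i) - 1 \<le> 0"
      by (auto simp: field_simps simp del: of_nat_Suc)
    then show "box_bump a b k x = 0"
      unfolding box_bump_def using i(1) by (intro prod_zero bexI[of _ i]) (auto simp: exp_flat_def simp del: of_nat_Suc)
  qed auto
  ultimately show ?thesis by (simp add: C0inf_def)
qed

lemma box_bump_bounds: "0 \<le> box_bump a b k x" "box_bump a b k x \<le> 1"
  unfolding box_bump_def
  by (auto intro!: prod_nonneg prod_le_1 mult_le_one mult_nonneg_nonneg flat_nonneg exp_flat0_le_1)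

lemma box_bump_tendsto: "(\<lambda>k. box_bump a b k x) \<leadsto> indicator (box a b) x"
proof -
  have "(\<lambda>k. box_bump a b k x) \<leadsto> (\<Prod>i\<in>Basis. (if x \<bullet> i - a \<bullet> i > 0 then 1 else 0) * (if b \<bullet> i - x \<bullet> i > 0 then 1 else 0))"
    unfolding box_bump_def by (intro tendsto_prod tendsto_mult exp_flat0_tendsto)
  also have "(\<Prod>i\<in>Basis. (if x \<bullet> i - a \<bullet> i > 0 then 1 else 0) * (if b \<bullet> i - x \<bullet> i > 0 then 1 else 0)) = (indicator (box a b) x :: real)"
  proof (cases "x \<in> box a b")
    case False
    then obtain i where "i \<in> Basis" "\<not> (x \<bullet> i - a \<bullet> i > 0 \<and> b \<bullet> i - x \<bullet> i > 0)" by (auto simp: mem_box)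
    then show ?thesis using False by (auto intro!: prod_zero bexI[of _ i])
  qed (auto simp: mem_box)
  finally show ?thesis .
qed

text \<open>The positive and the negative part of \<open>g\<close>, taken as densities, define two
  measures on \<Lambda>. Bump functions show that they agree on all boxes inside \<Lambda>, hence
  everywhere; evaluating both on the set where \<open>g\<close> is positive shows that this set is
  null. The two-sided conclusion comes from applying this to \<open>g\<close> and to
  \<open>- g\<close>.\<close>

lemma fundamental_lemma_le:
  fixes g :: "'a::euclidean_space \<Rightarrow> real"
  assumes \<Lambda>: "open \<Lambda>" and g: "integrable (lebesgue_on \<Lambda>) g"
    and 0: "\<And>\<psi>. \<psi> \<in> C0inf \<Lambda> \<Longrightarrow> (LINT x|lebesgue_on \<Lambda>. g x * \<psi> x) = 0"
  shows "AE x in lebesgue_on \<Lambda>. g x \<le> 0"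
proof -
  have L: "\<Lambda> \<inter> space lebesgue \<in> sets lebesgue" "\<Lambda> \<in> sets borel" using \<Lambda> by auto
  have intg: "integrable lebesgue (\<lambda>x. indicator \<Lambda> x *\<^sub>R g x)"
    using g by (simp add: integrable_restrict_space[OF L(1)])
  \<comment> \<open>\<open>g\<close> is only Lebesgue measurable; a Borel representative puts the
    argument on \<open>lborel\<close>, where measures can be compared on a generator of the Borel
    sets.\<close>
  then obtain h where [measurable]: "h \<in> borel_measurable lborel" and h: "AE x in lborel. indicator \<Lambda> x *\<^sub>R g x = h x"
    using completion_ex_borel_measurable_real[OF borel_measurable_integrable[OF intg]] by blast
  have hL: "AE x in lebesgue. indicator \<Lambda> x *\<^sub>R g x = h x" using h by (rule AE_completion)
  have inth: "integrable lborel h"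
  proof -
    have "integrable lebesgue h"
      by (rule integrable_cong_AE_imp[OF intg _ hL]) (intro measurable_completion, simp)
    then show ?thesis by (simp add: integrable_completion)
  qed
  have boxes: "(LINT x|lborel. h x * indicator X x) = 0" if X: "X = box a b" "X \<subseteq> \<Lambda>" for X a b
  proof -
    have lim: "(\<lambda>k. LINT x|lborel. h x * box_bump a b k x) \<leadsto> (LINT x|lborel. h x * indicator X x)"
    proof (rule integral_dominated_convergence[where w = "\<lambda>x. norm (h x)"])
      show "AE x in lborel. (\<lambda>k. h x * box_bump a b k x) \<leadsto> h x * indicator X x"
        unfolding X by (intro AE_I2 tendsto_mult box_bump_tendsto tendsto_const)
      show "AE x in lborel. norm (h x * box_bump a b k x) \<le> norm (h x)" for k
        using box_bump_bounds[of a b k] by (auto simp: abs_mult mult_left_le)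
      have [measurable]: "box_bump a b k \<in> borel_measurable borel" for k
        unfolding box_bump_def
        by (intro borel_measurable_continuous_onI Ck_imp_continuous[of 0] Ck_prod Ck_mult Ck_flat Ck_diff Ck_const Ck_inner)
      show "(\<lambda>x. h x * box_bump a b k x) \<in> borel_measurable lborel" for k by simp
      show "(\<lambda>x. h x * indicator X x) \<in> borel_measurable lborel" by (simp add: X)
    qed (use inth in auto)
    have "(LINT x|lborel. h x * box_bump a b k x) = 0" for k
    proof -
      have C: "box_bump a b k \<in> C0inf \<Lambda>" using X by (simp add: box_bump_C0inf)
      then have [measurable]: "box_bump a b k \<in> borel_measurable borel"
        by (intro borel_measurable_continuous_onI C0inf_continuous)
      have "0 = (LINT x|lebesgue_on \<Lambda>. g x * box_bump a b k x)" using 0[OF C] by simp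
      also have "\<dots> = (LINT x|lebesgue. indicator \<Lambda> x *\<^sub>R (g x * box_bump a b k x))"
        by (rule integral_restrict_space[OF L(1)])
      also have "\<dots> = (LINT x|lebesgue. h x * box_bump a b k x)"
      proof (rule integral_cong_AE)
        show "(\<lambda>x. indicator \<Lambda> x *\<^sub>R (g x * box_bump a b k x)) \<in> borel_measurable lebesgue"
          using borel_measurable_times[OF borel_measurable_integrable[OF intg], of "box_bump a b k"]
          by (simp add: mult.assoc measurable_completion)
        show "(\<lambda>x. h x * box_bump a b k x) \<in> borel_measurable lebesgue" by (intro measurable_completion) simp
        show "AE x in lebesgue. indicator \<Lambda> x *\<^sub>R (g x * box_bump a b k x) = h x * box_bump a b k x"
          using hL by eventually_elim (simp add: mult.assoc[symmetric])
      qed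
      finally show ?thesis by (simp add: integral_completion)
    qed
    with lim show ?thesis by (simp add: LIMSEQ_const_iff)
  qed
  \<comment> \<open>The boxes contained in \<Lambda> are stable under intersection and generate its
    Borel sets, because every open subset of \<Lambda> is a countable union of them.\<close>
  define E where "E = {X. X \<subseteq> \<Lambda> \<and> (\<exists>a b. X = box a b)}"
  define M where "M = (\<lambda>u. restrict_space (density lborel (\<lambda>x. ennreal (u x))) \<Lambda>)"
  have sM: "sets (M u) = sigma_sets \<Lambda> E" for u
  proof -
    have "sets (M u) = (\<inter>) \<Lambda> ` sigma_sets UNIV (range (\<lambda>(a, b). box a b))"
      unfolding M_def sets_restrict_space by (simp add: borel_eq_box)
    also have "\<dots> = sigma_sets \<Lambda> ((\<inter>) \<Lambda> ` range (\<lambda>(a, b). box a b))"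
      using L(2) by (intro sigma_sets_Int) (auto simp: borel_eq_box)
    also have "\<dots> = sigma_sets \<Lambda> E"
    proof (rule antisym)
      show "sigma_sets \<Lambda> E \<subseteq> sigma_sets \<Lambda> ((\<inter>) \<Lambda> ` range (\<lambda>(a, b). box a b))"
        by (intro sigma_sets_mono') (auto simp: E_def image_iff intro!: exI)
      show "sigma_sets \<Lambda> ((\<inter>) \<Lambda> ` range (\<lambda>(a, b). box a b)) \<subseteq> sigma_sets \<Lambda> E"
      proof (rule sigma_sets_mono, rule subsetI)
        fix S assume "S \<in> (\<inter>) \<Lambda> ` range (\<lambda>(a, b). box a b)"
        then have S: "open S" "S \<subseteq> \<Lambda>" using \<Lambda> by auto
        obtain D where D: "countable D" "D \<subseteq> Pow S" "\<And>X. X \<in> D \<Longrightarrow> \<exists>a b. X = box a b" "\<Union>D = S"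
          using open_countable_Union_open_box[OF S(1)] by metis
        then have "D \<subseteq> E" using S by (auto simp: E_def)
        then show "S \<in> sigma_sets \<Lambda> E"
          using D sigma_sets_UNION[of D \<Lambda> E] by (auto intro: sigma_sets.Basic)
      qed
    qed
    finally show ?thesis .
  qed
  have em: "emeasure (M u) X = (\<integral>\<^sup>+ x. ennreal (u x) * indicator X x \<partial>lborel)"
    if "X \<in> sigma_sets \<Lambda> E" "u \<in> borel_measurable borel" for u X
  proof -
    have "X \<in> (\<inter>) \<Lambda> ` sets borel"
      using sM[of u] that(1) unfolding M_def by (simp add: sets_restrict_space)
    then have X: "X \<subseteq> \<Lambda>" "X \<in> sets borel" using L(2) by auto
    then show ?thesis using that L(2) unfolding M_def
      by (subst emeasure_restrict_space) (auto simp: emeasure_density)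
  qed
  have int_ind: "integrable lborel (\<lambda>x. u x * indicator X x)"
    if "integrable lborel u" "X \<in> sets borel" for u :: "'a \<Rightarrow> real" and X
    using that integrable_mult_indicator[of X lborel u] by (simp add: mult.commute)
  have "M (\<lambda>x. max 0 (h x)) = M (\<lambda>x. max 0 (- h x))"
  proof -
    obtain D where D: "countable D" "D \<subseteq> Pow \<Lambda>" "\<And>X. X \<in> D \<Longrightarrow> \<exists>a b. X = box a b" "\<Union>D = \<Lambda>"
      using open_countable_Union_open_box[OF \<Lambda>] by metis
    \<comment> \<open>Adding the empty box keeps the enumeration meaningful when \<Lambda> is
      empty.\<close>
    define A where "A = from_nat_into (insert {} D)"
    have A: "range A = insert {} D"
      unfolding A_def using D by (intro range_from_nat_into) auto
    have "{} \<in> E" unfolding E_def by (auto intro!: exI[of _ 0] simp: box_eq_empty)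
    show ?thesis
    proof (rule measure_eqI_generator_eq[of E \<Lambda> _ _ A])
      show "Int_stable E" unfolding Int_stable_def E_def using box_Int_box by blast
      show "range A \<subseteq> E" using A D \<open>{} \<in> E\<close> by (auto simp: E_def)
      show "(\<Union>i. A i) = \<Lambda>" using A D by auto
      have eq: "emeasure (M (\<lambda>x. max 0 (h x))) X = ennreal (LINT x|lborel. max 0 (h x) * indicator X x)"
        "emeasure (M (\<lambda>x. max 0 (- h x))) X = ennreal (LINT x|lborel. max 0 (- h x) * indicator X x)"
        "(LINT x|lborel. max 0 (h x) * indicator X x) = (LINT x|lborel. max 0 (- h x) * indicator X x)"
        if X: "X \<in> E" for X
      proof -
        have XS: "X \<in> sigma_sets \<Lambda> E" "X \<in> sets borel" using X by (auto simp: E_def)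
        have *: "(\<integral>\<^sup>+ x. ennreal (u x) * indicator X x \<partial>lborel) = ennreal (LINT x|lborel. u x * indicator X x)"
          if "integrable lborel u" "\<And>x. u x \<ge> 0" for u :: "'a \<Rightarrow> real"
        proof -
          have "(\<integral>\<^sup>+ x. ennreal (u x) * indicator X x \<partial>lborel) = (\<integral>\<^sup>+ x. ennreal (u x * indicator X x) \<partial>lborel)"
            by (intro nn_integral_cong) (auto split: split_indicator)
          also have "\<dots> = ennreal (LINT x|lborel. u x * indicator X x)"
            by (rule nn_integral_eq_integral[OF int_ind[OF that(1) XS(2)]]) (use that in auto)
          finally show ?thesis .
        qed
        show "emeasure (M (\<lambda>x. max 0 (h x))) X = ennreal (LINT x|lborel. max 0 (h x) * indicator X x)"
          "emeasure (M (\<lambda>x. max 0 (- h x))) X = ennreal (LINT x|lborel. max 0 (- h x) * indicator X x)"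
          by (rule trans[OF em[OF XS(1)] *]; use inth in auto)+
        have "(LINT x|lborel. max 0 (h x) * indicator X x) - (LINT x|lborel. max 0 (- h x) * indicator X x)
          = (LINT x|lborel. max 0 (h x) * indicator X x - max 0 (- h x) * indicator X x)"
          using inth XS by (intro Bochner_Integration.integral_diff[symmetric] int_ind) auto
        also have "\<dots> = (LINT x|lborel. h x * indicator X x)"
          by (intro Bochner_Integration.integral_cong refl) (auto simp: indicator_def)
        also have "\<dots> = 0" using X boxes by (auto simp: E_def)
        finally show "(LINT x|lborel. max 0 (h x) * indicator X x) = (LINT x|lborel. max 0 (- h x) * indicator X x)"
          by simp
      qed
      show "\<And>X. X \<in> E \<Longrightarrow> emeasure (M (\<lambda>x. max 0 (h x))) X = emeasure (M (\<lambda>x. max 0 (- h x))) X"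
        using eq by simp
      show "emeasure (M (\<lambda>x. max 0 (h x))) (A i) \<noteq> \<infinity>" for i
        using eq(1)[of "A i"] \<open>range A \<subseteq> E\<close>[THEN subsetD, OF rangeI] by simp
    qed (auto simp: sM E_def)
  qed
  note MM = this
  define X where "X = {x \<in> \<Lambda>. h x > 0}"
  have Xb: "X \<in> sets borel" unfolding X_def using L(2) by measurable
  have "X = \<Lambda> \<inter> X" by (auto simp: X_def)
  then have "X \<in> sets (M (\<lambda>x. max 0 (h x)))" unfolding M_def sets_restrict_space using Xb by auto
  then have XS: "X \<in> sigma_sets \<Lambda> E" using sM by simp
  have "(\<integral>\<^sup>+ x. ennreal (max 0 (h x)) * indicator X x \<partial>lborel) = (\<integral>\<^sup>+ x. ennreal (max 0 (- h x)) * indicator X x \<partial>lborel)"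
    using arg_cong[OF MM, of "\<lambda>M. emeasure M X"] XS by (simp add: em)
  also have "\<dots> = nn_integral lborel (\<lambda>x::'a. 0)"
    by (rule nn_integral_cong) (auto simp: X_def indicator_def ennreal_neg)
  finally have "AE x in lborel. ennreal (max 0 (h x)) * indicator X x = 0"
    using Xb by (simp add: nn_integral_0_iff_AE)
  then have "AE x in lborel. x \<in> \<Lambda> \<longrightarrow> h x \<le> 0"
    by eventually_elim (auto simp: X_def indicator_def ennreal_eq_0_iff split: if_splits)
  then have "AE x in lebesgue. x \<in> \<Lambda> \<longrightarrow> h x \<le> 0" by (rule AE_completion)
  with hL have "AE x in lebesgue. x \<in> \<Lambda> \<longrightarrow> g x \<le> 0"
    by eventually_elim auto
  then show ?thesis using L by (simp add: AE_restrict_space_iff)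
qed

lemma fundamental_lemma:
  fixes g :: "'a::euclidean_space \<Rightarrow> real"
  assumes "open \<Lambda>" "integrable (lebesgue_on \<Lambda>) g"
    and 0: "\<And>\<psi>. \<psi> \<in> C0inf \<Lambda> \<Longrightarrow> (LINT x|lebesgue_on \<Lambda>. g x * \<psi> x) = 0"
  shows "AE x in lebesgue_on \<Lambda>. g x = 0"
proof -
  have "AE x in lebesgue_on \<Lambda>. g x \<le> 0"
    by (rule fundamental_lemma_le[OF assms])
  moreover have "AE x in lebesgue_on \<Lambda>. - g x \<le> 0"
    by (rule fundamental_lemma_le) (use assms in simp_all)
  ultimately show ?thesis by eventually_elim auto
qed

section \<open>Square-integrable functions\<close>

text \<open>Stated for an arbitrary measure and Euclidean values, so that one theory serves
  functions and their gradients.\<close>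

definition sq_integrable :: "'a measure \<Rightarrow> ('a \<Rightarrow> 'b::euclidean_space) \<Rightarrow> bool" where
  "sq_integrable M f \<longleftrightarrow> f \<in> borel_measurable M \<and> integrable M (\<lambda>x. (norm (f x))\<^sup>2)"

definition L2norm :: "'a measure \<Rightarrow> ('a \<Rightarrow> 'b::euclidean_space) \<Rightarrow> real" where
  "L2norm M f = sqrt (LINT x|M. (norm (f x))\<^sup>2)"

lemma L2_measurable: "sq_integrable M f \<Longrightarrow> f \<in> borel_measurable M"
  by (simp add: sq_integrable_def)

lemma Lq2_iff: "f \<in> Lq 2 \<Lambda> \<longleftrightarrow> sq_integrable (lebesgue_on \<Lambda>) f"
  by (simp add: Lq_def sq_integrable_def)

lemma Lq_norm2: "Lq_norm 2 \<Lambda> f = L2norm (lebesgue_on \<Lambda>) f"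
  by (simp add: Lq_norm_def L2norm_def powr_half_sqrt)

lemma L2norm_nonneg [simp]: "0 \<le> L2norm M f"
  by (simp add: L2norm_def)

lemma L2norm_sq: "(L2norm M f)\<^sup>2 = (LINT x|M. (norm (f x))\<^sup>2)"
  by (simp add: L2norm_def)

lemma abs_inner_le_squares: "\<bar>(x::'b::euclidean_space) \<bullet> y\<bar> \<le> ((norm x)\<^sup>2 + (norm y)\<^sup>2) / 2"
proof -
  have "\<bar>x \<bullet> y\<bar> \<le> norm x * norm y" by (rule Cauchy_Schwarz_ineq2)
  also have "\<dots> \<le> ((norm x)\<^sup>2 + (norm y)\<^sup>2) / 2"
    using sum_squares_bound[of "norm x" "norm y"] by simp
  finally show ?thesis .
qed

lemma L2_inner:
  assumes "sq_integrable M f" "sq_integrable M g"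
  shows "integrable M (\<lambda>x. f x \<bullet> g x)"
proof (rule Bochner_Integration.integrable_bound)
  show "integrable M (\<lambda>x. ((norm (f x))\<^sup>2 + (norm (g x))\<^sup>2) / 2)"
    using assms by (auto simp: sq_integrable_def)
  show "(\<lambda>x. f x \<bullet> g x) \<in> borel_measurable M"
    using assms by (auto simp: sq_integrable_def)
  show "AE x in M. norm (f x \<bullet> g x) \<le> norm (((norm (f x))\<^sup>2 + (norm (g x))\<^sup>2) / 2)"
    using abs_inner_le_squares by auto
qed

lemma L2_mult:
  "sq_integrable M f \<Longrightarrow> sq_integrable M g \<Longrightarrow> integrable M (\<lambda>x. f x * g x :: real)"
  using L2_inner[of M f g] by simp

lemma L2_scaleR: "sq_integrable M f \<Longrightarrow> sq_integrable M (\<lambda>x. c *\<^sub>R f x)"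
  by (auto simp: sq_integrable_def power_mult_distrib)

lemma L2_cmult: "sq_integrable M f \<Longrightarrow> sq_integrable M (\<lambda>x. c * f x :: real)"
  using L2_scaleR[of M f c] by simp

lemma L2_minus: "sq_integrable M f \<Longrightarrow> sq_integrable M (\<lambda>x. - f x)"
  by (auto simp: sq_integrable_def)

lemma norm_add_sq: "(norm (x + y))\<^sup>2 = (norm x)\<^sup>2 + 2 * (x \<bullet> y) + (norm (y::'b::euclidean_space))\<^sup>2"
  by (simp add: power2_norm_eq_inner inner_add_left inner_add_right inner_commute)

lemma L2_add:
  assumes "sq_integrable M f" "sq_integrable M g"
  shows "sq_integrable M (\<lambda>x. f x + g x)"
  using assms L2_inner[OF assms] unfolding sq_integrable_def norm_add_sq by auto

lemma L2_diff:
  "sq_integrable M f \<Longrightarrow> sq_integrable M g \<Longrightarrow> sq_integrable M (\<lambda>x. f x - g x)"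
  using L2_add[OF _ L2_minus, of M f g] by simp

lemma L2_zero [simp]: "sq_integrable M (\<lambda>x. 0)"
  by (simp add: sq_integrable_def)

lemma L2_sum:
  "(\<And>i. i \<in> I \<Longrightarrow> sq_integrable M (f i)) \<Longrightarrow> sq_integrable M (\<lambda>x. \<Sum>i\<in>I. f i x)"
  by (induction I rule: infinite_finite_induct) (auto intro: L2_add)

lemma L2_norm: "sq_integrable M f \<Longrightarrow> sq_integrable M (\<lambda>x. norm (f x))"
  by (auto simp: sq_integrable_def)

lemma L2_abs: "sq_integrable M f \<Longrightarrow> sq_integrable M (\<lambda>x. \<bar>f x :: real\<bar>)"
  by (auto simp: sq_integrable_def)

lemma L2_bound:
  assumes "sq_integrable M g" "f \<in> borel_measurable M" "AE x in M. norm (f x) \<le> norm (g x)"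
  shows "sq_integrable M f"
  unfolding sq_integrable_def
proof
  show "integrable M (\<lambda>x. (norm (f x))\<^sup>2)"
    by (rule Bochner_Integration.integrable_bound[of M "\<lambda>x. (norm (g x))\<^sup>2"])
      (use assms in \<open>auto simp: sq_integrable_def intro!: power_mono\<close>)
qed fact

lemma (in finite_measure) L2_bounded:
  assumes "f \<in> borel_measurable M" "AE x in M. norm (f x) \<le> B"
  shows "sq_integrable M f"
  unfolding sq_integrable_def
proof
  show "integrable M (\<lambda>x. (norm (f x))\<^sup>2)"
    by (rule integrable_const_bound[where B = "B\<^sup>2"]) (use assms in \<open>auto elim!: eventually_mono intro: power_mono\<close>)
qed fact

lemma (in finite_measure) L2_const: "sq_integrable M (\<lambda>x. c)"
  by (rule L2_bounded[where B = "norm c"]) auto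

lemma (in finite_measure) L2_integrable:
  assumes "sq_integrable M f"
  shows "integrable M f"
proof (rule Bochner_Integration.integrable_bound)
  show "integrable M (\<lambda>x. 1 + (norm (f x))\<^sup>2)" using assms by (auto simp: sq_integrable_def)
  have "a \<le> 1 + a\<^sup>2" for a :: real
    using zero_le_power2[of "a - 1"] by (simp add: power2_eq_square algebra_simps) (smt (verit) zero_le_square)
  then show "AE x in M. norm (f x) \<le> norm (1 + (norm (f x))\<^sup>2)" by auto
qed (use assms in \<open>simp add: sq_integrable_def\<close>)

lemma L2norm_cong_AE:
  "f \<in> borel_measurable M \<Longrightarrow> g \<in> borel_measurable M \<Longrightarrow> AE x in M. f x = g x \<Longrightarrow> L2norm M f = L2norm M g"
  unfolding L2norm_def by (intro arg_cong[of _ _ sqrt] integral_cong_AE) auto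

lemma real_le_mult_of_weighted:
  fixes x a b :: real
  assumes "a \<ge> 0" "b \<ge> 0" and *: "\<And>e. e > 0 \<Longrightarrow> x \<le> (e * a\<^sup>2 + b\<^sup>2 / e) / 2"
  shows "x \<le> a * b"
proof (rule field_le_epsilon)
  fix d :: real assume d: "d > 0"
  define s where "s = d / (a + b + 1 + d)"
  have s: "s > 0" "s \<le> 1" "s * (a + b + 1 + d) = d"
    using d assms(1,2) by (auto simp: s_def field_simps)
  define A B where "A = a + s" and "B = b + s"
  have AB: "A > 0" "B > 0" "a \<le> A" "b \<le> B" using s assms(1,2) by (auto simp: A_def B_def)
  have "x \<le> (B / A * a\<^sup>2 + b\<^sup>2 / (B / A)) / 2" by (rule *) (use AB in simp)
  also have "\<dots> \<le> (B / A * A\<^sup>2 + B\<^sup>2 / (B / A)) / 2"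
    using AB assms(1,2) by (intro divide_right_mono add_mono mult_left_mono power_mono) auto
  also have "\<dots> = A * B" using AB by (simp add: power2_eq_square field_simps)
  also have "\<dots> = a * b + s * (a + b + s)" by (simp add: A_def B_def algebra_simps)
  also have "s * (a + b + s) \<le> s * (a + b + 1 + d)"
    using s d by (intro mult_left_mono) auto
  finally show "x \<le> a * b + d" using s by simp
qed

lemma L2_Cauchy_Schwarz:
  assumes f: "sq_integrable M f" and g: "sq_integrable M g"
  shows "\<bar>LINT x|M. f x \<bullet> g x\<bar> \<le> L2norm M f * L2norm M g"
proof (rule real_le_mult_of_weighted)
  fix e :: real assume e: "e > 0"
  have "\<bar>LINT x|M. f x \<bullet> g x\<bar> \<le> (LINT x|M. \<bar>f x \<bullet> g x\<bar>)"
    by (rule integral_abs_bound)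
  also have "\<dots> \<le> (LINT x|M. (e * (norm (f x))\<^sup>2 + (norm (g x))\<^sup>2 / e) / 2)"
  proof (rule integral_mono)
    show "integrable M (\<lambda>x. \<bar>f x \<bullet> g x\<bar>)" using L2_inner[OF f g] by simp
    show "integrable M (\<lambda>x. (e * (norm (f x))\<^sup>2 + (norm (g x))\<^sup>2 / e) / 2)"
      using f g by (auto simp: sq_integrable_def)
    show "\<bar>f x \<bullet> g x\<bar> \<le> (e * (norm (f x))\<^sup>2 + (norm (g x))\<^sup>2 / e) / 2" for x
      using abs_inner_le_squares[of "sqrt e *\<^sub>R f x" "inverse (sqrt e) *\<^sub>R g x"] e
      by (simp add: power_mult_distrib field_simps)
  qed
  also have "\<dots> = (e * (L2norm M f)\<^sup>2 + (L2norm M g)\<^sup>2 / e) / 2"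
    using f g by (simp add: L2norm_sq sq_integrable_def)
  finally show "\<bar>LINT x|M. f x \<bullet> g x\<bar> \<le> (e * (L2norm M f)\<^sup>2 + (L2norm M g)\<^sup>2 / e) / 2" .
qed auto

lemma L2_Cauchy_Schwarz_real:
  fixes f g :: "'a \<Rightarrow> real"
  assumes "sq_integrable M f" "sq_integrable M g"
  shows "\<bar>LINT x|M. f x * g x\<bar> \<le> L2norm M f * L2norm M g"
  using L2_Cauchy_Schwarz[OF assms] by simp

lemma L2norm_scaleR: "L2norm M (\<lambda>x. c *\<^sub>R f x) = \<bar>c\<bar> * L2norm M f"
  by (simp add: L2norm_def power_mult_distrib real_sqrt_mult)

lemma L2norm_cmult: "L2norm M (\<lambda>x. c * f x :: real) = \<bar>c\<bar> * L2norm M f"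
  using L2norm_scaleR[of M c f] by simp

lemma L2norm_minus: "L2norm M (\<lambda>x. - f x) = L2norm M f"
  by (simp add: L2norm_def)

lemma L2norm_minus_commute: "L2norm M (\<lambda>x. f x - g x) = L2norm M (\<lambda>x. g x - f x)"
  by (simp add: L2norm_def norm_minus_commute)

lemma L2norm_add_sq:
  assumes f: "sq_integrable M f" and g: "sq_integrable M g"
  shows "(L2norm M (\<lambda>x. f x + g x))\<^sup>2 = (L2norm M f)\<^sup>2 + 2 * (LINT x|M. f x \<bullet> g x) + (L2norm M g)\<^sup>2"
  using f g L2_inner[OF f g] by (simp add: L2norm_sq norm_add_sq sq_integrable_def)

lemma L2norm_triangle:
  assumes f: "sq_integrable M f" and g: "sq_integrable M g"
  shows "L2norm M (\<lambda>x. f x + g x) \<le> L2norm M f + L2norm M g"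
proof (rule power2_le_imp_le)
  show "(L2norm M (\<lambda>x. f x + g x))\<^sup>2 \<le> (L2norm M f + L2norm M g)\<^sup>2"
    using L2_Cauchy_Schwarz[OF f g] unfolding L2norm_add_sq[OF f g] by (simp add: power2_sum)
qed auto

lemma L2norm_triangle_diff:
  assumes "sq_integrable M f" "sq_integrable M g" "sq_integrable M h"
  shows "L2norm M (\<lambda>x. f x - h x) \<le> L2norm M (\<lambda>x. f x - g x) + L2norm M (\<lambda>x. g x - h x)"
  using L2norm_triangle[OF L2_diff[OF assms(1,2)] L2_diff[OF assms(2,3)]] by simp

lemma L2norm_eq_0D:
  assumes "sq_integrable M f" "L2norm M f = 0"
  shows "AE x in M. f x = 0"
proof -
  have "(LINT x|M. (norm (f x))\<^sup>2) = 0" using assms(2) by (simp add: L2norm_def)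
  then show ?thesis
    using assms(1) by (subst (asm) integral_nonneg_eq_0_iff_AE) (auto simp: sq_integrable_def)
qed

text \<open>Fatou's lemma in a form that yields the integrability of the limit as well; it serves
  the completeness of L^2 and the removal of truncations in L^q.\<close>

lemma fatou_bound:
  fixes u :: "nat \<Rightarrow> 'a \<Rightarrow> real"
  assumes u: "\<And>k. integrable M (u k)" "\<And>k. AE x in M. 0 \<le> u k x"
    and lim: "AE x in M. (\<lambda>k. u k x) \<leadsto> v x" and v: "v \<in> borel_measurable M"
    and C: "\<And>k. (LINT x|M. u k x) \<le> C"
  shows "integrable M v" "(LINT x|M. v x) \<le> C"
proof -
  have C0: "0 \<le> C" using integral_nonneg_AE[OF u(2)[of 0]] C[of 0] by linarith
  have nn: "AE x in M. \<forall>k. 0 \<le> u k x" using u(2) by (simp add: AE_all_countable)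
  have v0: "AE x in M. 0 \<le> v x" using nn lim
    by eventually_elim (auto intro: LIMSEQ_le_const)
  have "(\<integral>\<^sup>+ x. ennreal (v x) \<partial>M) \<le> (\<integral>\<^sup>+ x. liminf (\<lambda>k. ennreal (u k x)) \<partial>M)"
  proof (rule nn_integral_mono_AE)
    show "AE x in M. ennreal (v x) \<le> liminf (\<lambda>k. ennreal (u k x))"
      using lim by eventually_elim (metis tendsto_ennrealI lim_imp_Liminf order_refl sequentially_bot)
  qed
  also have "\<dots> \<le> liminf (\<lambda>k. \<integral>\<^sup>+ x. ennreal (u k x) \<partial>M)"
    using u(1) by (intro nn_integral_liminf) auto
  also have "\<dots> \<le> ennreal C"
  proof -
    have "(\<integral>\<^sup>+ x. ennreal (u k x) \<partial>M) \<le> ennreal C" for k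
      using C[of k] by (subst nn_integral_eq_integral[OF u]) (simp add: ennreal_leI)
    then show ?thesis
      by (intro order_trans[OF Liminf_le_Limsup Limsup_bounded]) (auto intro: always_eventually)
  qed
  finally have *: "(\<integral>\<^sup>+ x. ennreal (v x) \<partial>M) \<le> ennreal C" .
  show int: "integrable M v"
    using v v0 * by (intro integrableI_nonneg) (auto intro: le_less_trans)
  show "(LINT x|M. v x) \<le> C"
    using * C0 by (subst (asm) nn_integral_eq_integral[OF int v0]) simp
qed

lemma (in finite_measure) L1_le_L2:
  assumes "sq_integrable M f"
  shows "(LINT x|M. norm (f x)) \<le> sqrt (measure M (space M)) * L2norm M f"
proof -
  have "\<bar>LINT x|M. (1::real) \<bullet> norm (f x)\<bar> \<le> L2norm M (\<lambda>x. 1::real) * L2norm M (\<lambda>x. norm (f x))"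
    by (intro L2_Cauchy_Schwarz L2_const L2_norm assms)
  then show ?thesis by (simp add: L2norm_def)
qed

text \<open>On a finite measure space the L^2 norm dominates the L^1 norm, and L^1 convergence has
  an almost everywhere convergent subsequence.\<close>

lemma (in finite_measure) L2_tendsto_AE_subseq:
  assumes f: "\<And>n. sq_integrable M (f n)" and g: "sq_integrable M g"
    and lim: "(\<lambda>n. L2norm M (\<lambda>x. f n x - g x)) \<leadsto> 0"
  shows "\<exists>r. strict_mono r \<and> (AE x in M. (\<lambda>n. f (r n) x) \<leadsto> g x)"
proof -
  have "(\<lambda>n. LINT x|M. norm (f n x - g x)) \<leadsto> 0"
  proof (rule Lim_null_comparison)
    show "\<forall>\<^sub>F n in sequentially. norm (LINT x|M. norm (f n x - g x)) \<le> sqrt (measure M (space M)) * L2norm M (\<lambda>x. f n x - g x)"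
      using L1_le_L2[OF L2_diff[OF f g]] by (auto intro!: always_eventually)
    show "(\<lambda>n. sqrt (measure M (space M)) * L2norm M (\<lambda>x. f n x - g x)) \<leadsto> 0"
      using tendsto_mult_right_zero[OF lim] by simp
  qed
  from tendsto_L1_AE_subseq[OF L2_integrable[OF L2_diff[OF f g]] this]
  obtain r where "strict_mono r" "AE x in M. (\<lambda>n. f (r n) x - g x) \<leadsto> 0" by auto
  then show ?thesis by (auto simp: LIM_zero_iff)
qed

text \<open>Riesz-Fischer. Along a subsequence whose successive distances are below 2^{-k} the
  increments are summable almost everywhere; Fatou turns the pointwise limit into an L^2 limit of
  the full sequence.\<close>

lemma (in finite_measure) L2_complete:
  fixes f :: "nat \<Rightarrow> 'a \<Rightarrow> 'b::euclidean_space"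
  assumes f: "\<And>n. sq_integrable M (f n)"
    and C: "\<And>e. e > 0 \<Longrightarrow> \<exists>N. \<forall>m\<ge>N. \<forall>n\<ge>N. L2norm M (\<lambda>x. f m x - f n x) < e"
  shows "\<exists>g. sq_integrable M g \<and> (\<lambda>n. L2norm M (\<lambda>x. f n x - g x)) \<leadsto> 0"
proof -
  have "\<exists>N. \<forall>m\<ge>N. \<forall>n\<ge>N. L2norm M (\<lambda>x. f m x - f n x) < (1/2) ^ k" for k by (rule C) simp
  then obtain N where N: "\<And>k m n. m \<ge> N k \<Longrightarrow> n \<ge> N k \<Longrightarrow> L2norm M (\<lambda>x. f m x - f n x) < (1/2) ^ k"
    by metis
  \<comment> \<open>Partial sums make \<open>r k\<close> and \<open>r (Suc k)\<close> both at least
    \<open>N k\<close>; the summand \<open>k\<close> makes the indices unbounded.\<close>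
  define r where "r = (\<lambda>k. (\<Sum>j\<le>k. N j) + k)"
  have r: "r k \<ge> N k" "r (Suc k) \<ge> N k" "r k \<ge> k" for k
    unfolding r_def by (auto simp: member_le_sum trans_le_add1 le_Suc_eq)
  define d where "d = (\<lambda>k x. norm (f (r (Suc k)) x - f (r k) x))"
  have [measurable]: "f n \<in> borel_measurable M" for n using f by (rule L2_measurable)
  have d: "(LINT x|M. d k x) \<le> sqrt (measure M (space M)) * (1/2) ^ k" "integrable M (d k)" for k
  proof -
    have "(LINT x|M. d k x) \<le> sqrt (measure M (space M)) * L2norm M (\<lambda>x. f (r (Suc k)) x - f (r k) x)"
      unfolding d_def by (rule L1_le_L2[OF L2_diff[OF f f]])
    also have "\<dots> \<le> sqrt (measure M (space M)) * (1/2) ^ k"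
      using N[of k "r (Suc k)" "r k"] r by (intro mult_left_mono) auto
    finally show "(LINT x|M. d k x) \<le> sqrt (measure M (space M)) * (1/2) ^ k" .
    show "integrable M (d k)" unfolding d_def
      by (intro integrable_norm L2_integrable L2_diff f)
  qed
  have "(\<integral>\<^sup>+ x. (\<Sum>k. ennreal (d k x)) \<partial>M) = (\<Sum>k. \<integral>\<^sup>+ x. ennreal (d k x) \<partial>M)"
    by (rule nn_integral_suminf) (simp add: d_def)
  also have "\<dots> \<le> (\<Sum>k. ennreal (sqrt (measure M (space M)) * (1/2) ^ k))"
  proof (rule suminf_le)
    show "(\<integral>\<^sup>+ x. ennreal (d k x) \<partial>M) \<le> ennreal (sqrt (measure M (space M)) * (1/2) ^ k)" for k
      using d[of k] by (subst nn_integral_eq_integral) (auto simp: d_def ennreal_leI)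
  qed auto
  also have "\<dots> = ennreal (\<Sum>k. sqrt (measure M (space M)) * (1/2) ^ k)"
    by (rule suminf_ennreal2) (auto intro!: summable_mult summable_geometric)
  also have "\<dots> < \<infinity>" by simp
  finally have "AE x in M. (\<Sum>k. ennreal (d k x)) \<noteq> \<infinity>"
    by (intro nn_integral_noteq_infinite) (auto simp: d_def)
  then have conv: "AE x in M. convergent (\<lambda>k. f (r k) x)"
  proof eventually_elim
    case (elim x)
    have "summable (\<lambda>k. d k x)"
      using elim by (intro summable_suminf_not_top) (auto simp: d_def)
    then have "summable (\<lambda>k. f (r (Suc k)) x - f (r k) x)"
      unfolding d_def by (rule summable_norm_cancel)
    then have "convergent (\<lambda>n. \<Sum>k<n. f (r (Suc k)) x - f (r k) x)"
      by (simp add: summable_iff_convergent)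
    then have "convergent (\<lambda>n. f (r n) x - f (r 0) x)"
      by (simp add: sum_lessThan_telescope[of "\<lambda>k. f (r k) x"])
    from convergent_add[OF this convergent_const[of "f (r 0) x"]] show ?case by simp
  qed
  define g where "g = (\<lambda>x. lim (\<lambda>k. f (r k) x))"
  have [measurable]: "g \<in> borel_measurable M" unfolding g_def by measurable
  have lim: "AE x in M. (\<lambda>k. f (r k) x) \<leadsto> g x"
    using conv by eventually_elim (simp add: g_def convergent_LIMSEQ_iff)
  have bound: "integrable M (\<lambda>x. (norm (f n x - g x))\<^sup>2)" "(LINT x|M. (norm (f n x - g x))\<^sup>2) \<le> ((1/2) ^ j)\<^sup>2"
    if n: "n \<ge> N j" for n j
  proof -
    have lim': "AE x in M. (\<lambda>k. (norm (f n x - f (r (k + N j)) x))\<^sup>2) \<leadsto> (norm (f n x - g x))\<^sup>2"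
      using lim by eventually_elim (auto intro!: tendsto_intros LIMSEQ_ignore_initial_segment)
    have b: "(LINT x|M. (norm (f n x - f (r (k + N j)) x))\<^sup>2) \<le> ((1/2) ^ j)\<^sup>2" for k
    proof -
      have "L2norm M (\<lambda>x. f n x - f (r (k + N j)) x) \<le> (1/2) ^ j"
        using N[of j n "r (k + N j)"] n r(3)[of "k + N j"] by auto
      then have "(L2norm M (\<lambda>x. f n x - f (r (k + N j)) x))\<^sup>2 \<le> ((1/2) ^ j)\<^sup>2"
        by (rule power_mono) simp
      then show ?thesis by (simp add: L2norm_sq)
    qed
    have "integrable M (\<lambda>x. (norm (f n x - f (r (k + N j)) x))\<^sup>2)" for k
      using L2_diff[OF f f] by (simp add: sq_integrable_def)
    from fatou_bound[OF this _ lim' _ b]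
    show "integrable M (\<lambda>x. (norm (f n x - g x))\<^sup>2)" "(LINT x|M. (norm (f n x - g x))\<^sup>2) \<le> ((1/2) ^ j)\<^sup>2"
      by auto
  qed
  have fg: "sq_integrable M (\<lambda>x. f (N 0) x - g x)"
    using bound(1)[of 0 "N 0"] by (simp add: sq_integrable_def)
  have "sq_integrable M g"
    using L2_diff[OF f[of "N 0"] fg] by simp
  moreover have "(\<lambda>n. L2norm M (\<lambda>x. f n x - g x)) \<leadsto> 0"
  proof (rule LIMSEQ_I)
    fix e :: real assume "e > 0"
    then obtain j where j: "(1/2) ^ j < e" using real_arch_pow_inv[of e "1/2"] by auto
    have "L2norm M (\<lambda>x. f n x - g x) < e" if "n \<ge> N j" for n
    proof -
      have "L2norm M (\<lambda>x. f n x - g x) \<le> (1/2) ^ j"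
        using bound(2)[OF that] unfolding L2norm_sq[symmetric] by (rule power2_le_imp_le) simp
      with j show ?thesis by simp
    qed
    then show "\<exists>no. \<forall>n\<ge>no. norm (L2norm M (\<lambda>x. f n x - g x) - 0) < e" by auto
  qed
  ultimately show ?thesis by blast
qed

lemma L2_tendsto_inner:
  assumes f: "\<And>n. sq_integrable M (f n)" and g: "sq_integrable M g" and h: "sq_integrable M h"
    and lim: "(\<lambda>n. L2norm M (\<lambda>x. f n x - g x)) \<leadsto> 0"
  shows "(\<lambda>n. LINT x|M. f n x \<bullet> h x) \<leadsto> (LINT x|M. g x \<bullet> h x)"
proof (rule LIM_zero_cancel, rule Lim_null_comparison)
  have "(LINT x|M. f n x \<bullet> h x) - (LINT x|M. g x \<bullet> h x) = (LINT x|M. (f n x - g x) \<bullet> h x)" for n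
    using L2_inner[OF f h] L2_inner[OF g h] by (simp add: inner_diff_left)
  then show "\<forall>\<^sub>F n in sequentially. norm ((LINT x|M. f n x \<bullet> h x) - (LINT x|M. g x \<bullet> h x)) \<le> L2norm M (\<lambda>x. f n x - g x) * L2norm M h"
    using L2_Cauchy_Schwarz[OF L2_diff[OF f g] h] by (auto intro!: always_eventually)
  show "(\<lambda>n. L2norm M (\<lambda>x. f n x - g x) * L2norm M h) \<leadsto> 0"
    using tendsto_mult_left_zero[OF lim] by simp
qed

section \<open>The Dirichlet form\<close>

text \<open>The variational part of the Riesz theorem, without completeness: a minimising sequence
  of \<open>B u u - 2 * F u\<close> is Cauchy by the parallelogram law, and the first variation
  vanishes in the limit. It is used for the energy form and for the L^2 product, on the same domain
  but with different completions.\<close>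

lemma riesz_minimizing_sequence:
  fixes D :: "('a \<Rightarrow> real) set" and B :: "('a \<Rightarrow> real) \<Rightarrow> ('a \<Rightarrow> real) \<Rightarrow> real"
  assumes ne: "D \<noteq> {}"
    and add: "\<And>u v. u \<in> D \<Longrightarrow> v \<in> D \<Longrightarrow> (\<lambda>x. u x + v x) \<in> D"
    and scale: "\<And>c u. u \<in> D \<Longrightarrow> (\<lambda>x. c * u x) \<in> D"
    and B_add: "\<And>u v w. u \<in> D \<Longrightarrow> v \<in> D \<Longrightarrow> w \<in> D \<Longrightarrow> B (\<lambda>x. u x + v x) w = B u w + B v w"
    and B_scale: "\<And>c u w. u \<in> D \<Longrightarrow> w \<in> D \<Longrightarrow> B (\<lambda>x. c * u x) w = c * B u w"
    and B_sym: "\<And>u w. u \<in> D \<Longrightarrow> w \<in> D \<Longrightarrow> B u w = B w u"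
    and B_pos: "\<And>u. u \<in> D \<Longrightarrow> B u u \<ge> 0"
    and F_add: "\<And>u v. u \<in> D \<Longrightarrow> v \<in> D \<Longrightarrow> F (\<lambda>x. u x + v x) = F u + F v"
    and F_scale: "\<And>c u. u \<in> D \<Longrightarrow> F (\<lambda>x. c * u x) = c * (F u :: real)"
    and F_bound: "\<And>u. u \<in> D \<Longrightarrow> \<bar>F u\<bar> \<le> K * sqrt (B u u)"
  obtains w :: "nat \<Rightarrow> 'a \<Rightarrow> real" where "\<And>k. w k \<in> D"
    "\<And>e. e > 0 \<Longrightarrow> \<exists>N. \<forall>j\<ge>N. \<forall>k\<ge>N. B (\<lambda>x. w j x - w k x) (\<lambda>x. w j x - w k x) < e"
    "\<And>v. v \<in> D \<Longrightarrow> (\<lambda>k. B (w k) v) \<leadsto> F v"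
proof -
  define Q where "Q = (\<lambda>u. B u u - 2 * F u)"
  have lin: "(\<lambda>x. u x + c * v x) \<in> D" if "u \<in> D" "v \<in> D" for u v c
    using add[OF that(1) scale[OF that(2)]] .
  have B_lin: "B (\<lambda>x. u x + c * v x) w = B u w + c * B v w" if "u \<in> D" "v \<in> D" "w \<in> D" for u v w c
    using that scale by (simp add: B_add B_scale)
  have B_quad: "B (\<lambda>x. u x + c * v x) (\<lambda>x. u x + c * v x) = B u u + 2 * c * B u v + c\<^sup>2 * B v v"
    if "u \<in> D" "v \<in> D" for u v c
  proof -
    have "B (\<lambda>x. u x + c * v x) (\<lambda>x. u x + c * v x)
      = B u (\<lambda>x. u x + c * v x) + c * B v (\<lambda>x. u x + c * v x)"
      using that lin by (intro B_lin) auto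
    also have "B u (\<lambda>x. u x + c * v x) = B u u + c * B v u"
      using that lin B_sym[of u "\<lambda>x. u x + c * v x"] B_lin[of u v u c] by simp
    also have "B v (\<lambda>x. u x + c * v x) = B u v + c * B v v"
      using that lin B_sym[of v "\<lambda>x. u x + c * v x"] B_lin[of u v v c] by simp
    also have "B v u = B u v" using that by (intro B_sym)
    finally show ?thesis by (simp add: algebra_simps power2_eq_square)
  qed
  have F_lin: "F (\<lambda>x. u x + c * v x) = F u + c * F v" if "u \<in> D" "v \<in> D" for u v c
    using that scale by (simp add: F_add F_scale)
  \<comment> \<open>Completing the square in the root of \<open>B u u\<close>.\<close>
  have Q_low: "Q u \<ge> - (K\<^sup>2)" if "u \<in> D" for u
  proof -
    have "F u \<le> K * sqrt (B u u)" using F_bound[OF that] by simp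
    moreover have "(sqrt (B u u) - K)\<^sup>2 \<ge> 0" by simp
    ultimately show ?thesis using B_pos[OF that] unfolding Q_def
      by (simp add: power2_diff mult_ac)
  qed
  define m where "m = (INF u\<in>D. Q u)"
  have bdd: "bdd_below (Q ` D)" using Q_low by (auto intro!: bdd_belowI)
  have m: "m \<le> Q u" if "u \<in> D" for u unfolding m_def by (rule cINF_lower[OF bdd that])
  have "\<exists>u\<in>D. Q u < m + inverse (real (Suc k))" for k
    using cINF_less_iff[OF ne bdd, of "m + inverse (real (Suc k))"] unfolding m_def[symmetric] by auto
  then obtain w where w: "\<And>k. w k \<in> D" "\<And>k. Q (w k) < m + inverse (real (Suc k))" by metis
  have eps: "(\<lambda>k. inverse (real (Suc k))) \<leadsto> 0" by (rule LIMSEQ_inverse_real_of_nat)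
  show ?thesis
  proof (rule that[of w])
    show "w k \<in> D" for k by (rule w)
    fix e :: real assume e: "e > 0"
    have "\<forall>\<^sub>F k in sequentially. inverse (real (Suc k)) < e / 4"
      using e by (intro order_tendstoD(2)[OF eps]) auto
    then obtain N where N: "\<And>k. k \<ge> N \<Longrightarrow> inverse (real (Suc k)) < e / 4"
      by (auto simp: eventually_sequentially)
    have "B (\<lambda>x. w j x - w k x) (\<lambda>x. w j x - w k x) < e" if "j \<ge> N" "k \<ge> N" for j k
    proof -
      \<comment> \<open>The midpoint competes with both members of the sequence; the parallelogram
        law then bounds their distance by their excess over the infimum.\<close>
      define h where "h = (\<lambda>x. (1/2) * (w j x + 1 * w k x))"
      have wjk: "(\<lambda>x. w j x + 1 * w k x) \<in> D" using w(1) by (intro lin)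
      have hD: "h \<in> D" unfolding h_def using scale[OF wjk] .
      have Bh: "B h h = (1/4) * (B (w j) (w j) + 2 * B (w j) (w k) + B (w k) (w k))"
      proof -
        have "B h h = (1/2) * B (\<lambda>x. w j x + 1 * w k x) h"
          unfolding h_def by (intro B_scale wjk scale)
        also have "B (\<lambda>x. w j x + 1 * w k x) h = B h (\<lambda>x. w j x + 1 * w k x)"
          by (intro B_sym wjk hD)
        also have "\<dots> = (1/2) * B (\<lambda>x. w j x + 1 * w k x) (\<lambda>x. w j x + 1 * w k x)"
          unfolding h_def by (intro B_scale wjk)
        also have "B (\<lambda>x. w j x + 1 * w k x) (\<lambda>x. w j x + 1 * w k x)
          = B (w j) (w j) + 2 * 1 * B (w j) (w k) + 1\<^sup>2 * B (w k) (w k)"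
          using w(1) by (intro B_quad)
        finally show ?thesis by simp
      qed
      have Fh: "F h = (1/2) * (F (w j) + F (w k))"
        unfolding h_def using F_scale[OF wjk, of "1/2"] F_lin[OF w(1) w(1), of j 1 k] by simp
      have "B (\<lambda>x. w j x - w k x) (\<lambda>x. w j x - w k x) = B (w j) (w j) - 2 * B (w j) (w k) + B (w k) (w k)"
        using B_quad[OF w(1) w(1), of j "-1" k] by simp
      also have "\<dots> = 2 * Q (w j) + 2 * Q (w k) - 4 * Q h"
        unfolding Q_def Bh Fh by (simp add: algebra_simps add_divide_distrib)
      also have "\<dots> < e"
        using m[OF hD] w(2)[of j] w(2)[of k] N[OF that(1)] N[OF that(2)] by linarith
      finally show ?thesis .
    qed
    then show "\<exists>N. \<forall>j\<ge>N. \<forall>k\<ge>N. B (\<lambda>x. w j x - w k x) (\<lambda>x. w j x - w k x) < e" by blast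
  next
    fix v assume v: "v \<in> D"
    have bound: "(B (w k) v - F v)\<^sup>2 \<le> inverse (real (Suc k)) * (B v v + 1)" for k
    proof -
      define d where "d = B (w k) v - F v"
      \<comment> \<open>The summand 1 keeps the step \<open>- d / b\<close> defined for those
        \<open>v\<close> with \<open>B v v = 0\<close>.\<close>
      define b where "b = B v v + 1"
      have b: "b > 0" "B v v \<le> b" using B_pos[OF v] by (auto simp: b_def)
      define t where "t = - d / b"
      have "m \<le> Q (\<lambda>x. w k x + t * v x)" by (intro m lin w v)
      also have "\<dots> = Q (w k) + 2 * t * d + t\<^sup>2 * B v v"
        unfolding Q_def d_def using w(1) v by (simp add: B_quad F_lin algebra_simps)
      also have "\<dots> \<le> Q (w k) + 2 * t * d + t\<^sup>2 * b"
        using b by (intro add_left_mono mult_left_mono) auto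
      also have "\<dots> = Q (w k) - d\<^sup>2 / b" using b(1) by (simp add: t_def field_simps power2_eq_square)
      finally have "d\<^sup>2 / b \<le> inverse (real (Suc k))" using w(2)[of k] by linarith
      then show ?thesis unfolding d_def[symmetric] b_def[symmetric]
        using b(1) by (simp add: pos_divide_le_eq)
    qed
    have "(\<lambda>k. (B (w k) v - F v)\<^sup>2) \<leadsto> 0"
    proof (rule Lim_null_comparison)
      show "\<forall>\<^sub>F k in sequentially. norm ((B (w k) v - F v)\<^sup>2) \<le> inverse (real (Suc k)) * (B v v + 1)"
        using bound by simp
      show "(\<lambda>k. inverse (real (Suc k)) * (B v v + 1)) \<leadsto> 0"
        using tendsto_mult_left_zero[OF eps] by simp
    qed
    then have "(\<lambda>k. \<bar>B (w k) v - F v\<bar>) \<leadsto> 0"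
      using tendsto_real_sqrt[of "\<lambda>k. (B (w k) v - F v)\<^sup>2" 0 sequentially] by simp
    then show "(\<lambda>k. B (w k) v) \<leadsto> F v"
      by (simp add: LIM_zero_iff tendsto_rabs_zero_iff)
  qed
qed

locale bounded_domain =
  fixes \<Lambda> :: "'a::euclidean_space set" and lam :: real
  assumes open_\<Lambda>: "open \<Lambda>" and bounded_\<Lambda>: "bounded \<Lambda>"
    and poincare: "poincare_constant \<Lambda> lam"
begin

abbreviation M where "M \<equiv> lebesgue_on \<Lambda>"

abbreviation "H0 \<equiv> H01 \<Lambda>"
abbreviation "HD \<equiv> Hdual \<Lambda>"
abbreviation "hnrm \<equiv> H01_norm \<Lambda>"
abbreviation "wg \<equiv> wgrad \<Lambda>"
abbreviation "emb \<equiv> embH \<Lambda>"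
abbreviation L2 :: "('a \<Rightarrow> 'b::euclidean_space) \<Rightarrow> bool" where "L2 \<equiv> sq_integrable M"
abbreviation nrm :: "('a \<Rightarrow> 'b::euclidean_space) \<Rightarrow> real" where "nrm \<equiv> L2norm M"
abbreviation BM :: "('a \<Rightarrow> 'b::topological_space) set" where "BM \<equiv> borel_measurable M"
abbreviation intM :: "('a \<Rightarrow> 'b::{banach,second_countable_topology}) \<Rightarrow> bool" where "intM \<equiv> integrable M"

lemma finite_measure_M: "finite_measure M"
  by (intro finite_measure_lebesgue_on lmeasurable_open open_\<Lambda> bounded_\<Lambda>)

end

sublocale bounded_domain \<subseteq> M: finite_measure "lebesgue_on \<Lambda>"
  by (rule finite_measure_M)

context bounded_domain
begin

definition ip :: "('a \<Rightarrow> real) \<Rightarrow> ('a \<Rightarrow> real) \<Rightarrow> real" where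
  "ip f g = (LINT x|M. f x * g x)"

text \<open>The Dirichlet form. Since \<open>wgrad\<close> chooses a representative, its linearity
  is an almost everywhere statement; under this integral it becomes an identity.\<close>

definition en :: "('a \<Rightarrow> real) \<Rightarrow> ('a \<Rightarrow> real) \<Rightarrow> real" where
  "en u w = (LINT x|M. wg u x \<bullet> wg w x)"

lemma lam_pos: "lam > 0" using poincare by (simp add: poincare_constant_def)

lemma continuous_measurable_M:
  "continuous_on UNIV (f :: 'a \<Rightarrow> 'b::euclidean_space) \<Longrightarrow> f \<in> BM"
  by (intro measurable_restrict_space1 measurable_completion) (simp add: borel_measurable_continuous_onI)

lemma continuous_bounded_M:
  assumes "continuous_on UNIV (f :: 'a \<Rightarrow> 'b::euclidean_space)"
  obtains B where "B \<ge> 0" "\<And>x. x \<in> \<Lambda> \<Longrightarrow> norm (f x) \<le> B"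
proof -
  have "compact (f ` closure \<Lambda>)"
    using bounded_\<Lambda> by (intro compact_continuous_image continuous_on_subset[OF assms]) auto
  then have "bounded (f ` closure \<Lambda>)" by (rule compact_imp_bounded)
  then obtain B where B: "B > 0" "\<And>x. x \<in> closure \<Lambda> \<Longrightarrow> norm (f x) \<le> B"
    unfolding bounded_pos by auto
  show ?thesis by (rule that[of B]) (use B closure_subset[of \<Lambda>] in auto)
qed

lemma continuous_L2:
  assumes "continuous_on UNIV (f :: 'a \<Rightarrow> 'b::euclidean_space)"
  shows "L2 f"
proof -
  obtain B where "\<And>x. x \<in> \<Lambda> \<Longrightarrow> norm (f x) \<le> B" using continuous_bounded_M[OF assms] by metis
  then show ?thesis
    by (intro M.L2_bounded[where B = B] continuous_measurable_M assms) auto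
qed

section \<open>Weak gradients and the space H_0^1\<close>

lemma weak_gradient_unique:
  assumes "weak_gradient \<Lambda> u G1" "weak_gradient \<Lambda> u G2"
  shows "AE x in M. G1 x = G2 x"
proof -
  have sq: "L2 G1" "L2 G2"
    using assms by (auto simp: weak_gradient_def Lq2_iff)
  have "AE x in M. (G1 x - G2 x) \<bullet> b = 0" if b: "b \<in> Basis" for b
  proof (rule fundamental_lemma[OF open_\<Lambda>])
    have i: "intM (\<lambda>x. G1 x \<bullet> b)" "intM (\<lambda>x. G2 x \<bullet> b)"
      using sq[THEN M.L2_integrable] by auto
    then show "intM (\<lambda>x. (G1 x - G2 x) \<bullet> b)" by (simp add: inner_diff_left)
    fix \<psi> assume \<psi>: "\<psi> \<in> C0inf \<Lambda>"
    have s: "L2 (\<lambda>x. G1 x \<bullet> b)" "L2 (\<lambda>x. G2 x \<bullet> b)"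
      by (rule L2_bound[OF sq(1)] L2_bound[OF sq(2)];
          use sq[THEN L2_measurable] b in \<open>auto simp: Basis_le_norm\<close>)+
    have p: "L2 \<psi>" by (intro continuous_L2 C0inf_continuous[OF \<psi>])
    have "(LINT x|M. (G1 x - G2 x) \<bullet> b * \<psi> x) = (LINT x|M. (G1 x \<bullet> b) * \<psi> x) - (LINT x|M. (G2 x \<bullet> b) * \<psi> x)"
      using L2_mult[OF s(1) p] L2_mult[OF s(2) p]
      by (simp add: inner_diff_left left_diff_distrib)
    also have "\<dots> = 0" using assms \<psi> b by (simp add: weak_gradient_def)
    finally show "(LINT x|M. (G1 x - G2 x) \<bullet> b * \<psi> x) = 0" .
  qed
  then have "AE x in M. \<forall>b\<in>Basis. (G1 x - G2 x) \<bullet> b = 0"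
    by (simp add: AE_finite_all)
  then show ?thesis
    by eventually_elim (simp add: euclidean_eq_iff[where 'a = 'a] inner_diff_left)
qed

lemma weak_gradient_C1:
  assumes "Ck (Suc 0) f"
  shows "weak_gradient \<Lambda> f (gradient f)"
  unfolding weak_gradient_def Lq2_iff
proof (intro conjI ballI)
  show "L2 (gradient f)"
    by (intro continuous_L2 Ck1_continuous_gradient[OF assms])
  fix \<psi> b assume "\<psi> \<in> C0inf \<Lambda>" "b \<in> (Basis :: 'a set)"
  then show "(LINT x|M. f x * frechet_derivative \<psi> (at x) b) = - (LINT x|M. (gradient f x \<bullet> b) * \<psi> x)"
    using integration_by_parts_C1(3)[OF open_\<Lambda> assms C0inf_C0k] by (simp add: gradient_inner)
qed

lemma wgrad_weak_gradient: "weak_gradient \<Lambda> u G \<Longrightarrow> weak_gradient \<Lambda> u (wg u)"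
  unfolding wgrad_def by (rule someI[of "weak_gradient \<Lambda> u"])

lemma wgrad_eq: "weak_gradient \<Lambda> u G \<Longrightarrow> AE x in M. wg u x = G x"
  by (rule weak_gradient_unique[OF wgrad_weak_gradient])

lemma H01_L2: "u \<in> H0 \<Longrightarrow> L2 u"
  by (simp add: H01_def Lq2_iff)

lemma H01_weak_gradient: "u \<in> H0 \<Longrightarrow> weak_gradient \<Lambda> u (wg u)"
  unfolding H01_def using wgrad_weak_gradient by blast

lemma wgrad_L2: "u \<in> H0 \<Longrightarrow> L2 (wg u)"
  using H01_weak_gradient[of u] by (simp add: weak_gradient_def Lq2_iff)

lemma C0inf_L2: "\<psi> \<in> C0inf \<Lambda> \<Longrightarrow> L2 \<psi>"
  by (intro continuous_L2 C0inf_continuous)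

lemma C0inf_Ck: "\<psi> \<in> C0inf \<Lambda> \<Longrightarrow> Ck k \<psi>"
  by (simp add: C0inf_def)

lemma C0inf_gradient_L2: "\<psi> \<in> C0inf \<Lambda> \<Longrightarrow> L2 (gradient \<psi>)"
  by (intro continuous_L2 Ck1_continuous_gradient C0inf_Ck)

lemma H01_approx:
  assumes "u \<in> H0"
  shows "\<exists>\<psi>. (\<forall>n. \<psi> n \<in> C0inf \<Lambda>) \<and> (\<lambda>n. nrm (\<lambda>x. \<psi> n x - u x)) \<leadsto> 0
    \<and> (\<lambda>n. nrm (\<lambda>x. gradient (\<psi> n) x - wg u x)) \<leadsto> 0"
  using assms unfolding H01_def Lq_norm2 by blast

text \<open>Weak gradients are closed: both sides of the defining identity converge by the L^2
  convergence. The second conclusion identifies the representative chosen by \<open>wgrad\<close>,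
  which later limits need.\<close>

lemma H01_limit:
  assumes \<psi>: "\<And>n. \<psi> n \<in> C0inf \<Lambda>" and u: "L2 u" and G: "L2 G"
    and lim: "(\<lambda>n. nrm (\<lambda>x. \<psi> n x - u x)) \<leadsto> 0"
      "(\<lambda>n. nrm (\<lambda>x. gradient (\<psi> n) x - G x)) \<leadsto> 0"
  shows "u \<in> H0" "AE x in M. wg u x = G x"
proof -
  have w: "weak_gradient \<Lambda> u G"
    unfolding weak_gradient_def Lq2_iff
  proof (intro conjI ballI G)
    fix \<eta> b assume \<eta>: "\<eta> \<in> C0inf \<Lambda>" and b: "b \<in> (Basis :: 'a set)"
    have d: "L2 (\<lambda>x. frechet_derivative \<eta> (at x) b)"
      using C0inf_Ck[OF \<eta>, of "Suc 0"] b by (intro continuous_L2) auto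
    have c: "L2 (\<lambda>x. \<eta> x *\<^sub>R b)"
      by (intro continuous_L2 continuous_intros C0inf_continuous[OF \<eta>])
    have l1: "(\<lambda>n. LINT x|M. \<psi> n x \<bullet> frechet_derivative \<eta> (at x) b) \<leadsto> (LINT x|M. u x \<bullet> frechet_derivative \<eta> (at x) b)"
      by (rule L2_tendsto_inner[OF C0inf_L2[OF \<psi>] u d lim(1)])
    have l2: "(\<lambda>n. - (LINT x|M. gradient (\<psi> n) x \<bullet> (\<eta> x *\<^sub>R b))) \<leadsto> - (LINT x|M. G x \<bullet> (\<eta> x *\<^sub>R b))"
      by (intro tendsto_minus L2_tendsto_inner[OF C0inf_gradient_L2[OF \<psi>] G c lim(2)])
    have eq: "(LINT x|M. \<psi> n x \<bullet> frechet_derivative \<eta> (at x) b) = - (LINT x|M. gradient (\<psi> n) x \<bullet> (\<eta> x *\<^sub>R b))" for n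
      using weak_gradient_C1[OF C0inf_Ck[OF \<psi>], of n] \<eta> b by (simp add: weak_gradient_def mult.commute)
    have "(LINT x|M. u x \<bullet> frechet_derivative \<eta> (at x) b) = - (LINT x|M. G x \<bullet> (\<eta> x *\<^sub>R b))"
      using LIMSEQ_unique[OF l1] l2 unfolding eq by blast
    then show "(LINT x|M. u x * frechet_derivative \<eta> (at x) b) = - (LINT x|M. (G x \<bullet> b) * \<eta> x)"
      by (simp add: mult.commute)
  qed
  show ae: "AE x in M. wg u x = G x" by (rule wgrad_eq[OF w])
  have ww: "L2 (wg u)"
    using wgrad_weak_gradient[OF w] by (simp add: weak_gradient_def Lq2_iff)
  have "nrm (\<lambda>x. gradient (\<psi> n) x - G x) = nrm (\<lambda>x. gradient (\<psi> n) x - wg u x)" for n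
    using ae by (intro L2norm_cong_AE L2_measurable L2_diff C0inf_gradient_L2 \<psi> G ww)
      (auto elim: eventually_mono)
  then show "u \<in> H0"
    unfolding H01_def Lq_norm2 Lq2_iff using w u \<psi> lim by auto
qed

lemma C0inf_H01:
  assumes "\<psi> \<in> C0inf \<Lambda>"
  shows "\<psi> \<in> H0" "AE x in M. wg \<psi> x = gradient \<psi> x"
  using H01_limit[of "\<lambda>n. \<psi>" \<psi> "gradient \<psi>"] assms
  by (auto simp: C0inf_L2 C0inf_gradient_L2 L2norm_def)

lemma zero_H01: "(\<lambda>x. 0) \<in> H0"
  by (rule C0inf_H01(1)[OF C0inf_zero])

lemma tendsto_L2norm_le:
  assumes "\<And>n. a n \<le> b n + c n" "\<And>n. 0 \<le> (a n :: real)" "b \<leadsto> 0" "c \<leadsto> 0"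
  shows "a \<leadsto> 0"
proof (rule Lim_null_comparison)
  show "\<forall>\<^sub>F n in sequentially. norm (a n) \<le> b n + c n" using assms(1,2) by auto
  show "(\<lambda>n. b n + c n) \<leadsto> 0" using tendsto_add[OF assms(3,4)] by simp
qed

lemma H01_add:
  assumes "u \<in> H0" "v \<in> H0"
  shows "(\<lambda>x. u x + v x) \<in> H0" "AE x in M. wg (\<lambda>x. u x + v x) x = wg u x + wg v x"
proof -
  obtain \<psi> where \<psi>: "\<And>n. \<psi> n \<in> C0inf \<Lambda>" "(\<lambda>n. nrm (\<lambda>x. \<psi> n x - u x)) \<leadsto> 0"
    "(\<lambda>n. nrm (\<lambda>x. gradient (\<psi> n) x - wg u x)) \<leadsto> 0" using H01_approx[OF assms(1)] by blast
  obtain \<eta> where \<eta>: "\<And>n. \<eta> n \<in> C0inf \<Lambda>" "(\<lambda>n. nrm (\<lambda>x. \<eta> n x - v x)) \<leadsto> 0"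
    "(\<lambda>n. nrm (\<lambda>x. gradient (\<eta> n) x - wg v x)) \<leadsto> 0" using H01_approx[OF assms(2)] by blast
  note s = H01_L2[OF assms(1)] H01_L2[OF assms(2)]
    wgrad_L2[OF assms(1)] wgrad_L2[OF assms(2)]
    C0inf_L2[OF \<psi>(1)] C0inf_L2[OF \<eta>(1)]
    C0inf_gradient_L2[OF \<psi>(1)] C0inf_gradient_L2[OF \<eta>(1)]
  have 1: "(\<lambda>n. nrm (\<lambda>x. (\<psi> n x + \<eta> n x) - (u x + v x))) \<leadsto> 0"
  proof (rule tendsto_L2norm_le[OF _ _ \<psi>(2) \<eta>(2)])
    show "nrm (\<lambda>x. (\<psi> n x + \<eta> n x) - (u x + v x)) \<le> nrm (\<lambda>x. \<psi> n x - u x) + nrm (\<lambda>x. \<eta> n x - v x)" for n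
      using L2norm_triangle[OF L2_diff[OF s(5) s(1)] L2_diff[OF s(6) s(2)], of n n]
      by (simp add: algebra_simps)
  qed simp
  have 2: "(\<lambda>n. nrm (\<lambda>x. gradient (\<lambda>x. \<psi> n x + \<eta> n x) x - (wg u x + wg v x))) \<leadsto> 0"
  proof (rule tendsto_L2norm_le[OF _ _ \<psi>(3) \<eta>(3)])
    show "nrm (\<lambda>x. gradient (\<lambda>x. \<psi> n x + \<eta> n x) x - (wg u x + wg v x))
      \<le> nrm (\<lambda>x. gradient (\<psi> n) x - wg u x) + nrm (\<lambda>x. gradient (\<eta> n) x - wg v x)" for n
      using L2norm_triangle[OF L2_diff[OF s(7) s(3)] L2_diff[OF s(8) s(4)], of n n]
      by (simp add: gradient_add C0inf_differentiable[OF \<psi>(1)] C0inf_differentiable[OF \<eta>(1)] algebra_simps)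
  qed simp
  show "(\<lambda>x. u x + v x) \<in> H0" "AE x in M. wg (\<lambda>x. u x + v x) x = wg u x + wg v x"
    using H01_limit[OF C0inf_add[OF \<psi>(1) \<eta>(1)] L2_add[OF s(1,2)] L2_add[OF s(3,4)] 1 2] by auto
qed

lemma H01_cmult:
  assumes "u \<in> H0"
  shows "(\<lambda>x. c * u x) \<in> H0" "AE x in M. wg (\<lambda>x. c * u x) x = c *\<^sub>R wg u x"
proof -
  obtain \<psi> where \<psi>: "\<And>n. \<psi> n \<in> C0inf \<Lambda>" "(\<lambda>n. nrm (\<lambda>x. \<psi> n x - u x)) \<leadsto> 0"
    "(\<lambda>n. nrm (\<lambda>x. gradient (\<psi> n) x - wg u x)) \<leadsto> 0" using H01_approx[OF assms(1)] by blast
  have "nrm (\<lambda>x. c * \<psi> n x - c * u x) = \<bar>c\<bar> * nrm (\<lambda>x. \<psi> n x - u x)" for n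
    using L2norm_cmult[of M c "\<lambda>x. \<psi> n x - u x"] by (simp add: right_diff_distrib)
  then have 1: "(\<lambda>n. nrm (\<lambda>x. c * \<psi> n x - c * u x)) \<leadsto> 0"
    using tendsto_mult_right_zero[OF \<psi>(2)] by simp
  have "nrm (\<lambda>x. gradient (\<lambda>x. c * \<psi> n x) x - c *\<^sub>R wg u x) = \<bar>c\<bar> * nrm (\<lambda>x. gradient (\<psi> n) x - wg u x)" for n
    using L2norm_scaleR[of M c "\<lambda>x. gradient (\<psi> n) x - wg u x"]
    by (simp add: scaleR_right_diff_distrib gradient_cmult C0inf_differentiable[OF \<psi>(1)])
  then have 2: "(\<lambda>n. nrm (\<lambda>x. gradient (\<lambda>x. c * \<psi> n x) x - c *\<^sub>R wg u x)) \<leadsto> 0"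
    using tendsto_mult_right_zero[OF \<psi>(3)] by simp
  show "(\<lambda>x. c * u x) \<in> H0" "AE x in M. wg (\<lambda>x. c * u x) x = c *\<^sub>R wg u x"
    using H01_limit[OF C0inf_cmult[OF \<psi>(1)] L2_cmult[OF H01_L2[OF assms]]
        L2_scaleR[OF wgrad_L2[OF assms]] 1 2] by auto
qed

lemma H01_diff:
  assumes "u \<in> H0" "v \<in> H0"
  shows "(\<lambda>x. u x - v x) \<in> H0" "AE x in M. wg (\<lambda>x. u x - v x) x = wg u x - wg v x"
proof -
  show "(\<lambda>x. u x - v x) \<in> H0"
    using H01_add(1)[OF assms(1) H01_cmult(1)[OF assms(2), of "-1"]] by simp
  show "AE x in M. wg (\<lambda>x. u x - v x) x = wg u x - wg v x"
    using H01_add(2)[OF assms(1) H01_cmult(1)[OF assms(2), of "-1"]] H01_cmult(2)[OF assms(2), of "-1"]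
    by eventually_elim simp
qed

text \<open>A diagonal choice of test functions, the n-th one within 1 / (n + 1) of
  \<open>w n\<close> in both norms, reduces the claim to limits of test functions.\<close>

lemma H01_closed:
  assumes w: "\<And>n. w n \<in> H0" and u: "L2 u" and G: "L2 G"
    and lim: "(\<lambda>n. nrm (\<lambda>x. w n x - u x)) \<leadsto> 0"
      "(\<lambda>n. nrm (\<lambda>x. wg (w n) x - G x)) \<leadsto> 0"
  shows "u \<in> H0" "AE x in M. wg u x = G x"
proof -
  have "\<exists>\<psi>\<in>C0inf \<Lambda>. nrm (\<lambda>x. \<psi> x - w n x) < inverse (real (Suc n)) \<and>
    nrm (\<lambda>x. gradient \<psi> x - wg (w n) x) < inverse (real (Suc n))" for n
  proof -
    obtain \<psi> where \<psi>: "\<And>n. \<psi> n \<in> C0inf \<Lambda>" "(\<lambda>k. nrm (\<lambda>x. \<psi> k x - w n x)) \<leadsto> 0"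
      "(\<lambda>k. nrm (\<lambda>x. gradient (\<psi> k) x - wg (w n) x)) \<leadsto> 0" using H01_approx[OF w[of n]] by blast
    have "\<forall>\<^sub>F k in sequentially. nrm (\<lambda>x. \<psi> k x - w n x) < inverse (real (Suc n)) \<and>
      nrm (\<lambda>x. gradient (\<psi> k) x - wg (w n) x) < inverse (real (Suc n))"
      by (intro eventually_conj order_tendstoD(2)[OF \<psi>(2)] order_tendstoD(2)[OF \<psi>(3)]) auto
    then show ?thesis using \<psi>(1) unfolding eventually_sequentially by blast
  qed
  then obtain \<psi> where \<psi>: "\<And>n. \<psi> n \<in> C0inf \<Lambda>" "\<And>n. nrm (\<lambda>x. \<psi> n x - w n x) < inverse (real (Suc n))"
    "\<And>n. nrm (\<lambda>x. gradient (\<psi> n) x - wg (w n) x) < inverse (real (Suc n))" by metis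
  have 1: "(\<lambda>n. nrm (\<lambda>x. \<psi> n x - u x)) \<leadsto> 0"
  proof (rule tendsto_L2norm_le[OF _ _ LIMSEQ_inverse_real_of_nat lim(1)])
    show "nrm (\<lambda>x. \<psi> n x - u x) \<le> inverse (real (Suc n)) + nrm (\<lambda>x. w n x - u x)" for n
      using L2norm_triangle_diff[OF C0inf_L2[OF \<psi>(1)] H01_L2[OF w] u, of n n] \<psi>(2)[of n] by linarith
  qed simp
  have 2: "(\<lambda>n. nrm (\<lambda>x. gradient (\<psi> n) x - G x)) \<leadsto> 0"
  proof (rule tendsto_L2norm_le[OF _ _ LIMSEQ_inverse_real_of_nat lim(2)])
    show "nrm (\<lambda>x. gradient (\<psi> n) x - G x) \<le> inverse (real (Suc n)) + nrm (\<lambda>x. wg (w n) x - G x)" for n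
      using L2norm_triangle_diff[OF C0inf_gradient_L2[OF \<psi>(1)] wgrad_L2[OF w] G, of n n] \<psi>(3)[of n] by linarith
  qed simp
  show "u \<in> H0" "AE x in M. wg u x = G x"
    using H01_limit[OF \<psi>(1) u G 1 2] by auto
qed

section \<open>The L^2 product, the Dirichlet form and the dual space\<close>

lemma ip_commute: "ip f g = ip g f"
  by (simp add: ip_def mult.commute)

lemma ip_add_left:
  "L2 f \<Longrightarrow> L2 g \<Longrightarrow> L2 h \<Longrightarrow> ip (\<lambda>x. f x + g x) h = ip f h + ip g h"
  by (simp add: ip_def distrib_right L2_mult)

lemma ip_diff_left:
  "L2 f \<Longrightarrow> L2 g \<Longrightarrow> L2 h \<Longrightarrow> ip (\<lambda>x. f x - g x) h = ip f h - ip g h"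
  by (simp add: ip_def left_diff_distrib L2_mult)

lemma ip_cmult_left: "ip (\<lambda>x. c * f x) h = c * ip f h"
  by (simp add: ip_def mult.assoc)

lemma ip_add_right:
  "L2 f \<Longrightarrow> L2 g \<Longrightarrow> L2 h \<Longrightarrow> ip h (\<lambda>x. f x + g x) = ip h f + ip h g"
  by (simp add: ip_def distrib_left L2_mult)

lemma ip_diff_right:
  "L2 f \<Longrightarrow> L2 g \<Longrightarrow> L2 h \<Longrightarrow> ip h (\<lambda>x. f x - g x) = ip h f - ip h g"
  by (simp add: ip_def right_diff_distrib L2_mult)

lemma ip_cmult_right: "ip h (\<lambda>x. c * f x) = c * ip h f"
  by (simp add: ip_def mult.left_commute)

lemma ip_self: "ip f f = (nrm f)\<^sup>2"
  by (simp add: ip_def L2norm_sq flip: power2_eq_square)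

lemma ip_bound: "L2 f \<Longrightarrow> L2 g \<Longrightarrow> \<bar>ip f g\<bar> \<le> nrm f * nrm g"
  unfolding ip_def by (rule L2_Cauchy_Schwarz_real)

lemma H01_norm_eq: "hnrm u = nrm (wg u)"
  by (simp add: H01_norm_def L2norm_def)

lemma H01_norm_nonneg [simp]: "0 \<le> hnrm u"
  by (simp add: H01_norm_eq)

lemma en_commute: "en u w = en w u"
  by (simp add: en_def inner_commute)

lemma en_self: "en u u = (hnrm u)\<^sup>2"
  by (simp add: en_def H01_norm_eq L2norm_sq power2_norm_eq_inner)

lemma en_nonneg: "0 \<le> en u u"
  by (simp add: en_self)

lemma en_bound: "u \<in> H0 \<Longrightarrow> w \<in> H0 \<Longrightarrow> \<bar>en u w\<bar> \<le> hnrm u * hnrm w"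
  unfolding en_def H01_norm_eq by (intro L2_Cauchy_Schwarz wgrad_L2)

lemma en_add_left:
  assumes "u \<in> H0" "v \<in> H0" "w \<in> H0"
  shows "en (\<lambda>x. u x + v x) w = en u w + en v w"
proof -
  note s = wgrad_L2[OF assms(1)] wgrad_L2[OF assms(2)] wgrad_L2[OF assms(3)]
  have "en (\<lambda>x. u x + v x) w = (LINT x|M. (wg u x + wg v x) \<bullet> wg w x)"
    unfolding en_def
  proof (rule integral_cong_AE)
    show "AE x in M. wg (\<lambda>x. u x + v x) x \<bullet> wg w x = (wg u x + wg v x) \<bullet> wg w x"
      using H01_add(2)[OF assms(1,2)] by eventually_elim simp
  qed (use s[THEN L2_measurable] wgrad_L2[OF H01_add(1)[OF assms(1,2)], THEN L2_measurable]
      in simp_all)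
  also have "\<dots> = en u w + en v w"
    unfolding en_def using s by (simp add: inner_add_left L2_inner)
  finally show ?thesis .
qed

lemma en_cmult_left:
  assumes "u \<in> H0" "w \<in> H0"
  shows "en (\<lambda>x. c * u x) w = c * en u w"
proof -
  note s = wgrad_L2[OF assms(1)] wgrad_L2[OF assms(2)]
  have "en (\<lambda>x. c * u x) w = (LINT x|M. (c *\<^sub>R wg u x) \<bullet> wg w x)"
    unfolding en_def
  proof (rule integral_cong_AE)
    show "AE x in M. wg (\<lambda>x. c * u x) x \<bullet> wg w x = (c *\<^sub>R wg u x) \<bullet> wg w x"
      using H01_cmult(2)[OF assms(1), of c] by eventually_elim simp
  qed (use s[THEN L2_measurable] wgrad_L2[OF H01_cmult(1)[OF assms(1)], THEN L2_measurable]
      in simp_all)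
  also have "\<dots> = c * en u w"
    unfolding en_def by simp
  finally show ?thesis .
qed

lemma en_diff_left:
  assumes "u \<in> H0" "v \<in> H0" "w \<in> H0"
  shows "en (\<lambda>x. u x - v x) w = en u w - en v w"
  using en_add_left[OF assms(1) H01_cmult(1)[OF assms(2), of "-1"] assms(3)] en_cmult_left[OF assms(2,3), of "-1"]
  by simp

lemma poincare_H01:
  assumes "u \<in> H0"
  shows "lam * (nrm u)\<^sup>2 \<le> en u u"
  using poincare assms by (simp add: poincare_constant_def L2norm_sq en_def power2_norm_eq_inner)

lemma poincare_norm:
  assumes "u \<in> H0"
  shows "nrm u \<le> hnrm u / sqrt lam"
proof (rule power2_le_imp_le)
  show "(nrm u)\<^sup>2 \<le> (hnrm u / sqrt lam)\<^sup>2"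
    using poincare_H01[OF assms] lam_pos by (simp add: en_self power_divide field_simps)
qed (use lam_pos in simp)

lemma HdualD:
  assumes "F \<in> HD"
  shows "u \<in> H0 \<Longrightarrow> v \<in> H0 \<Longrightarrow> F (\<lambda>x. u x + v x) = F u + F v"
    "u \<in> H0 \<Longrightarrow> F (\<lambda>x. k * u x) = k * F u"
  using assms by (auto simp: Hdual_def)

lemma Hdual_bound:
  assumes "F \<in> HD"
  obtains B where "B \<ge> 0" "\<And>u. u \<in> H0 \<Longrightarrow> \<bar>F u\<bar> \<le> B * hnrm u"
proof -
  obtain B where B: "\<forall>u\<in>H0. \<bar>F u\<bar> \<le> B * hnrm u" using assms by (auto simp: Hdual_def)
  have "\<bar>F u\<bar> \<le> \<bar>B\<bar> * hnrm u" if "u \<in> H0" for u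
    using B that mult_right_mono[of B "\<bar>B\<bar>" "hnrm u"] by fastforce
  then show ?thesis using that[of "\<bar>B\<bar>"] by simp
qed

text \<open>With \<beta> = 0 this represents functionals by their potentials, with \<beta> = n it
  yields the resolvent. The minimising sequence is Cauchy in the gradients, and the Poincare
  inequality makes it Cauchy in L^2, so its limit stays in H_0^1.\<close>

lemma riesz_energy:
  assumes F: "F \<in> HD" and \<beta>: "\<beta> \<ge> 0"
  shows "\<exists>u\<in>H0. \<forall>v\<in>H0. en u v + \<beta> * ip u v = F v"
proof -
  define B where "B = (\<lambda>u v. en u v + \<beta> * ip u v)"
  obtain K where K: "K \<ge> 0" "\<And>u. u \<in> H0 \<Longrightarrow> \<bar>F u\<bar> \<le> K * hnrm u" using Hdual_bound[OF F] by metis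
  have B_ge: "(hnrm u)\<^sup>2 \<le> B u u" for u
    using \<beta> by (simp add: B_def en_self ip_self)
  obtain w where w: "\<And>k. w k \<in> H0"
    "\<And>e. e > 0 \<Longrightarrow> \<exists>N. \<forall>j\<ge>N. \<forall>k\<ge>N. B (\<lambda>x. w j x - w k x) (\<lambda>x. w j x - w k x) < e"
    "\<And>v. v \<in> H0 \<Longrightarrow> (\<lambda>k. B (w k) v) \<leadsto> F v"
  proof (rule riesz_minimizing_sequence[of "H0" B F K])
    show "\<And>u v w. u \<in> H0 \<Longrightarrow> v \<in> H0 \<Longrightarrow> w \<in> H0 \<Longrightarrow> B (\<lambda>x. u x + v x) w = B u w + B v w"
      unfolding B_def by (simp add: en_add_left ip_add_left H01_L2 algebra_simps)
    show "\<And>c u w. u \<in> H0 \<Longrightarrow> w \<in> H0 \<Longrightarrow> B (\<lambda>x. c * u x) w = c * B u w"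
      unfolding B_def by (simp add: en_cmult_left ip_cmult_left algebra_simps)
    show "\<bar>F u\<bar> \<le> K * sqrt (B u u)" if "u \<in> H0" for u
    proof -
      have "hnrm u \<le> sqrt (B u u)" using B_ge by (intro real_le_rsqrt)
      then show ?thesis using K(2)[OF that] mult_left_mono[OF _ K(1)] by fastforce
    qed
    show "B u u \<ge> 0" for u using B_ge[of u] zero_le_power2[of "hnrm u"] by linarith
    show "B u w = B w u" for u w by (simp only: B_def en_commute[of u w] ip_commute[of u w])
    show "H0 \<noteq> {}" using zero_H01 by blast
  qed (use H01_add(1) H01_cmult(1) HdualD[OF F] in blast)+
  have grad: "\<exists>N. \<forall>m\<ge>N. \<forall>n\<ge>N. nrm (\<lambda>x. wg (w m) x - wg (w n) x) < e"
    and fct: "\<exists>N. \<forall>m\<ge>N. \<forall>n\<ge>N. nrm (\<lambda>x. w m x - w n x) < e" if e: "e > 0" for e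
  proof -
    \<comment> \<open>Small enough for the gradients directly, and for the functions after division
      by the root of the Poincare constant.\<close>
    define e' where "e' = min e (e * sqrt lam)"
    have e': "e' > 0" "e' \<le> e" "e' / sqrt lam \<le> e" using e lam_pos by (auto simp: e'_def field_simps min_def)
    obtain N where N: "\<And>j k. j \<ge> N \<Longrightarrow> k \<ge> N \<Longrightarrow> B (\<lambda>x. w j x - w k x) (\<lambda>x. w j x - w k x) < e'\<^sup>2"
      using w(2)[of "e'\<^sup>2"] e'(1) by auto
    have h: "hnrm (\<lambda>x. w j x - w k x) < e'" if "j \<ge> N" "k \<ge> N" for j k
      using order_le_less_trans[OF B_ge N[OF that]] e'(1) by (rule power2_less_imp_less[OF _ less_imp_le])
    have "nrm (\<lambda>x. wg (w j) x - wg (w k) x) = hnrm (\<lambda>x. w j x - w k x)" for j k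
      unfolding H01_norm_eq using H01_diff[OF w(1)[of j] w(1)[of k]]
      by (intro L2norm_cong_AE L2_measurable L2_diff wgrad_L2 w) (auto elim: eventually_mono)
    then have "nrm (\<lambda>x. wg (w j) x - wg (w k) x) < e" if "j \<ge> N" "k \<ge> N" for j k
      using h[OF that] e'(2) by simp
    then show "\<exists>N. \<forall>m\<ge>N. \<forall>n\<ge>N. nrm (\<lambda>x. wg (w m) x - wg (w n) x) < e" by blast
    have "nrm (\<lambda>x. w j x - w k x) < e" if "j \<ge> N" "k \<ge> N" for j k
    proof -
      have "nrm (\<lambda>x. w j x - w k x) \<le> hnrm (\<lambda>x. w j x - w k x) / sqrt lam"
        by (intro poincare_norm H01_diff w)
      also have "\<dots> < e' / sqrt lam" using h[OF that] lam_pos by (intro divide_strict_right_mono) auto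
      finally show ?thesis using e'(3) by simp
    qed
    then show "\<exists>N. \<forall>m\<ge>N. \<forall>n\<ge>N. nrm (\<lambda>x. w m x - w n x) < e" by blast
  qed
  obtain u where u: "L2 u" "(\<lambda>n. nrm (\<lambda>x. w n x - u x)) \<leadsto> 0"
    using M.L2_complete[of w, OF H01_L2[OF w(1)] fct] by auto
  obtain G where G: "L2 G" "(\<lambda>n. nrm (\<lambda>x. wg (w n) x - G x)) \<leadsto> 0"
    using M.L2_complete[of "\<lambda>k. wg (w k)", OF wgrad_L2[OF w(1)] grad] by auto
  note uH = H01_closed[OF w(1) u(1) G(1) u(2) G(2)]
  have "B u v = F v" if v: "v \<in> H0" for v
  proof -
    have "(\<lambda>k. LINT x|M. wg (w k) x \<bullet> wg v x) \<leadsto> (LINT x|M. G x \<bullet> wg v x)"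
      by (intro L2_tendsto_inner wgrad_L2 w G v)
    moreover have "(LINT x|M. G x \<bullet> wg v x) = en u v"
      unfolding en_def using uH wgrad_L2[OF uH(1)] G(1) wgrad_L2[OF v]
      by (intro integral_cong_AE) (auto simp: sq_integrable_def elim: eventually_mono)
    moreover have "(\<lambda>k. LINT x|M. w k x \<bullet> v x) \<leadsto> (LINT x|M. u x \<bullet> v x)"
      by (intro L2_tendsto_inner H01_L2 w u v)
    ultimately have "(\<lambda>k. B (w k) v) \<leadsto> B u v"
      unfolding B_def en_def ip_def by (auto intro!: tendsto_intros)
    with w(3)[OF v] show ?thesis using LIMSEQ_unique by blast
  qed
  then show ?thesis using uH(1) unfolding B_def by blast
qed

text \<open>Without control of gradients the minimisers converge only in L^2. They are kept in the
  conclusion because, for a functional that comes from an L^2 function, they approximate that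
  function by elements of H_0^1.\<close>

lemma riesz_L2:
  assumes F: "F \<in> HD" and K: "\<And>u. u \<in> H0 \<Longrightarrow> \<bar>F u\<bar> \<le> K * nrm u"
  shows "\<exists>f w. L2 f \<and> (\<forall>v\<in>H0. F v = ip f v) \<and>
    (\<forall>k::nat. w k \<in> H0) \<and> (\<lambda>k. nrm (\<lambda>x. w k x - f x)) \<leadsto> 0"
proof -
  obtain w where w: "\<And>k. w k \<in> H0"
    "\<And>e. e > 0 \<Longrightarrow> \<exists>N. \<forall>j\<ge>N. \<forall>k\<ge>N. ip (\<lambda>x. w j x - w k x) (\<lambda>x. w j x - w k x) < e"
    "\<And>v. v \<in> H0 \<Longrightarrow> (\<lambda>k. ip (w k) v) \<leadsto> F v"
  proof (rule riesz_minimizing_sequence[of "H0" ip F K])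
    show "ip u w = ip w u" for u w by (rule ip_commute)
    show "ip u u \<ge> 0" for u by (simp add: ip_self)
    show "ip (\<lambda>x. c * u x) w = c * ip u w" for c u w by (rule ip_cmult_left)
    show "ip (\<lambda>x. u x + v x) w = ip u w + ip v w" if "u \<in> H0" "v \<in> H0" "w \<in> H0" for u v w
      using that by (intro ip_add_left H01_L2)
    show "\<bar>F u\<bar> \<le> K * sqrt (ip u u)" if "u \<in> H0" for u using K[OF that] by (simp add: ip_self)
    show "H0 \<noteq> {}" using zero_H01 by blast
  qed (use H01_add(1) H01_cmult(1) HdualD[OF F] in blast)+
  have "\<exists>N. \<forall>m\<ge>N. \<forall>n\<ge>N. nrm (\<lambda>x. w m x - w n x) < e" if e: "e > 0" for e
  proof -
    obtain N where "\<And>j k. j \<ge> N \<Longrightarrow> k \<ge> N \<Longrightarrow> (nrm (\<lambda>x. w j x - w k x))\<^sup>2 < e\<^sup>2"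
      using w(2)[of "e\<^sup>2"] e unfolding ip_self by auto
    then have "nrm (\<lambda>x. w j x - w k x) < e" if "j \<ge> N" "k \<ge> N" for j k
      using power2_less_imp_less[OF _ less_imp_le[OF e]] that by blast
    then show ?thesis by blast
  qed
  then obtain f where f: "L2 f" "(\<lambda>n. nrm (\<lambda>x. w n x - f x)) \<leadsto> 0"
    using M.L2_complete[of w, OF H01_L2[OF w(1)]] by auto
  have "F v = ip f v" if v: "v \<in> H0" for v
  proof -
    have "(\<lambda>k. LINT x|M. w k x \<bullet> v x) \<leadsto> (LINT x|M. f x \<bullet> v x)"
      by (intro L2_tendsto_inner H01_L2 w f v)
    then have "(\<lambda>k. ip (w k) v) \<leadsto> ip f v" by (simp add: ip_def)
    with w(3)[OF v] show ?thesis using LIMSEQ_unique by blast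
  qed
  with f w(1) show ?thesis by blast
qed

end

section \<open>The resolvent of the Dirichlet Laplacian\<close>

text \<open>Almost everywhere inequalities with a parameter can be collected over countably many
  parameters; continuity extends them to all, in particular to a parameter that depends on the
  point.\<close>

lemma continuous_le_dense:
  fixes a b :: "'c::topological_space \<Rightarrow> real"
  assumes "closure D = UNIV" "continuous_on UNIV a" "continuous_on UNIV b" "\<And>x. x \<in> D \<Longrightarrow> a x \<le> b x"
  shows "a x \<le> b x"
proof -
  have "closed {x. a x \<le> b x}" using assms(2,3) by (intro closed_Collect_le)
  then have "closure D \<subseteq> {x. a x \<le> b x}" using assms(4) by (intro closure_minimal) auto
  then show ?thesis using assms(1) by auto
qed

lemma ex_countable_dense: "\<exists>D::'c::second_countable_topology set. countable D \<and> closure D = UNIV"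
proof -
  obtain D :: "'c set" where D: "countable D" "\<And>X. open X \<Longrightarrow> X \<noteq> {} \<Longrightarrow> \<exists>d\<in>D. d \<in> X"
    using countable_dense_exists by blast
  have "closure D = UNIV"
  proof (rule ccontr)
    assume "closure D \<noteq> UNIV"
    then obtain d where "d \<in> D" "d \<in> - closure D" using D(2)[of "- closure D"] by auto
    then show False using closure_subset by blast
  qed
  with D(1) show ?thesis by blast
qed

lemma Ck_norm_sq: "Ck k (\<lambda>y. (norm (y - x0))\<^sup>2)"
proof -
  have "(norm (y - x0))\<^sup>2 = (\<Sum>b\<in>Basis. (y \<bullet> b - x0 \<bullet> b) * (y \<bullet> b - x0 \<bullet> b))" for y
    by (subst power2_norm_eq_inner, subst euclidean_inner) (simp add: inner_diff_left)
  then show ?thesis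
    by (simp add: Ck_sum Ck_mult Ck_diff Ck_inner)
qed

lemma laplacian_const: "laplacian (\<lambda>x. c) x = 0"
  by (simp add: laplacian_def)

text \<open>Quadratic functions are the barriers of the comparison arguments; their constant
  Laplacian is the origin of the factors \<open>2 * DIM('a)\<close> below.\<close>

lemma laplacian_norm_sq:
  fixes x0 :: "'a::euclidean_space"
  shows "laplacian (\<lambda>y. c + k * (norm (y - x0))\<^sup>2) x = k * (2 * DIM('a))"
proof -
  have "((\<lambda>y. c + k * (norm (y - x0))\<^sup>2) has_derivative (\<lambda>h. k * (2 * ((y - x0) \<bullet> h)))) (at y)" for y
    unfolding power2_norm_eq_inner
    by (auto intro!: derivative_eq_intros simp: inner_commute)
  from frechet_derivative_at[OF this]
  have 1: "frechet_derivative (\<lambda>y. c + k * (norm (y - x0))\<^sup>2) (at y) = (\<lambda>h. k * (2 * ((y - x0) \<bullet> h)))" for y ..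
  have "((\<lambda>y. k * (2 * ((y - x0) \<bullet> b))) has_derivative (\<lambda>h. k * (2 * (h \<bullet> b)))) (at x)" for b
    by (auto intro!: derivative_eq_intros)
  from frechet_derivative_at[OF this]
  have 2: "frechet_derivative (\<lambda>y. k * (2 * ((y - x0) \<bullet> b))) (at x) = (\<lambda>h. k * (2 * (h \<bullet> b)))" for b ..
  show ?thesis unfolding laplacian_def 1 2 by simp
qed

context bounded_domain
begin

lemma embH_ip: "emb f = (\<lambda>u. ip f u)"
  by (simp add: embH_def ip_def)

lemma en_wgrad_eq:
  assumes "u \<in> H0" "w \<in> H0" "L2 G" "AE x in M. wg w x = G x"
  shows "en u w = (LINT x|M. wg u x \<bullet> G x)"
  unfolding en_def
proof (rule integral_cong_AE)
  show "AE x in M. wg u x \<bullet> wg w x = wg u x \<bullet> G x"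
    using assms(4) by eventually_elim simp
qed (intro borel_measurable_inner L2_measurable wgrad_L2 assms)+

lemma HdualI:
  assumes "\<And>u v. u \<in> H0 \<Longrightarrow> v \<in> H0 \<Longrightarrow> F (\<lambda>x. u x + v x) = F u + F v"
    "\<And>u k. u \<in> H0 \<Longrightarrow> F (\<lambda>x. k * u x) = k * F u"
    "\<And>u. u \<in> H0 \<Longrightarrow> \<bar>F u\<bar> \<le> B * hnrm u"
  shows "F \<in> HD"
  using assms unfolding Hdual_def by blast

lemma Hdual_cmult:
  assumes "F \<in> HD"
  shows "(\<lambda>u. n * F u) \<in> HD"
proof -
  obtain B where B: "\<And>u. u \<in> H0 \<Longrightarrow> \<bar>F u\<bar> \<le> B * hnrm u"
    using Hdual_bound[OF assms] by metis
  have "\<bar>n * F u\<bar> \<le> (\<bar>n\<bar> * B) * hnrm u" if "u \<in> H0" for u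
    using mult_left_mono[OF B[OF that], of "\<bar>n\<bar>"] by (simp add: abs_mult mult.assoc)
  then show ?thesis
    by (intro HdualI[where B = "\<bar>n\<bar> * B"]) (simp_all add: HdualD[OF assms] algebra_simps)
qed

lemma Hdual_add:
  assumes "F \<in> HD" "G \<in> HD"
  shows "(\<lambda>u. F u + G u) \<in> HD"
proof -
  obtain B where B: "\<And>u. u \<in> H0 \<Longrightarrow> \<bar>F u\<bar> \<le> B * hnrm u"
    using Hdual_bound[OF assms(1)] by metis
  obtain C where C: "\<And>u. u \<in> H0 \<Longrightarrow> \<bar>G u\<bar> \<le> C * hnrm u"
    using Hdual_bound[OF assms(2)] by metis
  have "\<bar>F u + G u\<bar> \<le> (B + C) * hnrm u" if "u \<in> H0" for u
    using B[OF that] C[OF that] by (simp add: distrib_right)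
  then show ?thesis
    by (intro HdualI[where B = "B + C"]) (simp_all add: HdualD[OF assms(1)] HdualD[OF assms(2)] algebra_simps)
qed

lemma Hdual_diff:
  assumes "F \<in> HD" "G \<in> HD"
  shows "(\<lambda>u. F u - G u) \<in> HD"
  using Hdual_add[OF assms(1) Hdual_cmult[OF assms(2), of "-1"]] by simp

lemma embH_Hdual:
  assumes "L2 f"
  shows "emb f \<in> HD"
proof -
  have "\<bar>ip f u\<bar> \<le> (nrm f / sqrt lam) * hnrm u" if "u \<in> H0" for u
    using ip_bound[OF assms H01_L2[OF that]] mult_left_mono[OF poincare_norm[OF that], of "nrm f"]
    by simp
  then show ?thesis
    using assms by (intro HdualI[where B = "nrm f / sqrt lam"])
      (simp_all add: embH_ip ip_add_right ip_cmult_right H01_L2)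
qed

text \<open>The operator n (n - \<Delta>)^{-1} on the whole dual space. The choice depends only on
  the values of \<open>F\<close> on H_0^1, so functionals that agree there have literally the same
  resolvent, not merely the same one up to null sets.\<close>

definition res :: "real \<Rightarrow> 'a functional \<Rightarrow> 'a \<Rightarrow> real" where
  "res n F = (SOME u. u \<in> H0 \<and> (\<forall>v\<in>H0. en u v + n * ip u v = n * F v))"

lemma res_spec:
  assumes "F \<in> HD" "n > 0"
  shows "res n F \<in> H0" "v \<in> H0 \<Longrightarrow> en (res n F) v + n * ip (res n F) v = n * F v"
proof -
  have "\<exists>u. u \<in> H0 \<and> (\<forall>v\<in>H0. en u v + n * ip u v = n * F v)"
    using riesz_energy[OF Hdual_cmult[OF assms(1), of n], of n] assms(2) by auto
  from someI_ex[OF this]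
  show "res n F \<in> H0" "v \<in> H0 \<Longrightarrow> en (res n F) v + n * ip (res n F) v = n * F v"
    unfolding res_def by auto
qed

lemma res_cong: "Heq \<Lambda> F G \<Longrightarrow> res n F = res n G"
  unfolding res_def Heq_def by (intro arg_cong[of _ _ Eps] ext) auto

text \<open>The difference solves the homogeneous equation; tested with itself it has vanishing L^2
  norm, as n is positive.\<close>

lemma res_unique:
  assumes F: "F \<in> HD" and n: "n > 0" and u: "u \<in> H0"
    and eq: "\<And>v. v \<in> H0 \<Longrightarrow> en u v + n * ip u v = n * F v"
  shows "AE x in M. res n F x = u x"
proof -
  define d where "d = (\<lambda>x. res n F x - u x)"
  note r = res_spec[OF F n]
  have d: "d \<in> H0" unfolding d_def by (rule H01_diff[OF r(1) u])
  have "en d d = en (res n F) d - en u d"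
    using en_diff_left[OF r(1) u d] unfolding d_def[symmetric] .
  moreover have "ip d d = ip (res n F) d - ip u d"
    using ip_diff_left[OF r(1)[THEN H01_L2] u[THEN H01_L2] d[THEN H01_L2]]
    unfolding d_def[symmetric] .
  ultimately have "en d d + n * ip d d = (en (res n F) d + n * ip (res n F) d) - (en u d + n * ip u d)"
    by (simp add: right_diff_distrib)
  also have "\<dots> = 0" using r(2)[OF d] eq[OF d] by simp
  finally have "n * (nrm d)\<^sup>2 \<le> 0" using en_nonneg[of d] by (simp add: ip_self)
  then have "nrm d = 0" using n by (simp add: mult_le_0_iff)
  from L2norm_eq_0D[OF H01_L2[OF d] this] show ?thesis
    by eventually_elim (simp add: d_def)
qed

abbreviation J :: "real \<Rightarrow> ('a \<Rightarrow> real) \<Rightarrow> 'a \<Rightarrow> real" where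
  "J n f \<equiv> res n (emb f)"

lemma J_H01: "L2 f \<Longrightarrow> n > 0 \<Longrightarrow> J n f \<in> H0"
  by (rule res_spec(1)[OF embH_Hdual])

lemma J_L2: "L2 f \<Longrightarrow> n > 0 \<Longrightarrow> L2 (J n f)"
  by (rule H01_L2[OF J_H01])

lemma J_measurable: "L2 f \<Longrightarrow> n > 0 \<Longrightarrow> J n f \<in> BM"
  by (rule L2_measurable[OF J_L2])

lemma J_eq:
  "L2 f \<Longrightarrow> n > 0 \<Longrightarrow> v \<in> H0 \<Longrightarrow> en (J n f) v + n * ip (J n f) v = n * ip f v"
  using res_spec(2)[OF embH_Hdual] by (simp add: embH_ip)

lemma J_unique:
  "L2 f \<Longrightarrow> n > 0 \<Longrightarrow> u \<in> H0 \<Longrightarrow>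
    (\<And>v. v \<in> H0 \<Longrightarrow> en u v + n * ip u v = n * ip f v) \<Longrightarrow> AE x in M. J n f x = u x"
  using res_unique[OF embH_Hdual] by (simp add: embH_ip)

text \<open>\<open>J n\<close> is defined by choice, so its algebra holds almost everywhere: the
  candidate solves the weak equation, and solutions are unique up to null sets.\<close>

lemma J_add:
  assumes "L2 f" "L2 g" "n > 0"
  shows "AE x in M. J n (\<lambda>x. f x + g x) x = J n f x + J n g x"
proof (rule J_unique)
  fix v assume v: "v \<in> H0"
  have "en (\<lambda>x. J n f x + J n g x) v + n * ip (\<lambda>x. J n f x + J n g x) v
    = (en (J n f) v + n * ip (J n f) v) + (en (J n g) v + n * ip (J n g) v)"
    using assms v by (simp add: en_add_left J_H01 ip_add_left J_L2 H01_L2 algebra_simps)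
  also have "\<dots> = n * ip (\<lambda>x. f x + g x) v"
    using assms v by (simp add: J_eq ip_add_left H01_L2 distrib_left)
  finally show "en (\<lambda>x. J n f x + J n g x) v + n * ip (\<lambda>x. J n f x + J n g x) v = n * ip (\<lambda>x. f x + g x) v" .
qed (use assms in \<open>auto intro!: L2_add H01_add J_H01\<close>)

lemma J_cmult:
  assumes "L2 f" "n > 0"
  shows "AE x in M. J n (\<lambda>x. c * f x) x = c * J n f x"
proof (rule J_unique)
  fix v assume v: "v \<in> H0"
  have "en (\<lambda>x. c * J n f x) v + n * ip (\<lambda>x. c * J n f x) v = c * (en (J n f) v + n * ip (J n f) v)"
    using assms v by (simp add: en_cmult_left J_H01 ip_cmult_left algebra_simps)
  also have "\<dots> = n * ip (\<lambda>x. c * f x) v" using assms v by (simp add: J_eq ip_cmult_left)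
  finally show "en (\<lambda>x. c * J n f x) v + n * ip (\<lambda>x. c * J n f x) v = n * ip (\<lambda>x. c * f x) v" .
qed (use assms in \<open>auto intro!: L2_cmult H01_cmult J_H01\<close>)

lemma J_diff:
  assumes "L2 f" "L2 g" "n > 0"
  shows "AE x in M. J n (\<lambda>x. f x - g x) x = J n f x - J n g x"
proof -
  have "AE x in M. J n (\<lambda>x. f x + (- 1) * g x) x = J n f x + J n (\<lambda>x. (- 1) * g x) x"
    by (intro J_add assms L2_cmult)
  moreover have "AE x in M. J n (\<lambda>x. (- 1) * g x) x = (- 1) * J n g x" by (intro J_cmult assms)
  ultimately show ?thesis by eventually_elim simp
qed

lemma J_zero: "n > 0 \<Longrightarrow> AE x in M. J n (\<lambda>x. 0) x = 0"
  using J_cmult[of "\<lambda>x. 0" n 0] by simp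

lemma J_sum:
  assumes "\<And>i. i \<in> I \<Longrightarrow> L2 (f i)" "n > 0"
  shows "AE x in M. J n (\<lambda>x. \<Sum>i\<in>I. c i * f i x) x = (\<Sum>i\<in>I. c i * J n (f i) x)"
  using assms(1)
proof (induction I rule: infinite_finite_induct)
  case (insert i I)
  have sq: "L2 (\<lambda>x. c i * f i x)" "L2 (\<lambda>x. \<Sum>i\<in>I. c i * f i x)"
    using insert.prems by (auto intro!: L2_sum L2_cmult)
  have "AE x in M. J n (\<lambda>x. \<Sum>i\<in>I. c i * f i x) x = (\<Sum>i\<in>I. c i * J n (f i) x)"
    using insert by simp
  with J_add[OF sq assms(2)] J_cmult[OF insert.prems[OF insertI1] assms(2), of "c i"]
  have "AE x in M. J n (\<lambda>x. c i * f i x + (\<Sum>i\<in>I. c i * f i x)) x = c i * J n (f i) x + (\<Sum>i\<in>I. c i * J n (f i) x)"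
    by eventually_elim simp
  then show ?case using insert.hyps by simp
qed (use J_zero[OF assms(2)] in auto)

text \<open>Each weak equation is tested with the solution of the other; the left-hand sides are
  symmetric.\<close>

lemma J_sym:
  assumes "L2 f" "L2 g" "n > 0"
  shows "ip (J n f) g = ip f (J n g)"
proof -
  have "n * ip f (J n g) = en (J n f) (J n g) + n * ip (J n f) (J n g)"
    using J_eq[OF assms(1,3) J_H01[OF assms(2,3)]] by simp
  also have "\<dots> = en (J n g) (J n f) + n * ip (J n g) (J n f)"
    by (simp only: en_commute[of "J n f"] ip_commute[of "J n f" "J n g"])
  also have "\<dots> = n * ip g (J n f)"
    by (rule J_eq[OF assms(2,3) J_H01[OF assms(1,3)]])
  finally have "ip f (J n g) = ip g (J n f)" using assms(3) by simp
  then show ?thesis by (simp only: ip_commute[of "J n f" g])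
qed

lemma J_energy:
  assumes "L2 f" "n > 0"
  shows "en (J n f) (J n f) = n * ip (\<lambda>x. f x - J n f x) (J n f)"
  using J_eq[OF assms J_H01[OF assms]] assms
  by (simp add: ip_diff_left J_L2 right_diff_distrib)

lemma J_norm_le:
  assumes f: "L2 f" and n: "n > 0"
  shows "nrm (J n f) \<le> nrm f"
proof -
  have "n * (nrm (J n f))\<^sup>2 \<le> n * ip f (J n f)"
    using J_eq[OF f n J_H01[OF f n]] en_nonneg[of "J n f"] by (simp add: ip_self)
  then have "(nrm (J n f))\<^sup>2 \<le> ip f (J n f)" using n by simp
  also have "\<dots> \<le> nrm f * nrm (J n f)"
    using ip_bound[OF f J_L2[OF f n]] by simp
  finally have "nrm (J n f) * nrm (J n f) \<le> nrm f * nrm (J n f)"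
    by (simp add: power2_eq_square)
  then show ?thesis using L2norm_nonneg[of M "J n f"] L2norm_nonneg[of M f]
    by (cases "nrm (J n f) = 0") (auto dest: mult_right_le_imp_le)
qed

text \<open>Weak maximum principle: the equation for \<open>J n f - v\<close> is tested with smooth
  approximations of an increasing function of \<open>J n f - v\<close> that vanishes on the negative half line.\<close>

lemma comparison:
  assumes f: "L2 f" and n: "n > 0"
    and v: "\<And>k. Ck k v" and C: "compact C" "C \<subseteq> \<Lambda>" "\<And>x. x \<notin> C \<Longrightarrow> 0 \<le> v x"
    and le: "AE x in M. f x \<le> v x - laplacian v x / n"
  shows "AE x in M. J n f x \<le> v x"
proof -
  define w where "w = J n f"
  have w: "w \<in> H0" unfolding w_def by (rule J_H01[OF f n])
  have sw: "L2 w" "L2 (wg w)"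
    using H01_L2[OF w] wgrad_L2[OF w] .
  have sv: "L2 v" "L2 (gradient v)" "L2 (laplacian v)"
    using v by (auto intro!: continuous_L2 Ck_imp_continuous Ck1_continuous_gradient continuous_on_laplacian)
  obtain \<psi> where \<psi>: "\<And>k. \<psi> k \<in> C0inf \<Lambda>" "(\<lambda>k. nrm (\<lambda>x. \<psi> k x - w x)) \<leadsto> 0"
    "(\<lambda>k. nrm (\<lambda>x. gradient (\<psi> k) x - wg w x)) \<leadsto> 0"
    using H01_approx[OF w] by blast
  define h where "h = (\<lambda>k x. \<psi> k x - v x)"
  \<comment> \<open>Where \<open>\<psi> k\<close> vanishes and \<open>v\<close> is nonnegative, the
    argument of \<open>exp_flat\<close> is nonpositive. So \<open>\<eta> k\<close> is supported in
    the union of the two compact sets and is admissible as a test function.\<close>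
  define \<eta> where "\<eta> = (\<lambda>k x. exp_flat 0 (h k x))"
  have hCk: "Ck j (h k)" for j k unfolding h_def by (intro Ck_diff v C0inf_Ck \<psi>)
  have \<eta>: "\<eta> k \<in> C0inf \<Lambda>" for k
  proof -
    obtain D where D: "compact D" "D \<subseteq> \<Lambda>" "\<And>x. x \<notin> D \<Longrightarrow> \<psi> k x = 0"
      using \<psi>(1)[of k] unfolding C0inf_def by (auto elim!: compactly_supported_inE)
    have "compactly_supported_in \<Lambda> (\<eta> k)"
    proof (rule compactly_supported_inI[of "C \<union> D"])
      show "\<eta> k x = 0" if "x \<notin> C \<union> D" for x
        using that C(3)[of x] D(3)[of x] by (simp add: \<eta>_def h_def exp_flat_def)
    qed (use C D in auto)
    then show ?thesis unfolding C0inf_def \<eta>_def using hCk by (auto intro: Ck_flat)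
  qed
  have g\<eta>: "gradient (\<eta> k) x = exp_flat 2 (h k x) *\<^sub>R (gradient (\<psi> k) x - gradient v x)" for k x
    unfolding \<eta>_def using gradient_flat[OF Ck1_differentiable[OF hCk], of 0 k x]
    by (simp add: h_def gradient_diff[OF C0inf_differentiable[OF \<psi>(1)] Ck1_differentiable[OF v]] numeral_2_eq_2)
  have \<eta>0: "0 \<le> \<eta> k x" for k x by (simp add: \<eta>_def flat_nonneg)
  note s\<psi> = C0inf_L2[OF \<psi>(1)] C0inf_gradient_L2[OF \<psi>(1)]
  note s\<eta> = C0inf_L2[OF \<eta>] C0inf_gradient_L2[OF \<eta>]
  define a where "a = (\<lambda>k. nrm (\<lambda>x. gradient (\<psi> k) x - wg w x))"
  define A where "A = nrm (\<lambda>x. wg w x - gradient v x)"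
  have key: "n * ip (\<lambda>x. w x - v x) (\<eta> k) \<le> a k * (2 * (a k + A))" for k
  proof -
    have "en w (\<eta> k) = (LINT x|M. wg w x \<bullet> gradient (\<eta> k) x)"
      by (rule en_wgrad_eq[OF w C0inf_H01(1)[OF \<eta>] s\<eta>(2) C0inf_H01(2)[OF \<eta>]])
    then have "(LINT x|M. wg w x \<bullet> gradient (\<eta> k) x) + n * ip w (\<eta> k) = n * ip f (\<eta> k)"
      using J_eq[OF f n C0inf_H01(1)[OF \<eta>[of k]]] unfolding w_def by simp
    moreover have "(LINT x|M. gradient v x \<bullet> gradient (\<eta> k) x) = - ip (laplacian v) (\<eta> k)"
      unfolding ip_def by (rule laplacian_integration_by_parts(3)[OF open_\<Lambda> v C0inf_C0k[OF \<eta>]])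
    moreover have "n * ip f (\<eta> k) \<le> n * ip v (\<eta> k) - ip (laplacian v) (\<eta> k)"
    proof -
      have "ip f (\<eta> k) \<le> (LINT x|M. (v x - laplacian v x / n) * \<eta> k x)"
        unfolding ip_def
      proof (rule integral_mono_AE)
        show "intM (\<lambda>x. f x * \<eta> k x)" by (intro L2_mult f s\<eta>)
        show "intM (\<lambda>x. (v x - laplacian v x / n) * \<eta> k x)"
          using L2_cmult[OF sv(3), of "1/n"] by (intro L2_mult L2_diff sv s\<eta>) simp
        show "AE x in M. f x * \<eta> k x \<le> (v x - laplacian v x / n) * \<eta> k x"
          using le by eventually_elim (intro mult_right_mono \<eta>0)
      qed
      also have "\<dots> = ip v (\<eta> k) - ip (laplacian v) (\<eta> k) / n"
        unfolding ip_def using L2_mult[OF sv(1) s\<eta>(1)] L2_mult[OF sv(3) s\<eta>(1)]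
        by (simp add: left_diff_distrib)
      finally show ?thesis using n by (simp add: field_simps)
    qed
    moreover have "ip (\<lambda>x. w x - v x) (\<eta> k) = ip w (\<eta> k) - ip v (\<eta> k)"
      by (intro ip_diff_left sw sv s\<eta>)
    ultimately have 1: "n * ip (\<lambda>x. w x - v x) (\<eta> k)
      \<le> (LINT x|M. gradient v x \<bullet> gradient (\<eta> k) x) - (LINT x|M. wg w x \<bullet> gradient (\<eta> k) x)"
      by (simp add: right_diff_distrib)
    \<comment> \<open>This is the sign on which the principle rests: the integrand is
      \<open>exp_flat 2\<close> times a squared norm. The solution itself is not known to be smooth;
      replacing its gradient by that of \<open>\<psi> k\<close> costs a multiple of the distance
      \<open>a k\<close>.\<close>
    have "(LINT x|M. (gradient (\<psi> k) x - gradient v x) \<bullet> gradient (\<eta> k) x) \<ge> 0"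
      by (rule Bochner_Integration.integral_nonneg) (simp add: g\<eta> flat_nonneg)
    then have "(LINT x|M. gradient v x \<bullet> gradient (\<eta> k) x) \<le> (LINT x|M. gradient (\<psi> k) x \<bullet> gradient (\<eta> k) x)"
      using L2_inner[OF s\<psi>(2) s\<eta>(2)] L2_inner[OF sv(2) s\<eta>(2)]
      by (simp add: inner_diff_left)
    with 1 have "n * ip (\<lambda>x. w x - v x) (\<eta> k) \<le> (LINT x|M. (gradient (\<psi> k) x - wg w x) \<bullet> gradient (\<eta> k) x)"
      using L2_inner[OF s\<psi>(2) s\<eta>(2)] L2_inner[OF sw(2) s\<eta>(2)]
      by (simp add: inner_diff_left)
    also have "\<dots> \<le> a k * nrm (gradient (\<eta> k))"
      unfolding a_def using L2_Cauchy_Schwarz[OF L2_diff[OF s\<psi>(2) sw(2)] s\<eta>(2)] by (rule order_trans[OF abs_ge_self])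
    also have "nrm (gradient (\<eta> k)) \<le> 2 * (a k + A)"
    proof -
      have "nrm (gradient (\<eta> k)) \<le> nrm (\<lambda>x. 2 *\<^sub>R (gradient (\<psi> k) x - gradient v x))"
        unfolding L2norm_def
      proof (intro real_sqrt_le_mono integral_mono)
        show "intM (\<lambda>x. (norm (gradient (\<eta> k) x))\<^sup>2)" using s\<eta>(2) by (simp add: sq_integrable_def)
        show "intM (\<lambda>x. (norm (2 *\<^sub>R (gradient (\<psi> k) x - gradient v x)))\<^sup>2)"
          using L2_scaleR[OF L2_diff[OF s\<psi>(2) sv(2)], of 2] by (simp add: sq_integrable_def)
        show "(norm (gradient (\<eta> k) x))\<^sup>2 \<le> (norm (2 *\<^sub>R (gradient (\<psi> k) x - gradient v x)))\<^sup>2" for x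
          unfolding g\<eta> using flat_bound[of 2 "h k x"] flat_nonneg[of 2 "h k x"]
          by (intro power_mono) (auto intro!: mult_right_mono simp: fact_numeral)
      qed
      also have "\<dots> = 2 * nrm (\<lambda>x. gradient (\<psi> k) x - gradient v x)"
        by (simp only: L2norm_scaleR abs_numeral)
      also have "\<dots> \<le> 2 * (a k + A)"
        unfolding a_def A_def using L2norm_triangle_diff[OF s\<psi>(2)[of k] sw(2) sv(2)] by simp
      finally show ?thesis .
    qed
    finally show ?thesis using L2norm_nonneg mult_left_mono unfolding a_def by fastforce
  qed
  have a0: "a \<leadsto> 0" using \<psi>(3) unfolding a_def .
  have "(\<lambda>k. a k * (2 * (a k + A))) \<leadsto> 0 * (2 * (0 + A))"
    by (intro tendsto_intros a0)
  moreover have lim: "(\<lambda>k. n * ip (\<lambda>x. w x - v x) (\<eta> k)) \<leadsto> n * ip (\<lambda>x. w x - v x) (\<lambda>x. exp_flat 0 (w x - v x))"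
  proof -
    have [measurable]: "w \<in> BM" "v \<in> BM" using sw sv by (auto simp: sq_integrable_def)
    have [measurable]: "exp_flat 0 \<in> borel_measurable borel"
      by (rule borel_measurable_continuous_onI[OF flat_continuous])
    have se: "L2 (\<lambda>x. exp_flat 0 (w x - v x))"
      by (rule M.L2_bounded[where B = 1]) (auto simp: flat_nonneg exp_flat0_le_1)
    have l: "(\<lambda>k. nrm (\<lambda>x. \<eta> k x - exp_flat 0 (w x - v x))) \<leadsto> 0"
    proof (rule Lim_null_comparison)
      have "nrm (\<lambda>x. \<eta> k x - exp_flat 0 (w x - v x)) \<le> nrm (\<lambda>x. 2 * (\<psi> k x - w x))" for k
        unfolding L2norm_def
      proof (intro real_sqrt_le_mono integral_mono)
        show "intM (\<lambda>x. (norm (\<eta> k x - exp_flat 0 (w x - v x)))\<^sup>2)"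
          using L2_diff[OF s\<eta>(1) se] by (simp add: sq_integrable_def)
        show "intM (\<lambda>x. (norm (2 * (\<psi> k x - w x)))\<^sup>2)"
          using L2_cmult[OF L2_diff[OF s\<psi>(1) sw(1)], of 2] by (simp add: sq_integrable_def)
        show "(norm (\<eta> k x - exp_flat 0 (w x - v x)))\<^sup>2 \<le> (norm (2 * (\<psi> k x - w x)))\<^sup>2" for x
        proof (rule power_mono)
          have "norm (\<eta> k x - exp_flat 0 (w x - v x)) \<le> 2 * \<bar>h k x - (w x - v x)\<bar>"
            using flat0_lipschitz[of "h k x" "w x - v x"] by (simp add: \<eta>_def)
          also have "\<dots> = norm (2 * (\<psi> k x - w x))"
            by (simp add: h_def abs_mult del: right_diff_distrib_numeral)
          finally show "norm (\<eta> k x - exp_flat 0 (w x - v x)) \<le> norm (2 * (\<psi> k x - w x))" .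
        qed simp
      qed
      then show "\<forall>\<^sub>F k in sequentially. norm (nrm (\<lambda>x. \<eta> k x - exp_flat 0 (w x - v x))) \<le> 2 * nrm (\<lambda>x. \<psi> k x - w x)"
        by (simp only: L2norm_cmult) simp
      show "(\<lambda>k. 2 * nrm (\<lambda>x. \<psi> k x - w x)) \<leadsto> 0"
        using tendsto_mult_right_zero[OF \<psi>(2)] by simp
    qed
    have "(\<lambda>k. LINT x|M. \<eta> k x \<bullet> (w x - v x)) \<leadsto> (LINT x|M. exp_flat 0 (w x - v x) \<bullet> (w x - v x))"
      by (rule L2_tendsto_inner[OF s\<eta>(1) se L2_diff[OF sw(1) sv(1)] l])
    then show ?thesis by (auto intro!: tendsto_mult simp: ip_def mult.commute)
  qed
  ultimately have "n * ip (\<lambda>x. w x - v x) (\<lambda>x. exp_flat 0 (w x - v x)) \<le> 0"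
    using key LIMSEQ_le[OF lim, of "\<lambda>k. a k * (2 * (a k + A))" 0] by auto
  then have le0: "ip (\<lambda>x. w x - v x) (\<lambda>x. exp_flat 0 (w x - v x)) \<le> 0" using n by (simp add: mult_le_0_iff)
  \<comment> \<open>A nonnegative integrand with nonpositive integral vanishes almost everywhere,
    and \<open>exp_flat 0\<close> is positive exactly where \<open>w\<close> exceeds
    \<open>v\<close>.\<close>
  have nn: "0 \<le> (w x - v x) * exp_flat 0 (w x - v x)" for x by (simp add: exp_flat_def)
  have int: "intM (\<lambda>x. (w x - v x) * exp_flat 0 (w x - v x))"
  proof (rule Bochner_Integration.integrable_bound)
    show "intM (\<lambda>x. w x - v x)" by (intro M.L2_integrable L2_diff sw sv)
    have [measurable]: "w \<in> BM" "v \<in> BM" using sw sv by (auto simp: sq_integrable_def)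
    have [measurable]: "exp_flat 0 \<in> borel_measurable borel"
      by (rule borel_measurable_continuous_onI[OF flat_continuous])
    show "(\<lambda>x. (w x - v x) * exp_flat 0 (w x - v x)) \<in> BM" by measurable
  qed (auto simp: abs_mult flat_nonneg exp_flat0_le_1 intro!: mult_left_le)
  have "(LINT x|M. (w x - v x) * exp_flat 0 (w x - v x)) = 0"
    using le0 Bochner_Integration.integral_nonneg[OF nn] unfolding ip_def by (intro antisym)
  then have "AE x in M. (w x - v x) * exp_flat 0 (w x - v x) = 0"
    using integral_nonneg_eq_0_iff_AE[OF int AE_I2[OF nn]] by blast
  then show ?thesis unfolding w_def[symmetric]
    by eventually_elim (metis diff_gt_0_iff_gt flat_pos less_irrefl mult_eq_0_iff not_le)
qed

section \<open>Order properties of the resolvent and quadratic barriers\<close>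

lemma J_nonpos:
  assumes "L2 f" "n > 0" "AE x in M. f x \<le> 0"
  shows "AE x in M. J n f x \<le> 0"
  by (rule comparison[where C = "{}", OF assms(1,2)]) (use assms(3) in \<open>auto simp: laplacian_const\<close>)

lemma J_mono:
  assumes "L2 f" "L2 g" "n > 0" "AE x in M. f x \<le> g x"
  shows "AE x in M. J n f x \<le> J n g x"
proof -
  have "AE x in M. J n (\<lambda>x. f x - g x) x \<le> 0"
    by (rule J_nonpos) (use assms in \<open>auto intro: L2_diff\<close>)
  with J_diff[OF assms(1-3)] show ?thesis by eventually_elim simp
qed

lemma J_nonneg:
  assumes "L2 f" "n > 0" "AE x in M. 0 \<le> f x"
  shows "AE x in M. 0 \<le> J n f x"
  using J_mono[of "\<lambda>x. 0" f n] assms J_zero[OF assms(2)] by (auto elim: eventually_elim2)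

text \<open>A constant satisfies the supersolution inequality with its own value; its sign enters
  because solutions have zero boundary values.\<close>

lemma J_le_const:
  assumes "L2 f" "n > 0" "AE x in M. f x \<le> B" "B \<ge> 0"
  shows "AE x in M. J n f x \<le> B"
  by (rule comparison[where C = "{}", OF assms(1,2)]) (use assms(3,4) in \<open>auto simp: laplacian_const\<close>)

lemma J_abs_le:
  assumes "L2 f" "L2 g" "n > 0" "AE x in M. \<bar>f x\<bar> \<le> g x"
  shows "AE x in M. \<bar>J n f x\<bar> \<le> J n g x"
proof -
  have "AE x in M. J n f x \<le> J n g x"
    by (rule J_mono) (use assms in \<open>auto elim: eventually_mono\<close>)
  moreover have "AE x in M. J n (\<lambda>x. (- 1) * f x) x \<le> J n g x"
    by (rule J_mono[OF L2_cmult]) (use assms in \<open>auto elim: eventually_mono\<close>)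
  moreover have "AE x in M. J n (\<lambda>x. (- 1) * f x) x = (- 1) * J n f x"
    by (rule J_cmult[OF assms(1,3)])
  ultimately show ?thesis by eventually_elim auto
qed

lemma J_bounded:
  assumes "L2 f" "n > 0" "AE x in M. \<bar>f x\<bar> \<le> B" "B \<ge> 0"
  shows "AE x in M. \<bar>J n f x\<bar> \<le> B"
proof -
  have "AE x in M. J n (\<lambda>x. B) x \<le> B"
    by (rule J_le_const) (use assms in \<open>auto intro: M.L2_const\<close>)
  with J_abs_le[OF assms(1) M.L2_const assms(2,3)] show ?thesis
    by eventually_elim simp
qed

text \<open>In kernel terms the total mass seen from x. \<open>1 - J1 n\<close> is the mass that the
  sub-Markovian operator loses through the boundary, the killing part of the form.\<close>

abbreviation J1 :: "real \<Rightarrow> 'a \<Rightarrow> real" where "J1 n \<equiv> J n (\<lambda>x. 1)"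

lemma J1_bounds:
  assumes "n > 0"
  shows "AE x in M. 0 \<le> J1 n x \<and> J1 n x \<le> 1"
  using J_nonneg[OF M.L2_const assms, of 1] J_le_const[OF M.L2_const assms, of 1 1]
  by (auto elim: eventually_elim2)

lemma J_const:
  assumes "n > 0"
  shows "AE x in M. J n (\<lambda>x. c) x = c * J1 n x"
  using J_cmult[OF M.L2_const[of 1] assms, of c] by simp

lemma norm_sq_L2: "L2 (\<lambda>y. (norm (y - x0))\<^sup>2)"
  by (intro continuous_L2 continuous_intros)

text \<open>The right-hand side solves the resolvent equation with equality, because the summand
  \<open>2 * DIM('a) / n\<close> cancels the Laplacian of the square, and it is nonnegative
  everywhere.\<close>

lemma J_norm_sq_le:
  assumes n: "n > 0"
  shows "AE x in M. J n (\<lambda>y. (norm (y - x0))\<^sup>2) x \<le> (norm (x - x0))\<^sup>2 + 2 * DIM('a) / n"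
proof -
  have "AE x in M. J n (\<lambda>y. (norm (y - x0))\<^sup>2) x \<le> 2 * DIM('a) / n + 1 * (norm (x - x0))\<^sup>2"
  proof (rule comparison[where C = "{}", OF norm_sq_L2 n])
    show "Ck k (\<lambda>x. 2 * DIM('a) / n + 1 * (norm (x - x0))\<^sup>2)" for k
      by (intro Ck_add Ck_cmult Ck_const Ck_norm_sq)
    show "AE x in M. (norm (x - x0))\<^sup>2 \<le> 2 * DIM('a) / n + 1 * (norm (x - x0))\<^sup>2
        - laplacian (\<lambda>x. 2 * DIM('a) / n + 1 * (norm (x - x0))\<^sup>2) x / n"
      unfolding laplacian_norm_sq by simp
  qed (use n in auto)
  then show ?thesis by (simp add: add.commute)
qed

text \<open>Comparison for the constant -1 with a paraboloid that is a supersolution and is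
  nonnegative outside the ball. The boundary lies at distance at least \<rho> from the centre,
  whence the decay like 1 / n there.\<close>

lemma J1_lower:
  assumes n: "n > 0" and \<rho>: "\<rho> > 0" "cball x0 \<rho> \<subseteq> \<Lambda>"
  shows "AE x in M. 1 - J1 n x \<le> ((norm (x - x0))\<^sup>2 + 2 * DIM('a) / n) / \<rho>\<^sup>2"
proof -
  define c where "c = 2 * DIM('a) / n / \<rho>\<^sup>2 - 1"
  have "AE x in M. J n (\<lambda>x. - 1) x \<le> c + (1 / \<rho>\<^sup>2) * (norm (x - x0))\<^sup>2"
  proof (rule comparison[where C = "cball x0 \<rho>", OF M.L2_const n])
    show "Ck k (\<lambda>x. c + (1 / \<rho>\<^sup>2) * (norm (x - x0))\<^sup>2)" for k
      by (intro Ck_add Ck_cmult Ck_const Ck_norm_sq)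
    show "0 \<le> c + (1 / \<rho>\<^sup>2) * (norm (x - x0))\<^sup>2" if "x \<notin> cball x0 \<rho>" for x
    proof -
      have "\<rho>\<^sup>2 \<le> (norm (x - x0))\<^sup>2" using that \<rho> by (intro power_mono) (auto simp: dist_norm norm_minus_commute)
      then have "1 \<le> (1 / \<rho>\<^sup>2) * (norm (x - x0))\<^sup>2" using \<rho> by (simp add: field_simps)
      then show ?thesis using n unfolding c_def by (smt (verit) divide_nonneg_nonneg of_nat_0_le_iff zero_le_power2)
    qed
    show "AE x in M. - 1 \<le> c + (1 / \<rho>\<^sup>2) * (norm (x - x0))\<^sup>2 - laplacian (\<lambda>x. c + (1 / \<rho>\<^sup>2) * (norm (x - x0))\<^sup>2) x / n"
      unfolding laplacian_norm_sq c_def using n by (auto simp: field_simps)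
  qed (use \<rho> in auto)
  with J_const[OF n, of "-1"] show ?thesis
  proof eventually_elim
    case (elim x)
    then show ?case by (simp add: c_def add_divide_distrib)
  qed
qed

text \<open>The barrier should be centred at the point itself, but the null set of the comparison
  depends on the centre. So the centres range over a countable dense set and are then moved to the
  point.\<close>

lemma J1_killing_bound:
  assumes K: "compact K" "K \<subseteq> \<Lambda>"
  obtains R where "R \<ge> 0" "\<And>n. n > 0 \<Longrightarrow> AE x in M. x \<in> K \<longrightarrow> n * (1 - J1 n x) \<le> R"
proof -
  obtain \<rho> where \<rho>: "\<rho> > 0" "(\<Union>x\<in>K. cball x \<rho>) \<subseteq> \<Lambda>"
    using compact_subset_open_imp_cball_epsilon_subset[OF K(1) open_\<Lambda> K(2)] by blast
  obtain D :: "'a set" where D: "countable D" "closure D = UNIV" using ex_countable_dense by blast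
  \<comment> \<open>Barriers of radius \<rho> / 2, so that the balls around nearby centres still lie
    in \<Lambda>.\<close>
  define R where "R = 2 * DIM('a) / (\<rho> / 2)\<^sup>2"
  have "AE x in M. x \<in> K \<longrightarrow> n * (1 - J1 n x) \<le> R" if n: "n > 0" for n
  proof -
    have "AE x in M. \<forall>x0\<in>{x0\<in>D. cball x0 (\<rho>/2) \<subseteq> \<Lambda>}. 1 - J1 n x \<le> ((norm (x - x0))\<^sup>2 + 2 * DIM('a) / n) / (\<rho>/2)\<^sup>2"
      by (subst AE_ball_countable) (use D(1) \<rho>(1) J1_lower[OF n, of "\<rho>/2"] in auto)
    then show ?thesis
    proof eventually_elim
      case (elim x)
      show ?case
      proof
        assume x: "x \<in> K"
        have "1 - J1 n x \<le> 2 * DIM('a) / n / (\<rho>/2)\<^sup>2 + e" if e: "e > 0" for e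
        proof -
          define d where "d = min (\<rho>/2) (\<rho>/2 * sqrt e)"
          have d: "d > 0" "d \<le> \<rho>/2" "d \<le> \<rho>/2 * sqrt e" using \<rho>(1) e by (auto simp: d_def)
          have "x \<in> closure D" using D(2) by simp
          then obtain x0 where x0: "x0 \<in> D" "dist x0 x < d" using d(1) by (auto simp: closure_approachable)
          have "cball x0 (\<rho>/2) \<subseteq> cball x \<rho>"
          proof
            fix y assume "y \<in> cball x0 (\<rho>/2)"
            then show "y \<in> cball x \<rho>" using x0(2) d(2) dist_triangle[of x y x0] by (simp add: dist_commute)
          qed
          then have "cball x0 (\<rho>/2) \<subseteq> \<Lambda>" using \<rho>(2) x by blast
          with elim x0(1) have "1 - J1 n x \<le> ((norm (x - x0))\<^sup>2 + 2 * DIM('a) / n) / (\<rho>/2)\<^sup>2" by blast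
          also have "\<dots> = 2 * DIM('a) / n / (\<rho>/2)\<^sup>2 + (norm (x - x0) / (\<rho>/2))\<^sup>2"
            by (simp add: add_divide_distrib power_divide)
          also have "(norm (x - x0) / (\<rho>/2))\<^sup>2 \<le> (sqrt e)\<^sup>2"
          proof (rule power_mono)
            have "norm (x - x0) \<le> \<rho>/2 * sqrt e" using x0(2) d(3) by (simp add: dist_norm norm_minus_commute)
            then show "norm (x - x0) / (\<rho>/2) \<le> sqrt e" using \<rho>(1) by (simp add: field_simps)
          qed (use \<rho>(1) in auto)
          finally show ?thesis using e by simp
        qed
        then have "1 - J1 n x \<le> 2 * DIM('a) / n / (\<rho>/2)\<^sup>2" by (rule field_le_epsilon)
        then have "n * (1 - J1 n x) \<le> n * (2 * DIM('a) / n / (\<rho>/2)\<^sup>2)" using n by (intro mult_left_mono) auto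
        also have "\<dots> = R" using n by (simp add: R_def)
        finally show "n * (1 - J1 n x) \<le> R" .
      qed
    qed
  qed
  then show ?thesis using that[of R] by (simp add: R_def)
qed

text \<open>In kernel terms the left-hand side is the integral of (g(y) - g(x))^2 j(x, y) dy, the
  carre du champ. For a fixed value \<open>g x0\<close> it is \<open>J n\<close> of a square that is
  dominated by a quadratic barrier; then x0 tends to x through a countable dense set.\<close>

lemma J_carre_bound:
  assumes n: "n > 0" and g: "continuous_on UNIV g" and L: "\<And>x y. \<bar>g x - g y\<bar> \<le> L * norm (x - y)"
  shows "AE x in M. J n (\<lambda>x. (g x)\<^sup>2) x - 2 * g x * J n g x + (g x)\<^sup>2 * J1 n x \<le> L\<^sup>2 * (2 * DIM('a) / n)"
proof -
  obtain D :: "'a set" where D: "countable D" "closure D = UNIV" using ex_countable_dense by blast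
  have sg: "L2 g" "L2 (\<lambda>x. (g x)\<^sup>2)"
    by (intro continuous_L2 continuous_intros g)+
  have "AE x in M. J n (\<lambda>x. (g x)\<^sup>2) x - 2 * g x0 * J n g x + (g x0)\<^sup>2 * J1 n x
      \<le> L\<^sup>2 * ((norm (x - x0))\<^sup>2 + 2 * DIM('a) / n)" for x0
  proof -
    have s1: "L2 (\<lambda>x. (g x0)\<^sup>2)" "L2 (\<lambda>x. 2 * g x0 * g x)"
      by (intro M.L2_const L2_cmult sg)+
    note s2 = L2_diff[OF sg(2) s1(2)]
    have "AE x in M. J n (\<lambda>x. ((g x)\<^sup>2 - 2 * g x0 * g x) + (g x0)\<^sup>2) x \<le> J n (\<lambda>x. L\<^sup>2 * (norm (x - x0))\<^sup>2) x"
    proof (rule J_mono[OF L2_add[OF s2 s1(1)] L2_cmult[OF norm_sq_L2] n], rule AE_I2)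
      fix x
      have "\<bar>g x - g x0\<bar>\<^sup>2 \<le> (L * norm (x - x0))\<^sup>2" using L by (intro power_mono) auto
      then show "(g x)\<^sup>2 - 2 * g x0 * g x + (g x0)\<^sup>2 \<le> L\<^sup>2 * (norm (x - x0))\<^sup>2"
        by (simp add: power2_diff power_mult_distrib algebra_simps)
    qed
    with J_cmult[OF norm_sq_L2 n, of "L\<^sup>2" x0] J_norm_sq_le[OF n, of x0]
      J_add[OF s2 s1(1) n] J_diff[OF sg(2) s1(2) n] J_cmult[OF sg(1) n, of "2 * g x0"] J_const[OF n, of "(g x0)\<^sup>2"]
    show ?thesis
    proof eventually_elim
      case (elim x)
      have "L\<^sup>2 * J n (\<lambda>y. (norm (y - x0))\<^sup>2) x \<le> L\<^sup>2 * ((norm (x - x0))\<^sup>2 + 2 * DIM('a) / n)"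
        using elim(2) by (intro mult_left_mono) auto
      then show ?case using elim by simp
    qed
  qed
  then have "AE x in M. \<forall>x0\<in>D. J n (\<lambda>x. (g x)\<^sup>2) x - 2 * g x0 * J n g x + (g x0)\<^sup>2 * J1 n x
      \<le> L\<^sup>2 * ((norm (x - x0))\<^sup>2 + 2 * DIM('a) / n)"
    by (subst AE_ball_countable[OF D(1)]) auto
  then show ?thesis
  proof eventually_elim
    case (elim x)
    have "J n (\<lambda>x. (g x)\<^sup>2) x - 2 * g x * J n g x + (g x)\<^sup>2 * J1 n x \<le> L\<^sup>2 * ((norm (x - x))\<^sup>2 + 2 * DIM('a) / n)"
      by (rule continuous_le_dense[OF D(2), where x = x and a = "\<lambda>x0. J n (\<lambda>x. (g x)\<^sup>2) x - 2 * g x0 * J n g x + (g x0)\<^sup>2 * J1 n x"])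
        (use elim in \<open>auto intro!: continuous_intros g\<close>)
    then show ?case by simp
  qed
qed

end

lemma sqrt_divide_self:
  assumes "n > 0"
  shows "sqrt n / n = sqrt (inverse n)"
proof -
  have "sqrt n / n = sqrt n / (sqrt n * sqrt n)" using assms by simp
  also have "\<dots> = inverse (sqrt n)" using assms by (simp only: divide_inverse) (simp add: field_simps)
  finally show ?thesis by (simp add: real_sqrt_inverse)
qed

lemma young_crude:
  fixes a b q d :: real
  assumes "0 \<le> a" "0 \<le> b" "q \<ge> 1" "d > 0"
  shows "a powr (q - 1) * b \<le> d * a powr q + d powr (1 - q) * b powr q"
proof (cases "b \<le> d * a")
  case True
  have "a powr (q - 1) * b \<le> a powr (q - 1) * (d * a)" using True by (intro mult_left_mono) auto
  also have "\<dots> = d * a powr q"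
    using assms by (cases "a = 0") (auto simp: powr_diff)
  finally show ?thesis by (simp add: add_increasing2)
next
  case False
  have "0 \<le> d * a" using assms by simp
  with False have "b > 0" by linarith
  with False have a: "a < b / d" "b > 0" using assms by (auto simp: field_simps)
  have "a powr (q - 1) * b \<le> (b / d) powr (q - 1) * b"
    using a assms by (intro mult_right_mono powr_mono2) auto
  also have "\<dots> = d powr (1 - q) * b powr q"
    using a(2) assms(4) by (simp add: powr_divide powr_diff)
  finally show ?thesis using assms by (simp add: add_increasing)
qed

context bounded_domain
begin

section \<open>Density, convergence of the resolvent, and the forms on the dual space\<close>

lemma embH_eqD:
  assumes "L2 f" "L2 g" "\<And>v. v \<in> H0 \<Longrightarrow> ip f v = ip g v"
  shows "AE x in M. f x = g x"
proof -
  have "AE x in M. f x - g x = 0"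
  proof (rule fundamental_lemma[OF open_\<Lambda>])
    show "intM (\<lambda>x. f x - g x)"
      by (intro M.L2_integrable L2_diff assms)
    fix \<psi> assume \<psi>: "\<psi> \<in> C0inf \<Lambda>"
    show "(LINT x|M. (f x - g x) * \<psi> x) = 0"
      using ip_diff_left[OF assms(1,2) C0inf_L2[OF \<psi>]] assms(3)[OF C0inf_H01(1)[OF \<psi>]]
      by (simp add: ip_def)
  qed
  then show ?thesis by simp
qed

text \<open>Applied to the functional induced by \<open>f\<close>, the L^2 representation returns
  minimisers in H_0^1 that converge to a representing function, which can only be
  \<open>f\<close>.\<close>

lemma H01_dense:
  assumes f: "L2 f"
  shows "\<exists>w. (\<forall>k::nat. w k \<in> H0) \<and> (\<lambda>k. nrm (\<lambda>x. w k x - f x)) \<leadsto> 0"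
proof -
  have "\<bar>emb f u\<bar> \<le> nrm f * nrm u" if "u \<in> H0" for u
    unfolding embH_ip by (rule ip_bound[OF f H01_L2[OF that]])
  from riesz_L2[OF embH_Hdual[OF f] this] obtain g w where
    g: "L2 g" "\<forall>v\<in>H0. emb f v = ip g v" and
    w: "\<forall>k::nat. w k \<in> H0" "(\<lambda>k. nrm (\<lambda>x. w k x - g x)) \<leadsto> 0" by blast
  have "AE x in M. f x = g x"
    by (rule embH_eqD[OF f g(1)]) (use g(2) in \<open>simp add: embH_ip\<close>)
  then have "nrm (\<lambda>x. w k x - g x) = nrm (\<lambda>x. w k x - f x)" for k
    using w(1) f g(1) H01_L2
    by (intro L2norm_cong_AE L2_measurable L2_diff) (auto elim: eventually_mono)
  with w show ?thesis by auto
qed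

lemma J_energy_le:
  assumes f: "L2 f" and n: "n > 0"
  shows "en (J n f) (J n f) \<le> n * ip (\<lambda>x. f x - J n f x) f"
    "n * (nrm (\<lambda>x. f x - J n f x))\<^sup>2 \<le> n * ip (\<lambda>x. f x - J n f x) f"
proof -
  note s = J_L2[OF f n] L2_diff[OF f J_L2[OF f n]]
  have "ip (\<lambda>x. f x - J n f x) f = ip (\<lambda>x. f x - J n f x) (\<lambda>x. f x - J n f x) + ip (\<lambda>x. f x - J n f x) (J n f)"
    using ip_diff_right[OF f s(1) s(2)] by simp
  then have "n * ip (\<lambda>x. f x - J n f x) f = n * (nrm (\<lambda>x. f x - J n f x))\<^sup>2 + en (J n f) (J n f)"
    using J_energy[OF f n] by (simp add: ip_self distrib_left)
  then show "en (J n f) (J n f) \<le> n * ip (\<lambda>x. f x - J n f x) f"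
    "n * (nrm (\<lambda>x. f x - J n f x))\<^sup>2 \<le> n * ip (\<lambda>x. f x - J n f x) f"
    using n en_nonneg[of "J n f"] by auto
qed

text \<open>The resolvent does not increase the energy, so on H_0^1 its L^2 error is of order
  n^{-1/2}.\<close>

lemma J_H01_error:
  assumes w: "w \<in> H0" and n: "n > 0"
  shows "n * (nrm (\<lambda>x. w x - J n w x))\<^sup>2 \<le> en w w"
proof -
  note sw = H01_L2[OF w]
  note Jw = J_H01[OF sw n]
  have "en (J n w) w = n * ip (\<lambda>x. w x - J n w x) w"
    using J_eq[OF sw n w] ip_diff_left[OF sw J_L2[OF sw n] sw] by (simp add: right_diff_distrib)
  moreover have "en (J n w) w \<le> hnrm (J n w) * hnrm w"
    using en_bound[OF Jw w] by simp
  moreover have "(hnrm (J n w))\<^sup>2 \<le> n * ip (\<lambda>x. w x - J n w x) w"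
    using J_energy_le(1)[OF sw n] by (simp add: en_self)
  ultimately have "hnrm (J n w) * hnrm (J n w) \<le> hnrm (J n w) * hnrm w"
    and le: "n * ip (\<lambda>x. w x - J n w x) w \<le> hnrm (J n w) * hnrm w"
    by (auto simp: power2_eq_square)
  then have "hnrm (J n w) \<le> hnrm w"
    using H01_norm_nonneg[of w] H01_norm_nonneg[of "J n w"]
    by (cases "hnrm (J n w) = 0") auto
  then have "hnrm (J n w) * hnrm w \<le> hnrm w * hnrm w"
    by (intro mult_right_mono) auto
  with le J_energy_le(2)[OF sw n] show ?thesis by (simp add: en_self power2_eq_square)
qed

text \<open>Convergence has a rate on H_0^1 and extends by density, since \<open>J n\<close> is a
  contraction of L^2.\<close>

lemma J_tendsto:
  assumes f: "L2 f"
  shows "(\<lambda>k. nrm (\<lambda>x. J (real (Suc k)) f x - f x)) \<leadsto> 0"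
proof (rule LIMSEQ_I)
  fix e :: real assume e: "e > 0"
  obtain w where w: "\<forall>k::nat. w k \<in> H0" "(\<lambda>k. nrm (\<lambda>x. w k x - f x)) \<leadsto> 0"
    using H01_dense[OF f] by blast
  have "\<forall>\<^sub>F k in sequentially. nrm (\<lambda>x. w k x - f x) < e / 3"
    by (rule order_tendstoD(2)[OF w(2)]) (use e in simp)
  then obtain u where u: "u \<in> H0" "nrm (\<lambda>x. u x - f x) < e / 3"
    using w(1) unfolding eventually_sequentially by blast
  note su = H01_L2[OF u(1)]
  obtain N :: nat where N: "en u u / (e/3)\<^sup>2 < real N" using reals_Archimedean2 by blast
  have "nrm (\<lambda>x. J (real (Suc k)) f x - f x) < e" if k: "k \<ge> N" for k
  proof -
    let ?n = "real (Suc k)"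
    note s = J_L2[OF f, of ?n] J_L2[OF su, of ?n]
    have 1: "nrm (\<lambda>x. J ?n f x - f x) \<le> nrm (\<lambda>x. J ?n f x - J ?n u x) + nrm (\<lambda>x. J ?n u x - f x)"
      by (rule L2norm_triangle_diff) (use s f in auto)
    have 2: "nrm (\<lambda>x. J ?n u x - f x) \<le> nrm (\<lambda>x. J ?n u x - u x) + nrm (\<lambda>x. u x - f x)"
      by (rule L2norm_triangle_diff) (use s su f in auto)
    have "nrm (\<lambda>x. J ?n f x - J ?n u x) = nrm (J ?n (\<lambda>x. f x - u x))"
    proof (rule L2norm_cong_AE)
      show "AE x in M. J ?n f x - J ?n u x = J ?n (\<lambda>x. f x - u x) x"
        using J_diff[OF f su, of ?n] by (simp add: eq_commute)
    qed (auto intro!: L2_measurable L2_diff J_L2 f su)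
    also have "\<dots> \<le> nrm (\<lambda>x. f x - u x)" by (intro J_norm_le L2_diff f su) simp
    also have "\<dots> = nrm (\<lambda>x. u x - f x)" by (rule L2norm_minus_commute)
    finally have 3: "nrm (\<lambda>x. J ?n f x - J ?n u x) \<le> nrm (\<lambda>x. u x - f x)" .
    have "?n * (nrm (\<lambda>x. u x - J ?n u x))\<^sup>2 \<le> en u u" by (rule J_H01_error[OF u(1)]) simp
    also have "\<dots> < real N * (e/3)\<^sup>2" using N e by (simp add: divide_less_eq)
    also have "\<dots> \<le> ?n * (e/3)\<^sup>2" using k by (intro mult_right_mono) auto
    finally have "(nrm (\<lambda>x. u x - J ?n u x))\<^sup>2 < (e/3)\<^sup>2" by simp
    then have "nrm (\<lambda>x. u x - J ?n u x) < e/3" by (rule power2_less_imp_less) (use e in simp)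
    then have 4: "nrm (\<lambda>x. J ?n u x - u x) < e/3" by (simp only: L2norm_minus_commute[of M "J ?n u"])
    show ?thesis using 1 2 3 4 u(2) by linarith
  qed
  then show "\<exists>no. \<forall>k\<ge>no. norm (nrm (\<lambda>x. J (real (Suc k)) f x - f x) - 0) < e"
    by auto
qed

lemma ip_J_tendsto:
  assumes f: "L2 f"
  shows "(\<lambda>k. ip f (J (real (Suc k)) f)) \<leadsto> (nrm f)\<^sup>2"
proof -
  have "(\<lambda>k. LINT x|M. J (real (Suc k)) f x \<bullet> f x) \<leadsto> (LINT x|M. f x \<bullet> f x)"
    by (rule L2_tendsto_inner[OF _ f f J_tendsto[OF f]]) (simp add: J_L2 f)
  then have "(\<lambda>k. ip (J (real (Suc k)) f) f) \<leadsto> ip f f" by (simp add: ip_def)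
  then show ?thesis unfolding ip_self by (simp only: ip_commute[of f])
qed

lemma ip_J_le:
  assumes "L2 f" "n > 0"
  shows "ip f (J n f) \<le> (nrm f)\<^sup>2"
proof -
  have "ip f (J n f) \<le> nrm f * nrm (J n f)"
    using ip_bound[OF assms(1) J_L2[OF assms]] by simp
  also have "\<dots> \<le> nrm f * nrm f" by (intro mult_left_mono J_norm_le assms) simp
  finally show ?thesis by (simp add: power2_eq_square)
qed

lemma res_energy:
  assumes "F \<in> HD" "n > 0"
  shows "F (res n F) = en (res n F) (res n F) / n + (nrm (res n F))\<^sup>2"
  using res_spec(2)[OF assms res_spec(1)[OF assms]] assms(2) by (simp add: ip_self field_simps)

lemma res_sym:
  assumes "F \<in> HD" "G \<in> HD" "n > 0"
  shows "F (res n G) = G (res n F)"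
proof -
  have "n * F (res n G) = en (res n F) (res n G) + n * ip (res n F) (res n G)"
    using res_spec(2)[OF assms(1,3) res_spec(1)[OF assms(2,3)]] by simp
  also have "\<dots> = en (res n G) (res n F) + n * ip (res n G) (res n F)"
    by (simp only: en_commute[of "res n F"] ip_commute[of "res n F" "res n G"])
  also have "\<dots> = n * G (res n F)"
    by (rule res_spec(2)[OF assms(2,3) res_spec(1)[OF assms(1,3)]])
  finally show ?thesis using assms(3) by simp
qed

lemma res_diff:
  assumes "F \<in> HD" "G \<in> HD" "n > 0"
  shows "AE x in M. res n (\<lambda>u. F u - G u) x = res n F x - res n G x"
proof (rule res_unique[OF Hdual_diff[OF assms(1,2)] assms(3) H01_diff(1)])
  note r = res_spec[OF assms(1,3)] res_spec[OF assms(2,3)]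
  show "res n F \<in> H0" "res n G \<in> H0" by (rule r)+
  fix v assume v: "v \<in> H0"
  show "en (\<lambda>x. res n F x - res n G x) v + n * ip (\<lambda>x. res n F x - res n G x) v = n * (F v - G v)"
    using r(2)[OF v] r(4)[OF v] v r(1,3)
    by (simp add: en_diff_left ip_diff_left H01_L2 algebra_simps)
qed

text \<open>\<open>wgrad\<close> may choose different representatives for functions that agree
  almost everywhere, but their difference has weak gradient zero, hence energy norm zero.\<close>

lemma Hdual_cong_AE:
  assumes F: "F \<in> HD" and u: "u \<in> H0" "v \<in> H0" "AE x in M. u x = v x"
  shows "F u = F v"
proof -
  obtain B where B: "\<And>u. u \<in> H0 \<Longrightarrow> \<bar>F u\<bar> \<le> B * hnrm u" using Hdual_bound[OF F] by metis
  define d where "d = (\<lambda>x. u x - v x)"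
  have d: "d \<in> H0" unfolding d_def by (rule H01_diff(1)[OF u(1,2)])
  have d0: "AE x in M. d x = 0" using u(3) by eventually_elim (simp add: d_def)
  have dm: "d \<in> BM" by (intro L2_measurable H01_L2 d)
  have "weak_gradient \<Lambda> d (\<lambda>x. 0)"
    unfolding weak_gradient_def Lq2_iff
  proof (intro conjI ballI)
    fix \<psi> b assume \<psi>: "\<psi> \<in> C0inf \<Lambda>" and b: "b \<in> (Basis :: 'a set)"
    have "(LINT x|M. d x * frechet_derivative \<psi> (at x) b) = (LINT x|M. 0)"
      using C0inf_Ck[OF \<psi>, of "Suc 0"] b d0
      by (intro integral_cong_AE borel_measurable_times dm continuous_measurable_M) (auto elim: eventually_mono)
    then show "(LINT x|M. d x * frechet_derivative \<psi> (at x) b) = - (LINT x|M. (0 \<bullet> b) * \<psi> x)" by simp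
  qed simp
  then have "AE x in M. wg d x = 0" by (rule wgrad_eq)
  then have "hnrm d = nrm (\<lambda>x. 0 :: 'a)"
    unfolding H01_norm_eq by (intro L2norm_cong_AE L2_measurable wgrad_L2 d) auto
  then have "F d = 0" using B[OF d] by (simp add: L2norm_def)
  moreover have "F u = F (\<lambda>x. v x + d x)" by (simp add: d_def)
  ultimately show ?thesis using HdualD(1)[OF F u(2) d] by simp
qed

text \<open>Exact second order expansion of the quadratic form \<open>F (res n F)\<close>, by
  symmetry of the resolvent. The remainder is the form at the difference, so the identity yields
  both the convexity inequality for time increments and the continuity of the form in time.\<close>

lemma res_convex:
  assumes F: "F \<in> HD" and G: "G \<in> HD" and n: "n > 0"
  shows "F (res n F) = G (res n G) + 2 * (F (res n G) - G (res n G))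
      + (\<lambda>u. F u - G u) (res n (\<lambda>u. F u - G u))"
    "(\<lambda>u. F u - G u) (res n (\<lambda>u. F u - G u)) \<ge> 0"
proof -
  note D = Hdual_diff[OF F G]
  note r = res_spec(1)[OF F n] res_spec(1)[OF G n] res_spec(1)[OF D n]
  note dd = H01_diff(1)[OF r(1,2)]
  have lin: "K (\<lambda>x. res n F x - res n G x) = K (res n F) - K (res n G)" if K: "K \<in> HD" for K
    using HdualD(1)[OF K r(1) H01_cmult(1)[OF r(2), of "- 1"]] HdualD(2)[OF K r(2), of "- 1"] by simp
  have "K (res n (\<lambda>u. F u - G u)) = K (res n F) - K (res n G)" if K: "K \<in> HD" for K
    using Hdual_cong_AE[OF K r(3) dd res_diff[OF F G n]] lin[OF K] by simp
  from this[OF F] this[OF G] res_sym[OF F G n]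
  show "F (res n F) = G (res n G) + 2 * (F (res n G) - G (res n G))
      + (\<lambda>u. F u - G u) (res n (\<lambda>u. F u - G u))" by simp
  show "(\<lambda>u. F u - G u) (res n (\<lambda>u. F u - G u)) \<ge> 0"
    using res_energy[OF D n] en_nonneg n by simp
qed

text \<open>The squared energy norm of the resolvent is at most n times the form, and the form is at
  most \<open>K\<close> times that norm.\<close>

lemma res_form_bound:
  assumes F: "F \<in> HD" and n: "n > 0" and K: "\<And>u. u \<in> H0 \<Longrightarrow> \<bar>F u\<bar> \<le> K * hnrm u" "K \<ge> 0"
  shows "F (res n F) \<le> n * K\<^sup>2"
proof -
  let ?h = "hnrm (res n F)"
  have "F (res n F) \<le> K * ?h" using K(1)[OF res_spec(1)[OF F n]] by simp
  moreover have "?h\<^sup>2 / n \<le> F (res n F)" unfolding res_energy[OF F n] en_self by simp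
  moreover have "n * F (res n F) \<le> n * (K * ?h)"
    using \<open>F (res n F) \<le> K * ?h\<close> n by (intro mult_left_mono) auto
  moreover have "?h\<^sup>2 \<le> n * F (res n F)"
    using \<open>?h\<^sup>2 / n \<le> F (res n F)\<close> n by (simp add: pos_divide_le_eq mult.commute)
  ultimately have "?h\<^sup>2 \<le> n * K * ?h" by (simp only: mult.assoc)
  then have "?h \<le> n * K"
    using n K(2) H01_norm_nonneg[of "res n F"]
    by (cases "?h = 0") (auto simp: power2_eq_square)
  then have "K * ?h \<le> K * (n * K)" using K(2) by (rule mult_left_mono)
  with \<open>F (res n F) \<le> K * ?h\<close> show ?thesis by (simp add: power2_eq_square mult_ac)
qed

text \<open>In F v = en u v / n + ip u v, with u the resolvent, the bound \<open>C\<close> controls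
  the L^2 norm of u and the energy norm of u divided by the root of n. So the first term vanishes in
  the limit, and F is bounded with respect to the L^2 norm.\<close>

lemma res_bounded_imp_L2:
  assumes F: "F \<in> HD" and C: "\<And>k. k \<ge> N \<Longrightarrow> F (res (real (Suc k)) F) \<le> C"
  shows "\<exists>f. L2 f \<and> Heq \<Lambda> F (emb f)"
proof -
  have "\<bar>F v\<bar> \<le> sqrt C * nrm v" if v: "v \<in> H0" for v
  proof -
    have "\<bar>F v\<bar> \<le> sqrt C * hnrm v * sqrt (inverse (real (Suc k))) + sqrt C * nrm v" if k: "k \<ge> N" for k
    proof -
      let ?n = "real (Suc k)" let ?u = "res ?n F"
      have n: "?n > 0" by simp
      note r = res_spec[OF F n]
      have F_eq: "F v = en ?u v / ?n + ip ?u v" using r(2)[OF v] n by (simp add: field_simps)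
      have e: "en ?u ?u / ?n + (nrm ?u)\<^sup>2 \<le> C" using res_energy[OF F n] C[OF k] by simp
      have "(nrm ?u)\<^sup>2 \<le> C" using e en_nonneg[of ?u] n by (smt (verit) divide_nonneg_pos)
      then have u2: "nrm ?u \<le> sqrt C" by (rule real_le_rsqrt)
      have "(hnrm ?u)\<^sup>2 / ?n \<le> C"
        using e zero_le_power2[of "nrm ?u"] unfolding en_self by linarith
      then have "(hnrm ?u)\<^sup>2 \<le> C * ?n"
        using n by (simp add: pos_divide_le_eq del: of_nat_Suc)
      then have "hnrm ?u \<le> sqrt (C * ?n)" by (rule real_le_rsqrt)
      then have "hnrm ?u / ?n \<le> sqrt (C * ?n) / ?n" by (rule divide_right_mono) simp
      also have "\<dots> = sqrt C * sqrt (inverse ?n)"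
        unfolding real_sqrt_mult sqrt_divide_self[OF n, symmetric] by (rule times_divide_eq_right[symmetric])
      finally have u1: "hnrm ?u / ?n \<le> sqrt C * sqrt (inverse ?n)" .
      have "\<bar>F v\<bar> \<le> \<bar>en ?u v\<bar> / ?n + \<bar>ip ?u v\<bar>" unfolding F_eq using n by (intro order_trans[OF abs_triangle_ineq]) simp
      also have "\<dots> \<le> hnrm ?u * hnrm v / ?n + nrm ?u * nrm v"
        using n by (intro add_mono divide_right_mono en_bound ip_bound H01_L2 r(1) v) auto
      also have "\<dots> = (hnrm ?u / ?n) * hnrm v + nrm ?u * nrm v" by simp
      also have "\<dots> \<le> (sqrt C * sqrt (inverse ?n)) * hnrm v + sqrt C * nrm v"
        by (intro add_mono mult_right_mono u1 u2) auto
      finally show ?thesis by (simp add: mult_ac)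
    qed
    moreover have "(\<lambda>k. sqrt C * hnrm v * sqrt (inverse (real (Suc k))) + sqrt C * nrm v)
       \<leadsto> sqrt C * hnrm v * sqrt 0 + sqrt C * nrm v"
      by (intro tendsto_intros LIMSEQ_inverse_real_of_nat)
    ultimately show ?thesis
      using LIMSEQ_le_const[of _ _ "\<bar>F v\<bar>"] by (metis (no_types, lifting) add_0 mult_zero_right real_sqrt_zero)
  qed
  from riesz_L2[OF F this] show ?thesis unfolding Heq_def embH_ip by blast
qed

section \<open>The resolvent as a positive kernel, and its bounds in L^q\<close>

lemma bounded_comp:
  fixes U :: "'a \<Rightarrow> 'c::euclidean_space"
  assumes c: "continuous_on UNIV (\<phi> :: 'c \<Rightarrow> real)" and U: "U \<in> BM" "bounded (U ` \<Lambda>)"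
  shows "L2 (\<lambda>x. \<phi> (U x))" "\<exists>B\<ge>0. \<forall>x\<in>\<Lambda>. \<bar>\<phi> (U x)\<bar> \<le> B"
proof -
  have "compact (\<phi> ` closure (U ` \<Lambda>))"
    using U(2) by (intro compact_continuous_image continuous_on_subset[OF c]) auto
  then have "bounded (\<phi> ` closure (U ` \<Lambda>))" by (rule compact_imp_bounded)
  then obtain B where B: "B > 0" "\<And>y. y \<in> closure (U ` \<Lambda>) \<Longrightarrow> norm (\<phi> y) \<le> B"
    unfolding bounded_pos by auto
  then have B': "\<forall>x\<in>\<Lambda>. \<bar>\<phi> (U x)\<bar> \<le> B" using closure_subset[of "U ` \<Lambda>"] by auto
  then show "\<exists>B\<ge>0. \<forall>x\<in>\<Lambda>. \<bar>\<phi> (U x)\<bar> \<le> B" using B(1) by (auto intro!: exI[of _ B])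
  have "\<phi> \<in> borel_measurable borel" using c by (rule borel_measurable_continuous_onI)
  then have "(\<lambda>x. \<phi> (U x)) \<in> BM" by (rule measurable_compose[OF U(1)])
  then show "L2 (\<lambda>x. \<phi> (U x))"
    by (rule M.L2_bounded[where B = B]) (use B' in auto)
qed

text \<open>\<open>J n\<close> acts like a symmetric nonnegative kernel \<open>j(x, y)\<close>: a separable nonnegative function
  of \<open>U x\<close> and \<open>U y\<close> has a nonnegative integral against it. The value \<open>\<alpha> = U x\<close> is reached from a
  countable dense set.\<close>

lemma kernel_positive:
  fixes U :: "'a \<Rightarrow> 'c::euclidean_space"
  assumes n: "n > 0" and I: "finite I"
    and a: "\<And>i. i \<in> I \<Longrightarrow> continuous_on UNIV (a i)" and b: "\<And>i. i \<in> I \<Longrightarrow> continuous_on UNIV (b i)"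
    and U: "U \<in> BM" "bounded (U ` \<Lambda>)"
    and pos: "\<And>\<alpha> \<beta>. 0 \<le> (\<Sum>i\<in>I. a i \<alpha> * b i \<beta> :: real)"
  shows "0 \<le> (\<Sum>i\<in>I. ip (\<lambda>x. a i (U x)) (J n (\<lambda>x. b i (U x))))"
proof -
  obtain D :: "'c set" where D: "countable D" "closure D = UNIV" using ex_countable_dense by blast
  note sb = bounded_comp(1)[OF b U] and sa = bounded_comp(1)[OF a U]
  have "AE x in M. 0 \<le> (\<Sum>i\<in>I. a i \<alpha> * J n (\<lambda>x. b i (U x)) x)" for \<alpha>
  proof -
    have "AE x in M. 0 \<le> J n (\<lambda>x. \<Sum>i\<in>I. a i \<alpha> * b i (U x)) x"
      by (rule J_nonneg[OF _ n]) (use pos sb in \<open>auto intro!: L2_sum L2_cmult\<close>)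
    moreover have "AE x in M. J n (\<lambda>x. \<Sum>i\<in>I. a i \<alpha> * b i (U x)) x = (\<Sum>i\<in>I. a i \<alpha> * J n (\<lambda>x. b i (U x)) x)"
      by (rule J_sum[OF sb n])
    ultimately show ?thesis by eventually_elim simp
  qed
  then have "AE x in M. \<forall>\<alpha>\<in>D. 0 \<le> (\<Sum>i\<in>I. a i \<alpha> * J n (\<lambda>x. b i (U x)) x)"
    by (subst AE_ball_countable[OF D(1)]) auto
  then have nn: "AE x in M. 0 \<le> (\<Sum>i\<in>I. a i (U x) * J n (\<lambda>x. b i (U x)) x)"
  proof eventually_elim
    case (elim x)
    show ?case
      by (rule continuous_le_dense[OF D(2), of "\<lambda>_. 0" "\<lambda>\<alpha>. \<Sum>i\<in>I. a i \<alpha> * J n (\<lambda>x. b i (U x)) x"])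
        (use elim a in \<open>auto intro!: continuous_intros\<close>)
  qed
  have "(\<Sum>i\<in>I. ip (\<lambda>x. a i (U x)) (J n (\<lambda>x. b i (U x)))) = (LINT x|M. (\<Sum>i\<in>I. a i (U x) * J n (\<lambda>x. b i (U x)) x))"
    unfolding ip_def using sa sb n by (intro Bochner_Integration.integral_sum[symmetric] L2_mult J_L2)
  also have "\<dots> \<ge> 0" by (rule integral_nonneg_AE[OF nn])
  finally show ?thesis .
qed

definition Lp_integrable :: "real \<Rightarrow> ('a \<Rightarrow> real) \<Rightarrow> bool" where
  "Lp_integrable q f \<longleftrightarrow> f \<in> BM \<and> intM (\<lambda>x. \<bar>f x\<bar> powr q)"

lemma Lp_integrable_Lq: "f \<in> Lq q \<Lambda> \<longleftrightarrow> Lp_integrable q f"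
  by (simp add: Lq_def Lp_integrable_def)

lemma Lp_integrable_sq:
  assumes "Lp_integrable q f" "q \<ge> 2"
  shows "L2 f"
  unfolding sq_integrable_def
proof
  show "intM (\<lambda>x. (norm (f x))\<^sup>2)"
  proof (rule Bochner_Integration.integrable_bound)
    show "intM (\<lambda>x. 1 + \<bar>f x\<bar> powr q)" using assms by (auto simp: Lp_integrable_def)
    have "(norm (f x))\<^sup>2 \<le> 1 + \<bar>f x\<bar> powr q" for x
    proof (cases "\<bar>f x\<bar> \<le> 1")
      case True
      then have "(norm (f x))\<^sup>2 \<le> 1" by (simp add: abs_square_le_1)
      then show ?thesis by (simp add: add_increasing2)
    next
      case False
      then have "\<bar>f x\<bar> powr 2 \<le> \<bar>f x\<bar> powr q" using assms(2) by (intro powr_mono) auto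
      then show ?thesis using False by simp
    qed
    then show "AE x in M. norm ((norm (f x))\<^sup>2) \<le> norm (1 + \<bar>f x\<bar> powr q)" by auto
  qed (use assms in \<open>auto simp: Lp_integrable_def\<close>)
qed (use assms in \<open>simp add: Lp_integrable_def\<close>)

text \<open>Young's inequality for w(x)^{q-1} f(y), integrated against the kernel with w = J n f,
  bounds the integral of w^q by half of itself plus a multiple of the integral of f^q. Positivity of
  the kernel is available for functions with bounded range, hence the bound on
  \<open>f\<close>.\<close>

lemma J_Lp_bounded:
  assumes n: "n > 0" and q: "q \<ge> 2" and f: "f \<in> BM" "\<And>x. 0 \<le> f x" "\<And>x. f x \<le> B"
  shows "intM (\<lambda>x. \<bar>J n f x\<bar> powr q)"
    "(LINT x|M. \<bar>J n f x\<bar> powr q) \<le> 2 powr q * (LINT x|M. f x powr q)"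
proof -
  have B: "B \<ge> 0" using f(2,3) order_trans by blast
  have sf: "L2 f" by (rule M.L2_bounded[where B = B]) (use f in auto)
  \<comment> \<open>A version of \<open>J n f\<close> that is bounded at every point, so that the
    pair of \<open>w\<close> and \<open>f\<close> has bounded range.\<close>
  define w where "w = (\<lambda>x. max 0 (min B (J n f x)))"
  have wJ: "AE x in M. J n f x = w x"
    using J_bounded[OF sf n, of B] J_nonneg[OF sf n] f B by (auto simp: w_def elim!: eventually_elim2)
  have [measurable]: "J n f \<in> BM" "f \<in> BM" using J_measurable[OF sf n] f by auto
  have [measurable]: "w \<in> BM" unfolding w_def by measurable
  have w: "0 \<le> w x" "w x \<le> B" for x using B by (auto simp: w_def)
  define U where "U = (\<lambda>x. (w x, f x))"
  have U: "U \<in> BM" unfolding U_def by measurable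
  have Ub: "bounded (U ` \<Lambda>)"
  proof (rule bounded_subset)
    show "bounded (cbox (0::real, 0::real) (B, B))" by (rule bounded_cbox)
    show "U ` \<Lambda> \<subseteq> cbox (0, 0) (B, B)" using w f by (auto simp: U_def cbox_Pair_eq)
  qed
  \<comment> \<open>The three products encode Young's inequality with parameter 1/2: the first is
    absorbed by the left-hand side, and twice the coefficient of the second is
    \<open>2 powr q\<close>.\<close>
  define a where "a = (\<lambda>i (\<alpha>::real\<times>real). if i = (0::nat) then \<bar>fst \<alpha>\<bar> powr q / 2 else if i = 1 then (1/2) powr (1 - q) else - (\<bar>fst \<alpha>\<bar> powr (q - 1)))"
  define b where "b = (\<lambda>i (\<beta>::real\<times>real). if i = (0::nat) then 1 else if i = 1 then \<bar>snd \<beta>\<bar> powr q else \<bar>snd \<beta>\<bar>)"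
  have pc: "continuous_on UNIV (\<lambda>\<alpha>::real\<times>real. \<bar>fst \<alpha>\<bar> powr r)" "continuous_on UNIV (\<lambda>\<alpha>::real\<times>real. \<bar>snd \<alpha>\<bar> powr r)" if "r > 0" for r
  proof -
    have "continuous_on UNIV (\<lambda>\<alpha>::real\<times>real. \<bar>fst \<alpha>\<bar>)" "continuous_on UNIV (\<lambda>\<alpha>::real\<times>real. \<bar>snd \<alpha>\<bar>)"
      by (intro continuous_intros)+
    from this[THEN continuous_on_powr'[OF _ continuous_on_const]]
    show "continuous_on UNIV (\<lambda>\<alpha>::real\<times>real. \<bar>fst \<alpha>\<bar> powr r)" "continuous_on UNIV (\<lambda>\<alpha>::real\<times>real. \<bar>snd \<alpha>\<bar> powr r)"
      using that by auto
  qed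
  have "0 \<le> (\<Sum>i\<in>{0,1,2}. ip (\<lambda>x. a i (U x)) (J n (\<lambda>x. b i (U x))))"
  proof (rule kernel_positive[OF n _ _ _ U Ub])
    show "continuous_on UNIV (a i)" if "i \<in> {0,1,2}" for i
      using that q pc[of q] pc[of "q - 1"] by (auto simp: a_def intro!: continuous_intros)
    show "continuous_on UNIV (b i)" if "i \<in> {0,1,2}" for i
      using that q pc[of q] by (auto simp: b_def intro!: continuous_intros)
    show "0 \<le> (\<Sum>i\<in>{0,1,2}. a i \<alpha> * b i \<beta>)" for \<alpha> \<beta>
      using young_crude[of "\<bar>fst \<alpha>\<bar>" "\<bar>snd \<beta>\<bar>" q "1/2"] q by (simp add: a_def b_def)
  qed simp
  then have main: "ip (\<lambda>x. w x powr (q - 1)) (J n f) \<le> ip (\<lambda>x. w x powr q / 2) (J1 n) + ip (\<lambda>x. (1/2) powr (1 - q)) (J n (\<lambda>x. f x powr q))"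
    using w f by (simp add: a_def b_def U_def ip_def abs_of_nonneg)
  have i1: "intM (\<lambda>x. w x powr q)"
    by (rule M.integrable_const_bound[where B = "B powr q"]) (use w q in \<open>auto intro!: powr_mono2\<close>)
  have sfq: "L2 (\<lambda>x. f x powr q)"
    by (rule M.L2_bounded[where B = "B powr q"]) (use f q in \<open>auto intro!: powr_mono2\<close>)
  have "ip (\<lambda>x. w x powr (q - 1)) (J n f) = (LINT x|M. w x powr q)"
    unfolding ip_def
  proof (rule integral_cong_AE)
    show "AE x in M. w x powr (q - 1) * J n f x = w x powr q"
      using wJ by eventually_elim (use w q in \<open>simp add: powr_mult_base mult.commute[of "_ powr _"]\<close>)
  qed auto
  moreover have "ip (\<lambda>x. w x powr q / 2) (J1 n) \<le> (LINT x|M. w x powr q) / 2"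
  proof -
    have "ip (\<lambda>x. w x powr q / 2) (J1 n) \<le> (LINT x|M. w x powr q / 2)"
      unfolding ip_def
    proof (rule integral_mono_AE)
      have "L2 (\<lambda>x. w x powr q / 2)"
        by (rule M.L2_bounded[where B = "B powr q / 2"]) (use w q in \<open>auto intro!: powr_mono2 divide_right_mono\<close>)
      then show "intM (\<lambda>x. w x powr q / 2 * J1 n x)"
        by (rule L2_mult) (rule J_L2[OF M.L2_const n])
      show "AE x in M. w x powr q / 2 * J1 n x \<le> w x powr q / 2"
        using J1_bounds[OF n] by eventually_elim (intro mult_left_le, auto)
    qed (use i1 in auto)
    then show ?thesis by simp
  qed
  moreover have "ip (\<lambda>x. (1/2) powr (1 - q)) (J n (\<lambda>x. f x powr q)) \<le> (1/2) powr (1 - q) * (LINT x|M. f x powr q)"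
  proof -
    have "ip (\<lambda>x. (1/2) powr (1 - q)) (J n (\<lambda>x. f x powr q)) = (1/2) powr (1 - q) * ip (\<lambda>x. 1) (J n (\<lambda>x. f x powr q))"
      using ip_cmult_left[of "(1/2) powr (1 - q)" "\<lambda>x. 1"] by simp
    also have "ip (\<lambda>x. 1) (J n (\<lambda>x. f x powr q)) = ip (J1 n) (\<lambda>x. f x powr q)"
      by (rule J_sym[symmetric, OF M.L2_const sfq n])
    also have "\<dots> \<le> (LINT x|M. f x powr q)"
      unfolding ip_def
    proof (rule integral_mono_AE)
      show "intM (\<lambda>x. J1 n x * f x powr q)"
        by (rule L2_mult[OF J_L2[OF M.L2_const n] sfq])
      show "AE x in M. J1 n x * f x powr q \<le> f x powr q"
        using J1_bounds[OF n] by eventually_elim (intro mult_left_le_one_le, auto)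
    qed (rule M.L2_integrable[OF sfq])
    finally show ?thesis by (simp add: mult_left_mono)
  qed
  ultimately have "(LINT x|M. w x powr q) / 2 \<le> (1/2) powr (1 - q) * (LINT x|M. f x powr q)"
    using main by linarith
  moreover have "(1/2) powr (1 - q) = 2 powr q / (2::real)"
    by (simp add: powr_diff powr_divide powr_minus)
  ultimately have le: "(LINT x|M. w x powr q) \<le> 2 powr q * (LINT x|M. f x powr q)" by simp
  have eq: "AE x in M. w x powr q = \<bar>J n f x\<bar> powr q" using wJ by eventually_elim (simp add: w)
  show "intM (\<lambda>x. \<bar>J n f x\<bar> powr q)"
    by (rule integrable_cong_AE_imp[OF i1 _ eq]) measurable
  have "(LINT x|M. w x powr q) = (LINT x|M. \<bar>J n f x\<bar> powr q)"
    by (rule integral_cong_AE[OF _ _ eq]) measurable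
  with le show "(LINT x|M. \<bar>J n f x\<bar> powr q) \<le> 2 powr q * (LINT x|M. f x powr q)" by simp
qed

text \<open>Truncations of the absolute value converge in L^2, so their images under
  \<open>J n\<close> converge almost everywhere along a subsequence, and Fatou keeps the constant.
  The sign is restored by positivity of \<open>J n\<close>.\<close>

lemma J_Lp:
  assumes n: "n > 0" and q: "q \<ge> 2" and f: "Lp_integrable q f"
  shows "Lp_integrable q (J n f)" "(LINT x|M. \<bar>J n f x\<bar> powr q) \<le> 2 powr q * (LINT x|M. \<bar>f x\<bar> powr q)"
proof -
  note sf = Lp_integrable_sq[OF f q]
  note saf = L2_abs[OF sf]
  have [measurable]: "f \<in> BM" using f by (simp add: Lp_integrable_def)
  have intf: "intM (\<lambda>x. \<bar>f x\<bar> powr q)" using f by (simp add: Lp_integrable_def)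
  define g where "g = (\<lambda>k x. min \<bar>f x\<bar> (real k))"
  have gm [measurable]: "g k \<in> BM" for k unfolding g_def by measurable
  have g: "0 \<le> g k x" "g k x \<le> real k" "g k x \<le> \<bar>f x\<bar>" for k x by (auto simp: g_def)
  have sg: "L2 (g k)" for k by (rule M.L2_bounded[where B = "real k"]) (use g in auto)
  have lim: "(\<lambda>k. nrm (\<lambda>x. g k x - \<bar>f x\<bar>)) \<leadsto> 0"
  proof -
    have "(\<lambda>k. LINT x|M. (norm (g k x - \<bar>f x\<bar>))\<^sup>2) \<leadsto> (LINT x|M. 0)"
    proof (rule integral_dominated_convergence[where w = "\<lambda>x. (norm (f x))\<^sup>2"])
      show "AE x in M. (\<lambda>k. (norm (g k x - \<bar>f x\<bar>))\<^sup>2) \<leadsto> 0"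
      proof (rule AE_I2, rule tendsto_eventually)
        fix x
        obtain N :: nat where "\<bar>f x\<bar> \<le> real N" using real_arch_simple by blast
        note N = this
        show "\<forall>\<^sub>F k in sequentially. (norm (g k x - \<bar>f x\<bar>))\<^sup>2 = 0"
          using eventually_ge_at_top[of N] by eventually_elim (use N in \<open>simp add: g_def\<close>)
      qed
      show "AE x in M. norm ((norm (g k x - \<bar>f x\<bar>))\<^sup>2) \<le> (norm (f x))\<^sup>2" for k
      proof (rule AE_I2)
        fix x show "norm ((norm (g k x - \<bar>f x\<bar>))\<^sup>2) \<le> (norm (f x))\<^sup>2"
          using g[of k x] power_mono[of "\<bar>g k x - \<bar>f x\<bar>\<bar>" "\<bar>f x\<bar>" 2] by auto
      qed
      show "intM (\<lambda>x. (norm (f x))\<^sup>2)" using sf by (simp add: sq_integrable_def)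
    qed auto
    from tendsto_real_sqrt[OF this] show ?thesis unfolding L2norm_def by simp
  qed
  have limJ: "(\<lambda>k. nrm (\<lambda>x. J n (g k) x - J n (\<lambda>x. \<bar>f x\<bar>) x)) \<leadsto> 0"
  proof (rule Lim_null_comparison[OF _ lim])
    have "nrm (\<lambda>x. J n (g k) x - J n (\<lambda>x. \<bar>f x\<bar>) x) \<le> nrm (\<lambda>x. g k x - \<bar>f x\<bar>)" for k
    proof -
      have "nrm (\<lambda>x. J n (g k) x - J n (\<lambda>x. \<bar>f x\<bar>) x) = nrm (J n (\<lambda>x. g k x - \<bar>f x\<bar>))"
      proof (rule L2norm_cong_AE)
        show "AE x in M. J n (g k) x - J n (\<lambda>x. \<bar>f x\<bar>) x = J n (\<lambda>x. g k x - \<bar>f x\<bar>) x"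
          using J_diff[OF sg[of k] saf n] by eventually_elim simp
      qed (auto intro!: L2_measurable L2_diff J_L2 sg saf n)
      also have "\<dots> \<le> nrm (\<lambda>x. g k x - \<bar>f x\<bar>)" by (intro J_norm_le L2_diff sg saf n)
      finally show ?thesis .
    qed
    then show "\<forall>\<^sub>F k in sequentially. norm (nrm (\<lambda>x. J n (g k) x - J n (\<lambda>x. \<bar>f x\<bar>) x)) \<le> nrm (\<lambda>x. g k x - \<bar>f x\<bar>)"
      by simp
  qed
  obtain r where r: "strict_mono r" "AE x in M. (\<lambda>k. J n (g (r k)) x) \<leadsto> J n (\<lambda>x. \<bar>f x\<bar>) x"
    using M.L2_tendsto_AE_subseq[OF J_L2[OF sg n] J_L2[OF saf n] limJ] by blast
  have [measurable]: "J n (\<lambda>x. \<bar>f x\<bar>) \<in> BM" "J n f \<in> BM"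
    using J_measurable[OF saf n] J_measurable[OF sf n] .
  have b: "(LINT x|M. \<bar>J n (g (r k)) x\<bar> powr q) \<le> 2 powr q * (LINT x|M. \<bar>f x\<bar> powr q)" for k
  proof -
    have "(LINT x|M. \<bar>J n (g (r k)) x\<bar> powr q) \<le> 2 powr q * (LINT x|M. g (r k) x powr q)"
      by (rule J_Lp_bounded(2)[OF n q gm g(1) g(2)])
    also have "(LINT x|M. g (r k) x powr q) \<le> (LINT x|M. \<bar>f x\<bar> powr q)"
    proof (rule integral_mono)
      show "intM (\<lambda>x. g (r k) x powr q)"
        by (rule M.integrable_const_bound[where B = "real (r k) powr q"]) (use g q in \<open>auto intro!: powr_mono2\<close>)
    qed (use intf g q in \<open>auto intro!: powr_mono2\<close>)
    finally show ?thesis by (simp add: mult_left_mono)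
  qed
  have lim': "AE x in M. (\<lambda>k. \<bar>J n (g (r k)) x\<bar> powr q) \<leadsto> \<bar>J n (\<lambda>x. \<bar>f x\<bar>) x\<bar> powr q"
    using r(2) by eventually_elim (use q in \<open>auto intro!: tendsto_powr' tendsto_rabs\<close>)
  note fb = fatou_bound[OF J_Lp_bounded(1)[OF n q gm g(1) g(2)] _ lim' _ b]
  have le: "AE x in M. \<bar>J n f x\<bar> powr q \<le> \<bar>J n (\<lambda>x. \<bar>f x\<bar>) x\<bar> powr q"
    using J_abs_le[OF sf saf n] q by (auto elim!: eventually_mono intro!: powr_mono2)
  have int: "intM (\<lambda>x. \<bar>J n f x\<bar> powr q)"
    by (rule Bochner_Integration.integrable_bound[OF fb(1)]) (use le in auto)
  then show "Lp_integrable q (J n f)" by (simp add: Lp_integrable_def)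
  have "(LINT x|M. \<bar>J n f x\<bar> powr q) \<le> (LINT x|M. \<bar>J n (\<lambda>x. \<bar>f x\<bar>) x\<bar> powr q)"
    by (rule integral_mono_AE[OF int fb(1) le]) auto
  also have "\<dots> \<le> 2 powr q * (LINT x|M. \<bar>f x\<bar> powr q)" by (rule fb(2)) auto
  finally show "(LINT x|M. \<bar>J n f x\<bar> powr q) \<le> 2 powr q * (LINT x|M. \<bar>f x\<bar> powr q)" .
qed

end

definition clip :: "nat \<Rightarrow> real \<Rightarrow> real" where
  "clip k y = max (- real k) (min (real k) y)"

lemma clip_abs_le: "\<bar>clip k y\<bar> \<le> \<bar>y\<bar>" "\<bar>clip k y\<bar> \<le> real k"
  by (auto simp: clip_def)

lemma clip_tendsto: "(\<lambda>k. clip k y) \<leadsto> y"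
proof (rule tendsto_eventually)
  obtain N :: nat where N: "\<bar>y\<bar> \<le> real N" using real_arch_simple by blast
  show "\<forall>\<^sub>F k in sequentially. clip k y = y"
    using eventually_ge_at_top[of N] by eventually_elim (use N in \<open>auto simp: clip_def\<close>)
qed

lemma clip_measurable [measurable]: "clip k \<in> borel_measurable borel"
  unfolding clip_def by measurable

context bounded_domain
begin

section \<open>Membership in H_0^1, resolvent bounds for C^2 functions, and the spectral gap\<close>

lemma en_add_sq:
  assumes u: "u \<in> H0" and d: "d \<in> H0"
  shows "en (\<lambda>x. u x + d x) (\<lambda>x. u x + d x) = en u u + 2 * en u d + en d d"
proof -
  note s = H01_add(1)[OF u d]
  have "en (\<lambda>x. u x + d x) (\<lambda>x. u x + d x) = en u (\<lambda>x. u x + d x) + en d (\<lambda>x. u x + d x)"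
    by (rule en_add_left[OF u d s])
  moreover have "en u (\<lambda>x. u x + d x) = en u u + en d u"
    using en_add_left[OF u d u] by (simp only: en_commute[of u "\<lambda>x. u x + d x"])
  moreover have "en d (\<lambda>x. u x + d x) = en u d + en d d"
    using en_add_left[OF u d d] by (simp only: en_commute[of d "\<lambda>x. u x + d x"])
  ultimately show ?thesis using en_commute[of d u] by linarith
qed

text \<open>The energies of \<open>J n f\<close> increase with n, and the energy of a difference is
  at most the difference of the energies. Since they are bounded, \<open>J n f\<close> is Cauchy in
  the energy norm, while it tends to \<open>f\<close> in L^2.\<close>

lemma H01_of_bounded_energy:
  assumes f: "L2 f"
    and C: "\<And>k. real (Suc k) * ip (\<lambda>x. f x - J (real (Suc k)) f x) f \<le> C"
  shows "f \<in> H0"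
proof -
  define n where "n = (\<lambda>k::nat. real (Suc k))"
  define u where "u = (\<lambda>k. J (n k) f)"
  have n: "n k > 0" for k by (simp add: n_def)
  have u: "u k \<in> H0" "L2 (u k)" for k
    unfolding u_def by (auto intro: J_H01 J_L2 f n)
  define E where "E = (\<lambda>k. en (u k) (u k))"
  have incr: "en (\<lambda>x. u j x - u k x) (\<lambda>x. u j x - u k x) \<le> E j - E k" if "k < j" for j k
  proof -
    define d where "d = (\<lambda>x. u j x - u k x)"
    have d: "d \<in> H0" "L2 d" unfolding d_def by (auto intro: H01_diff H01_L2 u)
    have weak: "en (u i) d = n i * (ip f d - ip (u i) d)" for i
      using J_eq[OF f n d(1), of i] by (simp add: u_def algebra_simps)
    have "ip d d = ip (u j) d - ip (u k) d" "en d d = en (u j) d - en (u k) d"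
      using ip_diff_left[OF u(2) u(2) d(2), of j k] en_diff_left[OF u(1) u(1) d(1), of j k] unfolding d_def[symmetric] .
    \<comment> \<open>The two weak equations, tested with \<open>d\<close> and subtracted. The sign
      of the right-hand side shows that \<open>u k\<close> and the increment \<open>d\<close> have
      nonnegative energy product.\<close>
    then have "(n j - n k) * (ip f d - ip (u k) d) = en d d + n j * ip d d" by (simp only: weak) (simp add: algebra_simps)
    also have "\<dots> \<ge> 0" using n[of j] en_nonneg[of d] by (simp add: ip_self)
    finally have "0 \<le> en (u k) d" unfolding weak using that n[of k] by (simp add: zero_le_mult_iff n_def)
    moreover have "u j = (\<lambda>x. u k x + d x)" by (simp add: d_def)
    then have "E j = E k + 2 * en (u k) d + en d d" unfolding E_def using en_add_sq[OF u(1)[of k] d(1)] by simp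
    ultimately show ?thesis unfolding d_def[symmetric] by linarith
  qed
  have EC: "E k \<le> C" for k
    using order_trans[OF J_energy_le(1)[OF f n[of k]]] C[of k] unfolding E_def u_def n_def by blast
  have "incseq E"
  proof (rule incseq_SucI)
    show "E k \<le> E (Suc k)" for k
      using incr[of k "Suc k"] en_nonneg[of "\<lambda>x. u (Suc k) x - u k x"] by simp
  qed
  then obtain l where "E \<leadsto> l"
    by (rule incseq_convergent[of E C]) (use EC in auto)
  then have "Cauchy E" by (rule LIMSEQ_imp_Cauchy)
  have hn: "(hnrm (\<lambda>x. u j x - u k x))\<^sup>2 \<le> \<bar>E j - E k\<bar>" for j k
  proof (cases j k rule: linorder_cases)
    case less
    have "hnrm (\<lambda>x. u j x - u k x) = hnrm (\<lambda>x. u k x - u j x)"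
      unfolding H01_norm_eq
    proof (rule L2norm_minus[THEN trans[rotated]], rule L2norm_cong_AE)
      show "AE x in M. wg (\<lambda>x. u j x - u k x) x = - wg (\<lambda>x. u k x - u j x) x"
        using H01_diff(2)[OF u(1)[of j] u(1)[of k]] H01_diff(2)[OF u(1)[of k] u(1)[of j]]
        by eventually_elim simp
    qed (auto intro!: L2_measurable wgrad_L2 H01_diff u L2_minus)
    then show ?thesis using incr[OF less] by (simp add: en_self)
  next
    case equal
    have "(hnrm (\<lambda>x. u k x - u k x))\<^sup>2 = en (\<lambda>x. 0 * u k x) (\<lambda>x. 0 * u k x)"
      by (simp add: en_self)
    also have "\<dots> = 0" by (simp only: en_cmult_left[OF u(1) H01_cmult(1)[OF u(1)]])
    finally show ?thesis using equal by simp
  next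
    case greater
    then show ?thesis using incr[OF greater] by (simp add: en_self)
  qed
  have "\<exists>N. \<forall>j\<ge>N. \<forall>k\<ge>N. nrm (\<lambda>x. wg (u j) x - wg (u k) x) < e" if e: "e > 0" for e
  proof -
    obtain N where N: "\<And>j k. j \<ge> N \<Longrightarrow> k \<ge> N \<Longrightarrow> \<bar>E j - E k\<bar> < e\<^sup>2"
      using CauchyD[OF \<open>Cauchy E\<close>, of "e\<^sup>2"] e by auto
    have "nrm (\<lambda>x. wg (u j) x - wg (u k) x) < e" if "j \<ge> N" "k \<ge> N" for j k
    proof -
      have "nrm (\<lambda>x. wg (u j) x - wg (u k) x) = hnrm (\<lambda>x. u j x - u k x)"
        unfolding H01_norm_eq using H01_diff[OF u(1)[of j] u(1)[of k]]
        by (intro L2norm_cong_AE L2_measurable L2_diff wgrad_L2 u) (auto elim: eventually_mono)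
      moreover have "hnrm (\<lambda>x. u j x - u k x) < e"
        using le_less_trans[OF hn N[OF that]] by (rule power2_less_imp_less) (use e in simp)
      ultimately show ?thesis by simp
    qed
    then show ?thesis by blast
  qed
  then obtain G where G: "L2 G" "(\<lambda>k. nrm (\<lambda>x. wg (u k) x - G x)) \<leadsto> 0"
    using M.L2_complete[of "\<lambda>k. wg (u k)", OF wgrad_L2[OF u(1)]] by auto
  show ?thesis
    by (rule H01_closed(1)[OF u(1) f G(1) _ G(2)]) (use J_tendsto[OF f] in \<open>simp add: u_def n_def\<close>)
qed

text \<open>The reason is the identity n (\<phi> - J n \<phi>) = - J n (\<Delta> \<phi>), together
  with the fact that \<open>J n\<close> preserves bounds. It presupposes that \<phi> lies in H_0^1,
  which is the closure of smooth functions, whereas \<phi> is only C^2. Instead of a mollification,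
  the carre du champ and killing bounds give \<phi> a bounded energy.\<close>

lemma J_C2_bound:
  assumes \<phi>: "\<phi> \<in> C0k 2 \<Lambda>"
  obtains B where "B \<ge> 0" "\<And>n. n > 0 \<Longrightarrow> AE x in M. \<bar>n * (\<phi> x - J n \<phi> x)\<bar> \<le> B"
proof -
  have \<phi>1: "\<phi> \<in> C0k (Suc 0) \<Lambda>" using C0k_le[OF \<phi>] by simp
  have Ck: "Ck 2 \<phi>" "Ck (Suc 0) \<phi>" "compactly_supported_in \<Lambda> \<phi>" using \<phi> \<phi>1 by (auto simp: C0k_def)
  have c: "continuous_on UNIV \<phi>" by (rule Ck_imp_continuous[OF Ck(1)])
  have s: "L2 \<phi>" "L2 (\<lambda>x. (\<phi> x)\<^sup>2)"
    by (intro continuous_L2 continuous_intros c)+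
  obtain L where L: "L \<ge> 0" "\<And>x. \<bar>\<phi> x\<bar> \<le> L" "\<And>x y. \<bar>\<phi> x - \<phi> y\<bar> \<le> L * norm (x - y)"
    using C0k1_bounded[OF \<phi>1] by metis
  obtain K where K: "compact K" "K \<subseteq> \<Lambda>" "\<And>x. x \<notin> K \<Longrightarrow> \<phi> x = 0"
    using compactly_supported_inE[OF Ck(3)] by metis
  obtain R where R: "R \<ge> 0" "\<And>n. n > 0 \<Longrightarrow> AE x in M. x \<in> K \<longrightarrow> n * (1 - J1 n x) \<le> R"
    using J1_killing_bound[OF K(1,2)] by metis
  define \<mu> where "\<mu> = measure M (space M)"
  have "\<phi> \<in> H0"
  proof (rule H01_of_bounded_energy[OF s(1)])
    fix k
    let ?n = "real (Suc k)"
    have n: "?n > 0" by simp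
    note sJ = J_L2[OF s(1) n] J_L2[OF s(2) n] J_L2[OF M.L2_const n, of 1]
    have e1: "ip (J1 ?n) (\<lambda>x. (\<phi> x)\<^sup>2) = ip (\<lambda>x. 1) (J ?n (\<lambda>x. (\<phi> x)\<^sup>2))"
      by (rule J_sym[OF M.L2_const s(2) n])
    have i: "intM (\<lambda>x. (\<phi> x)\<^sup>2 * J1 ?n x)" "intM (\<lambda>x. \<phi> x * J ?n \<phi> x)" "intM (J ?n (\<lambda>x. (\<phi> x)\<^sup>2))"
      "intM (\<lambda>x. (\<phi> x)\<^sup>2)"
      by (intro L2_mult s sJ M.L2_integrable)+
    have "2 * (\<phi> x * J ?n \<phi> x) = 2 * \<phi> x * J ?n \<phi> x" for x by simp
    have carre: "(LINT x|M. J ?n (\<lambda>x. (\<phi> x)\<^sup>2) x - 2 * (\<phi> x * J ?n \<phi> x) + (\<phi> x)\<^sup>2 * J1 ?n x) \<le> (LINT x|M. L\<^sup>2 * (2 * DIM('a) / ?n))"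
    proof (rule integral_mono_AE)
      show "AE x in M. J ?n (\<lambda>x. (\<phi> x)\<^sup>2) x - 2 * (\<phi> x * J ?n \<phi> x) + (\<phi> x)\<^sup>2 * J1 ?n x \<le> L\<^sup>2 * (2 * DIM('a) / ?n)"
        using J_carre_bound[OF n c L(3)] by eventually_elim (simp add: mult.assoc)
    qed (use i in auto)
    have kill: "(LINT x|M. (\<phi> x)\<^sup>2 - (\<phi> x)\<^sup>2 * J1 ?n x) \<le> (LINT x|M. L\<^sup>2 * (R / ?n))"
    proof (rule integral_mono_AE)
      show "AE x in M. (\<phi> x)\<^sup>2 - (\<phi> x)\<^sup>2 * J1 ?n x \<le> L\<^sup>2 * (R / ?n)"
        using R(2)[OF n]
      proof eventually_elim
        case (elim x)
        show ?case
        proof (cases "x \<in> K")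
          case True
          have "1 - J1 ?n x \<le> R / ?n" using elim True n by (simp add: pos_le_divide_eq mult.commute del: of_nat_Suc)
          moreover have "(\<phi> x)\<^sup>2 \<le> L\<^sup>2" using L(2)[of x] by (intro abs_le_square_iff[THEN iffD1]) (use L(1) in auto)
          moreover have "(\<phi> x)\<^sup>2 * (1 - J1 ?n x) \<le> (\<phi> x)\<^sup>2 * (R / ?n)" using calculation by (intro mult_left_mono) auto
          moreover have "(\<phi> x)\<^sup>2 * (R / ?n) \<le> L\<^sup>2 * (R / ?n)" using calculation R(1) n by (intro mult_right_mono) auto
          ultimately show ?thesis by (simp add: right_diff_distrib)
        next
          case False
          then show ?thesis using K(3)[of x] R(1) n by simp
        qed
      qed
    qed (use i in auto)
    have eq: "(LINT x|M. J ?n (\<lambda>x. (\<phi> x)\<^sup>2) x) = (LINT x|M. (\<phi> x)\<^sup>2 * J1 ?n x)"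
      using e1 by (simp add: ip_def mult.commute)
    \<comment> \<open>Twice the pairing is twice the killing part plus the carre du champ part; by
      symmetry the integral of \<open>J ?n\<close> of the square equals that of the square times
      \<open>J1 ?n\<close>.\<close>
    have "2 * ip (\<lambda>x. \<phi> x - J ?n \<phi> x) \<phi> = 2 * (LINT x|M. (\<phi> x)\<^sup>2 - (\<phi> x)\<^sup>2 * J1 ?n x)
       + (LINT x|M. J ?n (\<lambda>x. (\<phi> x)\<^sup>2) x - 2 * (\<phi> x * J ?n \<phi> x) + (\<phi> x)\<^sup>2 * J1 ?n x)"
    proof -
      have "ip (\<lambda>x. \<phi> x - J ?n \<phi> x) \<phi> = ip \<phi> \<phi> - ip \<phi> (J ?n \<phi>)"
        using ip_diff_left[OF s(1) sJ(1) s(1)] by (simp only: ip_commute[of "J ?n \<phi>"])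
      then have e2: "ip (\<lambda>x. \<phi> x - J ?n \<phi> x) \<phi> = (LINT x|M. (\<phi> x)\<^sup>2) - (LINT x|M. \<phi> x * J ?n \<phi> x)"
        by (simp only: ip_def power2_eq_square)
      show ?thesis unfolding e2 using i eq by simp
    qed
    also have "\<dots> \<le> 2 * (\<mu> * (L\<^sup>2 * (R / ?n))) + \<mu> * (L\<^sup>2 * (2 * DIM('a) / ?n))"
      using carre kill by (simp add: \<mu>_def)
    also have "\<dots> = 2 * (\<mu> * L\<^sup>2 * (R + DIM('a)) / ?n)"
      by (simp add: algebra_simps add_divide_distrib del: of_nat_Suc)
    finally show "?n * ip (\<lambda>x. \<phi> x - J ?n \<phi> x) \<phi> \<le> \<mu> * L\<^sup>2 * (R + DIM('a))"
      using n by (simp add: pos_le_divide_eq mult.commute del: of_nat_Suc)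
  qed
  note \<phi>H = this
  have \<phi>g: "AE x in M. wg \<phi> x = gradient \<phi> x" by (rule wgrad_eq[OF weak_gradient_C1[OF Ck(2)]])
  have sg: "L2 (gradient \<phi>)" by (rule continuous_L2[OF Ck1_continuous_gradient[OF Ck(2)]])
  have cl: "continuous_on UNIV (laplacian \<phi>)" by (rule continuous_on_laplacian[OF Ck(1)])
  have sl: "L2 (laplacian \<phi>)" by (rule continuous_L2[OF cl])
  obtain B where B: "B \<ge> 0" "\<And>x. x \<in> \<Lambda> \<Longrightarrow> norm (laplacian \<phi> x) \<le> B"
    using continuous_bounded_M[OF cl] by metis
  \<comment> \<open>Integration by parts against test functions, extended to H_0^1 by
    density.\<close>
  have en\<phi>: "en v \<phi> = - ip v (laplacian \<phi>)" if v: "v \<in> H0" for v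
  proof -
    obtain \<psi> where \<psi>: "\<And>n. \<psi> n \<in> C0inf \<Lambda>" "(\<lambda>n. nrm (\<lambda>x. \<psi> n x - v x)) \<leadsto> 0"
      "(\<lambda>n. nrm (\<lambda>x. gradient (\<psi> n) x - wg v x)) \<leadsto> 0" using H01_approx[OF v] by blast
    have "(\<lambda>n. LINT x|M. gradient (\<psi> n) x \<bullet> gradient \<phi> x) \<leadsto> (LINT x|M. wg v x \<bullet> gradient \<phi> x)"
      by (rule L2_tendsto_inner[OF C0inf_gradient_L2[OF \<psi>(1)] wgrad_L2[OF v] sg \<psi>(3)])
    moreover have "(LINT x|M. wg v x \<bullet> gradient \<phi> x) = en v \<phi>"
      by (rule en_wgrad_eq[OF v \<phi>H sg \<phi>g, symmetric])
    moreover have "(LINT x|M. gradient (\<psi> n) x \<bullet> gradient \<phi> x) = - (LINT x|M. \<psi> n x \<bullet> laplacian \<phi> x)" for n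
      using laplacian_integration_by_parts(3)[OF open_\<Lambda> Ck(1) C0inf_C0k[OF \<psi>(1)], of n]
      by (simp add: inner_commute mult.commute)
    moreover have "(\<lambda>n. - (LINT x|M. \<psi> n x \<bullet> laplacian \<phi> x)) \<leadsto> - (LINT x|M. v x \<bullet> laplacian \<phi> x)"
      by (intro tendsto_minus L2_tendsto_inner[OF C0inf_L2[OF \<psi>(1)] H01_L2[OF v] sl \<psi>(2)])
    ultimately show ?thesis using LIMSEQ_unique by (fastforce simp: ip_def)
  qed
  have "AE x in M. \<bar>n * (\<phi> x - J n \<phi> x)\<bar> \<le> B" if n: "n > 0" for n
  proof -
    have sl': "L2 (\<lambda>x. (1/n) * laplacian \<phi> x)" by (rule L2_cmult[OF sl])
    have "AE x in M. J n (\<lambda>x. \<phi> x - (1/n) * laplacian \<phi> x) x = \<phi> x"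
    proof (rule J_unique[OF L2_diff[OF s(1) sl'] n \<phi>H])
      fix v assume v: "v \<in> H0"
      have "ip (\<lambda>x. \<phi> x - (1/n) * laplacian \<phi> x) v = ip \<phi> v - (1/n) * ip (laplacian \<phi>) v"
        by (simp only: ip_diff_left[OF s(1) sl' H01_L2[OF v]] ip_cmult_left)
      moreover have "en \<phi> v = - ip (laplacian \<phi>) v"
        using en\<phi>[OF v] by (simp only: en_commute[of \<phi>] ip_commute[of v])
      ultimately show "en \<phi> v + n * ip \<phi> v = n * ip (\<lambda>x. \<phi> x - (1/n) * laplacian \<phi> x) v"
        using n by (simp add: right_diff_distrib)
    qed
    moreover have "AE x in M. \<bar>J n (laplacian \<phi>) x\<bar> \<le> B"
      by (rule J_bounded[OF sl n _ B(1)]) (use B(2) in auto)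
    ultimately have "AE x in M. J n \<phi> x - (1/n) * J n (laplacian \<phi>) x = \<phi> x \<and> \<bar>J n (laplacian \<phi>) x\<bar> \<le> B"
      using J_diff[OF s(1) sl' n] J_cmult[OF sl n, of "1/n"] by eventually_elim simp
    then show ?thesis
    proof eventually_elim
      case (elim x)
      then have "\<phi> x - J n \<phi> x = - (1/n) * J n (laplacian \<phi>) x" by simp
      then have "n * (\<phi> x - J n \<phi> x) = - J n (laplacian \<phi>) x" using n by simp
      with elim show ?case by simp
    qed
  qed
  with B(1) show ?thesis using that by blast
qed

text \<open>With A the norm of f - J n f and B that of J n f, the form is n A^2 plus the energy of J
  n f, hence at least n A^2 + lam B^2. The constant is the minimum of this expression under A + B =
  1.\<close>

lemma spectral_gap:
  assumes f: "L2 f" and n: "n > 0"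
  shows "n * lam / (n + lam) * (nrm f)\<^sup>2 \<le> n * ip f (\<lambda>x. f x - J n f x)"
proof -
  define w where "w = J n f"
  have w: "w \<in> H0" "L2 w" unfolding w_def by (auto intro: J_H01 J_L2 f n)
  note sd = L2_diff[OF f w(2)]
  define A B where "A = nrm (\<lambda>x. f x - w x)" and "B = nrm w"
  have AB: "A \<ge> 0" "B \<ge> 0" by (auto simp: A_def B_def)
  have l: "n + lam > 0" using n lam_pos by simp
  have "nrm f \<le> A + B" using L2norm_triangle[OF sd w(2)] by (simp add: A_def B_def)
  then have "(nrm f)\<^sup>2 \<le> (A + B)\<^sup>2" by (intro power_mono) auto
  then have "n * lam / (n + lam) * (nrm f)\<^sup>2 \<le> n * lam / (n + lam) * (A + B)\<^sup>2"
    using n lam_pos by (intro mult_left_mono) auto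
  also have "\<dots> \<le> n * A\<^sup>2 + lam * B\<^sup>2"
  proof -
    have "n * lam * (A + B)\<^sup>2 \<le> (n * A\<^sup>2 + lam * B\<^sup>2) * (n + lam)"
      using zero_le_power2[of "n * A - lam * B"] by (simp add: power2_eq_square algebra_simps)
    then show ?thesis using l by (simp add: pos_divide_le_eq)
  qed
  also have "\<dots> \<le> n * A\<^sup>2 + en w w" using poincare_H01[OF w(1)] by (simp add: B_def)
  also have "en w w = n * ip (\<lambda>x. f x - w x) w" using J_energy[OF f n] by (simp add: w_def)
  also have "n * A\<^sup>2 + n * ip (\<lambda>x. f x - w x) w = n * ip f (\<lambda>x. f x - w x)"
  proof -
    have "ip f (\<lambda>x. f x - w x) = ip (\<lambda>x. (f x - w x) + w x) (\<lambda>x. f x - w x)" by simp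
    also have "\<dots> = ip (\<lambda>x. f x - w x) (\<lambda>x. f x - w x) + ip w (\<lambda>x. f x - w x)"
      by (rule ip_add_left[OF sd w(2) sd])
    also have "\<dots> = A\<^sup>2 + ip (\<lambda>x. f x - w x) w" by (simp add: ip_self A_def ip_commute[of w])
    finally show ?thesis by (simp add: distrib_left)
  qed
  finally show ?thesis unfolding w_def .
qed

end

section \<open>Dissipativity of the regularised nonlinearity\<close>

text \<open>Beyond the threshold \<open>R\<close>, where |y|^{p-1} equals 1 / d, the higher power
  dominates; below it the square is bounded. For p > 1 this allows every \<alpha>.\<close>

lemma sq_le_powr:
  assumes "p > 1" "d > 0"
  shows "\<exists>K\<ge>0. \<forall>y::real. y\<^sup>2 \<le> d * \<bar>y\<bar> powr (p + 1) + K"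
proof -
  define R where "R = (1 / d) powr (1 / (p - 1))"
  have R: "R > 0" "R powr (p - 1) = 1 / d" using assms by (auto simp: R_def powr_powr)
  have "y\<^sup>2 \<le> d * \<bar>y\<bar> powr (p + 1) + R\<^sup>2" for y :: real
  proof (cases "\<bar>y\<bar> \<le> R")
    case True
    then have "y\<^sup>2 \<le> R\<^sup>2" using R by (simp add: abs_le_square_iff[symmetric])
    then show ?thesis using assms by (simp add: add_increasing)
  next
    case False
    then have y: "\<bar>y\<bar> > 0" "R \<le> \<bar>y\<bar>" using R by auto
    have "1 / d \<le> \<bar>y\<bar> powr (p - 1)" unfolding R(2)[symmetric] using y R assms by (intro powr_mono2) auto
    then have "y\<^sup>2 * 1 \<le> y\<^sup>2 * (d * \<bar>y\<bar> powr (p - 1))"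
      using assms by (intro mult_left_mono) (auto simp: field_simps)
    also have "y\<^sup>2 * (d * \<bar>y\<bar> powr (p - 1)) = d * \<bar>y\<bar> powr (p + 1)"
    proof -
      have "2 + (p - 1) = p + 1" by simp
      with powr_add[of "\<bar>y\<bar>" 2 "p - 1"]
      have "\<bar>y\<bar> powr (p + 1) = \<bar>y\<bar> powr 2 * \<bar>y\<bar> powr (p - 1)" by metis
      moreover have "\<bar>y\<bar> powr 2 = y\<^sup>2" using y by simp
      ultimately show ?thesis by simp
    qed
    finally have "y\<^sup>2 \<le> d * \<bar>y\<bar> powr (p + 1)" using y by simp
    then show ?thesis by (rule order_trans) simp
  qed
  then show ?thesis by (intro exI[of _ "R\<^sup>2"]) auto
qed

text \<open>Real powers of the noise are replaced by integer powers of 1 + m^2, which are easily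
  seen to be continuous along a path and of polynomial growth.\<close>

lemma powr_le_one_plus_sq:
  assumes "0 \<le> m" "0 \<le> q" "q \<le> real k"
  shows "m powr q \<le> (1 + m\<^sup>2) ^ k"
proof -
  have "m \<le> 1 + m\<^sup>2" using zero_le_power2[of "m - 1"] assms(1) by (simp add: power2_eq_square algebra_simps)
  then have "m powr q \<le> (1 + m\<^sup>2) powr q" using assms by (intro powr_mono2) auto
  also have "\<dots> \<le> (1 + m\<^sup>2) powr real k" using assms by (intro powr_mono) auto
  also have "\<dots> = (1 + m\<^sup>2) ^ k" by (rule powr_realpow) (simp add: add_pos_nonneg)
  finally show ?thesis .
qed

text \<open>The crude Young inequality at the squares of a and b, with exponent (q + 1) / 2.\<close>

lemma young_crude_sq:
  fixes a b q d :: real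
  assumes "0 \<le> a" "0 \<le> b" "q \<ge> 1" "d > 0"
  shows "a powr (q - 1) * b\<^sup>2 \<le> d * a powr (q + 1) + d powr ((1 - q) / 2) * b powr (q + 1)"
proof -
  have sq: "(x\<^sup>2) powr r = x powr (2 * r)" if "x \<ge> 0" for x r :: real
    using that powr_powr[of x 2 r] by simp
  have "(a\<^sup>2) powr ((q + 1) / 2 - 1) * b\<^sup>2 \<le> d * (a\<^sup>2) powr ((q + 1) / 2) + d powr (1 - (q + 1) / 2) * (b\<^sup>2) powr ((q + 1) / 2)"
    using assms by (intro young_crude) auto
  moreover have "2 * ((q + 1) / 2 - 1) = q - 1" "2 * ((q + 1) / 2) = q + 1" "1 - (q + 1) / 2 = (1 - q) / 2"
    by (auto simp: field_simps)
  ultimately show ?thesis using assms by (simp only: sq)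
qed

lemma one_plus_powr_le:
  assumes "q \<ge> 0" "y \<ge> (0::real)"
  shows "(1 + y) powr q \<le> 2 powr q * (1 + y powr q)"
proof -
  have "(1 + y) powr q \<le> (2 * max 1 y) powr q" using assms by (intro powr_mono2) auto
  also have "\<dots> = 2 powr q * (max 1 y) powr q" using assms by (simp add: powr_mult)
  also have "(max 1 y) powr q \<le> 1 + y powr q" by (auto simp: max_def)
  finally show ?thesis by (simp add: mult_left_mono)
qed

text \<open>The common frame of the two hypotheses: a root \<open>\<zeta>\<close> whose squared
  increments are dominated through those of \<open>\<Phi>\<close>. The kernel argument needs it to
  be continuous, which is derived from the continuity of \<open>\<Phi>\<close> when the frame is
  instantiated.\<close>

locale porous = bounded_domain +
  fixes p a c c1 c2 :: real and \<Phi> \<zeta> :: "real \<Rightarrow> real"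
  assumes p1: "1 \<le> p" and a_pos: "0 < a" and c_nonneg: "0 \<le> c" "0 \<le> c1" "0 \<le> c2"
    and \<Phi>_cont: "continuous_on UNIV \<Phi>" and \<Phi>_0: "\<Phi> 0 = 0"
    and \<Phi>_growth: "\<bar>\<Phi> s\<bar> \<le> c1 * \<bar>s\<bar> powr p + c2"
    and \<zeta>_cont: "continuous_on UNIV \<zeta>" and \<zeta>_0: "\<zeta> 0 = 0"
    and \<zeta>_diff: "(\<zeta> t - \<zeta> s)\<^sup>2 \<le> (\<Phi> t - \<Phi> s) * (t - s)"
    and \<zeta>_coercive: "a * \<bar>s\<bar> powr (p + 1) - c \<le> (\<zeta> s)\<^sup>2"
begin

abbreviation "Lp \<equiv> Lp_integrable (p + 1)"
text \<open>\<open>\<zeta>E\<close> is the approximate Dirichlet energy of \<zeta>(Y). In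
  \<open>\<Phi>E\<close> the difference \<open>Y - g\<close> is the solution with the noise removed,
  so this is the term that the equation produces; the dissipation estimates bound it from below
  through \<open>\<zeta>E\<close>.\<close>

abbreviation "\<zeta>E n Y \<equiv> n * ip (\<lambda>x. \<zeta> (Y x)) (\<lambda>x. \<zeta> (Y x) - J n (\<lambda>x. \<zeta> (Y x)) x)"
abbreviation "\<Phi>E n Y g \<equiv> n * ip (\<lambda>x. \<Phi> (Y x)) (\<lambda>x. (Y x - g x) - J n (\<lambda>x. Y x - g x) x)"

text \<open>Young's inequality on both summands of the growth bound; the free factor d stays with
  the power of y, and the price falls on the test function v.\<close>

lemma growth_young:
  assumes "d > 0"
  shows "(c1 * \<bar>y\<bar> powr p + c2) * \<bar>v\<bar> \<le> (c1 + c2) * (d * (1 + \<bar>y\<bar> powr (p + 1)) + d powr (- p) * \<bar>v\<bar> powr (p + 1))"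
proof -
  let ?r = "d powr (- p) * \<bar>v\<bar> powr (p + 1)"
  have 1: "\<bar>y\<bar> powr p * \<bar>v\<bar> \<le> d * \<bar>y\<bar> powr (p + 1) + ?r"
    using young_crude[of "\<bar>y\<bar>" "\<bar>v\<bar>" "p + 1" d] p1 assms by simp
  have 2: "\<bar>v\<bar> \<le> d + ?r" using young_crude[of 1 "\<bar>v\<bar>" "p + 1" d] p1 assms by simp
  have "(c1 * \<bar>y\<bar> powr p + c2) * \<bar>v\<bar> = c1 * (\<bar>y\<bar> powr p * \<bar>v\<bar>) + c2 * \<bar>v\<bar>" by (simp add: algebra_simps)
  also have "\<dots> \<le> c1 * (d * \<bar>y\<bar> powr (p + 1) + ?r) + c2 * (d + ?r)"
    using c_nonneg 1 2 by (intro add_mono mult_left_mono) auto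
  also have "\<dots> \<le> (c1 + c2) * (d * (1 + \<bar>y\<bar> powr (p + 1)) + ?r)"
    using c_nonneg assms by (simp add: algebra_simps)
  finally show ?thesis .
qed

lemma \<Phi>_young:
  assumes "d > 0"
  shows "\<bar>\<Phi> y\<bar> * \<bar>v\<bar> \<le> (c1 + c2) * (d * (1 + \<bar>y\<bar> powr (p + 1)) + d powr (- p) * \<bar>v\<bar> powr (p + 1))"
  by (rule order_trans[OF mult_right_mono[OF \<Phi>_growth] growth_young[OF assms]]) simp

text \<open>A pointwise inequality between two points is integrated against the kernel of
  \<open>J n\<close>. The diagonal terms acquire the factor \<open>J1 n\<close>; writing it as 1
  minus the killing part produces the killing term and the forms of the statement. The parameter
  \<open>r\<close> decides whether the noise \<open>g\<close> stays inside the test function, and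
  \<open>C * h\<close> weighs its squared increments.\<close>

lemma kernel_estimate:
  assumes n: "n > 0" and Y: "Y \<in> BM" "bounded (Y ` \<Lambda>)"
    and g: "g \<in> BM" "bounded (g ` \<Lambda>)" and h: "continuous_on UNIV h"
    and pos: "\<And>s t x y. 0 \<le> (\<Phi> s - \<Phi> t) * ((s - r * x) - (t - r * y)) - \<theta> * (\<zeta> s - \<zeta> t)\<^sup>2 + C * ((h s + h t) * (x - y)\<^sup>2)"
  shows "ip (\<lambda>x. \<Phi> (Y x) * (Y x - r * g x) - \<theta> * (\<zeta> (Y x))\<^sup>2) (\<lambda>x. 1 - J1 n x)
     + \<theta> * ip (\<lambda>x. \<zeta> (Y x)) (\<lambda>x. \<zeta> (Y x) - J n (\<lambda>x. \<zeta> (Y x)) x)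
     - C * ip (\<lambda>x. h (Y x)) (\<lambda>x. J n (\<lambda>x. (g x)\<^sup>2) x - 2 * g x * J n g x + (g x)\<^sup>2 * J1 n x)
    \<le> ip (\<lambda>x. \<Phi> (Y x)) (\<lambda>x. (Y x - r * g x) - J n (\<lambda>x. Y x - r * g x) x)"
proof -
  define U where "U = (\<lambda>x. (Y x, g x))"
  have Um: "U \<in> BM" unfolding U_def using Y g by measurable
  have Ub: "bounded (U ` \<Lambda>)"
    by (rule bounded_subset[OF bounded_Times[OF Y(2) g(2)]]) (auto simp: U_def)
  define A where "A = (\<lambda>\<alpha>::real\<times>real. \<Phi> (fst \<alpha>) * (fst \<alpha> - r * snd \<alpha>) - \<theta> * (\<zeta> (fst \<alpha>))\<^sup>2)"
  define D where "D = (\<lambda>\<alpha>::real\<times>real. h (fst \<alpha>) * (snd \<alpha>)\<^sup>2)"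
  \<comment> \<open>Expanding the inequality at (s, x) and (t, y) gives nine products: two for the
    diagonal part \<open>A + C * D\<close>, two for \<open>\<Phi>\<close>, one for
    \<open>\<zeta>\<close> and four for the weighted increments of the noise.\<close>
  define as where "as = [\<lambda>\<alpha>. A \<alpha> + C * D \<alpha>, \<lambda>\<alpha>. 1, \<lambda>\<alpha>. (- 1) * \<Phi> (fst \<alpha>), \<lambda>\<alpha>. (- 1) * (fst \<alpha> - r * snd \<alpha>),
    \<lambda>\<alpha>. (2 * \<theta>) * \<zeta> (fst \<alpha>), \<lambda>\<alpha>. (- 2 * C) * (h (fst \<alpha>) * snd \<alpha>), \<lambda>\<alpha>. (- 2 * C) * snd \<alpha>, \<lambda>\<alpha>. C * h (fst \<alpha>), \<lambda>\<alpha>. C * (snd \<alpha>)\<^sup>2]"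
  define bs where "bs = [\<lambda>\<beta>. 1, \<lambda>\<beta>. A \<beta> + C * D \<beta>, \<lambda>\<beta>. fst \<beta> - r * snd \<beta>, \<lambda>\<beta>. \<Phi> (fst \<beta>),
    \<lambda>\<beta>::real\<times>real. \<zeta> (fst \<beta>), \<lambda>\<beta>. snd \<beta>, \<lambda>\<beta>. h (fst \<beta>) * snd \<beta>, \<lambda>\<beta>. (snd \<beta>)\<^sup>2, \<lambda>\<beta>. h (fst \<beta>)]"
  have cf: "continuous_on UNIV (\<lambda>\<alpha>::real\<times>real. \<Phi> (fst \<alpha>))" "continuous_on UNIV (\<lambda>\<alpha>::real\<times>real. \<zeta> (fst \<alpha>))"
    "continuous_on UNIV (\<lambda>\<alpha>::real\<times>real. h (fst \<alpha>))"
    by (auto intro!: continuous_on_compose2[OF \<Phi>_cont] continuous_on_compose2[OF \<zeta>_cont] continuous_on_compose2[OF h] continuous_intros)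
  have cA: "continuous_on UNIV A" "continuous_on UNIV D" unfolding A_def D_def by (intro continuous_intros cf)+
  have cz: "continuous_on UNIV (\<lambda>\<alpha>::real\<times>real. fst \<alpha> - r * snd \<alpha>)"
    "continuous_on UNIV (\<lambda>\<alpha>::real\<times>real. h (fst \<alpha>) * snd \<alpha>)"
    "continuous_on UNIV (\<lambda>\<alpha>::real\<times>real. (snd \<alpha>)\<^sup>2)"
    "continuous_on UNIV (\<lambda>\<alpha>::real\<times>real. snd \<alpha>)"
    by (intro continuous_intros cf)+
  have set9: "{..<9::nat} = {0,1,2,3,4,5,6,7,8}" by auto
  have ca: "continuous_on UNIV (as ! i)" "continuous_on UNIV (bs ! i)" if "i \<in> {..<9}" for i
    using that unfolding set9 as_def bs_def by (auto intro!: continuous_intros cf cA)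
  have "0 \<le> (\<Sum>i\<in>{..<9}. ip (\<lambda>x. (as ! i) (U x)) (J n (\<lambda>x. (bs ! i) (U x))))"
  proof (rule kernel_positive[OF n _ ca Um Ub])
    fix \<alpha> \<beta> :: "real \<times> real"
    have "(\<Sum>i\<in>{..<9}. (as ! i) \<alpha> * (bs ! i) \<beta>) = (\<Phi> (fst \<alpha>) - \<Phi> (fst \<beta>)) * ((fst \<alpha> - r * snd \<alpha>) - (fst \<beta> - r * snd \<beta>))
       - \<theta> * (\<zeta> (fst \<alpha>) - \<zeta> (fst \<beta>))\<^sup>2 + C * ((h (fst \<alpha>) + h (fst \<beta>)) * (snd \<alpha> - snd \<beta>)\<^sup>2)"
      unfolding set9 as_def bs_def A_def D_def by (simp add: power2_eq_square algebra_simps)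
    then show "0 \<le> (\<Sum>i\<in>{..<9}. (as ! i) \<alpha> * (bs ! i) \<beta>)" using pos by simp
  qed auto
  note sqU = bounded_comp(1)[OF _ Um Ub]
  define A' where "A' = (\<lambda>x. A (U x))" define D' where "D' = (\<lambda>x. D (U x))"
  define f where "f = (\<lambda>x. \<Phi> (Y x))" define z where "z = (\<lambda>x. Y x - r * g x)"
  define e where "e = (\<lambda>x. \<zeta> (Y x))" define h' where "h' = (\<lambda>x. h (Y x))"
  define hg where "hg = (\<lambda>x. h (Y x) * g x)" define g2 where "g2 = (\<lambda>x. (g x)\<^sup>2)"
  have s: "L2 A'" "L2 D'" "L2 f" "L2 z" "L2 e"
    "L2 h'" "L2 hg" "L2 g2" "L2 g"
    using sqU[OF cA(1)] sqU[OF cA(2)] sqU[OF cf(1)] sqU[OF cz(1)] sqU[OF cf(2)]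
      sqU[OF cf(3)] sqU[OF cz(2)] sqU[OF cz(3)] sqU[OF cz(4)]
    unfolding A'_def D'_def f_def z_def e_def h'_def hg_def g2_def U_def by simp_all
  have s1: "L2 (\<lambda>x. 1::real)" by (rule M.L2_const)
  note sJ = J_L2[OF s1 n] s[THEN J_L2, OF n]
  have sAD: "L2 (\<lambda>x. A' x + C * D' x)" by (intro L2_add L2_cmult s)
  have "0 \<le> ip (\<lambda>x. A' x + C * D' x) (J1 n) + ip (\<lambda>x. 1) (J n (\<lambda>x. A' x + C * D' x)) + ip (\<lambda>x. (- 1) * f x) (J n z)
     + ip (\<lambda>x. (- 1) * z x) (J n f) + ip (\<lambda>x. (2 * \<theta>) * e x) (J n e) + ip (\<lambda>x. (- 2 * C) * hg x) (J n g)
     + ip (\<lambda>x. (- 2 * C) * g x) (J n hg) + ip (\<lambda>x. C * h' x) (J n g2) + ip (\<lambda>x. C * g2 x) (J n h')"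
    using \<open>0 \<le> (\<Sum>i\<in>{..<9}. ip (\<lambda>x. (as ! i) (U x)) (J n (\<lambda>x. (bs ! i) (U x))))\<close>
    unfolding set9 as_def bs_def
    by (simp add: A'_def D'_def f_def z_def e_def h'_def hg_def g2_def U_def add.assoc)
  \<comment> \<open>Symmetry of \<open>J n\<close> identifies the mirrored products, so a common
    factor 2 can be removed.\<close>
  also have "\<dots> = 2 * ip (\<lambda>x. A' x + C * D' x) (J1 n) - 2 * ip f (J n z) + 2 * \<theta> * ip e (J n e) - 4 * C * ip hg (J n g) + 2 * C * ip h' (J n g2)"
  proof -
    have sy: "ip (\<lambda>x. 1) (J n (\<lambda>x. A' x + C * D' x)) = ip (\<lambda>x. A' x + C * D' x) (J1 n)"
      using J_sym[OF s1 sAD n] by (simp only: ip_commute[of "J1 n"])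
    have sy2: "ip z (J n f) = ip f (J n z)" using J_sym[OF s(4,3) n] by (simp only: ip_commute[of "J n z"])
    have sy3: "ip g (J n hg) = ip hg (J n g)" using J_sym[OF s(9,7) n] by (simp only: ip_commute[of "J n g"])
    have sy4: "ip g2 (J n h') = ip h' (J n g2)" using J_sym[OF s(8,6) n] by (simp only: ip_commute[of "J n g2"])
    show ?thesis unfolding sy ip_cmult_left sy2 sy3 sy4 by (simp add: algebra_simps)
  qed
  also have "ip (\<lambda>x. A' x + C * D' x) (J1 n) = ip A' (J1 n) + C * ip D' (J1 n)"
    by (simp only: ip_add_left[OF s(1) L2_cmult[OF s(2)] sJ(1)] ip_cmult_left)
  finally have main: "0 \<le> ip A' (J1 n) + C * ip D' (J1 n) - ip f (J n z) + \<theta> * ip e (J n e) - 2 * C * ip hg (J n g) + C * ip h' (J n g2)"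
    by (simp add: algebra_simps)
  have 1: "ip A' (\<lambda>x. 1 - J1 n x) = ip f z - \<theta> * ip e e - ip A' (J1 n)"
  proof -
    have "ip A' (\<lambda>x. 1 - J1 n x) = ip A' (\<lambda>x. 1) - ip A' (J1 n)" by (rule ip_diff_right[OF s1 sJ(1) s(1)])
    also have "ip A' (\<lambda>x. 1) = (LINT x|M. f x * z x - \<theta> * (e x * e x))"
      by (simp add: ip_def A'_def A_def U_def f_def z_def e_def power2_eq_square)
    also have "\<dots> = ip f z - \<theta> * ip e e"
      unfolding ip_def using L2_mult[OF s(3,4)] L2_mult[OF s(5,5)] by simp
    finally show ?thesis .
  qed
  have 2: "ip e (\<lambda>x. e x - J n e x) = ip e e - ip e (J n e)" by (rule ip_diff_right[OF s(5) sJ(6) s(5)])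
  have 3: "ip h' (\<lambda>x. J n g2 x - 2 * g x * J n g x + (g x)\<^sup>2 * J1 n x) = ip h' (J n g2) - 2 * ip hg (J n g) + ip D' (J1 n)"
  proof -
    have "ip h' (\<lambda>x. J n g2 x - 2 * g x * J n g x + (g x)\<^sup>2 * J1 n x)
      = (LINT x|M. (h' x * J n g2 x - 2 * (hg x * J n g x)) + D' x * J1 n x)"
      by (simp add: ip_def h'_def hg_def D'_def D_def U_def algebra_simps)
    also have "\<dots> = ip h' (J n g2) - 2 * ip hg (J n g) + ip D' (J1 n)"
      unfolding ip_def using L2_mult[OF s(6) sJ(9)] L2_mult[OF s(7) sJ(10)] L2_mult[OF s(2) sJ(1)] by simp
    finally show ?thesis .
  qed
  have 4: "ip f (\<lambda>x. z x - J n z x) = ip f z - ip f (J n z)" by (rule ip_diff_right[OF s(4) sJ(5) s(3)])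
  have goal: "ip A' (\<lambda>x. 1 - J1 n x) + \<theta> * ip e (\<lambda>x. e x - J n e x) - C * ip h' (\<lambda>x. J n g2 x - 2 * g x * J n g x + (g x)\<^sup>2 * J1 n x)
     \<le> ip f (\<lambda>x. z x - J n z x)"
    unfolding 1 2 3 4 using main by (simp add: algebra_simps)
  then show ?thesis
    by (simp add: A'_def A_def U_def e_def h'_def g2_def f_def z_def)
qed

lemma measurable_comp_\<Phi>\<zeta>:
  assumes "Y \<in> BM"
  shows "(\<lambda>x. \<Phi> (Y x)) \<in> BM" "(\<lambda>x. \<zeta> (Y x)) \<in> BM"
  using measurable_compose[OF assms borel_measurable_continuous_onI[OF \<Phi>_cont]]
    measurable_compose[OF assms borel_measurable_continuous_onI[OF \<zeta>_cont]] by auto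

text \<open>The kernel inequality is used without noise; its killing term is nonnegative by the root
  inequality between \<open>Y\<close> and 0. The noise is split off by linearity and costs at most
  \<open>m\<close> times the integral of |\<Phi>(Y)|, by the bound on \<open>n * (g - J n g)\<close>
  that C^2 noise provides.\<close>

lemma key_I:
  assumes n: "n > 0" and Y: "Y \<in> BM" "bounded (Y ` \<Lambda>)"
    and g: "L2 g" and m: "AE x in M. \<bar>n * (g x - J n g x)\<bar> \<le> m"
  shows "\<zeta>E n Y - (LINT x|M. m * \<bar>\<Phi> (Y x)\<bar>)
    \<le> \<Phi>E n Y g"
proof -
  have "ip (\<lambda>x. \<Phi> (Y x) * (Y x - 0 * 0) - 1 * (\<zeta> (Y x))\<^sup>2) (\<lambda>x. 1 - J1 n x)
     + 1 * ip (\<lambda>x. \<zeta> (Y x)) (\<lambda>x. \<zeta> (Y x) - J n (\<lambda>x. \<zeta> (Y x)) x)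
     - 0 * ip (\<lambda>x. 0) (\<lambda>x. J n (\<lambda>x. 0\<^sup>2) x - 2 * 0 * J n (\<lambda>x. 0) x + 0\<^sup>2 * J1 n x)
    \<le> ip (\<lambda>x. \<Phi> (Y x)) (\<lambda>x. (Y x - 0 * 0) - J n (\<lambda>x. Y x - 0 * 0) x)"
    by (rule kernel_estimate[OF n Y, where h = "\<lambda>_. 0"]) (use \<zeta>_diff in \<open>auto simp: image_constant_conv\<close>)
  then have 1: "ip (\<lambda>x. \<Phi> (Y x) * Y x - (\<zeta> (Y x))\<^sup>2) (\<lambda>x. 1 - J1 n x)
     + ip (\<lambda>x. \<zeta> (Y x)) (\<lambda>x. \<zeta> (Y x) - J n (\<lambda>x. \<zeta> (Y x)) x)
    \<le> ip (\<lambda>x. \<Phi> (Y x)) (\<lambda>x. Y x - J n Y x)" by simp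
  have 2: "0 \<le> ip (\<lambda>x. \<Phi> (Y x) * Y x - (\<zeta> (Y x))\<^sup>2) (\<lambda>x. 1 - J1 n x)"
    unfolding ip_def
  proof (rule integral_nonneg_AE)
    show "AE x in M. 0 \<le> (\<Phi> (Y x) * Y x - (\<zeta> (Y x))\<^sup>2) * (1 - J1 n x)"
      using J1_bounds[OF n]
    proof eventually_elim
      case (elim x)
      show ?case using elim \<zeta>_diff[of "Y x" 0] \<Phi>_0 \<zeta>_0 by (intro mult_nonneg_nonneg) auto
    qed
  qed
  note sY = bounded_comp(1)[OF continuous_on_id Y] and s\<Phi> = bounded_comp(1)[OF \<Phi>_cont Y]
  have sY: "L2 Y" using sY by simp
  note sJ = J_L2[OF sY n] J_L2[OF g n]
  have 3: "ip (\<lambda>x. \<Phi> (Y x)) (\<lambda>x. (Y x - g x) - J n (\<lambda>x. Y x - g x) x)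
    = ip (\<lambda>x. \<Phi> (Y x)) (\<lambda>x. Y x - J n Y x) - ip (\<lambda>x. \<Phi> (Y x)) (\<lambda>x. g x - J n g x)"
  proof -
    have "ip (\<lambda>x. \<Phi> (Y x)) (\<lambda>x. (Y x - g x) - J n (\<lambda>x. Y x - g x) x)
      = ip (\<lambda>x. \<Phi> (Y x)) (\<lambda>x. (Y x - J n Y x) - (g x - J n g x))"
      unfolding ip_def
    proof (rule integral_cong_AE)
      show "AE x in M. \<Phi> (Y x) * ((Y x - g x) - J n (\<lambda>x. Y x - g x) x) = \<Phi> (Y x) * ((Y x - J n Y x) - (g x - J n g x))"
        using J_diff[OF sY g n] by eventually_elim simp
    qed (intro borel_measurable_times borel_measurable_diff measurable_comp_\<Phi>\<zeta> Y(1) L2_measurable g sJ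
        J_L2[OF L2_diff[OF sY g] n])+
    also have "\<dots> = ip (\<lambda>x. \<Phi> (Y x)) (\<lambda>x. Y x - J n Y x) - ip (\<lambda>x. \<Phi> (Y x)) (\<lambda>x. g x - J n g x)"
      by (intro ip_diff_right L2_diff sY g sJ s\<Phi>)
    finally show ?thesis .
  qed
  have 4: "n * ip (\<lambda>x. \<Phi> (Y x)) (\<lambda>x. g x - J n g x) \<le> (LINT x|M. m * \<bar>\<Phi> (Y x)\<bar>)"
  proof -
    have "n * ip (\<lambda>x. \<Phi> (Y x)) (\<lambda>x. g x - J n g x) = (LINT x|M. n * (\<Phi> (Y x) * (g x - J n g x)))"
      by (simp add: ip_def)
    also have "\<dots> \<le> (LINT x|M. m * \<bar>\<Phi> (Y x)\<bar>)"
    proof (rule integral_mono_AE)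
      show "intM (\<lambda>x. n * (\<Phi> (Y x) * (g x - J n g x)))"
        by (intro integrable_mult_right L2_mult s\<Phi> L2_diff g sJ)
      show "intM (\<lambda>x. m * \<bar>\<Phi> (Y x)\<bar>)"
        by (intro integrable_mult_right M.L2_integrable L2_abs s\<Phi>)
      show "AE x in M. n * (\<Phi> (Y x) * (g x - J n g x)) \<le> m * \<bar>\<Phi> (Y x)\<bar>"
        using m
      proof eventually_elim
        case (elim x)
        have "n * (\<Phi> (Y x) * (g x - J n g x)) \<le> \<bar>\<Phi> (Y x) * (n * (g x - J n g x))\<bar>" by (simp add: mult.left_commute)
        also have "\<dots> = \<bar>\<Phi> (Y x)\<bar> * \<bar>n * (g x - J n g x)\<bar>" by (rule abs_mult)
        also have "\<dots> \<le> \<bar>\<Phi> (Y x)\<bar> * m" by (intro mult_left_mono elim) simp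
        finally show ?case by (simp add: mult.commute)
      qed
    qed
    finally show ?thesis .
  qed
  have "\<zeta>E n Y \<le> n * ip (\<lambda>x. \<Phi> (Y x)) (\<lambda>x. Y x - J n Y x)"
    using 1 2 n by (intro mult_left_mono) auto
  then show ?thesis unfolding 3 using 4 by (simp add: right_diff_distrib)
qed

text \<open>For C^1 noise no uniform bound on \<open>n * (g - J n g)\<close> is at hand, so
  \<open>g\<close> stays inside the kernel. The mixed term is absorbed by a quarter of the
  \<zeta>-energy, which leaves 3/4. The remainder, weighted by \<open>H\<close>, consists of squared
  increments of \<open>g\<close>, controlled by the Lipschitz bound, and of \<open>g\<close> times
  the killing part, controlled on \<open>K\<close>.\<close>

lemma key_II:
  assumes n: "n > 0" and Y: "Y \<in> BM" "bounded (Y ` \<Lambda>)"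
    and H: "continuous_on UNIV H" "\<And>s. 0 \<le> H s" "\<And>s t. (\<Phi> s - \<Phi> t)\<^sup>2 \<le> (H s + H t) * (\<zeta> s - \<zeta> t)\<^sup>2"
    and g: "continuous_on UNIV g" "\<And>x. \<bar>g x\<bar> \<le> m" "\<And>x y. \<bar>g x - g y\<bar> \<le> m * norm (x - y)" "\<And>x. x \<notin> K \<Longrightarrow> g x = 0"
    and R: "R \<ge> 0" "AE x in M. x \<in> K \<longrightarrow> n * (1 - J1 n x) \<le> R"
  shows "3/4 * \<zeta>E n Y
      - (LINT x|M. (R + 2 * DIM('a)) * m\<^sup>2 * (H (Y x) + H 0))
    \<le> \<Phi>E n Y g"
proof -
  have gm: "g \<in> BM" by (rule continuous_measurable_M[OF g(1)])
  have gb: "bounded (g ` \<Lambda>)" using g(2) by (auto simp: bounded_iff)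
  have pos: "0 \<le> (\<Phi> s - \<Phi> t) * ((s - x) - (t - y)) - 3/4 * (\<zeta> s - \<zeta> t)\<^sup>2 + 1 * ((H s + H t) * (x - y)\<^sup>2)" for s t x y
  proof -
    define A B where "A = (\<zeta> s - \<zeta> t)\<^sup>2" and "B = (H s + H t) * (x - y)\<^sup>2"
    have AB: "A \<ge> 0" "B \<ge> 0" using H(2)[of s] H(2)[of t] by (auto simp: A_def B_def)
    have "((\<Phi> s - \<Phi> t) * (x - y))\<^sup>2 \<le> A * B"
      using mult_right_mono[OF H(3)[of s t], of "(x - y)\<^sup>2"] by (simp add: A_def B_def power_mult_distrib mult_ac)
    \<comment> \<open>The inequality between the means; it fixes the loss of a quarter of the
      \<zeta>-energy.\<close>
    also have "\<dots> \<le> (A / 4 + B)\<^sup>2"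
      using zero_le_power2[of "A/4 - B"] by (simp add: power2_eq_square algebra_simps)
    finally have "(\<Phi> s - \<Phi> t) * (x - y) \<le> A / 4 + B" by (rule power2_le_imp_le) (use AB in simp)
    moreover have "A \<le> (\<Phi> s - \<Phi> t) * (s - t)" unfolding A_def by (rule \<zeta>_diff)
    ultimately show ?thesis unfolding A_def[symmetric] B_def[symmetric] by (simp add: algebra_simps)
  qed
  define A where "A = (\<lambda>x. \<Phi> (Y x) * (Y x - g x) - 3/4 * (\<zeta> (Y x))\<^sup>2)"
  define G where "G = (\<lambda>x. J n (\<lambda>x. (g x)\<^sup>2) x - 2 * g x * J n g x + (g x)\<^sup>2 * J1 n x)"
  note s\<Phi> = bounded_comp(1)[OF \<Phi>_cont Y] and sH = bounded_comp(1)[OF H(1) Y]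
  have sg: "L2 g" "L2 (\<lambda>x. (g x)\<^sup>2)"
    by (intro continuous_L2 continuous_intros g(1))+
  have est: "ip A (\<lambda>x. 1 - J1 n x) + 3/4 * ip (\<lambda>x. \<zeta> (Y x)) (\<lambda>x. \<zeta> (Y x) - J n (\<lambda>x. \<zeta> (Y x)) x)
     - ip (\<lambda>x. H (Y x)) G \<le> ip (\<lambda>x. \<Phi> (Y x)) (\<lambda>x. (Y x - g x) - J n (\<lambda>x. Y x - g x) x)"
    using kernel_estimate[OF n Y gm gb H(1), of 1 "3/4" 1] pos unfolding A_def G_def by simp
  have iH: "intM (\<lambda>x. R * m\<^sup>2 * (H (Y x) + H 0))" "intM (\<lambda>x. 2 * DIM('a) * m\<^sup>2 * (H (Y x) + H 0))"
    using M.L2_integrable[OF sH] by auto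
  have 1: "- (LINT x|M. R * m\<^sup>2 * (H (Y x) + H 0)) \<le> n * ip A (\<lambda>x. 1 - J1 n x)"
  proof -
    have "- (LINT x|M. R * m\<^sup>2 * (H (Y x) + H 0)) = (LINT x|M. - (R * m\<^sup>2 * (H (Y x) + H 0)))" by simp
    also have "\<dots> \<le> (LINT x|M. A x * (n * (1 - J1 n x)))"
    proof (rule integral_mono_AE)
      show "intM (\<lambda>x. - (R * m\<^sup>2 * (H (Y x) + H 0)))" using iH by simp
      define U where "U = (\<lambda>x. (Y x, g x))"
      have Um: "U \<in> BM" unfolding U_def using Y gm by measurable
      have Ub: "bounded (U ` \<Lambda>)"
        by (rule bounded_subset[OF bounded_Times[OF Y(2) gb]]) (auto simp: U_def)
      have "continuous_on UNIV (\<lambda>\<alpha>::real\<times>real. \<Phi> (fst \<alpha>) * (fst \<alpha> - snd \<alpha>) - 3/4 * (\<zeta> (fst \<alpha>))\<^sup>2)"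
        by (auto intro!: continuous_on_compose2[OF \<Phi>_cont] continuous_on_compose2[OF \<zeta>_cont] continuous_intros)
      from bounded_comp(1)[OF this Um Ub] have sA: "L2 A" by (simp add: U_def A_def)
      show "intM (\<lambda>x. A x * (n * (1 - J1 n x)))"
        by (intro L2_mult sA L2_cmult L2_diff J_L2 M.L2_const n)
      show "AE x in M. - (R * m\<^sup>2 * (H (Y x) + H 0)) \<le> A x * (n * (1 - J1 n x))"
        using J1_bounds[OF n] R(2)
      proof eventually_elim
        case (elim x)
        define r where "r = n * (1 - J1 n x)"
        have r0: "0 \<le> r" using elim n by (simp add: r_def)
        \<comment> \<open>The pointwise inequality with (0, 0) as second point, where \<Phi> and
          \<zeta> vanish.\<close>
        have "- ((H (Y x) + H 0) * (g x)\<^sup>2) \<le> A x"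
          using pos[of "Y x" 0 "g x" 0] by (simp add: \<Phi>_0 \<zeta>_0 A_def)
        then have "- ((H (Y x) + H 0) * (g x)\<^sup>2) * r \<le> A x * r" using r0 by (rule mult_right_mono)
        moreover have "(g x)\<^sup>2 * r \<le> m\<^sup>2 * R"
        proof (cases "x \<in> K")
          case True
          have "(g x)\<^sup>2 \<le> m\<^sup>2" using g(2)[of x] by (intro abs_le_square_iff[THEN iffD1]) auto
          then show ?thesis using elim True r0 by (intro mult_mono) (auto simp: r_def)
        next
          case False
          then show ?thesis using g(4)[OF False] R(1) by simp
        qed
        moreover have "(H (Y x) + H 0) * ((g x)\<^sup>2 * r) \<le> (H (Y x) + H 0) * (m\<^sup>2 * R)"
          using calculation(2) H(2)[of "Y x"] H(2)[of 0] by (intro mult_left_mono) auto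
        ultimately show ?case unfolding r_def[symmetric] by (simp add: mult_ac)
      qed
    qed
    also have "\<dots> = n * ip A (\<lambda>x. 1 - J1 n x)"
      unfolding ip_def by (subst Bochner_Integration.integral_mult_right_zero[symmetric]) (simp add: mult_ac)
    finally show ?thesis .
  qed
  have 2: "n * ip (\<lambda>x. H (Y x)) G \<le> (LINT x|M. 2 * DIM('a) * m\<^sup>2 * (H (Y x) + H 0))"
  proof -
    have "n * ip (\<lambda>x. H (Y x)) G = (LINT x|M. n * (H (Y x) * G x))" by (simp add: ip_def)
    also have "\<dots> \<le> (LINT x|M. 2 * DIM('a) * m\<^sup>2 * (H (Y x) + H 0))"
    proof (rule integral_mono_AE)
      have i: "intM (\<lambda>x. H (Y x) * J n (\<lambda>x. (g x)\<^sup>2) x)" by (intro L2_mult sH J_L2 sg n)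
      obtain B where B: "\<And>x. x \<in> \<Lambda> \<Longrightarrow> \<bar>H (Y x)\<bar> \<le> B" using bounded_comp(2)[OF H(1) Y] by auto
      have sHg: "L2 (\<lambda>x. H (Y x) * g x)" "L2 (\<lambda>x. H (Y x) * (g x)\<^sup>2)"
      proof -
        have b1: "\<bar>H (Y x) * g x\<bar> \<le> B * m" if "x \<in> \<Lambda>" for x
          unfolding abs_mult using B[OF that] g(2)[of x] by (intro mult_mono) auto
        have "(g x)\<^sup>2 \<le> m\<^sup>2" for x using g(2)[of x] by (intro abs_le_square_iff[THEN iffD1]) auto
        then have b2: "\<bar>H (Y x) * (g x)\<^sup>2\<bar> \<le> B * m\<^sup>2" if "x \<in> \<Lambda>" for x
          unfolding abs_mult using B[OF that] by (intro mult_mono) auto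
        have [measurable]: "(\<lambda>x. H (Y x)) \<in> BM" "g \<in> BM"
          using L2_measurable[OF sH] gm .
        show "L2 (\<lambda>x. H (Y x) * g x)" by (rule M.L2_bounded[where B = "B * m"]) (use b1 in auto)
        show "L2 (\<lambda>x. H (Y x) * (g x)\<^sup>2)" by (rule M.L2_bounded[where B = "B * m\<^sup>2"]) (use b2 in auto)
      qed
      have "intM (\<lambda>x. n * (H (Y x) * J n (\<lambda>x. (g x)\<^sup>2) x - 2 * ((H (Y x) * g x) * J n g x) + (H (Y x) * (g x)\<^sup>2) * J1 n x))"
        by (intro integrable_mult_right Bochner_Integration.integrable_add Bochner_Integration.integrable_diff i
            L2_mult sHg J_L2 sg M.L2_const n)
      then show "intM (\<lambda>x. n * (H (Y x) * G x))" by (simp add: G_def algebra_simps)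
      show "AE x in M. n * (H (Y x) * G x) \<le> 2 * DIM('a) * m\<^sup>2 * (H (Y x) + H 0)"
        using J_carre_bound[OF n g(1) g(3)]
      proof eventually_elim
        case (elim x)
        have "n * G x \<le> n * (m\<^sup>2 * (2 * DIM('a) / n))" using elim n unfolding G_def by (intro mult_left_mono) auto
        also have "\<dots> = 2 * DIM('a) * m\<^sup>2" using n by simp
        finally have "H (Y x) * (n * G x) \<le> H (Y x) * (2 * DIM('a) * m\<^sup>2)" using H(2) by (intro mult_left_mono) auto
        also have "\<dots> \<le> (H (Y x) + H 0) * (2 * DIM('a) * m\<^sup>2)" using H(2) by (intro mult_right_mono) auto
        finally show ?case by (simp add: mult_ac)
      qed
    qed (use iH in simp)
    finally show ?thesis .
  qed
  have 3: "(LINT x|M. (R + 2 * DIM('a)) * m\<^sup>2 * (H (Y x) + H 0)) = (LINT x|M. R * m\<^sup>2 * (H (Y x) + H 0)) + (LINT x|M. 2 * DIM('a) * m\<^sup>2 * (H (Y x) + H 0))"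
    by (subst Bochner_Integration.integral_add[OF iH, symmetric]) (simp add: algebra_simps)
  have "n * (ip A (\<lambda>x. 1 - J1 n x) + 3/4 * ip (\<lambda>x. \<zeta> (Y x)) (\<lambda>x. \<zeta> (Y x) - J n (\<lambda>x. \<zeta> (Y x)) x) - ip (\<lambda>x. H (Y x)) G)
     \<le> \<Phi>E n Y g"
    using est n by (intro mult_left_mono) auto
  then show ?thesis using 1 2 unfolding 3 by (simp add: algebra_simps)
qed

end

context bounded_domain
begin

section \<open>From bounded functions to L^{p+1}\<close>

lemma Lp_integrable_add:
  assumes "q \<ge> 1" "Lp_integrable q f" "Lp_integrable q g"
  shows "Lp_integrable q (\<lambda>x. f x + g x)"
  unfolding Lp_integrable_def
proof
  show m: "(\<lambda>x. f x + g x) \<in> BM" using assms by (auto simp: Lp_integrable_def)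
  show "intM (\<lambda>x. \<bar>f x + g x\<bar> powr q)"
  proof (rule Bochner_Integration.integrable_bound)
    show "intM (\<lambda>x. 2 powr q * (\<bar>f x\<bar> powr q + \<bar>g x\<bar> powr q))"
      using assms by (auto simp: Lp_integrable_def)
    have "\<bar>s + t\<bar> powr q \<le> 2 powr q * (\<bar>s\<bar> powr q + \<bar>t\<bar> powr q)" for s t :: real
    proof -
      have "\<bar>s + t\<bar> powr q \<le> (2 * max \<bar>s\<bar> \<bar>t\<bar>) powr q" using assms(1) by (intro powr_mono2) auto
      also have "\<dots> = 2 powr q * (max \<bar>s\<bar> \<bar>t\<bar>) powr q" by (simp add: powr_mult)
      also have "(max \<bar>s\<bar> \<bar>t\<bar>) powr q \<le> \<bar>s\<bar> powr q + \<bar>t\<bar> powr q" by (auto simp: max_def)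
      finally show ?thesis by (simp add: mult_left_mono)
    qed
    then show "AE x in M. norm (\<bar>f x + g x\<bar> powr q) \<le> norm (2 powr q * (\<bar>f x\<bar> powr q + \<bar>g x\<bar> powr q))" by simp
  qed (use m in measurable)
qed

lemma Lp_integrable_cmult: "Lp_integrable q f \<Longrightarrow> Lp_integrable q (\<lambda>x. c * f x)"
  by (auto simp: Lp_integrable_def abs_mult powr_mult)

lemma Lp_integrable_diff:
  "q \<ge> 1 \<Longrightarrow> Lp_integrable q f \<Longrightarrow> Lp_integrable q g \<Longrightarrow> Lp_integrable q (\<lambda>x. f x - g x)"
  using Lp_integrable_add[OF _ _ Lp_integrable_cmult, of q f g "- 1"] by simp

lemma Lp_integrable_abs: "Lp_integrable q f \<Longrightarrow> Lp_integrable q (\<lambda>x. \<bar>f x\<bar>)"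
  by (auto simp: Lp_integrable_def)

lemma Lp_integrable_bounded:
  assumes "q \<ge> 0" "f \<in> BM" "\<And>x. x \<in> \<Lambda> \<Longrightarrow> \<bar>f x\<bar> \<le> B"
  shows "Lp_integrable q f"
  unfolding Lp_integrable_def
proof
  show "intM (\<lambda>x. \<bar>f x\<bar> powr q)"
    by (rule M.integrable_const_bound[where B = "B powr q"]) (use assms in \<open>auto intro!: powr_mono2\<close>)
qed fact

lemma J_L2_tendsto:
  assumes f: "\<And>k. L2 (f k)" and g: "L2 g" and n: "n > 0"
    and lim: "(\<lambda>k. nrm (\<lambda>x. f k x - g x)) \<leadsto> 0"
  shows "(\<lambda>k. nrm (\<lambda>x. J n (f k) x - J n g x)) \<leadsto> 0"
proof (rule Lim_null_comparison[OF _ lim])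
  have "nrm (\<lambda>x. J n (f k) x - J n g x) \<le> nrm (\<lambda>x. f k x - g x)" for k
  proof -
    have "nrm (\<lambda>x. J n (f k) x - J n g x) = nrm (J n (\<lambda>x. f k x - g x))"
    proof (rule L2norm_cong_AE)
      show "AE x in M. J n (f k) x - J n g x = J n (\<lambda>x. f k x - g x) x"
        using J_diff[OF f[of k] g n] by eventually_elim simp
    qed (intro L2_measurable L2_diff J_L2 f g n)+
    also have "\<dots> \<le> nrm (\<lambda>x. f k x - g x)" by (intro J_norm_le L2_diff f g n)
    finally show ?thesis .
  qed
  then show "\<forall>\<^sub>F k in sequentially. norm (nrm (\<lambda>x. J n (f k) x - J n g x)) \<le> nrm (\<lambda>x. f k x - g x)"
    by simp
qed

lemma clip_L2_tendsto:
  assumes "L2 f"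
  shows "L2 (\<lambda>x. clip k (f x))" "(\<lambda>k. nrm (\<lambda>x. clip k (f x) - f x)) \<leadsto> 0"
proof -
  have [measurable]: "f \<in> BM" using assms by (rule L2_measurable)
  show s: "L2 (\<lambda>x. clip k (f x))" for k
    by (rule L2_bound[OF assms]) (auto simp: clip_abs_le)
  have "(\<lambda>k. LINT x|M. (norm (clip k (f x) - f x))\<^sup>2) \<leadsto> (LINT x|M. 0)"
  proof (rule integral_dominated_convergence[where w = "\<lambda>x. 4 * (norm (f x))\<^sup>2"])
    show "AE x in M. (\<lambda>k. (norm (clip k (f x) - f x))\<^sup>2) \<leadsto> 0"
    proof (rule AE_I2)
      fix x
      have "(\<lambda>k. (norm (clip k (f x) - f x))\<^sup>2) \<leadsto> (norm (f x - f x))\<^sup>2"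
        by (intro tendsto_intros clip_tendsto)
      then show "(\<lambda>k. (norm (clip k (f x) - f x))\<^sup>2) \<leadsto> 0" by simp
    qed
    show "AE x in M. norm ((norm (clip k (f x) - f x))\<^sup>2) \<le> 4 * (norm (f x))\<^sup>2" for k
    proof (rule AE_I2)
      fix x
      have "norm (clip k (f x) - f x) \<le> 2 * norm (f x)" using clip_abs_le(1)[of k "f x"] by auto
      from power_mono[OF this, of 2] show "norm ((norm (clip k (f x) - f x))\<^sup>2) \<le> 4 * (norm (f x))\<^sup>2"
        by (simp add: power_mult_distrib)
    qed
    show "intM (\<lambda>x. 4 * (norm (f x))\<^sup>2)" using assms by (simp add: sq_integrable_def)
  qed auto
  from tendsto_real_sqrt[OF this] show "(\<lambda>k. nrm (\<lambda>x. clip k (f x) - f x)) \<leadsto> 0"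
    unfolding L2norm_def by simp
qed

end

context porous
begin

lemma p_ge: "p + 1 \<ge> 2" "p + 1 \<ge> 1" "p + 1 \<ge> 0" "p > 0"
  using p1 by auto

lemma growth_integrable:
  assumes Y: "Lp Y" and v: "Lp v"
  shows "intM (\<lambda>x. (c1 * \<bar>Y x\<bar> powr p + c2) * \<bar>v x\<bar>)"
proof (rule Bochner_Integration.integrable_bound)
  show "intM (\<lambda>x. (c1 + c2) * (1 * (1 + \<bar>Y x\<bar> powr (p + 1)) + 1 powr (- p) * \<bar>v x\<bar> powr (p + 1)))"
    using Y v by (auto simp: Lp_integrable_def)
  have "0 \<le> (c1 * \<bar>Y x\<bar> powr p + c2) * \<bar>v x\<bar>" for x
    using c_nonneg by (intro mult_nonneg_nonneg add_nonneg_nonneg) auto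
  then show "AE x in M. norm ((c1 * \<bar>Y x\<bar> powr p + c2) * \<bar>v x\<bar>)
      \<le> norm ((c1 + c2) * (1 * (1 + \<bar>Y x\<bar> powr (p + 1)) + 1 powr (- p) * \<bar>v x\<bar> powr (p + 1)))"
    using growth_young[of 1] by (intro AE_I2) (auto intro: order_trans[OF _ abs_ge_self])
qed (use Y v in \<open>auto simp: Lp_integrable_def\<close>)

lemma \<Phi>_integrable:
  assumes Y: "Lp Y" and v: "Lp v"
  shows "intM (\<lambda>x. \<Phi> (Y x) * v x)"
proof (rule Bochner_Integration.integrable_bound[OF growth_integrable[OF assms]])
  show "(\<lambda>x. \<Phi> (Y x) * v x) \<in> BM"
    using assms by (intro borel_measurable_times measurable_comp_\<Phi>\<zeta>) (auto simp: Lp_integrable_def)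
  have "norm (\<Phi> (Y x) * v x) \<le> (c1 * \<bar>Y x\<bar> powr p + c2) * \<bar>v x\<bar>" for x
    using \<Phi>_growth by (simp add: abs_mult mult_right_mono)
  then show "AE x in M. norm (\<Phi> (Y x) * v x) \<le> norm ((c1 * \<bar>Y x\<bar> powr p + c2) * \<bar>v x\<bar>)"
    by (intro AE_I2) (auto intro: order_trans[OF _ abs_ge_self])
qed

text \<open>The threshold on n makes the spectral gap at least 5/6 lam. Of 3/4 * 5/6 = 5/8 of lam *
  a the noise term \<open>\<Psi>\<close> takes 1/8, and one half is left.\<close>

lemma key_reduce:
  assumes n: "n \<ge> 5 * lam" and Y: "Y \<in> BM" "bounded (Y ` \<Lambda>)"
    and \<Psi>: "continuous_on UNIV \<Psi>" "\<And>y. \<Psi> y \<le> lam * a / 8 * \<bar>y\<bar> powr (p + 1) + E"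
    and X: "3/4 * \<zeta>E n Y - (LINT x|M. \<Psi> (Y x)) \<le> X"
  shows "lam * a / 2 * (LINT x|M. \<bar>Y x\<bar> powr (p + 1)) - (lam * c + E) * measure M (space M) \<le> X"
proof -
  have n0: "n > 0" using n lam_pos by linarith
  define \<kappa> where "\<kappa> = n * lam / (n + lam)"
  have \<kappa>: "5/6 * lam \<le> \<kappa>" "\<kappa> \<le> lam" "0 \<le> \<kappa>"
  proof -
    have "5/6 * lam * (n + lam) \<le> n * lam"
      using mult_right_mono[OF n, of lam] lam_pos by (simp add: algebra_simps)
    then show "5/6 * lam \<le> \<kappa>" unfolding \<kappa>_def using n0 lam_pos by (simp add: pos_le_divide_eq)
    show "\<kappa> \<le> lam" unfolding \<kappa>_def using n0 lam_pos by (simp add: pos_divide_le_eq algebra_simps)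
    show "0 \<le> \<kappa>" unfolding \<kappa>_def using n0 lam_pos by simp
  qed
  note s\<zeta> = bounded_comp(1)[OF \<zeta>_cont Y] and s\<Psi> = bounded_comp(1)[OF \<Psi>(1) Y]
  obtain B where B: "\<And>x. x \<in> \<Lambda> \<Longrightarrow> \<bar>Y x\<bar> \<le> B" using Y(2) by (auto simp: bounded_iff)
  have iY: "intM (\<lambda>x. \<bar>Y x\<bar> powr (p + 1))"
    using Lp_integrable_bounded[OF p_ge(3) Y(1) B] by (simp add: Lp_integrable_def)
  have i\<zeta>: "intM (\<lambda>x. (\<zeta> (Y x))\<^sup>2)" using s\<zeta> by (simp add: sq_integrable_def)
  have i\<Psi>: "intM (\<lambda>x. \<Psi> (Y x))" by (rule M.L2_integrable[OF s\<Psi>])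
  have "lam * a / 2 * (LINT x|M. \<bar>Y x\<bar> powr (p + 1)) - (lam * c + E) * measure M (space M)
    = (LINT x|M. lam * a / 2 * \<bar>Y x\<bar> powr (p + 1) - (lam * c + E))"
    using iY by simp
  also have "\<dots> \<le> (LINT x|M. 3/4 * (\<kappa> * (\<zeta> (Y x))\<^sup>2) - \<Psi> (Y x))"
  proof (rule integral_mono)
    fix x
    let ?s = "\<bar>Y x\<bar> powr (p + 1)"
    have "\<kappa> * (a * ?s - c) \<le> \<kappa> * (\<zeta> (Y x))\<^sup>2" using \<kappa> \<zeta>_coercive by (intro mult_left_mono) auto
    moreover have "5/6 * lam * (a * ?s) \<le> \<kappa> * (a * ?s)" using \<kappa> a_pos by (intro mult_right_mono) auto
    moreover have "\<kappa> * c \<le> lam * c" "0 \<le> lam * c" using \<kappa> c_nonneg lam_pos by (auto intro: mult_right_mono)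
    ultimately show "lam * a / 2 * ?s - (lam * c + E) \<le> 3/4 * (\<kappa> * (\<zeta> (Y x))\<^sup>2) - \<Psi> (Y x)"
      using \<Psi>(2)[of "Y x"] by (simp add: right_diff_distrib)
  qed (use iY i\<zeta> i\<Psi> in auto)
  also have "\<dots> = 3/4 * (\<kappa> * (nrm (\<lambda>x. \<zeta> (Y x)))\<^sup>2) - (LINT x|M. \<Psi> (Y x))"
    using i\<zeta> i\<Psi> by (simp add: L2norm_sq)
  also have "\<dots> \<le> X"
  proof -
    have "\<kappa> * (nrm (\<lambda>x. \<zeta> (Y x)))\<^sup>2 \<le> \<zeta>E n Y"
      unfolding \<kappa>_def by (rule spectral_gap[OF s\<zeta> n0])
    then show ?thesis using X by linarith
  qed
  finally show ?thesis .
qed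

text \<open>The kernel argument covers bounded \<open>Y\<close>. Truncations approach
  \<open>Y\<close> along a subsequence on which their images under \<open>J n\<close> converge
  almost everywhere; positivity of \<open>J n\<close> supplies the dominating function, which is
  integrable because \<open>J n\<close> maps L^{p+1} to itself.\<close>

lemma key_unbounded:
  assumes n: "n > 0" and Y: "Lp Y"
    and g: "g \<in> BM" "\<And>x. x \<in> \<Lambda> \<Longrightarrow> \<bar>g x\<bar> \<le> B"
    and bd: "\<And>Y. Y \<in> BM \<Longrightarrow> bounded (Y ` \<Lambda>) \<Longrightarrow>
      b * (LINT x|M. \<bar>Y x\<bar> powr (p + 1)) - E \<le> \<Phi>E n Y g"
  shows "b * (LINT x|M. \<bar>Y x\<bar> powr (p + 1)) - E \<le> \<Phi>E n Y g"
proof -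
  have Lg: "Lp g" by (rule Lp_integrable_bounded[OF p_ge(3) g])
  have sY: "L2 Y" and sg: "L2 g" using Lp_integrable_sq[OF Y p_ge(1)] Lp_integrable_sq[OF Lg p_ge(1)] .
  have [measurable]: "Y \<in> BM" "g \<in> BM" using sY g by (auto simp: sq_integrable_def)
  define z where "z = (\<lambda>x. Y x - g x)"
  define zk where "zk = (\<lambda>k x. clip k (Y x) - g x)"
  have sz: "L2 z" unfolding z_def by (intro L2_diff sY sg)
  have szk: "L2 (zk k)" for k unfolding zk_def by (intro L2_diff clip_L2_tendsto(1) sY sg)
  have "(\<lambda>k. nrm (\<lambda>x. zk k x - z x)) \<leadsto> 0"
    using clip_L2_tendsto(2)[OF sY] by (simp add: zk_def z_def)
  note limJ = J_L2_tendsto[OF szk sz n this]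
  obtain r where r: "strict_mono r" "AE x in M. (\<lambda>k. J n (zk (r k)) x) \<leadsto> J n z x"
    using M.L2_tendsto_AE_subseq[OF J_L2[OF szk n] J_L2[OF sz n] limJ] by blast
  define W where "W = (\<lambda>x. \<bar>Y x\<bar> + \<bar>g x\<bar>)"
  have LW: "Lp W" unfolding W_def by (intro Lp_integrable_add Lp_integrable_abs Y Lg p_ge)
  have sW: "L2 W" by (rule Lp_integrable_sq[OF LW p_ge(1)])
  have LJW: "Lp (\<lambda>x. W x + J n W x)"
    by (intro Lp_integrable_add J_Lp(1)[OF n p_ge(1)] LW p_ge)
  have lim1: "(\<lambda>k. LINT x|M. \<Phi> (clip (r k) (Y x)) * (zk (r k) x - J n (zk (r k)) x)) \<leadsto> (LINT x|M. \<Phi> (Y x) * (z x - J n z x))"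
  proof (rule integral_dominated_convergence[OF _ _ growth_integrable[OF Y LJW]])
    show "(\<lambda>x. \<Phi> (Y x) * (z x - J n z x)) \<in> BM"
      by (intro borel_measurable_times borel_measurable_diff measurable_comp_\<Phi>\<zeta> L2_measurable sz J_L2 sY n)
    show "(\<lambda>x. \<Phi> (clip (r k) (Y x)) * (zk (r k) x - J n (zk (r k)) x)) \<in> BM" for k
      by (intro borel_measurable_times borel_measurable_diff measurable_comp_\<Phi>\<zeta> L2_measurable szk J_L2
          clip_L2_tendsto(1) sY n)
    show "AE x in M. (\<lambda>k. \<Phi> (clip (r k) (Y x)) * (zk (r k) x - J n (zk (r k)) x)) \<leadsto> \<Phi> (Y x) * (z x - J n z x)"
      using r(2)
    proof eventually_elim
      case (elim x)
      have c: "(\<lambda>k. clip (r k) (Y x)) \<leadsto> Y x" using LIMSEQ_subseq_LIMSEQ[OF clip_tendsto r(1)] by (simp add: o_def)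
      have "isCont \<Phi> (Y x)" using \<Phi>_cont by (simp add: continuous_on_eq_continuous_at)
      from isCont_tendsto_compose[OF this c] elim c show ?case
        unfolding zk_def z_def by (auto intro!: tendsto_intros)
    qed
    show "AE x in M. norm (\<Phi> (clip (r k) (Y x)) * (zk (r k) x - J n (zk (r k)) x))
      \<le> (c1 * \<bar>Y x\<bar> powr p + c2) * \<bar>W x + J n W x\<bar>" for k
    proof -
      have zW: "\<bar>zk (r k) x\<bar> \<le> W x" for x using clip_abs_le(1)[of "r k" "Y x"] by (auto simp: zk_def W_def)
      have "AE x in M. \<bar>J n (zk (r k)) x\<bar> \<le> J n W x" by (rule J_abs_le[OF szk sW n]) (use zW in auto)
      then show ?thesis
      proof eventually_elim
        case (elim x)
        have "\<bar>\<Phi> (clip (r k) (Y x))\<bar> \<le> c1 * \<bar>clip (r k) (Y x)\<bar> powr p + c2" by (rule \<Phi>_growth)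
        also have "\<dots> \<le> c1 * \<bar>Y x\<bar> powr p + c2"
          using c_nonneg p_ge clip_abs_le(1) by (intro add_right_mono mult_left_mono powr_mono2) auto
        finally have 1: "\<bar>\<Phi> (clip (r k) (Y x))\<bar> \<le> c1 * \<bar>Y x\<bar> powr p + c2" .
        moreover have "\<bar>zk (r k) x - J n (zk (r k)) x\<bar> \<le> \<bar>W x + J n W x\<bar>" using elim zW[of x] by linarith
        ultimately show ?case unfolding real_norm_def abs_mult using c_nonneg by (intro mult_mono) auto
      qed
    qed
  qed
  have iY: "intM (\<lambda>x. \<bar>Y x\<bar> powr (p + 1))" using Y by (simp add: Lp_integrable_def)
  have lim2: "(\<lambda>k. LINT x|M. \<bar>clip (r k) (Y x)\<bar> powr (p + 1)) \<leadsto> (LINT x|M. \<bar>Y x\<bar> powr (p + 1))"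
  proof (rule integral_dominated_convergence[OF _ _ iY])
    show "AE x in M. (\<lambda>k. \<bar>clip (r k) (Y x)\<bar> powr (p + 1)) \<leadsto> \<bar>Y x\<bar> powr (p + 1)"
    proof (rule AE_I2)
      fix x
      have c: "(\<lambda>k. clip (r k) (Y x)) \<leadsto> Y x" using LIMSEQ_subseq_LIMSEQ[OF clip_tendsto r(1)] by (simp add: o_def)
      show "(\<lambda>k. \<bar>clip (r k) (Y x)\<bar> powr (p + 1)) \<leadsto> \<bar>Y x\<bar> powr (p + 1)"
        by (rule tendsto_powr'[OF tendsto_rabs[OF c] tendsto_const]) (use p_ge in auto)
    qed
    show "AE x in M. norm (\<bar>clip (r k) (Y x)\<bar> powr (p + 1)) \<le> \<bar>Y x\<bar> powr (p + 1)" for k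
      using p_ge clip_abs_le(1) by (auto intro!: powr_mono2)
  qed measurable
  have "b * (LINT x|M. \<bar>clip (r k) (Y x)\<bar> powr (p + 1)) - E \<le> n * (LINT x|M. \<Phi> (clip (r k) (Y x)) * (zk (r k) x - J n (zk (r k)) x))" for k
  proof -
    have "bounded ((\<lambda>x. clip (r k) (Y x)) ` \<Lambda>)"
      using clip_abs_le(2) by (auto simp: bounded_iff)
    from bd[OF _ this] show ?thesis unfolding ip_def zk_def by simp
  qed
  then have "b * (LINT x|M. \<bar>Y x\<bar> powr (p + 1)) - E \<le> n * (LINT x|M. \<Phi> (Y x) * (z x - J n z x))"
    by (intro LIMSEQ_le[OF tendsto_diff[OF tendsto_mult[OF tendsto_const lim2] tendsto_const] tendsto_mult[OF tendsto_const lim1]]) auto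
  then show ?thesis unfolding ip_def z_def .
qed

text \<open>Since (Y - g)^2 \<le> 2 Y^2 + 2 g^2, the damping term is paid by lam * a * |Y|^{p+1} as
  soon as 2 \<alpha> Y^2 is. For p = 1 this is the assumption on \<alpha>, for p > 1 it holds up to
  a constant. \<open>K\<close> is chosen before \<open>n\<close>, \<open>Y\<close> and the
  noise.\<close>

lemma key_final:
  assumes \<alpha>: "\<alpha> > 0" "p = 1 \<Longrightarrow> \<alpha> \<le> a * lam / 2" and E0: "E0 \<ge> 0"
  obtains K where "K \<ge> 0" "\<And>m g n Y \<Psi>. m \<ge> 0 \<Longrightarrow> g \<in> BM \<Longrightarrow> (\<And>x. x \<in> \<Lambda> \<Longrightarrow> \<bar>g x\<bar> \<le> m) \<Longrightarrow>
     n \<ge> 5 * lam \<Longrightarrow> Lp Y \<Longrightarrow> continuous_on UNIV \<Psi> \<Longrightarrow>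
     (\<And>y. \<Psi> y \<le> lam * a / 8 * \<bar>y\<bar> powr (p + 1) + E0 * (1 + m\<^sup>2) ^ Suc k) \<Longrightarrow>
     (\<And>Y. Y \<in> BM \<Longrightarrow> bounded (Y ` \<Lambda>) \<Longrightarrow>
       3/4 * \<zeta>E n Y - (LINT x|M. \<Psi> (Y x))
        \<le> \<Phi>E n Y g) \<Longrightarrow>
     - 2 * \<Phi>E n Y g
       \<le> - \<alpha> * (nrm (\<lambda>x. Y x - g x))\<^sup>2 + K * (1 + m\<^sup>2) ^ Suc k"
proof -
  have "\<exists>K1\<ge>0. \<forall>y. 2 * \<alpha> * y\<^sup>2 \<le> lam * a * \<bar>y\<bar> powr (p + 1) + K1"
  proof (cases "p = 1")
    case True
    have "2 * \<alpha> * y\<^sup>2 \<le> lam * a * \<bar>y\<bar> powr (p + 1)" for y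
    proof -
      have "2 * \<alpha> * y\<^sup>2 \<le> (a * lam) * y\<^sup>2" using \<alpha>(2)[OF True] by (intro mult_right_mono) auto
      then show ?thesis using True by (cases "y = 0") (auto simp: mult_ac)
    qed
    then show ?thesis by (intro exI[of _ 0]) auto
  next
    case False
    then have "p > 1" using p1 by simp
    moreover have "lam * a / (2 * \<alpha>) > 0" using lam_pos a_pos \<alpha> by simp
    ultimately obtain K where K: "K \<ge> 0" "\<And>y::real. y\<^sup>2 \<le> lam * a / (2 * \<alpha>) * \<bar>y\<bar> powr (p + 1) + K"
      using sq_le_powr by blast
    have "2 * \<alpha> * y\<^sup>2 \<le> lam * a * \<bar>y\<bar> powr (p + 1) + 2 * \<alpha> * K" for y
      using mult_left_mono[OF K(2)[of y], of "2 * \<alpha>"] \<alpha> by (simp add: distrib_left)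
    then show ?thesis using K(1) \<alpha>(1) by (intro exI[of _ "2 * \<alpha> * K"]) auto
  qed
  then obtain K1 where K1: "K1 \<ge> 0" "\<And>y. 2 * \<alpha> * y\<^sup>2 \<le> lam * a * \<bar>y\<bar> powr (p + 1) + K1" by blast
  define \<mu> where "\<mu> = measure M (space M)"
  have \<mu>: "\<mu> \<ge> 0" by (simp add: \<mu>_def)
  define K where "K = (K1 + 2 * \<alpha> + 2 * (lam * c + E0)) * \<mu>"
  show ?thesis
  proof (rule that[of K])
    show "K \<ge> 0" unfolding K_def using K1 \<alpha> lam_pos c_nonneg E0 \<mu> by (intro mult_nonneg_nonneg add_nonneg_nonneg) auto
    fix m n :: real and g Y \<Psi>
    assume m: "m \<ge> 0" and g: "g \<in> BM" "\<And>x. x \<in> \<Lambda> \<Longrightarrow> \<bar>g x\<bar> \<le> m"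
      and n: "n \<ge> 5 * lam" and Y: "Lp Y" and \<Psi>: "continuous_on UNIV \<Psi>"
      and le: "\<And>y. \<Psi> y \<le> lam * a / 8 * \<bar>y\<bar> powr (p + 1) + E0 * (1 + m\<^sup>2) ^ Suc k"
      and bd: "\<And>Y. Y \<in> BM \<Longrightarrow> bounded (Y ` \<Lambda>) \<Longrightarrow>
       3/4 * \<zeta>E n Y - (LINT x|M. \<Psi> (Y x))
        \<le> \<Phi>E n Y g"
    have n0: "n > 0" using n lam_pos by linarith
    \<comment> \<open>The exponent is positive, so \<open>w\<close> dominates both 1 and
      \<open>m\<^sup>2\<close>, and every constant can be collected as a multiple of it.\<close>
    define w where "w = (1 + m\<^sup>2) ^ Suc k"
    have w1: "1 \<le> w" unfolding w_def by (rule one_le_power) simp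
    have w2: "m\<^sup>2 \<le> w"
    proof -
      have "1 + m\<^sup>2 \<le> w" unfolding w_def using power_increasing[of 1 "Suc k" "1 + m\<^sup>2"] by simp
      then show ?thesis by linarith
    qed
    define I where "I = (LINT x|M. \<bar>Y x\<bar> powr (p + 1))"
    define X where "X = \<Phi>E n Y g"
    have X: "lam * a / 2 * I - (lam * c + E0 * w) * \<mu> \<le> X"
      unfolding I_def X_def \<mu>_def
      by (rule key_unbounded[OF n0 Y g]) (use key_reduce[OF n _ _ \<Psi> le[folded w_def] bd] in blast)+
    have sY: "L2 Y" by (rule Lp_integrable_sq[OF Y p_ge(1)])
    have sg: "L2 g" by (rule M.L2_bounded[OF g(1), of m]) (use g in auto)
    have iY: "intM (\<lambda>x. \<bar>Y x\<bar> powr (p + 1))" using Y by (simp add: Lp_integrable_def)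
    have "\<alpha> * (nrm (\<lambda>x. Y x - g x))\<^sup>2 = (LINT x|M. \<alpha> * (norm (Y x - g x))\<^sup>2)"
      by (simp add: L2norm_sq)
    also have "\<dots> \<le> (LINT x|M. lam * a * \<bar>Y x\<bar> powr (p + 1) + (K1 + 2 * \<alpha> * w))"
    proof (rule integral_mono)
      show "intM (\<lambda>x. \<alpha> * (norm (Y x - g x))\<^sup>2)"
        using L2_diff[OF sY sg] by (simp add: sq_integrable_def)
      show "intM (\<lambda>x. lam * a * \<bar>Y x\<bar> powr (p + 1) + (K1 + 2 * \<alpha> * w))" using iY by simp
      fix x assume "x \<in> space M"
      then have "\<bar>g x\<bar> \<le> m" using g by simp
      then have "(g x)\<^sup>2 \<le> m\<^sup>2" using m by (simp add: abs_le_square_iff[symmetric])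
      then have "(g x)\<^sup>2 \<le> w" using w2 by simp
      then have "2 * \<alpha> * (g x)\<^sup>2 \<le> 2 * \<alpha> * w" using \<alpha> by (intro mult_left_mono) auto
      moreover have "(Y x - g x)\<^sup>2 \<le> 2 * (Y x)\<^sup>2 + 2 * (g x)\<^sup>2"
        using zero_le_power2[of "Y x + g x"] by (simp add: power2_eq_square algebra_simps)
      then have "\<alpha> * (Y x - g x)\<^sup>2 \<le> \<alpha> * (2 * (Y x)\<^sup>2 + 2 * (g x)\<^sup>2)" using \<alpha> by (intro mult_left_mono) auto
      ultimately show "\<alpha> * (norm (Y x - g x))\<^sup>2 \<le> lam * a * \<bar>Y x\<bar> powr (p + 1) + (K1 + 2 * \<alpha> * w)"
        using K1(2)[of "Y x"] by (simp add: distrib_left)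
    qed
    also have "\<dots> = lam * a * I + (K1 + 2 * \<alpha> * w) * \<mu>" unfolding I_def \<mu>_def using iY by simp
    finally have Z: "\<alpha> * (nrm (\<lambda>x. Y x - g x))\<^sup>2 \<le> lam * a * I + (K1 + 2 * \<alpha> * w) * \<mu>" .
    have "(K1 + 2 * \<alpha> * w) * \<mu> + 2 * ((lam * c + E0 * w) * \<mu>) \<le> K * w"
    proof -
      have "K1 * \<mu> \<le> K1 * \<mu> * w" "lam * c * \<mu> \<le> lam * c * \<mu> * w"
        using mult_left_mono[OF w1, of "K1 * \<mu>"] mult_left_mono[OF w1, of "lam * c * \<mu>"] K1(1) \<mu> c_nonneg(1) lam_pos
        by simp_all
      then show ?thesis unfolding K_def by (simp add: algebra_simps)
    qed
    then show "- 2 * \<Phi>E n Y g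
       \<le> - \<alpha> * (nrm (\<lambda>x. Y x - g x))\<^sup>2 + K * (1 + m\<^sup>2) ^ Suc k"
      using X Z unfolding X_def[symmetric] w_def[symmetric] by simp
  qed
qed

section \<open>Absorption of the noise terms\<close>

lemma absorb_I:
  assumes d: "d > 0" and k: "p + 1 \<le> real k"
  obtains E0 where "E0 \<ge> 0" "\<And>m y. m \<ge> 0 \<Longrightarrow> m * \<bar>\<Phi> y\<bar> \<le> d * \<bar>y\<bar> powr (p + 1) + E0 * (1 + m\<^sup>2) ^ k"
proof -
  \<comment> \<open>The summand 1 avoids a division by zero if both growth constants vanish.\<close>
  define e where "e = d / (c1 + c2 + 1)"
  have c: "c1 + c2 + 1 > 0" using c_nonneg by simp
  have e: "e > 0" "(c1 + c2) * e \<le> d" using d c c_nonneg by (auto simp: e_def field_simps)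
  define E0 where "E0 = d + (c1 + c2) * e powr (- p)"
  have "m * \<bar>\<Phi> y\<bar> \<le> d * \<bar>y\<bar> powr (p + 1) + E0 * (1 + m\<^sup>2) ^ k" if m: "m \<ge> 0" for m y
  proof -
    let ?w = "(1 + m\<^sup>2) ^ k"
    have w: "1 \<le> ?w" "m powr (p + 1) \<le> ?w" using powr_le_one_plus_sq[OF m p_ge(3) k] by (auto intro: one_le_power)
    have "m * \<bar>\<Phi> y\<bar> = \<bar>\<Phi> y\<bar> * \<bar>m\<bar>" using m by simp
    also have "\<dots> \<le> (c1 + c2) * (e * (1 + \<bar>y\<bar> powr (p + 1)) + e powr (- p) * \<bar>m\<bar> powr (p + 1))"
      by (rule \<Phi>_young[OF e(1)])
    also have "\<dots> = (c1 + c2) * e * (1 + \<bar>y\<bar> powr (p + 1)) + (c1 + c2) * e powr (- p) * m powr (p + 1)"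
      using m by (simp add: algebra_simps)
    also have "\<dots> \<le> d * (1 + \<bar>y\<bar> powr (p + 1)) + (c1 + c2) * e powr (- p) * ?w"
      using e w c_nonneg by (intro add_mono mult_right_mono mult_left_mono) auto
    also have "d * (1 + \<bar>y\<bar> powr (p + 1)) \<le> d * \<bar>y\<bar> powr (p + 1) + d * ?w"
      using w d by (simp add: distrib_left)
    finally show ?thesis unfolding E0_def by (simp add: distrib_right)
  qed
  moreover have "E0 \<ge> 0" unfolding E0_def using d c_nonneg by simp
  ultimately show ?thesis using that by blast
qed

text \<open>The left-hand side is the noise term of the estimate for C^1 noise. In y it has order p
  - 1, two orders below the coercive power, so Young's inequality for squares leaves only a small
  multiple of |y|^{p+1}.\<close>

lemma absorb_II:
  assumes d: "d > 0" and k: "p + 1 \<le> real k" and A: "A \<ge> 0"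
  obtains E0 where "E0 \<ge> 0" "\<And>m y. m \<ge> 0 \<Longrightarrow> A * m\<^sup>2 * ((1 + \<bar>y\<bar>) powr (p - 1) + 1) \<le> d * \<bar>y\<bar> powr (p + 1) + E0 * (1 + m\<^sup>2) ^ k"
proof -
  define T where "T = (2::real) powr (p + 1)"
  define e where "e = d / (A * T + 1)"
  have T: "T > 0" by (simp add: T_def)
  have c: "A * T + 1 > 0" using A T by (simp add: add_nonneg_pos)
  have e: "e > 0" "A * T * e \<le> d" using d c A T by (auto simp: e_def field_simps)
  define E0 where "E0 = d + A * e powr ((1 - p) / 2) + A"
  have "A * m\<^sup>2 * ((1 + \<bar>y\<bar>) powr (p - 1) + 1) \<le> d * \<bar>y\<bar> powr (p + 1) + E0 * (1 + m\<^sup>2) ^ k" if m: "m \<ge> 0" for m y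
  proof -
    let ?w = "(1 + m\<^sup>2) ^ k"
    have k1: "k \<ge> 1" using k p1 by (cases k) auto
    have w: "1 \<le> ?w" "m powr (p + 1) \<le> ?w" using powr_le_one_plus_sq[OF m p_ge(3) k] by (auto intro: one_le_power)
    have w2: "m\<^sup>2 \<le> ?w"
      using power_increasing[OF k1, of "1 + m\<^sup>2"] by simp
    have "(1 + \<bar>y\<bar>) powr (p - 1) * m\<^sup>2 \<le> e * (1 + \<bar>y\<bar>) powr (p + 1) + e powr ((1 - p) / 2) * m powr (p + 1)"
      using young_crude_sq[of "1 + \<bar>y\<bar>" m p e] m e p1 by simp
    also have "\<dots> \<le> e * (T * (1 + \<bar>y\<bar> powr (p + 1))) + e powr ((1 - p) / 2) * ?w"
      unfolding T_def using w e p_ge by (intro add_mono mult_left_mono one_plus_powr_le) auto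
    finally have "A * ((1 + \<bar>y\<bar>) powr (p - 1) * m\<^sup>2) \<le> A * (e * (T * (1 + \<bar>y\<bar> powr (p + 1))) + e powr ((1 - p) / 2) * ?w)"
      using A by (rule mult_left_mono)
    also have "\<dots> = A * T * e * (1 + \<bar>y\<bar> powr (p + 1)) + A * e powr ((1 - p) / 2) * ?w" by (simp add: algebra_simps)
    also have "\<dots> \<le> d * (1 + \<bar>y\<bar> powr (p + 1)) + A * e powr ((1 - p) / 2) * ?w"
      using e by (intro add_right_mono mult_right_mono) auto
    also have "d * (1 + \<bar>y\<bar> powr (p + 1)) \<le> d * \<bar>y\<bar> powr (p + 1) + d * ?w" using w d by (simp add: distrib_left)
    finally have 1: "A * ((1 + \<bar>y\<bar>) powr (p - 1) * m\<^sup>2) \<le> d * \<bar>y\<bar> powr (p + 1) + d * ?w + A * e powr ((1 - p) / 2) * ?w" by simp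
    have 2: "A * m\<^sup>2 \<le> A * ?w" using w2 A by (rule mult_left_mono)
    have "A * m\<^sup>2 * ((1 + \<bar>y\<bar>) powr (p - 1) + 1) = A * ((1 + \<bar>y\<bar>) powr (p - 1) * m\<^sup>2) + A * m\<^sup>2"
      by (simp add: algebra_simps)
    with 1 2 show ?thesis unfolding E0_def by (simp add: distrib_right)
  qed
  moreover have "E0 \<ge> 0" unfolding E0_def using d A by simp
  ultimately show ?thesis using that by blast
qed

end

section \<open>Averages in time\<close>

lemma lb_integrable_subinterval:
  "integrable (lb s T) (f :: real \<Rightarrow> real) \<Longrightarrow> s \<le> a \<Longrightarrow> b \<le> T \<Longrightarrow> integrable (lb a b) f"
  by (rule integrable_subinterval) auto

lemma AE_lebesgue_on_subset:
  assumes "AE x in lebesgue_on S. P x" "A \<subseteq> S" "S \<in> sets lebesgue" "A \<in> sets lebesgue"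
  shows "AE x in lebesgue_on A. P x"
  using assms by (auto simp: AE_restrict_space_iff elim!: eventually_mono)

text \<open>With a primitive \<open>Q\<close> of \<open>e\<close>, the integrated difference
  quotients telescope into a backward quotient of \<open>Q\<close> at \<open>t2\<close> minus one at
  \<open>t1\<close>.\<close>

lemma avg_diff_tendsto:
  fixes e :: "real \<Rightarrow> real"
  assumes e: "continuous_on UNIV e" and h: "\<And>k. h k > 0" "h \<leadsto> 0" and t: "t1 \<le> t2"
  shows "(\<lambda>k. LINT r|lb t1 t2. (e r - e (r - h k)) / h k) \<leadsto> e t2 - e t1"
proof -
  \<comment> \<open>Room of length 1 on both sides makes the end points interior, so that
    \<open>Q\<close> is differentiable there; eventually the steps are below 1.\<close>
  define a where "a = t1 - 1"
  define b where "b = t2 + 1"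
  define Q where "Q = (\<lambda>x. integral {a..x} e)"
  have ec: "continuous_on A e" for A using e continuous_on_subset by blast
  have dQ: "(Q has_real_derivative e x) (at x)" if "a < x" "x < b" for x
  proof -
    have "(Q has_vector_derivative e x) (at x within {a..b})"
      unfolding Q_def by (rule integral_has_vector_derivative[OF ec]) (use that in auto)
    then have "(Q has_vector_derivative e x) (at x within {a<..<b})"
      by (rule has_vector_derivative_within_subset) auto
    then show ?thesis using that
      by (simp add: has_real_derivative_iff_has_vector_derivative at_within_open[of x "{a<..<b}"])
  qed
  have quot: "(\<lambda>k. (Q x - Q (x - h k)) / h k) \<leadsto> e x" if "a < x" "x < b" for x
  proof -
    have "(\<lambda>d. (Q (x + d) - Q x) / d) \<midarrow>0\<rightarrow> e x" using dQ[OF that] by (simp add: DERIV_def)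
    moreover have "filterlim (\<lambda>k. - h k) (at 0) sequentially"
      using tendsto_minus[OF h(2)] h(1) by (auto simp: filterlim_at less_imp_neq[symmetric] intro!: always_eventually)
    ultimately have "(\<lambda>k. (Q (x + - h k) - Q x) / (- h k)) \<leadsto> e x" by (rule filterlim_compose)
    moreover have "(Q (x + - h k) - Q x) / (- h k) = (Q x - Q (x - h k)) / h k" for k
      using h(1)[of k] by (simp add: field_simps)
    ultimately show ?thesis by simp
  qed
  have "(\<lambda>k. (Q t2 - Q (t2 - h k)) / h k - (Q t1 - Q (t1 - h k)) / h k) \<leadsto> e t2 - e t1"
    using t by (intro tendsto_diff quot) (auto simp: a_def b_def)
  moreover have "\<forall>\<^sub>F k in sequentially. (Q t2 - Q (t2 - h k)) / h k - (Q t1 - Q (t1 - h k)) / h k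
    = (LINT r|lb t1 t2. (e r - e (r - h k)) / h k)"
    using order_tendstoD(2)[OF h(2) zero_less_one]
  proof eventually_elim
    case (elim k)
    have int: "integral {x..y} e = Q y - Q x" if "a \<le> x" "x \<le> y" for x y
      using Henstock_Kurzweil_Integration.integral_combine[of a x y e] that integrable_continuous_real[OF ec]
      by (simp add: Q_def)
    have sh: "continuous_on A (\<lambda>r. e (r - h k))" for A
      by (rule continuous_on_compose2[OF e]) (auto intro!: continuous_intros)
    have i1: "integrable (lb t1 t2) e" "integrable (lb t1 t2) (\<lambda>r. e (r - h k))"
      by (intro continuous_imp_integrable_real ec sh)+
    have "(LINT r|lb t1 t2. (e r - e (r - h k)) / h k)
      = ((LINT r|lb t1 t2. e r) - (LINT r|lb t1 t2. e (r - h k))) / h k"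
      using i1 by simp
    also have "(LINT r|lb t1 t2. e r) = Q t2 - Q t1"
      using lebesgue_integral_eq_integral[OF i1(1)] int[of t1 t2] t by (simp add: a_def)
    also have "(LINT r|lb t1 t2. e (r - h k)) = Q (t2 - h k) - Q (t1 - h k)"
    proof -
      have "(LINT r|lb t1 t2. e (r - h k)) = integral {t1..t2} (e \<circ> ((+) (- h k)))"
        using lebesgue_integral_eq_integral[OF i1(2)] by (simp add: o_def)
      also have "\<dots> = integral {t1 + - h k..t2 + - h k} e" by (rule integral_shift_Icc_real)
      also have "\<dots> = Q (t2 - h k) - Q (t1 - h k)" using int[of "t1 - h k" "t2 - h k"] t elim by (simp add: a_def)
      finally show ?thesis .
    qed
    finally show ?case by (simp add: diff_divide_distrib)
  qed
  ultimately show ?thesis by (rule Lim_transform_eventually)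
qed

text \<open>Truncation costs little in L^1. The function is an almost everywhere limit of continuous
  functions, and truncated at the same level these converge boundedly.\<close>

lemma L1_continuous_approx:
  fixes \<beta> :: "real \<Rightarrow> real"
  assumes \<beta>: "integrable (lb a b) \<beta>" and \<epsilon>: "\<epsilon> > 0"
  obtains \<gamma> where "continuous_on UNIV \<gamma>" "(LINT x|lb a b. \<bar>\<beta> x - \<gamma> x\<bar>) < \<epsilon>"
proof -
  let ?L = "lb a b"
  interpret L: finite_measure ?L by (intro finite_measure_lebesgue_on) auto
  have [measurable]: "\<beta> \<in> borel_measurable ?L" using \<beta> by auto
  define f where "f = (\<lambda>x. if x \<in> {a..b} then \<beta> x else 0)"
  have fm: "f \<in> borel_measurable lebesgue"
    unfolding f_def using \<beta> by (subst borel_measurable_if) auto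
  have "(\<lambda>k. LINT x|?L. \<bar>clip k (\<beta> x) - \<beta> x\<bar>) \<leadsto> (LINT x|?L. 0)"
  proof (rule integral_dominated_convergence[where w = "\<lambda>x. 2 * \<bar>\<beta> x\<bar>"])
    show "AE x in ?L. (\<lambda>k. \<bar>clip k (\<beta> x) - \<beta> x\<bar>) \<leadsto> 0"
      using clip_tendsto by (auto intro!: AE_I2 tendsto_rabs_zero simp: LIM_zero_iff)
    show "AE x in ?L. norm \<bar>clip k (\<beta> x) - \<beta> x\<bar> \<le> 2 * \<bar>\<beta> x\<bar>" for k
    proof (rule AE_I2)
      fix x show "norm \<bar>clip k (\<beta> x) - \<beta> x\<bar> \<le> 2 * \<bar>\<beta> x\<bar>" using clip_abs_le(1)[of k "\<beta> x"] by auto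
    qed
  qed (use \<beta> in auto)
  then have "\<forall>\<^sub>F k in sequentially. (LINT x|?L. \<bar>clip k (\<beta> x) - \<beta> x\<bar>) < \<epsilon> / 2"
    using \<epsilon> by (intro order_tendstoD(2)[where y = 0]) auto
  then obtain k where k: "(LINT x|?L. \<bar>clip k (\<beta> x) - \<beta> x\<bar>) < \<epsilon> / 2"
    unfolding eventually_sequentially by blast
  have "f measurable_on UNIV" by (rule lebesgue_measurable_imp_measurable_on_real[OF fm]) simp
  then obtain N g where g: "negligible N" "\<And>n. continuous_on UNIV (g n)" "\<And>x. x \<notin> N \<Longrightarrow> (\<lambda>n. g n x) \<leadsto> f x"
    unfolding measurable_on_def by auto
  have clipc: "continuous_on UNIV (clip k)" unfolding clip_def by (intro continuous_intros)
  have gc: "continuous_on UNIV (\<lambda>x. clip k (g n x))" for n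
    by (rule continuous_on_compose2[OF clipc g(2)]) auto
  have [measurable]: "(\<lambda>x. clip k (g n x)) \<in> borel_measurable ?L" for n
    by (intro continuous_imp_measurable_on_sets_lebesgue continuous_on_subset[OF gc]) auto
  have "(\<lambda>n. LINT x|?L. \<bar>clip k (\<beta> x) - clip k (g n x)\<bar>) \<leadsto> (LINT x|?L. 0)"
  proof (rule integral_dominated_convergence[where w = "\<lambda>x. 2 * real k"])
    have "AE x in lebesgue. x \<notin> N" using g(1) by (intro AE_not_in) (simp add: negligible_iff_null_sets)
    then have "AE x in ?L. x \<notin> N" by (auto simp: AE_restrict_space_iff elim: eventually_mono)
    then show "AE x in ?L. (\<lambda>n. \<bar>clip k (\<beta> x) - clip k (g n x)\<bar>) \<leadsto> 0"
      using AE_space[of ?L]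
    proof eventually_elim
      case (elim x)
      have "isCont (clip k) (\<beta> x)" using clipc by (simp add: continuous_on_eq_continuous_at)
      moreover have "(\<lambda>n. g n x) \<leadsto> \<beta> x" using g(3)[OF elim(1)] elim(2) by (simp add: f_def)
      ultimately have "(\<lambda>n. clip k (g n x)) \<leadsto> clip k (\<beta> x)" by (rule isCont_tendsto_compose)
      from tendsto_rabs[OF tendsto_diff[OF tendsto_const[of "clip k (\<beta> x)"] this]] show ?case by simp
    qed
    show "AE x in ?L. norm \<bar>clip k (\<beta> x) - clip k (g n x)\<bar> \<le> 2 * real k" for n
    proof (rule AE_I2)
      fix x show "norm \<bar>clip k (\<beta> x) - clip k (g n x)\<bar> \<le> 2 * real k"
        using clip_abs_le(2)[of k "\<beta> x"] clip_abs_le(2)[of k "g n x"] by auto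
    qed
  qed auto
  then have "\<forall>\<^sub>F n in sequentially. (LINT x|?L. \<bar>clip k (\<beta> x) - clip k (g n x)\<bar>) < \<epsilon> / 2"
    using \<epsilon> by (intro order_tendstoD(2)[where y = 0]) auto
  then obtain n where n: "(LINT x|?L. \<bar>clip k (\<beta> x) - clip k (g n x)\<bar>) < \<epsilon> / 2"
    unfolding eventually_sequentially by blast
  have ib: "integrable ?L (\<lambda>x. clip k (u x))" if "(\<lambda>x. clip k (u x)) \<in> borel_measurable ?L" for u
    by (rule L.integrable_const_bound[OF _ that, of "real k"]) (intro AE_I2, simp add: clip_abs_le(2))
  have i: "integrable ?L (\<lambda>x. \<bar>clip k (\<beta> x) - \<beta> x\<bar>)" "integrable ?L (\<lambda>x. \<bar>clip k (\<beta> x) - clip k (g n x)\<bar>)"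
    "integrable ?L (\<lambda>x. \<bar>\<beta> x - clip k (g n x)\<bar>)"
  proof -
    have 1: "integrable ?L (\<lambda>x. clip k (\<beta> x))" by (rule ib) measurable
    have 2: "integrable ?L (\<lambda>x. clip k (g n x))" by (rule ib) measurable
    show "integrable ?L (\<lambda>x. \<bar>clip k (\<beta> x) - \<beta> x\<bar>)" "integrable ?L (\<lambda>x. \<bar>clip k (\<beta> x) - clip k (g n x)\<bar>)"
      "integrable ?L (\<lambda>x. \<bar>\<beta> x - clip k (g n x)\<bar>)"
      by (intro integrable_abs Bochner_Integration.integrable_diff 1 2 \<beta>)+
  qed
  have "(LINT x|?L. \<bar>\<beta> x - clip k (g n x)\<bar>) \<le> (LINT x|?L. \<bar>clip k (\<beta> x) - \<beta> x\<bar> + \<bar>clip k (\<beta> x) - clip k (g n x)\<bar>)"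
    by (rule integral_mono) (use i in auto)
  also have "\<dots> < \<epsilon>" using i k n by simp
  finally show ?thesis using that[OF gc] by blast
qed

text \<open>Lebesgue differentiation in L^1. Apart from the uniform continuity of an approximant
  \<gamma>, the error consists of |\<beta> - \<gamma>| and its running average. The average
  integrates to a telescoping quotient of a primitive, so in the limit it is no larger than the
  integral of |\<beta> - \<gamma>|.\<close>

lemma avg_L1_tendsto:
  fixes \<beta> :: "real \<Rightarrow> real"
  assumes \<beta>: "integrable (lb s T) \<beta>" and t: "s < t1" "t1 \<le> t2" "t2 \<le> T"
    and h: "\<And>k. h k > 0" "h \<leadsto> 0" "\<And>k. h k \<le> t1 - s"
  shows "(\<lambda>k. LINT r|lb t1 t2. \<bar>(LINT \<tau>|lb (r - h k) r. \<beta> \<tau>) / h k - \<beta> r\<bar>) \<leadsto> 0"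
    "integrable (lb t1 t2) (\<lambda>r. LINT \<tau>|lb (r - h k) r. \<beta> \<tau>)"
proof -
  let ?L = "lb t1 t2"
  interpret L: finite_measure ?L by (intro finite_measure_lebesgue_on) auto
  have ext: "\<exists>P. continuous_on UNIV P \<and> P t1 \<ge> P t1 \<and> (\<forall>k. \<forall>r\<in>{t1..t2}. (LINT \<tau>|lb (r - h k) r. u \<tau>) = P r - P (r - h k))
      \<and> P t2 - P t1 = (LINT \<tau>|lb t1 t2. u \<tau>)"
    if u: "integrable (lb s T) u" for u :: "real \<Rightarrow> real"
  proof -
    define P0 where "P0 = (\<lambda>x. LINT \<tau>|lb s x. u \<tau>)"
    define P where "P = (\<lambda>x. P0 (max s (min T x)))"
    have "continuous_on {s..T} P0" unfolding P0_def by (rule indefinite_integral_continuous_real[OF u])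
    then have "continuous_on UNIV P" unfolding P_def
      by (rule continuous_on_compose2) (use t in \<open>auto intro!: continuous_intros\<close>)
    moreover have cmb: "(LINT \<tau>|lb x y. u \<tau>) = P y - P x" if "s \<le> x" "x \<le> y" "y \<le> T" for x y
      using lb_integral_combine[of s y u x] lb_integrable_subinterval[OF u, of s y] that
      by (simp add: P_def P0_def)
    moreover have "(LINT \<tau>|lb (r - h k) r. u \<tau>) = P r - P (r - h k)" if "r \<in> {t1..t2}" for r k
      using that t h(1)[of k] h(3)[of k] by (intro cmb) auto
    ultimately show ?thesis using t by (intro exI[of _ P]) auto
  qed
  obtain P where P: "continuous_on UNIV P" "\<And>k r. r \<in> {t1..t2} \<Longrightarrow> (LINT \<tau>|lb (r - h k) r. \<beta> \<tau>) = P r - P (r - h k)"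
    using ext[OF \<beta>] by blast
  have Pi: "integrable ?L (\<lambda>r. P r - P (r - h k))" for k
    by (intro continuous_imp_integrable_real continuous_intros continuous_on_subset[OF P(1)] continuous_on_compose2[OF P(1)]) auto
  have avgi: "integrable ?L (\<lambda>r. LINT \<tau>|lb (r - h k) r. \<beta> \<tau>)" for k
    using Bochner_Integration.integrable_cong[THEN iffD2, OF refl _ Pi[of k]] P(2) by simp
  then show "integrable ?L (\<lambda>r. LINT \<tau>|lb (r - h k) r. \<beta> \<tau>)" .
  have \<beta>L: "integrable ?L \<beta>" using lb_integrable_subinterval[OF \<beta>] t by simp
  show "(\<lambda>k. LINT r|?L. \<bar>(LINT \<tau>|lb (r - h k) r. \<beta> \<tau>) / h k - \<beta> r\<bar>) \<leadsto> 0"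
  proof (rule LIMSEQ_I)
    fix \<epsilon>' :: real assume \<epsilon>': "\<epsilon>' > 0"
    define \<epsilon> where "\<epsilon> = \<epsilon>' / (3 + (t2 - t1))"
    have \<epsilon>: "\<epsilon> > 0" using \<epsilon>' t by (simp add: \<epsilon>_def)
    obtain \<gamma> where \<gamma>: "continuous_on UNIV \<gamma>" "(LINT x|lb s T. \<bar>\<beta> x - \<gamma> x\<bar>) < \<epsilon>"
      using L1_continuous_approx[OF \<beta> \<epsilon>] by blast
    have \<gamma>i: "integrable (lb x y) \<gamma>" for x y
      by (intro continuous_imp_integrable_real continuous_on_subset[OF \<gamma>(1)]) auto
    define u where "u = (\<lambda>x. \<bar>\<beta> x - \<gamma> x\<bar>)"
    have ui: "integrable (lb s T) u" unfolding u_def using \<beta> \<gamma>i by auto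
    have uL: "integrable ?L u" using lb_integrable_subinterval[OF ui] t by simp
    obtain G where G: "continuous_on UNIV G" "\<And>k r. r \<in> {t1..t2} \<Longrightarrow> (LINT \<tau>|lb (r - h k) r. u \<tau>) = G r - G (r - h k)"
      "G t2 - G t1 = (LINT \<tau>|?L. u \<tau>)"
      using ext[OF ui] by blast
    have uu: "(LINT \<tau>|?L. u \<tau>) < \<epsilon>"
    proof -
      have "(LINT \<tau>|lb s T. u \<tau>) = (LINT \<tau>|lb s t1. u \<tau>) + ((LINT \<tau>|?L. u \<tau>) + (LINT \<tau>|lb t2 T. u \<tau>))"
        using lb_integral_combine[OF ui, of t1]
          lb_integral_combine[OF lb_integrable_subinterval[OF ui, of t1 T], of t2] t by simp
      moreover have "0 \<le> (LINT \<tau>|lb s t1. u \<tau>)" "0 \<le> (LINT \<tau>|lb t2 T. u \<tau>)"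
        by (auto intro!: Bochner_Integration.integral_nonneg simp: u_def)
      moreover have "(LINT \<tau>|lb s T. u \<tau>) < \<epsilon>" using \<gamma>(2) by (simp add: u_def)
      ultimately show ?thesis by linarith
    qed
    have "(\<lambda>k. LINT r|?L. (G r - G (r - h k)) / h k) \<leadsto> G t2 - G t1"
      by (rule avg_diff_tendsto[OF G(1) h(1,2) t(2)])
    then have ev1: "\<forall>\<^sub>F k in sequentially. (LINT r|?L. (G r - G (r - h k)) / h k) < \<epsilon>"
      by (rule order_tendstoD(2)) (simp add: G uu)
    have "uniformly_continuous_on {s..T} \<gamma>"
      by (intro compact_uniformly_continuous continuous_on_subset[OF \<gamma>(1)]) auto
    then obtain d where d: "d > 0" "\<And>x y. x \<in> {s..T} \<Longrightarrow> y \<in> {s..T} \<Longrightarrow> dist y x < d \<Longrightarrow> dist (\<gamma> y) (\<gamma> x) < \<epsilon>"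
      using \<epsilon> unfolding uniformly_continuous_on_def by metis
    have ev2: "\<forall>\<^sub>F k in sequentially. h k < d" by (rule order_tendstoD(2)[OF h(2) d(1)])
    from ev1 ev2 have "\<forall>\<^sub>F k in sequentially. (LINT r|?L. \<bar>(LINT \<tau>|lb (r - h k) r. \<beta> \<tau>) / h k - \<beta> r\<bar>) < \<epsilon>'"
    proof eventually_elim
      case (elim k)
      have Gi: "integrable ?L (\<lambda>r. (G r - G (r - h k)) / h k)"
        by (intro integrable_divide continuous_imp_integrable_real continuous_intros continuous_on_subset[OF G(1)] continuous_on_compose2[OF G(1)]) auto
      have "(LINT r|?L. \<bar>(LINT \<tau>|lb (r - h k) r. \<beta> \<tau>) / h k - \<beta> r\<bar>)
        \<le> (LINT r|?L. (G r - G (r - h k)) / h k + \<epsilon> + u r)"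
      proof (rule integral_mono)
        show "integrable ?L (\<lambda>r. \<bar>(LINT \<tau>|lb (r - h k) r. \<beta> \<tau>) / h k - \<beta> r\<bar>)"
          using avgi[of k] \<beta>L by simp
        show "integrable ?L (\<lambda>r. (G r - G (r - h k)) / h k + \<epsilon> + u r)" using Gi uL by simp
        fix r assume "r \<in> space ?L"
        then have r: "r \<in> {t1..t2}" by simp
        let ?K = "lb (r - h k) r"
        have b: "integrable ?K \<beta>" "integrable ?K u"
          using lb_integrable_subinterval[OF \<beta>, of "r - h k" r] lb_integrable_subinterval[OF ui, of "r - h k" r] r t h(3)[of k] by auto
        have mK: "measure ?K (space ?K) = h k" using h(1)[of k] by (simp add: measure_restrict_space)
        interpret K: finite_measure ?K by (intro finite_measure_lebesgue_on) auto
        have "\<bar>(LINT \<tau>|?K. \<beta> \<tau> - \<gamma> r)\<bar> \<le> (LINT \<tau>|?K. u \<tau> + \<epsilon>)"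
        proof (rule order_trans[OF integral_abs_bound integral_mono])
          fix \<tau> assume "\<tau> \<in> space ?K"
          then have "dist (\<gamma> \<tau>) (\<gamma> r) < \<epsilon>" using r t h(3)[of k] elim by (intro d(2)) (auto simp: dist_real_def)
          then show "\<bar>\<beta> \<tau> - \<gamma> r\<bar> \<le> u \<tau> + \<epsilon>" by (auto simp: u_def dist_real_def)
        qed (use b in auto)
        then have "\<bar>(LINT \<tau>|?K. \<beta> \<tau>) - h k * \<gamma> r\<bar> \<le> (LINT \<tau>|?K. u \<tau>) + h k * \<epsilon>"
          using b mK by simp
        then have "\<bar>(LINT \<tau>|?K. \<beta> \<tau>) - h k * \<gamma> r\<bar> / h k \<le> ((LINT \<tau>|?K. u \<tau>) + h k * \<epsilon>) / h k"
          using h(1)[of k] by (intro divide_right_mono) auto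
        moreover have "\<bar>(LINT \<tau>|?K. \<beta> \<tau>) - h k * \<gamma> r\<bar> / h k = \<bar>(LINT \<tau>|?K. \<beta> \<tau>) / h k - \<gamma> r\<bar>"
        proof -
          have "(LINT \<tau>|?K. \<beta> \<tau>) / h k - \<gamma> r = ((LINT \<tau>|?K. \<beta> \<tau>) - h k * \<gamma> r) / h k"
            using h(1)[of k] by (simp add: diff_divide_distrib)
          then show ?thesis using h(1)[of k] by (simp only: abs_divide abs_of_pos)
        qed
        moreover have "((LINT \<tau>|?K. u \<tau>) + h k * \<epsilon>) / h k = (G r - G (r - h k)) / h k + \<epsilon>"
          using h(1)[of k] G(2)[OF r] by (simp add: add_divide_distrib)
        moreover have "\<bar>\<gamma> r - \<beta> r\<bar> = u r" by (simp add: u_def abs_minus_commute)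
        ultimately show "\<bar>(LINT \<tau>|?K. \<beta> \<tau>) / h k - \<beta> r\<bar> \<le> (G r - G (r - h k)) / h k + \<epsilon> + u r" by linarith
      qed
      also have "\<dots> = (LINT r|?L. (G r - G (r - h k)) / h k) + \<epsilon> * (t2 - t1) + (LINT r|?L. u r)"
        using Gi uL t by (simp add: measure_restrict_space mult.commute)
      also have "\<dots> < \<epsilon> + \<epsilon> * (t2 - t1) + \<epsilon>" using elim uu by simp
      also have "\<dots> \<le> \<epsilon> * (3 + (t2 - t1))" using \<epsilon> by (simp add: algebra_simps)
      also have "\<dots> = \<epsilon>'" using t by (simp add: \<epsilon>_def)
      finally show ?case .
    qed
    then show "\<exists>no. \<forall>k\<ge>no. norm ((LINT r|?L. \<bar>(LINT \<tau>|lb (r - h k) r. \<beta> \<tau>) / h k - \<beta> r\<bar>) - 0) < \<epsilon>'"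
      unfolding eventually_sequentially by (auto simp: abs_of_nonneg)
  qed
qed

text \<open>Averaging over all base points avoids choosing a partition.\<close>

lemma increment_bound:
  fixes e :: "real \<Rightarrow> real" and \<beta> :: "'i \<Rightarrow> real \<Rightarrow> real"
  assumes e: "continuous_on {s..T} e" and I: "finite I" "\<And>r. \<iota> r \<in> I"
    and \<iota>: "\<And>i. i \<in> I \<Longrightarrow> {r \<in> {s..T}. \<iota> r = i} \<in> sets lebesgue"
    and \<beta>: "\<And>i. i \<in> I \<Longrightarrow> integrable (lb s T) (\<beta> i)"
    and g: "integrable (lb s T) g" "\<And>r. 0 \<le> g r" and \<eta>: "integrable (lb s T) \<eta>" "\<And>r. 0 \<le> \<eta> r"
    and U: "integrable (lb s T) U"
    and inc: "AE r in lb s T. \<forall>h>0. h \<le> r - s \<longrightarrow>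
       e r - e (r - h) \<le> (LINT \<tau>|lb (r - h) r. \<beta> (\<iota> r) \<tau>) + (LINT \<tau>|lb (r - h) r. g \<tau>) + h * \<eta> r"
    and le: "AE r in lb s T. \<beta> (\<iota> r) r \<le> U r + g r + \<eta> r"
    and t: "s < t1" "t1 \<le> t2" "t2 \<le> T"
  shows "e t2 - e t1 \<le> (LINT r|lb t1 t2. U r) + 2 * (LINT r|lb s T. g r) + 2 * (LINT r|lb s T. \<eta> r)"
proof -
  let ?L = "lb t1 t2" and ?I = "\<lambda>i. indicator {r \<in> {s..T}. \<iota> r = i} :: real \<Rightarrow> real"
  define e' where "e' = (\<lambda>x. e (max s (min T x)))"
  have e': "continuous_on UNIV e'" unfolding e'_def
    by (rule continuous_on_compose2[OF e]) (use t in \<open>auto intro!: continuous_intros\<close>)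
  have e'_eq: "e' x = e x" if "s \<le> x" "x \<le> T" for x using that by (simp add: e'_def)
  \<comment> \<open>Steps that tend to 0 and never exceed t1 - s, so that the backward intervals
    stay inside the domain.\<close>
  define h where "h = (\<lambda>k. (t1 - s) * inverse (real (Suc k)))"
  have h: "h k > 0" "h k \<le> t1 - s" for k
  proof -
    show "h k > 0" using t by (simp add: h_def)
    have "inverse (real (Suc k)) \<le> 1" by (rule inverse_le_1_iff[THEN iffD2]) auto
    then show "h k \<le> t1 - s" unfolding h_def using t by (intro mult_left_le) auto
  qed
  have h0: "h \<leadsto> 0" unfolding h_def by (rule tendsto_mult_right_zero[OF LIMSEQ_inverse_real_of_nat])
  have sub: "integrable ?L u" if "integrable (lb s T) u" for u :: "real \<Rightarrow> real"
    using lb_integrable_subinterval[OF that] t by simp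
  have AEsub: "AE r in ?L. Q r" if "AE r in lb s T. Q r" for Q
    by (rule AE_lebesgue_on_subset[OF that]) (use t in auto)
  define av where "av = (\<lambda>u k r. (LINT \<tau>|lb (r - h k) r. u \<tau>) / h k :: real)"
  have avi: "integrable ?L (av u k)" if "integrable (lb s T) u" for u k
    unfolding av_def by (rule integrable_divide[OF avg_L1_tendsto(2)[OF that t h(1) h0 h(2)]])
  have indm: "(\<lambda>r. ?I i r) \<in> borel_measurable ?L" if "i \<in> I" for i
    by (rule measurable_restrict_space1, rule borel_measurable_indicator, rule \<iota>[OF that])
  have indi: "integrable ?L (\<lambda>r. ?I i r * u r)" if "i \<in> I" "integrable ?L u" for i and u :: "real \<Rightarrow> real"
    by (rule Bochner_Integration.integrable_bound[OF that(2)])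
      (use indm[OF that(1)] that(2) in \<open>auto simp: indicator_def intro!: borel_measurable_times AE_I2\<close>)
  have avlim: "(\<lambda>k. LINT r|?L. ?I i r * av (\<beta> i) k r) \<leadsto> (LINT r|?L. ?I i r * \<beta> i r)"
    if i: "i \<in> I" for i
  proof (rule LIM_zero_cancel, rule Lim_null_comparison[OF _ avg_L1_tendsto(1)[OF \<beta>[OF i] t h(1) h0 h(2)]], rule always_eventually, rule allI)
    fix k
    have "norm ((LINT r|?L. ?I i r * av (\<beta> i) k r) - (LINT r|?L. ?I i r * \<beta> i r))
      = \<bar>LINT r|?L. ?I i r * av (\<beta> i) k r - ?I i r * \<beta> i r\<bar>"
      using indi[OF i avi[OF \<beta>[OF i]]] indi[OF i sub[OF \<beta>[OF i]]] by simp
    also have "\<dots> \<le> (LINT r|?L. \<bar>av (\<beta> i) k r - \<beta> i r\<bar>)"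
    proof (rule order_trans[OF integral_abs_bound integral_mono])
      show "integrable ?L (\<lambda>r. \<bar>?I i r * av (\<beta> i) k r - ?I i r * \<beta> i r\<bar>)"
        using indi[OF i avi[OF \<beta>[OF i]]] indi[OF i sub[OF \<beta>[OF i]]] by simp
    qed (use avi[OF \<beta>[OF i]] sub[OF \<beta>[OF i]] in \<open>auto simp: indicator_def\<close>)
    finally show "norm ((LINT r|?L. ?I i r * av (\<beta> i) k r) - (LINT r|?L. ?I i r * \<beta> i r))
      \<le> (LINT r|?L. \<bar>(LINT \<tau>|lb (r - h k) r. \<beta> i \<tau>) / h k - \<beta> i r\<bar>)" by (simp add: av_def)
  qed
  have avg: "(\<lambda>k. LINT r|?L. av g k r) \<leadsto> (LINT r|?L. g r)"
  proof (rule LIM_zero_cancel, rule Lim_null_comparison[OF _ avg_L1_tendsto(1)[OF g(1) t h(1) h0 h(2)]], rule always_eventually, rule allI)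
    fix k
    have "norm ((LINT r|?L. av g k r) - (LINT r|?L. g r)) = \<bar>LINT r|?L. av g k r - g r\<bar>"
      using avi[OF g(1)] sub[OF g(1)] by simp
    also have "\<dots> \<le> (LINT r|?L. \<bar>av g k r - g r\<bar>)" by (rule integral_abs_bound)
    finally show "norm ((LINT r|?L. av g k r) - (LINT r|?L. g r)) \<le> (LINT r|?L. \<bar>(LINT \<tau>|lb (r - h k) r. g \<tau>) / h k - g r\<bar>)"
      by (simp add: av_def)
  qed
  \<comment> \<open>\<open>\<iota>\<close> takes finitely many values, so the integrand with frozen
    index is a finite sum over measurable pieces, and the averages converge for each index
    separately.\<close>
  have sel: "(\<Sum>i\<in>I. ?I i x * F i) = F (\<iota> x)" if "x \<in> {t1..t2}" for x and F :: "'i \<Rightarrow> real"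
  proof -
    have *: "?I i x = (if \<iota> x = i then 1 else 0 :: real)" for i
      using that t by (auto simp: indicator_def)
    have "(\<Sum>i\<in>I. ?I i x * F i) = (\<Sum>i\<in>I. if \<iota> x = i then F i else 0)"
      unfolding * by (rule sum.cong) simp_all
    also have "\<dots> = F (\<iota> x)" unfolding sum.delta'[OF I(1)] using I(2) by simp
    finally show ?thesis .
  qed
  have bound: "(LINT r|?L. (e' r - e' (r - h k)) / h k)
     \<le> (\<Sum>i\<in>I. LINT r|?L. ?I i r * av (\<beta> i) k r) + (LINT r|?L. av g k r) + (LINT r|?L. \<eta> r)" for k
  proof -
    have "(LINT r|?L. (e' r - e' (r - h k)) / h k)
      \<le> (LINT r|?L. (\<Sum>i\<in>I. ?I i r * av (\<beta> i) k r) + av g k r + \<eta> r)"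
    proof (rule integral_mono_AE)
      show "integrable ?L (\<lambda>r. (e' r - e' (r - h k)) / h k)"
        by (intro integrable_divide continuous_imp_integrable_real continuous_intros continuous_on_subset[OF e'] continuous_on_compose2[OF e']) auto
      show "integrable ?L (\<lambda>r. (\<Sum>i\<in>I. ?I i r * av (\<beta> i) k r) + av g k r + \<eta> r)"
        by (intro Bochner_Integration.integrable_add Bochner_Integration.integrable_sum indi avi \<beta> g(1) sub[OF \<eta>(1)])
      show "AE r in ?L. (e' r - e' (r - h k)) / h k \<le> (\<Sum>i\<in>I. ?I i r * av (\<beta> i) k r) + av g k r + \<eta> r"
        using AEsub[OF inc] AE_space[of ?L]
      proof eventually_elim
        case (elim r)
        then have r: "r \<in> {t1..t2}" by simp
        have "e r - e (r - h k) \<le> (LINT \<tau>|lb (r - h k) r. \<beta> (\<iota> r) \<tau>) + (LINT \<tau>|lb (r - h k) r. g \<tau>) + h k * \<eta> r"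
          using elim(1) h(1)[of k] h(2)[of k] r by auto
        then have "(e r - e (r - h k)) / h k \<le> ((LINT \<tau>|lb (r - h k) r. \<beta> (\<iota> r) \<tau>) + (LINT \<tau>|lb (r - h k) r. g \<tau>) + h k * \<eta> r) / h k"
          using h(1)[of k] by (intro divide_right_mono) auto
        also have "\<dots> = av (\<beta> (\<iota> r)) k r + av g k r + \<eta> r"
          using h(1)[of k] by (simp add: av_def add_divide_distrib)
        finally show ?case using sel[OF r, of "\<lambda>i. av (\<beta> i) k r"] r t h(1)[of k] h(2)[of k] by (simp add: e'_eq)
      qed
    qed
    also have "\<dots> = (\<Sum>i\<in>I. LINT r|?L. ?I i r * av (\<beta> i) k r) + (LINT r|?L. av g k r) + (LINT r|?L. \<eta> r)"
      using indi[OF _ avi[OF \<beta>]] avi[OF g(1)] sub[OF \<eta>(1)] by (simp add: Bochner_Integration.integral_sum)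
    finally show ?thesis .
  qed
  \<comment> \<open>In the limit the base time and the running time coincide, so the hypothesis on
    \<open>\<beta> (\<iota> r) r\<close> applies. \<open>g\<close> and \<open>\<eta>\<close> enter
    once through the increments and once through that hypothesis, whence the factors 2.\<close>
  have "e' t2 - e' t1 \<le> (\<Sum>i\<in>I. LINT r|?L. ?I i r * \<beta> i r) + (LINT r|?L. g r) + (LINT r|?L. \<eta> r)"
    by (rule LIMSEQ_le[OF avg_diff_tendsto[OF e' h(1) h0 t(2)]
          tendsto_add[OF tendsto_add[OF tendsto_sum[OF avlim] avg] tendsto_const]]) (use bound in auto)
  also have "(\<Sum>i\<in>I. LINT r|?L. ?I i r * \<beta> i r) = (LINT r|?L. (\<Sum>i\<in>I. ?I i r * \<beta> i r))"
    by (rule Bochner_Integration.integral_sum[symmetric]) (intro indi sub \<beta>)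
  also have "\<dots> \<le> (LINT r|?L. U r + g r + \<eta> r)"
  proof (rule integral_mono_AE)
    show "AE r in ?L. (\<Sum>i\<in>I. ?I i r * \<beta> i r) \<le> U r + g r + \<eta> r"
      using AEsub[OF le] AE_space[of ?L]
    proof eventually_elim
      case (elim r)
      then show ?case using sel[of r "\<lambda>i. \<beta> i r"] by simp
    qed
  next
    show "integrable ?L (\<lambda>r. \<Sum>i\<in>I. ?I i r * \<beta> i r)"
      by (intro Bochner_Integration.integrable_sum indi sub \<beta>)
    show "integrable ?L (\<lambda>r. U r + g r + \<eta> r)" using sub[OF U] sub[OF g(1)] sub[OF \<eta>(1)] by simp
  qed
  also have "\<dots> = (LINT r|?L. U r) + (LINT r|?L. g r) + (LINT r|?L. \<eta> r)"
    using sub[OF U] sub[OF g(1)] sub[OF \<eta>(1)] by simp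
  finally have main: "e t2 - e t1 \<le> (LINT r|?L. U r) + 2 * (LINT r|?L. g r) + 2 * (LINT r|?L. \<eta> r)"
    using t by (simp add: e'_eq)
  have mono: "(LINT r|?L. u r) \<le> (LINT r|lb s T. u r)"
    if u: "integrable (lb s T) u" "\<And>r. 0 \<le> u r" for u :: "real \<Rightarrow> real"
  proof -
    have "(LINT \<tau>|lb s T. u \<tau>) = (LINT \<tau>|lb s t1. u \<tau>) + ((LINT \<tau>|?L. u \<tau>) + (LINT \<tau>|lb t2 T. u \<tau>))"
      using lb_integral_combine[OF u(1), of t1]
        lb_integral_combine[OF lb_integrable_subinterval[OF u(1), of t1 T], of t2] t by simp
    moreover have "0 \<le> (LINT \<tau>|lb s t1. u \<tau>)" "0 \<le> (LINT \<tau>|lb t2 T. u \<tau>)"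
      using u(2) by (auto intro!: Bochner_Integration.integral_nonneg)
    ultimately show ?thesis by linarith
  qed
  show ?thesis using main mono[OF g] mono[OF \<eta>] by linarith
qed

context bounded_domain
begin

section \<open>The dual norm and Riesz representatives\<close>

lemma H01_norm_cmult:
  assumes "u \<in> H0"
  shows "hnrm (\<lambda>x. c * u x) = \<bar>c\<bar> * hnrm u"
proof -
  have "(hnrm (\<lambda>x. c * u x))\<^sup>2 = en (\<lambda>x. c * u x) (\<lambda>x. c * u x)" by (simp add: en_self)
  also have "\<dots> = c * en u (\<lambda>x. c * u x)" by (rule en_cmult_left[OF assms H01_cmult(1)[OF assms]])
  also have "en u (\<lambda>x. c * u x) = en (\<lambda>x. c * u x) u" by (rule en_commute)
  also have "\<dots> = c * en u u" by (rule en_cmult_left[OF assms assms])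
  finally have "(hnrm (\<lambda>x. c * u x))\<^sup>2 = (\<bar>c\<bar> * hnrm u)\<^sup>2"
    by (simp add: en_self power_mult_distrib power2_eq_square)
  then show ?thesis by (rule power2_eq_imp_eq) auto
qed

text \<open>Cauchy-Schwarz for the energy form, with equality at the normalised
  representative.\<close>

lemma Hnorm_riesz:
  assumes u: "u \<in> H0" "\<And>v. v \<in> H0 \<Longrightarrow> F v = en u v"
  shows "Hnorm \<Lambda> F = hnrm u"
proof -
  let ?B = "{w \<in> H0. hnrm w \<le> 1}"
  have z: "(\<lambda>x. 0) \<in> ?B" using H01_norm_cmult[OF zero_H01, of 0] zero_H01 by simp
  have up: "\<bar>F w\<bar> \<le> hnrm u" if "w \<in> ?B" for w
  proof -
    have "\<bar>F w\<bar> \<le> hnrm u * hnrm w" using u that en_bound[OF u(1), of w] by simp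
    also have "\<dots> \<le> hnrm u * 1" using that by (intro mult_left_mono) auto
    finally show ?thesis by simp
  qed
  have bdd: "bdd_above ((\<lambda>w. \<bar>F w\<bar>) ` ?B)" using up by (auto intro!: bdd_aboveI)
  have "hnrm u \<le> (SUP w\<in>?B. \<bar>F w\<bar>)"
  proof (cases "hnrm u = 0")
    case True
    then show ?thesis using cSUP_upper[OF z bdd] by simp
  next
    case False
    define k where "k = 1 / hnrm u"
    define w where "w = (\<lambda>x. k * u x)"
    have "hnrm w = 1" unfolding w_def H01_norm_cmult[OF u(1)] using False by (simp add: k_def)
    then have w: "w \<in> ?B" using H01_cmult(1)[OF u(1), of k] by (simp add: w_def)
    have "F w = k * en u u"
      using u(2)[of w] w en_commute[of u w] en_cmult_left[OF u(1) u(1), of k] by (simp add: w_def)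
    also have "\<dots> = hnrm u" using False by (simp add: en_self power2_eq_square k_def)
    finally show ?thesis using cSUP_upper[OF w bdd] by (simp add: abs_of_nonneg)
  qed
  moreover have "(SUP w\<in>?B. \<bar>F w\<bar>) \<le> hnrm u" using z up by (intro cSUP_least) auto
  ultimately show ?thesis unfolding Hnorm_def by simp
qed

lemma Hdual_riesz:
  assumes "F \<in> HD"
  obtains u where "u \<in> H0" "\<And>v. v \<in> H0 \<Longrightarrow> F v = en u v"
proof -
  from riesz_energy[OF assms order_refl] obtain u where "u \<in> H0" "\<forall>v\<in>H0. en u v + 0 * ip u v = F v" by blast
  then show ?thesis by (intro that[of u]) auto
qed

lemma Hnorm_bound:
  assumes "F \<in> HD" "v \<in> H0"
  shows "\<bar>F v\<bar> \<le> Hnorm \<Lambda> F * hnrm v" "0 \<le> Hnorm \<Lambda> F"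
proof -
  obtain u where u: "u \<in> H0" "\<And>v. v \<in> H0 \<Longrightarrow> F v = en u v" using Hdual_riesz[OF assms(1)] by blast
  show "\<bar>F v\<bar> \<le> Hnorm \<Lambda> F * hnrm v" "0 \<le> Hnorm \<Lambda> F"
    using en_bound[OF u(1) assms(2)] u(2)[OF assms(2)] Hnorm_riesz[OF u] by auto
qed

text \<open>Polarisation of the dual norm becomes polarisation of the energy form of the
  representatives, so pairing with \<open>G\<close> is evaluation at its potential
  \<open>u\<close>.\<close>

lemma Hinner_eq:
  assumes F: "F \<in> HD" and u: "u \<in> H0" "\<And>v. v \<in> H0 \<Longrightarrow> G v = en u v"
  shows "Hinner \<Lambda> F G = F u"
proof -
  obtain w where w: "w \<in> H0" "\<And>v. v \<in> H0 \<Longrightarrow> F v = en w v" using Hdual_riesz[OF F] by blast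
  have 1: "Hnorm \<Lambda> (\<lambda>v. F v + G v) = hnrm (\<lambda>x. w x + u x)"
    by (rule Hnorm_riesz[OF H01_add(1)[OF w(1) u(1)]]) (simp add: w u en_add_left)
  have 2: "Hnorm \<Lambda> (\<lambda>v. F v - G v) = hnrm (\<lambda>x. w x - u x)"
    by (rule Hnorm_riesz[OF H01_diff(1)[OF w(1) u(1)]]) (simp add: w u en_diff_left)
  define m where "m = (\<lambda>x. (- 1) * u x)"
  have m: "m \<in> H0" unfolding m_def by (rule H01_cmult(1)[OF u(1)])
  have em: "en w m = - en w u" "en m m = en u u"
  proof -
    have "en m v = - en u v" if "v \<in> H0" for v unfolding m_def using en_cmult_left[OF u(1) that, of "- 1"] by simp
    from this[OF w(1)] this[OF m] this[OF u(1)] show "en w m = - en w u" "en m m = en u u"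
      by (auto simp: en_commute[of w] en_commute[of u m])
  qed
  have "(\<lambda>x. w x - u x) = (\<lambda>x. w x + m x)" by (simp add: m_def)
  then have "(hnrm (\<lambda>x. w x - u x))\<^sup>2 = en w w - 2 * en w u + en u u"
    using en_add_sq[OF w(1) m] em by (simp add: en_self)
  moreover have "(hnrm (\<lambda>x. w x + u x))\<^sup>2 = en w w + 2 * en w u + en u u"
    using en_add_sq[OF w(1) u(1)] by (simp add: en_self)
  ultimately show ?thesis unfolding Hinner_def 1 2 using w(2)[OF u(1)] by simp
qed

end

section \<open>Measurability in time\<close>

lemma AE_limit_measurable:
  fixes f :: "'a::euclidean_space \<Rightarrow> real"
  assumes g: "\<And>j::nat. g j \<in> borel_measurable (lebesgue_on S)" and S: "S \<in> sets lebesgue"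
    and lim: "AE t in lebesgue_on S. (\<lambda>j. g j t) \<leadsto> f t"
  shows "f \<in> borel_measurable (lebesgue_on S)"
proof -
  have "(\<lambda>t. lim (\<lambda>j. g j t)) \<in> borel_measurable (lebesgue_on S)" by (rule borel_measurable_lim_metric[OF g])
  then have 1: "(\<lambda>t. if t \<in> S then lim (\<lambda>j. g j t) else 0) \<in> borel_measurable lebesgue" using S by (simp add: borel_measurable_if)
  have "AE t in lebesgue. t \<in> S \<longrightarrow> (\<lambda>j. g j t) \<leadsto> f t" using lim S by (simp add: AE_restrict_space_iff)
  then have "AE t in lebesgue. (if t \<in> S then lim (\<lambda>j. g j t) else 0) = (if t \<in> S then f t else 0)"
    by eventually_elim (auto simp: limI)
  from borel_measurable_AE[OF 1 this] show ?thesis using S by (simp add: borel_measurable_if)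
qed

text \<open>Arguments closer than the distance \<open>d\<close> from uniform continuity contribute
  \<epsilon>; for all others |x - y|^q / d^q is at least 1 and absorbs twice the supremum. This
  makes truncated superposition operators continuous with respect to L^q convergence.\<close>

lemma bounded_uniform_modulus:
  fixes h :: "real \<Rightarrow> real"
  assumes h: "continuous_on UNIV h" and q: "q \<ge> 1" and \<epsilon>: "\<epsilon> > 0"
  obtains C where "C \<ge> 0" "\<And>x y. \<bar>h (clip k x) - h (clip k y)\<bar> \<le> \<epsilon> + C * \<bar>x - y\<bar> powr q"
proof -
  let ?I = "{- real k..real k}"
  have c: "continuous_on ?I h" using h continuous_on_subset by blast
  then have "uniformly_continuous_on ?I h" by (rule compact_uniformly_continuous) simp
  then obtain d where d: "d > 0" "\<And>x y. x \<in> ?I \<Longrightarrow> y \<in> ?I \<Longrightarrow> dist y x < d \<Longrightarrow> dist (h y) (h x) < \<epsilon>"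
    using \<epsilon> unfolding uniformly_continuous_on_def by metis
  have "bounded (h ` ?I)" by (intro compact_imp_bounded compact_continuous_image c) simp
  then obtain B where B: "\<And>x. x \<in> ?I \<Longrightarrow> \<bar>h x\<bar> \<le> B" unfolding bounded_iff by (metis imageI real_norm_def)
  have B0: "B \<ge> 0" using B[of 0] by auto
  have cl: "clip k x \<in> ?I" for x using clip_abs_le(2)[of k x] by auto
  have "\<bar>h (clip k x) - h (clip k y)\<bar> \<le> \<epsilon> + 2 * B / d powr q * \<bar>x - y\<bar> powr q" for x y
  proof (cases "\<bar>x - y\<bar> < d")
    case True
    have "\<bar>clip k x - clip k y\<bar> \<le> \<bar>x - y\<bar>" unfolding clip_def by (auto simp: max_def min_def)
    then have "\<bar>h (clip k x) - h (clip k y)\<bar> < \<epsilon>" using d(2)[OF cl cl, of x y] True by (simp add: dist_real_def)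
    moreover have "0 \<le> 2 * B / d powr q * \<bar>x - y\<bar> powr q" using B0 by simp
    ultimately show ?thesis by linarith
  next
    case False
    have "2 * B = 2 * B / d powr q * d powr q" using d(1) by simp
    also have "\<dots> \<le> 2 * B / d powr q * \<bar>x - y\<bar> powr q"
      using False d(1) q B0 by (intro mult_left_mono powr_mono2) auto
    finally show ?thesis using B[OF cl, of x] B[OF cl, of y] \<epsilon> by linarith
  qed
  moreover have "0 \<le> 2 * B / d powr q" using B0 by simp
  ultimately show ?thesis by (rule that[rotated])
qed

lemma simple_function_lebesgue_on_subset:
  assumes "simple_function (lebesgue_on A) f" "B \<subseteq> A" "A \<in> sets lebesgue" "B \<in> sets lebesgue"
  shows "simple_function (lebesgue_on B) f"
proof -
  have "finite (f ` A)" using assms(1) by (simp add: simple_function_def)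
  then have "finite (f ` B)" by (rule finite_subset[rotated]) (use assms(2) in auto)
  moreover have "f -` {x} \<inter> B \<in> sets (lebesgue_on B)" if "x \<in> f ` B" for x
  proof -
    have "f -` {x} \<inter> A \<in> sets (lebesgue_on A)" using assms(1,2) that by (auto simp: simple_function_def)
    then have "f -` {x} \<inter> A \<in> sets lebesgue" using assms(3) by (simp add: sets_restrict_space_iff)
    then have "(f -` {x} \<inter> A) \<inter> B \<in> sets lebesgue" using assms(4) by blast
    moreover have "(f -` {x} \<inter> A) \<inter> B = f -` {x} \<inter> B" using assms(2) by auto
    ultimately show ?thesis using assms(4) by (simp add: sets_restrict_space_iff)
  qed
  ultimately show ?thesis by (simp add: simple_function_def)
qed

lemma integrable_lebesgue_on_bounded_interval:
  fixes f :: "real \<Rightarrow> real"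
  assumes "f \<in> borel_measurable (lb s T)" "integrable (lb s T) g"
    and "\<And>t. t \<in> {s..T} \<Longrightarrow> \<bar>f t\<bar> \<le> g t"
  shows "integrable (lb s T) f"
  by (rule Bochner_Integration.integrable_bound[OF assms(2,1)]) (use assms(3) in \<open>auto intro!: AE_I2 intro: order_trans[OF _ abs_ge_self]\<close>)

context bounded_domain
begin

text \<open>The functions \<open>h (f x + w \<tau> x) v x\<close> need not be jointly measurable in \<open>(\<tau>, x)\<close>; truncation makes
  the integral depend continuously on \<open>f\<close> in \<open>L\<^sup>q\<close>, so that simple functions can be used.\<close>

lemma nemytskii_measurable:
  fixes h :: "real \<Rightarrow> real" and s T :: real
  assumes q: "q \<ge> 1" and h: "continuous_on UNIV h" and H: "\<And>k y. \<bar>h (clip k y)\<bar> \<le> H y"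
    and w: "\<And>\<tau>. w \<tau> \<in> BM" "\<And>x. x \<in> \<Lambda> \<Longrightarrow> continuous_on UNIV (\<lambda>\<tau>. w \<tau> x)" and v: "v \<in> BM"
    and S: "\<And>j::nat. simple_function (lb s T) (S j)" "\<And>j t. t \<in> {s..T} \<Longrightarrow> Lp_integrable q (S j t)"
    and z: "\<And>t. t \<in> {s..T} \<Longrightarrow> Lp_integrable q (z t)"
    and lim: "AE t in lb s T. (\<lambda>j. LINT x|M. \<bar>S j t x - z t x\<bar> powr q) \<leadsto> 0"
    and int: "\<And>t. t \<in> {s..T} \<Longrightarrow> intM (\<lambda>x. H (z t x + w t x) * \<bar>v x\<bar>)"
  shows "(\<lambda>t. LINT x|M. h (z t x + w t x) * v x) \<in> borel_measurable (lb s T)"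
proof -
  let ?L = "lb s T"
  have hm: "h \<in> borel_measurable borel" by (rule borel_measurable_continuous_onI[OF h])
  define G where "G = (\<lambda>k t f. LINT x|M. h (clip k (f x + w t x)) * clip k (v x))"
  have B: "\<exists>B. \<forall>y. \<bar>h (clip k y)\<bar> \<le> B" for k
  proof -
    have "bounded (h ` {- real k..real k})"
      by (intro compact_imp_bounded compact_continuous_image continuous_on_subset[OF h]) auto
    then obtain B where "\<And>x. x \<in> {- real k..real k} \<Longrightarrow> \<bar>h x\<bar> \<le> B" unfolding bounded_iff by (metis imageI real_norm_def)
    then show ?thesis using clip_abs_le(2)[of k] by (intro exI[of _ B]) (metis abs_le_D1 abs_le_D2 atLeastAtMost_iff minus_le_iff)
  qed
  have meas: "(\<lambda>x. h (clip k (f x + w t x)) * clip k (v x)) \<in> BM" if "f \<in> BM" for k t f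
    using that w(1)[of t] v hm by measurable
  \<comment> \<open>For a fixed function \<open>f\<close> the truncated integral is continuous in
    time, by pointwise continuity of \<open>w\<close> and bounded convergence.\<close>
  have G_time: "continuous_on UNIV (\<lambda>t. G k t f)" if f: "f \<in> BM" for k f
  proof -
    obtain B where B: "\<And>y. \<bar>h (clip k y)\<bar> \<le> B" using B by blast
    have "(\<lambda>i. G k (r i) f) \<leadsto> G k t f" if r: "r \<leadsto> t" for r t
      unfolding G_def
    proof (rule integral_dominated_convergence[where w = "\<lambda>x. B * real k"])
      show "AE x in M. (\<lambda>i. h (clip k (f x + w (r i) x)) * clip k (v x)) \<leadsto> h (clip k (f x + w t x)) * clip k (v x)"
      proof (rule AE_I2)
        fix x assume "x \<in> space M"
        then have "x \<in> \<Lambda>" by simp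
        have 1: "isCont h y" for y using h by (simp add: continuous_on_eq_continuous_at)
        have 2: "isCont (clip k) y" for y unfolding clip_def by (intro continuous_intros)
        have "isCont (\<lambda>\<tau>. w \<tau> x) t" using w(2)[OF \<open>x \<in> \<Lambda>\<close>] by (simp add: continuous_on_eq_continuous_at)
        from isCont_tendsto_compose[OF this r] have "(\<lambda>i. f x + w (r i) x) \<leadsto> f x + w t x" by (intro tendsto_intros)
        then show "(\<lambda>i. h (clip k (f x + w (r i) x)) * clip k (v x)) \<leadsto> h (clip k (f x + w t x)) * clip k (v x)"
          by (intro tendsto_mult_right isCont_tendsto_compose[OF 1] isCont_tendsto_compose[OF 2])
      qed
      show "AE x in M. norm (h (clip k (f x + w (r i) x)) * clip k (v x)) \<le> B * real k" for i
        using B clip_abs_le(2)[of k] by (intro AE_I2) (auto simp: abs_mult intro!: mult_mono order_trans[OF abs_ge_zero B])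
    qed (use meas f M.integrable_const in auto)
    then show ?thesis by (simp add: continuous_on_sequentially o_def)
  qed
  \<comment> \<open>A simple function of time takes finitely many values in the function space, so
    the dependence on time is a finite sum of continuous functions cut off by measurable
    sets.\<close>
  have G_simple: "(\<lambda>t. G k t (S j t)) \<in> borel_measurable ?L" for k j
  proof -
    have fin: "finite (S j ` {s..T})" using S(1)[of j] by (simp add: simple_function_def)
    have ind: "(\<lambda>t. indicator (S j -` {f} \<inter> {s..T}) t :: real) \<in> borel_measurable ?L" if "f \<in> S j ` {s..T}" for f
      using S(1)[of j] that by (intro borel_measurable_indicator) (auto simp: simple_function_def)
    have "(\<lambda>t. \<Sum>f\<in>S j ` {s..T}. indicator (S j -` {f} \<inter> {s..T}) t * G k t f) \<in> borel_measurable ?L"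
    proof (intro borel_measurable_sum borel_measurable_times ind)
      fix f assume "f \<in> S j ` {s..T}"
      then have fm: "f \<in> BM" using S(2) by (auto simp: Lp_integrable_def)
      show "(\<lambda>t. G k t f) \<in> borel_measurable ?L"
        by (intro continuous_imp_measurable_on_sets_lebesgue continuous_on_subset[OF G_time[OF fm]]) auto
    qed
    then show ?thesis
    proof (rule measurable_cong[THEN iffD1, rotated])
      fix t assume "t \<in> space ?L"
      then have t: "t \<in> {s..T}" by simp
      have *: "indicator (S j -` {f} \<inter> {s..T}) t * G k t f = (if S j t = f then G k t f else 0)" for f
        using t by (auto simp: indicator_def)
      show "(\<Sum>f\<in>S j ` {s..T}. indicator (S j -` {f} \<inter> {s..T}) t * G k t f) = G k t (S j t)"
        unfolding * sum.delta'[OF fin] using t by auto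
    qed
  qed
  have G_lim: "(\<lambda>j. G k t (f j)) \<leadsto> G k t g"
    if f: "\<And>j. Lp_integrable q (f j)" "Lp_integrable q g" "(\<lambda>j. LINT x|M. \<bar>f j x - g x\<bar> powr q) \<leadsto> 0" for k t f g
  proof (rule LIMSEQ_I)
    fix r :: real assume r: "r > 0"
    obtain B where B: "\<And>y. \<bar>h (clip k y)\<bar> \<le> B" using B by blast
    have B0: "B \<ge> 0" using B[of 0] by auto
    define \<epsilon> where "\<epsilon> = r / (2 * (real k * measure M (space M) + 1))"
    have pos: "0 \<le> real k * measure M (space M)" by simp
    then have pos': "0 < real k * measure M (space M) + 1" by linarith
    have \<epsilon>: "\<epsilon> > 0" using r pos' by (simp add: \<epsilon>_def)
    obtain C where C: "C \<ge> 0" "\<And>x y. \<bar>h (clip k x) - h (clip k y)\<bar> \<le> \<epsilon> + C * \<bar>x - y\<bar> powr q"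
      using bounded_uniform_modulus[OF h q \<epsilon>] by blast
    have gi: "intM (\<lambda>x. h (clip k (f x + w t x)) * clip k (v x))" if "f \<in> BM" for f
      by (rule M.integrable_const_bound[where B = "B * real k", OF _ meas[OF that]])
        (use B clip_abs_le(2)[of k] in \<open>auto simp: abs_mult intro!: AE_I2 mult_mono order_trans[OF abs_ge_zero B]\<close>)
    have bd: "\<bar>G k t (f j) - G k t g\<bar> \<le> real k * measure M (space M) * \<epsilon> + real k * C * (LINT x|M. \<bar>f j x - g x\<bar> powr q)" for j
    proof -
      have di: "intM (\<lambda>x. \<bar>f j x - g x\<bar> powr q)" using Lp_integrable_diff[OF q f(1,2)] by (simp add: Lp_integrable_def)
      have m: "f j \<in> BM" "g \<in> BM" using f(1)[of j] f(2) by (auto simp: Lp_integrable_def)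
      have "\<bar>G k t (f j) - G k t g\<bar> = \<bar>LINT x|M. h (clip k (f j x + w t x)) * clip k (v x) - h (clip k (g x + w t x)) * clip k (v x)\<bar>"
        unfolding G_def using gi[OF m(1)] gi[OF m(2)] by simp
      also have "\<dots> \<le> (LINT x|M. real k * \<epsilon> + real k * C * \<bar>f j x - g x\<bar> powr q)"
      proof (rule order_trans[OF integral_abs_bound integral_mono])
        fix x
        have "\<bar>h (clip k (f j x + w t x)) * clip k (v x) - h (clip k (g x + w t x)) * clip k (v x)\<bar>
          = \<bar>h (clip k (f j x + w t x)) - h (clip k (g x + w t x))\<bar> * \<bar>clip k (v x)\<bar>"
          by (simp add: abs_mult[symmetric] left_diff_distrib)
        also have "\<dots> \<le> (\<epsilon> + C * \<bar>(f j x + w t x) - (g x + w t x)\<bar> powr q) * real k"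
          using \<epsilon> C(1) by (intro mult_mono C(2) clip_abs_le(2)) auto
        finally show "\<bar>h (clip k (f j x + w t x)) * clip k (v x) - h (clip k (g x + w t x)) * clip k (v x)\<bar>
            \<le> real k * \<epsilon> + real k * C * \<bar>f j x - g x\<bar> powr q" by (simp add: algebra_simps)
      qed (use gi[OF m(1)] gi[OF m(2)] di in auto)
      also have "\<dots> = real k * measure M (space M) * \<epsilon> + real k * C * (LINT x|M. \<bar>f j x - g x\<bar> powr q)"
        using di by simp
      finally show ?thesis .
    qed
    have "(\<lambda>j. real k * C * (LINT x|M. \<bar>f j x - g x\<bar> powr q)) \<leadsto> 0"
      by (rule tendsto_mult_right_zero[OF f(3)])
    from order_tendstoD(2)[OF this, of "r / 2"] r
    have "\<forall>\<^sub>F j in sequentially. real k * C * (LINT x|M. \<bar>f j x - g x\<bar> powr q) < r / 2" by simp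
    then have "\<forall>\<^sub>F j in sequentially. norm (G k t (f j) - G k t g) < r"
    proof eventually_elim
      case (elim j)
      have "real k * measure M (space M) * \<epsilon> \<le> (real k * measure M (space M) + 1) * \<epsilon>"
        using \<epsilon> by (intro mult_right_mono) auto
      also have "\<dots> = r / 2" unfolding \<epsilon>_def using pos' by (simp only: mult.commute[of 2] times_divide_eq_right divide_divide_eq_left[symmetric]) simp
      finally show ?case using bd[of j] elim by simp
    qed
    then show "\<exists>no. \<forall>j\<ge>no. norm (G k t (f j) - G k t g) < r" unfolding eventually_sequentially .
  qed
  have Gm: "(\<lambda>t. G k t (z t)) \<in> borel_measurable ?L" for k
  proof (rule AE_limit_measurable[OF G_simple])
    show "AE t in ?L. (\<lambda>j. G k t (S j t)) \<leadsto> G k t (z t)"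
      using lim AE_space[of ?L]
    proof eventually_elim
      case (elim t)
      then show ?case using S(2) z by (intro G_lim) auto
    qed
  qed auto
  show ?thesis
  proof (rule AE_limit_measurable[OF Gm])
    show "AE t in ?L. (\<lambda>k. G k t (z t)) \<leadsto> (LINT x|M. h (z t x + w t x) * v x)"
    proof (rule AE_I2)
      fix t assume "t \<in> space ?L"
      then have t: "t \<in> {s..T}" by simp
      have zm: "z t \<in> BM" using z[OF t] by (simp add: Lp_integrable_def)
      show "(\<lambda>k. G k t (z t)) \<leadsto> (LINT x|M. h (z t x + w t x) * v x)"
        unfolding G_def
      proof (rule integral_dominated_convergence[OF _ meas[OF zm] int[OF t]])
        show "(\<lambda>x. h (z t x + w t x) * v x) \<in> BM" using zm w(1)[of t] v hm by measurable
        show "AE x in M. (\<lambda>k. h (clip k (z t x + w t x)) * clip k (v x)) \<leadsto> h (z t x + w t x) * v x"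
        proof (rule AE_I2)
          fix x
          have 1: "isCont h y" for y using h by (simp add: continuous_on_eq_continuous_at)
          show "(\<lambda>k. h (clip k (z t x + w t x)) * clip k (v x)) \<leadsto> h (z t x + w t x) * v x"
            by (intro tendsto_mult isCont_tendsto_compose[OF 1] clip_tendsto)
        qed
        show "AE x in M. norm (h (clip k (z t x + w t x)) * clip k (v x)) \<le> H (z t x + w t x) * \<bar>v x\<bar>" for k
          using H clip_abs_le(1)[of k] by (intro AE_I2) (auto simp: abs_mult intro!: mult_mono order_trans[OF abs_ge_zero H])
      qed
    qed
  qed auto
qed

text \<open>The difference is tested with the truncation of its own resolvent u; then the integral
  of \<open>clip 1 u * u\<close> vanishes, so u = 0. The truncation is bounded, so test functions
  that are admissible in the weak equation suffice.\<close>

lemma Heq_of_resolvent_test: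
  assumes F: "F \<in> HD" and G: "G \<in> HD" and n: "n > 0"
    and eq: "\<And>f. f \<in> BM \<Longrightarrow> bounded (f ` \<Lambda>) \<Longrightarrow> F (J n f) = G (J n f)"
  shows "Heq \<Lambda> F G"
proof -
  define D where "D = (\<lambda>u. F u - G u)"
  have D: "D \<in> HD" unfolding D_def by (rule Hdual_diff[OF F G])
  note u = res_spec(1)[OF D n]
  have um: "L2 (res n D)" by (rule H01_L2[OF u])
  let ?f = "\<lambda>x. clip 1 (res n D x)"
  have fm: "?f \<in> BM" using um by (auto simp: sq_integrable_def)
  have fb: "bounded (?f ` \<Lambda>)" using clip_abs_le(2)[of 1] by (intro boundedI[of _ 1]) auto
  note fs = clip_L2_tendsto(1)[OF um, of 1]
  have "ip ?f (res n D) = D (J n ?f)" using res_sym[OF D embH_Hdual[OF fs] n] by (simp add: embH_ip)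
  also have "\<dots> = 0" using eq[OF fm fb] by (subst D_def) simp
  finally have 0: "(LINT x|M. ?f x * res n D x) = 0" by (simp add: ip_def)
  have "AE x in M. ?f x * res n D x = 0"
  proof (rule integral_nonneg_eq_0_iff_AE[THEN iffD1, OF _ _ 0])
    show "intM (\<lambda>x. ?f x * res n D x)" by (rule L2_mult[OF fs um])
    show "AE x in M. 0 \<le> ?f x * res n D x" by (intro AE_I2) (auto simp: clip_def max_def min_def zero_le_mult_iff)
  qed
  then have z: "AE x in M. res n D x = 0" by eventually_elim (auto simp: clip_def max_def min_def split: if_splits)
  have "D (res n D) = D (\<lambda>x. 0)" by (rule Hdual_cong_AE[OF D u zero_H01 z])
  also have "\<dots> = 0" using HdualD(2)[OF D zero_H01, of 0] by simp
  finally have "en (res n D) (res n D) / n + (nrm (res n D))\<^sup>2 = 0" using res_energy[OF D n] by simp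
  moreover have "0 \<le> en (res n D) (res n D) / n" using n en_nonneg[of "res n D"] by simp
  ultimately have "en (res n D) (res n D) = 0" "nrm (res n D) = 0" using n
    by (smt (verit) zero_le_power2 divide_eq_0_iff zero_eq_power2)+
  then have e0: "hnrm (res n D) = 0" "nrm (res n D) = 0" by (auto simp: en_self)
  show ?thesis unfolding Heq_def
  proof
    fix v assume v: "v \<in> H0"
    have "en (res n D) v = 0" using en_bound[OF u v] e0 by simp
    moreover have "ip (res n D) v = 0" using ip_bound[OF um H01_L2[OF v]] e0 by simp
    ultimately have "n * D v = 0" using res_spec(2)[OF D n v] by simp
    then show "F v = G v" using n by (simp add: D_def)
  qed
qed

end

section \<open>The pathwise equation\<close>

lemma abs_convex_bound:
  fixes x y u v d c b :: real
  assumes "x = y + 2 * (u - v) + d" "0 \<le> d" "d \<le> c" "\<bar>u - v\<bar> \<le> b"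
  shows "\<bar>x - y\<bar> \<le> 2 * b + c"
proof (rule abs_leI)
  have "u - v \<le> b" "- (u - v) \<le> b" using assms(4) by (simp_all only: abs_le_iff)
  then show "x - y \<le> 2 * b + c" "- (x - y) \<le> 2 * b + c" using assms(1-3) by (simp_all add: algebra_simps)
qed

lemma convex_bound:
  fixes x y u v d :: real
  assumes "x = y + 2 * (u - v) + d" "0 \<le> d"
  shows "y - x \<le> 2 * (v - u)"
  using assms by (simp add: algebra_simps)

lemma abs_add_powr_le:
  fixes s t q :: real
  assumes "q \<ge> 1"
  shows "\<bar>s + t\<bar> powr q \<le> 2 powr q * (\<bar>s\<bar> powr q + \<bar>t\<bar> powr q)"
proof -
  have "\<bar>s + t\<bar> powr q \<le> (2 * max \<bar>s\<bar> \<bar>t\<bar>) powr q" using assms by (intro powr_mono2) auto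
  also have "\<dots> = 2 powr q * (max \<bar>s\<bar> \<bar>t\<bar>) powr q" by (simp add: powr_mult)
  also have "(max \<bar>s\<bar> \<bar>t\<bar>) powr q \<le> \<bar>s\<bar> powr q + \<bar>t\<bar> powr q" by (auto simp: max_def)
  finally show ?thesis by (simp add: mult_left_mono)
qed

lemma (in bounded_domain) Lp_add_le:
  assumes "q \<ge> 1" "Lp_integrable q f" "Lp_integrable q g"
  shows "(LINT x|M. \<bar>f x + g x\<bar> powr q) \<le> 2 powr q * ((LINT x|M. \<bar>f x\<bar> powr q) + (LINT x|M. \<bar>g x\<bar> powr q))"
proof -
  have "(LINT x|M. \<bar>f x + g x\<bar> powr q) \<le> (LINT x|M. 2 powr q * (\<bar>f x\<bar> powr q + \<bar>g x\<bar> powr q))"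
    by (rule integral_mono) (use assms Lp_integrable_add[OF assms] abs_add_powr_le[OF assms(1)] in \<open>auto simp: Lp_integrable_def\<close>)
  then show ?thesis using assms by (simp add: Lp_integrable_def)
qed

lemma (in porous) \<Phi>_pairing_bound:
  assumes "\<delta> > 0" "Lp Y" "Lp u"
  shows "\<bar>ip (\<lambda>x. \<Phi> (Y x)) u\<bar> \<le> (c1 + c2) * (\<delta> * (measure M (space M) + (LINT x|M. \<bar>Y x\<bar> powr (p + 1))) + \<delta> powr (- p) * (LINT x|M. \<bar>u x\<bar> powr (p + 1)))"
proof -
  have "\<bar>ip (\<lambda>x. \<Phi> (Y x)) u\<bar> \<le> (LINT x|M. (c1 + c2) * (\<delta> * (1 + \<bar>Y x\<bar> powr (p + 1)) + \<delta> powr (- p) * \<bar>u x\<bar> powr (p + 1)))"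
    unfolding ip_def
  proof (rule order_trans[OF integral_abs_bound integral_mono])
    show "intM (\<lambda>x. \<bar>\<Phi> (Y x) * u x\<bar>)" using \<Phi>_integrable[OF assms(2,3)] by simp
    show "intM (\<lambda>x. (c1 + c2) * (\<delta> * (1 + \<bar>Y x\<bar> powr (p + 1)) + \<delta> powr (- p) * \<bar>u x\<bar> powr (p + 1)))"
      using assms by (auto simp: Lp_integrable_def)
    show "\<bar>\<Phi> (Y x) * u x\<bar> \<le> (c1 + c2) * (\<delta> * (1 + \<bar>Y x\<bar> powr (p + 1)) + \<delta> powr (- p) * \<bar>u x\<bar> powr (p + 1))" for x
      using \<Phi>_young[OF assms(1)] by (simp add: abs_mult)
  qed
  also have "\<dots> = (c1 + c2) * (\<delta> * (measure M (space M) + (LINT x|M. \<bar>Y x\<bar> powr (p + 1))) + \<delta> powr (- p) * (LINT x|M. \<bar>u x\<bar> powr (p + 1)))"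
    using assms by (simp add: Lp_integrable_def)
  finally show ?thesis .
qed

text \<open>The equation on a bounded time interval, detached from the probability space:
  \<open>w\<close> is the noise, \<open>X0\<close> the initial functional, and the simple functions
  \<open>S\<close> approximate \<open>z\<close>, which represents \<open>Z\<close> at almost every
  time.\<close>

locale porous_path = porous +
  fixes s T B :: real and w z :: "real \<Rightarrow> 'a \<Rightarrow> real" and S :: "nat \<Rightarrow> real \<Rightarrow> 'a \<Rightarrow> real"
    and Z :: "real \<Rightarrow> 'a functional" and X0 :: "'a functional"
  assumes w_cont: "continuous_on UNIV (w \<tau>)" and w_time: "x \<in> \<Lambda> \<Longrightarrow> continuous_on UNIV (\<lambda>\<tau>. w \<tau> x)"
    and w_bound: "\<tau> \<in> {s..T} \<Longrightarrow> x \<in> \<Lambda> \<Longrightarrow> \<bar>w \<tau> x\<bar> \<le> B"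
    and z_Lp: "\<tau> \<in> {s..T} \<Longrightarrow> Lp (z \<tau>)"
    and S_simple: "simple_function (lb s T) (S j)"
    and S_Lp: "\<tau> \<in> {s..T} \<Longrightarrow> Lp (S j \<tau>)"
    and S_lim: "AE \<tau> in lb s T. (\<lambda>j. LINT x|lebesgue_on \<Lambda>. \<bar>S j \<tau> x - z \<tau> x\<bar> powr (p + 1)) \<leadsto> 0"
    and z_int: "integrable (lb s T) (\<lambda>\<tau>. LINT x|lebesgue_on \<Lambda>. \<bar>z \<tau> x\<bar> powr (p + 1))"
    and Z_Hdual: "\<tau> \<in> {s..T} \<Longrightarrow> Z \<tau> \<in> HD" and X0_Hdual: "X0 \<in> HD"
    and Z_cont: "\<tau> \<in> {s..T} \<Longrightarrow> ((\<lambda>r. Hnorm \<Lambda> (\<lambda>u. Z r u - Z \<tau> u)) \<longlongrightarrow> 0) (at \<tau> within {s..T})"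
    and Z_z: "AE \<tau> in lb s T. Heq \<Lambda> (Z \<tau>) (emb (z \<tau>))"
    and Z_eq: "Lp v \<Longrightarrow> \<tau> \<in> {s..T} \<Longrightarrow> Hinner \<Lambda> (Z \<tau>) (emb v) = Hinner \<Lambda> X0 (emb v)
        - (LINT r|lebesgue_on {s..\<tau>}. LINT x|lebesgue_on \<Lambda>. \<Phi> (z r x + w r x) * v x)"
begin

abbreviation "L \<equiv> lb s T"

sublocale L: finite_measure L by (rule finite_measure_lebesgue_on) auto

definition Y where "Y \<tau> x = z \<tau> x + w \<tau> x"
definition YN where "YN \<tau> = (LINT x|M. \<bar>Y \<tau> x\<bar> powr (p + 1))"
text \<open>The equation can be tested with functions that do not depend on time, so
  \<open>f\<close> is fixed while \<tau> varies; \<open>n * pairing n f \<tau>\<close> is the rate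
  at which \<open>Z \<tau> (J n f)\<close> decreases.\<close>

definition pairing where "pairing n f \<tau> = ip (\<lambda>x. \<Phi> (Y \<tau> x)) (\<lambda>x. f x - J n f x)"
definition e where "e n \<tau> = Z \<tau> (res n (Z \<tau>))"

lemma w_meas: "w \<tau> \<in> BM" by (rule continuous_measurable_M[OF w_cont])

lemma w_Lp: "\<tau> \<in> {s..T} \<Longrightarrow> Lp (w \<tau>)"
  by (rule Lp_integrable_bounded[OF p_ge(3) w_meas w_bound])

lemma Y_Lp: "\<tau> \<in> {s..T} \<Longrightarrow> Lp (Y \<tau>)"
  unfolding Y_def by (rule Lp_integrable_add[OF p_ge(2) z_Lp w_Lp])

lemma S_lim': "AE \<tau> in L. (\<lambda>j. LINT x|M. \<bar>z \<tau> x - S j \<tau> x\<bar> powr (p + 1)) \<leadsto> 0"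
  using S_lim by (simp add: abs_minus_commute)

lemma nemytskii_powr_measurable:
  assumes g: "\<And>\<tau>. g \<tau> \<in> BM" "\<And>x. x \<in> \<Lambda> \<Longrightarrow> continuous_on UNIV (\<lambda>\<tau>. g \<tau> x)"
    "\<And>\<tau>. \<tau> \<in> {s..T} \<Longrightarrow> Lp (g \<tau>)"
  shows "(\<lambda>\<tau>. LINT x|M. \<bar>z \<tau> x + g \<tau> x\<bar> powr (p + 1)) \<in> borel_measurable L"
proof -
  have "continuous_on UNIV (\<lambda>y::real. \<bar>y\<bar> powr (p + 1))" using p1 by (intro continuous_on_powr' continuous_intros) auto
  then have "(\<lambda>\<tau>. LINT x|M. \<bar>z \<tau> x + g \<tau> x\<bar> powr (p + 1) * 1) \<in> borel_measurable L"
  proof (rule nemytskii_measurable[OF p_ge(2), where H = "\<lambda>y. \<bar>y\<bar> powr (p + 1)"])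
    show "\<bar>\<bar>clip k y\<bar> powr (p + 1)\<bar> \<le> \<bar>y\<bar> powr (p + 1)" for k y
      using p1 clip_abs_le(1)[of k y] by (simp add: powr_mono2)
    show "intM (\<lambda>x. \<bar>z \<tau> x + g \<tau> x\<bar> powr (p + 1) * \<bar>1\<bar>)" if "\<tau> \<in> {s..T}" for \<tau>
      using Lp_integrable_add[OF p_ge(2) z_Lp[OF that] g(3)[OF that]] by (simp add: Lp_integrable_def)
  qed (use g S_simple S_Lp z_Lp S_lim in auto)
  then show ?thesis by simp
qed

lemma YN_integrable: "integrable L YN"
proof (rule integrable_lebesgue_on_bounded_interval)
  show "YN \<in> borel_measurable L"
    using nemytskii_powr_measurable[of w, OF w_meas w_time w_Lp] by (simp add: YN_def[abs_def] Y_def)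
  show "integrable L (\<lambda>\<tau>. 2 powr (p + 1) * ((LINT x|M. \<bar>z \<tau> x\<bar> powr (p + 1)) + (LINT x|M. \<bar>B\<bar> powr (p + 1))))"
    using z_int by simp
  fix \<tau> assume \<tau>: "\<tau> \<in> {s..T}"
  have "YN \<tau> \<le> 2 powr (p + 1) * ((LINT x|M. \<bar>z \<tau> x\<bar> powr (p + 1)) + (LINT x|M. \<bar>w \<tau> x\<bar> powr (p + 1)))"
    unfolding YN_def Y_def by (rule Lp_add_le[OF p_ge(2) z_Lp[OF \<tau>] w_Lp[OF \<tau>]])
  also have "(LINT x|M. \<bar>w \<tau> x\<bar> powr (p + 1)) \<le> (LINT x|M. \<bar>B\<bar> powr (p + 1))"
    by (rule integral_mono) (use w_Lp[OF \<tau>] w_bound[OF \<tau>] p1 in \<open>auto simp: Lp_integrable_def intro!: powr_mono2 intro: order_trans[OF _ abs_ge_self]\<close>)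
  finally show "\<bar>YN \<tau>\<bar> \<le> 2 powr (p + 1) * ((LINT x|M. \<bar>z \<tau> x\<bar> powr (p + 1)) + (LINT x|M. \<bar>B\<bar> powr (p + 1)))"
    by (simp add: YN_def)
qed

lemma resolvent_defect_Lp:
  assumes "Lp f" "n > 0"
  shows "Lp (\<lambda>x. f x - J n f x)"
    "(LINT x|M. \<bar>f x - J n f x\<bar> powr (p + 1)) \<le> 2 powr (p + 1) * (1 + 2 powr (p + 1)) * (LINT x|M. \<bar>f x\<bar> powr (p + 1))"
proof -
  note j = J_Lp[OF assms(2) p_ge(1) assms(1)]
  show "Lp (\<lambda>x. f x - J n f x)" by (rule Lp_integrable_diff[OF p_ge(2) assms(1) j(1)])
  have "(LINT x|M. \<bar>f x + (- 1) * J n f x\<bar> powr (p + 1)) \<le> 2 powr (p + 1) * ((LINT x|M. \<bar>f x\<bar> powr (p + 1)) + (LINT x|M. \<bar>(- 1) * J n f x\<bar> powr (p + 1)))"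
    by (rule Lp_add_le[OF p_ge(2) assms(1) Lp_integrable_cmult[OF j(1)]])
  also have "\<dots> \<le> 2 powr (p + 1) * ((LINT x|M. \<bar>f x\<bar> powr (p + 1)) + 2 powr (p + 1) * (LINT x|M. \<bar>f x\<bar> powr (p + 1)))"
    using j(2) by (intro mult_left_mono add_left_mono) auto
  finally show "(LINT x|M. \<bar>f x - J n f x\<bar> powr (p + 1)) \<le> 2 powr (p + 1) * (1 + 2 powr (p + 1)) * (LINT x|M. \<bar>f x\<bar> powr (p + 1))"
    by (simp add: algebra_simps)
qed

lemma pairing_bound:
  assumes "\<tau> \<in> {s..T}" "Lp f" "n > 0" "\<delta> > 0"
  shows "\<bar>pairing n f \<tau>\<bar> \<le> (c1 + c2) * (\<delta> * (measure M (space M) + YN \<tau>) + \<delta> powr (- p) * (2 powr (p + 1) * (1 + 2 powr (p + 1)) * (LINT x|M. \<bar>f x\<bar> powr (p + 1))))"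
proof -
  note d = resolvent_defect_Lp[OF assms(2,3)]
  have "\<bar>pairing n f \<tau>\<bar> \<le> (c1 + c2) * (\<delta> * (measure M (space M) + YN \<tau>) + \<delta> powr (- p) * (LINT x|M. \<bar>f x - J n f x\<bar> powr (p + 1)))"
    unfolding pairing_def YN_def by (rule \<Phi>_pairing_bound[OF assms(4) Y_Lp[OF assms(1)] d(1)])
  also have "\<dots> \<le> (c1 + c2) * (\<delta> * (measure M (space M) + YN \<tau>) + \<delta> powr (- p) * (2 powr (p + 1) * (1 + 2 powr (p + 1)) * (LINT x|M. \<bar>f x\<bar> powr (p + 1))))"
    using d(2) c_nonneg by (intro mult_left_mono add_left_mono) auto
  finally show ?thesis .
qed

lemma pairing_diff:
  assumes \<tau>: "\<tau> \<in> {s..T}" and f: "Lp f" "Lp g" and n: "n > 0"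
  shows "pairing n f \<tau> - pairing n g \<tau> = pairing n (\<lambda>x. f x - g x) \<tau>"
proof -
  note i = \<Phi>_integrable[OF Y_Lp[OF \<tau>] resolvent_defect_Lp(1)[OF _ n]]
  have "pairing n f \<tau> - pairing n g \<tau> = (LINT x|M. \<Phi> (Y \<tau> x) * (f x - J n f x) - \<Phi> (Y \<tau> x) * (g x - J n g x))"
    unfolding pairing_def ip_def using i[OF f(1)] i[OF f(2)] by simp
  also have "\<dots> = pairing n (\<lambda>x. f x - g x) \<tau>" unfolding pairing_def ip_def
  proof (rule integral_cong_AE)
    show "AE x in M. \<Phi> (Y \<tau> x) * (f x - J n f x) - \<Phi> (Y \<tau> x) * (g x - J n g x)
        = \<Phi> (Y \<tau> x) * ((f x - g x) - J n (\<lambda>x. f x - g x) x)"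
      using J_diff[OF Lp_integrable_sq[OF f(1) p_ge(1)] Lp_integrable_sq[OF f(2) p_ge(1)] n]
      by eventually_elim (simp add: right_diff_distrib)
  qed (use i[OF f(1)] i[OF f(2)] i[OF Lp_integrable_diff[OF p_ge(2) f]] in auto)
  finally show ?thesis .
qed

lemma pairing_integrable:
  assumes f: "Lp f" and n: "n > 0"
  shows "integrable L (pairing n f)"
proof (rule integrable_lebesgue_on_bounded_interval[OF _ _ pairing_bound[OF _ f n zero_less_one]])
  note d = resolvent_defect_Lp(1)[OF f n]
  have "(\<lambda>\<tau>. LINT x|M. \<Phi> (z \<tau> x + w \<tau> x) * (f x - J n f x)) \<in> borel_measurable L"
  proof (rule nemytskii_measurable[OF p_ge(2) \<Phi>_cont, where H = "\<lambda>y. c1 * \<bar>y\<bar> powr p + c2"])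
    show "\<bar>\<Phi> (clip k y)\<bar> \<le> c1 * \<bar>y\<bar> powr p + c2" for k y
      using \<Phi>_growth[of "clip k y"] c_nonneg p1 clip_abs_le(1)[of k y]
      by (meson add_right_mono mult_left_mono order_trans powr_mono2 abs_ge_zero p_ge(4) less_imp_le)
    show "intM (\<lambda>x. (c1 * \<bar>z \<tau> x + w \<tau> x\<bar> powr p + c2) * \<bar>f x - J n f x\<bar>)" if "\<tau> \<in> {s..T}" for \<tau>
      using growth_integrable[OF Y_Lp[OF that] d] by (simp add: Y_def)
    show "(\<lambda>x. f x - J n f x) \<in> BM" using d by (simp add: Lp_integrable_def)
  qed (use w_meas w_time S_simple S_Lp z_Lp S_lim in auto)
  then show "pairing n f \<in> borel_measurable L" by (simp add: pairing_def[abs_def] ip_def Y_def)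
  show "integrable L (\<lambda>\<tau>. (c1 + c2) * (1 * (measure M (space M) + YN \<tau>) + 1 powr (- p) * (2 powr (p + 1) * (1 + 2 powr (p + 1)) * (LINT x|M. \<bar>f x\<bar> powr (p + 1)))))"
    using YN_integrable by simp
qed

lemma weak_eq_resolvent:
  assumes f: "Lp f" and n: "n > 0" and \<tau>: "\<tau> \<in> {s..T}"
  shows "Z \<tau> (J n f) = X0 (J n f) - (LINT r|lebesgue_on {s..\<tau>}. n * pairing n f r)"
proof -
  let ?v = "\<lambda>x. n * (f x - J n f x)"
  have fs: "L2 f" by (rule Lp_integrable_sq[OF f p_ge(1)])
  have vL: "Lp ?v" by (rule Lp_integrable_cmult[OF resolvent_defect_Lp(1)[OF f n]])
  have emb: "emb ?v u = en (J n f) u" if u: "u \<in> H0" for u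
  proof -
    have "emb ?v u = n * (ip f u - ip (J n f) u)"
      unfolding fun_cong[OF embH_ip] ip_cmult_left ip_diff_left[OF fs J_L2[OF fs n] H01_L2[OF u]] ..
    also have "\<dots> = en (J n f) u" using J_eq[OF fs n u] by (simp add: algebra_simps)
    finally show ?thesis .
  qed
  have "Z \<tau> (J n f) = Hinner \<Lambda> (Z \<tau>) (emb ?v)"
    by (rule Hinner_eq[OF Z_Hdual[OF \<tau>] J_H01[OF fs n] emb, symmetric])
  also have "\<dots> = X0 (J n f) - (LINT r|lebesgue_on {s..\<tau>}. LINT x|M. \<Phi> (z r x + w r x) * ?v x)"
    using Z_eq[OF vL \<tau>] Hinner_eq[OF X0_Hdual J_H01[OF fs n] emb] by simp
  also have "(\<lambda>r. LINT x|M. \<Phi> (z r x + w r x) * ?v x) = (\<lambda>r. n * pairing n f r)"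
    unfolding pairing_def ip_def Y_def by (simp add: mult.left_commute)
  finally show ?thesis .
qed

text \<open>At the initial time the integral runs over a null set, and agreement on resolvents of
  bounded functions identifies the functionals.\<close>

lemma Z_initial: "s \<le> T \<Longrightarrow> Heq \<Lambda> (Z s) X0"
proof (rule Heq_of_resolvent_test[OF Z_Hdual X0_Hdual zero_less_one])
  assume sT: "s \<le> T"
  fix f :: "'a \<Rightarrow> real" assume f: "f \<in> BM" "bounded (f ` \<Lambda>)"
  then obtain b where "\<And>x. x \<in> \<Lambda> \<Longrightarrow> \<bar>f x\<bar> \<le> b" by (auto simp: bounded_iff)
  then have fL: "Lp f" by (rule Lp_integrable_bounded[OF p_ge(3) f(1)])
  have "(LINT r|lb s s. 1 * pairing 1 f r) = (LINT r|lb s s. 0)"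
    by (rule integral_cong_AE[OF _ _ AE_I'[of "{s}"]])
      (use lb_integrable_subinterval[OF pairing_integrable[OF fL zero_less_one], of s s] sT in \<open>auto simp: null_sets_restrict_space\<close>)
  then show "Z s (J 1 f) = X0 (J 1 f)" using weak_eq_resolvent[OF fL zero_less_one, of s] sT by simp
qed auto

text \<open>In the second order expansion of the form both the linear and the quadratic term are
  controlled by the dual norm of the increment of \<open>Z\<close>, with a constant that depends on
  n.\<close>

lemma e_continuous:
  assumes n: "n > 0"
  shows "continuous_on {s..T} (e n)"
  unfolding continuous_on_def
proof
  fix t assume t: "t \<in> {s..T}"
  let ?F = "at t within {s..T}"
  define N where "N = (\<lambda>r. Hnorm \<Lambda> (\<lambda>u. Z r u - Z t u))"
  note u = res_spec(1)[OF Z_Hdual[OF t] n]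
  have N0: "(N \<longlongrightarrow> 0) ?F" using Z_cont[OF t] by (simp add: N_def)
  have "((\<lambda>r. 2 * (N r * hnrm (res n (Z t))) + n * (N r)\<^sup>2) \<longlongrightarrow> 2 * (0 * hnrm (res n (Z t))) + n * 0\<^sup>2) ?F"
    by (intro tendsto_intros N0)
  then have lim: "((\<lambda>r. 2 * (N r * hnrm (res n (Z t))) + n * (N r)\<^sup>2) \<longlongrightarrow> 0) ?F" by simp
  have "\<forall>\<^sub>F r in ?F. norm (e n r - e n t) \<le> 2 * (N r * hnrm (res n (Z t))) + n * (N r)\<^sup>2"
    unfolding eventually_at_filter
  proof (intro always_eventually allI impI)
    fix r assume "r \<noteq> t" "r \<in> {s..T}"
    then have r: "r \<in> {s..T}" by simp
    note D = Hdual_diff[OF Z_Hdual[OF r] Z_Hdual[OF t]]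
    note cx = res_convex[OF Z_Hdual[OF r] Z_Hdual[OF t] n]
    have 1: "\<bar>Z r (res n (Z t)) - Z t (res n (Z t))\<bar> \<le> N r * hnrm (res n (Z t))"
      using Hnorm_bound(1)[OF D u] by (simp add: N_def)
    have 2: "(\<lambda>u. Z r u - Z t u) (res n (\<lambda>u. Z r u - Z t u)) \<le> n * (N r)\<^sup>2"
      unfolding N_def by (rule res_form_bound[OF D n]) (use Hnorm_bound[OF D] zero_H01 in auto)
    show "norm (e n r - e n t) \<le> 2 * (N r * hnrm (res n (Z t))) + n * (N r)\<^sup>2"
      unfolding e_def real_norm_def by (rule abs_convex_bound[OF cx 2 1])
  qed
  then have "((\<lambda>r. e n r - e n t) \<longlongrightarrow> 0) ?F" by (rule Lim_null_comparison[OF _ lim])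
  then show "(e n \<longlongrightarrow> e n t) ?F" by (rule LIM_zero_cancel)
qed

text \<open>On each of the finitely many level sets of \<open>S j\<close> the subtracted function is
  constant in time, so the measurability of superposition operators applies.\<close>

lemma simple_defect_measurable: "(\<lambda>\<tau>. LINT x|M. \<bar>z \<tau> x - S j \<tau> x\<bar> powr (p + 1)) \<in> borel_measurable L"
proof -
  let ?D = "\<lambda>f \<tau>. LINT x|M. \<bar>z \<tau> x - f x\<bar> powr (p + 1)"
  have fin: "finite (S j ` {s..T})" using S_simple[of j] by (simp add: simple_function_def)
  have "(\<lambda>t. \<Sum>f\<in>S j ` {s..T}. indicator (S j -` {f} \<inter> {s..T}) t * ?D f t) \<in> borel_measurable L"
  proof (intro borel_measurable_sum borel_measurable_times borel_measurable_indicator)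
    fix f assume f: "f \<in> S j ` {s..T}"
    show "S j -` {f} \<inter> {s..T} \<in> sets L" using S_simple[of j] f by (auto simp: simple_function_def)
    have "Lp f" using f S_Lp by auto
    then have "Lp (\<lambda>x. (- 1) * f x)" by (rule Lp_integrable_cmult)
    from nemytskii_powr_measurable[of "\<lambda>\<tau> x. (- 1) * f x", OF _ _ this] this
    show "?D f \<in> borel_measurable L" by (simp add: Lp_integrable_def)
  qed
  then show ?thesis
  proof (rule measurable_cong[THEN iffD1, rotated])
    fix t assume "t \<in> space L"
    then have t: "t \<in> {s..T}" by simp
    have *: "indicator (S j -` {f} \<inter> {s..T}) t * ?D f t = (if S j t = f then ?D f t else 0)" for f
      using t by (auto simp: indicator_def)
    show "(\<Sum>f\<in>S j ` {s..T}. indicator (S j -` {f} \<inter> {s..T}) t * ?D f t) = ?D (S j t) t"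
      unfolding * sum.delta'[OF fin] using t by auto
  qed
qed

text \<open>Replacing the approximants by 0 where they are bad makes dominated convergence applicable.\<close>

definition V where "V j \<tau> = (if \<tau> \<in> {s..T} \<and> (LINT x|M. \<bar>z \<tau> x - S j \<tau> x\<bar> powr (p + 1)) \<le> 1 then S j \<tau> else (\<lambda>x. 0))"
definition VD where "VD j \<tau> = (LINT x|M. \<bar>z \<tau> x - V j \<tau> x\<bar> powr (p + 1))"

lemma V_simple: "simple_function L (V j)"
proof -
  have "{\<tau> \<in> space L. (LINT x|M. \<bar>z \<tau> x - S j \<tau> x\<bar> powr (p + 1)) \<le> 1} \<in> sets L"
    using simple_defect_measurable by measurable
  then have "simple_function L (\<lambda>\<tau>. if (LINT x|M. \<bar>z \<tau> x - S j \<tau> x\<bar> powr (p + 1)) \<le> 1 then S j \<tau> else (\<lambda>x. 0))"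
    by (intro simple_function_If S_simple simple_function_const)
  then show ?thesis by (rule simple_function_cong[THEN iffD1, rotated]) (simp add: V_def)
qed

lemma V_Lp: "Lp (V j \<tau>)"
  using S_Lp Lp_integrable_bounded[OF p_ge(3), of "\<lambda>x. 0" 0] by (auto simp: V_def)

text \<open>Defects above 1 are replaced by the integral of |z|^{p+1}, so 1 plus that integral
  dominates. Where the defect tends to 0, it is eventually left unchanged.\<close>

lemma VD_integrable: "integrable L (VD j)" and VD_tendsto: "(\<lambda>j. LINT \<tau>|L. VD j \<tau>) \<leadsto> 0"
proof -
  let ?d = "\<lambda>j \<tau>. LINT x|M. \<bar>z \<tau> x - S j \<tau> x\<bar> powr (p + 1)" and ?z = "\<lambda>\<tau>. LINT x|M. \<bar>z \<tau> x\<bar> powr (p + 1)"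
  have eq: "VD j \<tau> = (if ?d j \<tau> \<le> 1 then ?d j \<tau> else ?z \<tau>)" if "\<tau> \<in> {s..T}" for j \<tau> using that by (simp add: VD_def V_def)
  have m: "VD j \<in> borel_measurable L" for j
  proof (rule measurable_cong[THEN iffD1])
    show "(\<lambda>\<tau>. if ?d j \<tau> \<le> 1 then ?d j \<tau> else ?z \<tau>) \<in> borel_measurable L"
      using simple_defect_measurable[of j] borel_measurable_integrable[OF z_int] by measurable
  qed (simp add: eq)
  have nn: "0 \<le> VD j \<tau>" "0 \<le> ?z \<tau>" for j \<tau> by (auto simp: VD_def)
  have bd: "\<bar>VD j \<tau>\<bar> \<le> 1 + ?z \<tau>" if "\<tau> \<in> {s..T}" for j \<tau> 
  proof (cases "?d j \<tau> \<le> 1")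
    case True
    then have "VD j \<tau> = ?d j \<tau>" using eq[OF that, of j] by simp
    with True nn(1)[of j \<tau>] nn(2)[of \<tau>] show ?thesis by linarith
  next
    case False
    then have "VD j \<tau> = ?z \<tau>" using eq[OF that, of j] by simp
    with nn(2)[of \<tau>] show ?thesis by linarith
  qed
  have i: "integrable L (\<lambda>\<tau>. 1 + ?z \<tau>)" using z_int by simp
  show "integrable L (VD j)" by (rule integrable_lebesgue_on_bounded_interval[OF m i bd])
  have "(\<lambda>j. LINT \<tau>|L. VD j \<tau>) \<leadsto> (LINT \<tau>|L. 0)"
  proof (rule integral_dominated_convergence[OF _ m i])
    show "AE \<tau> in L. (\<lambda>j. VD j \<tau>) \<leadsto> 0"
      using S_lim' AE_space[of L]
    proof eventually_elim
      case (elim \<tau>)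
      from order_tendstoD(2)[OF elim(1) zero_less_one]
      have "\<forall>\<^sub>F j in sequentially. ?d j \<tau> = VD j \<tau>" by eventually_elim (use elim(2) eq[of \<tau>] in simp)
      with elim(1) show ?case by (rule Lim_transform_eventually)
    qed
  qed (use bd in auto)
  then show "(\<lambda>j. LINT \<tau>|L. VD j \<tau>) \<leadsto> 0" by simp
qed

text \<open>Convexity of the form with base point \<open>Z r\<close>, whose resolvent at a good time
  is \<open>J n (z r)\<close>; this fixed function is admissible in the equation on [r - h, r]. The
  base point is the right end, so that the increment is bounded from above.\<close>

lemma e_increment:
  assumes n: "n > 0" and good: "Heq \<Lambda> (Z r) (emb (z r))" and r: "r \<in> {s..T}" and h: "h > 0" "h \<le> r - s"
  shows "e n r - e n (r - h) \<le> (LINT \<tau>|lb (r - h) r. - 2 * (n * pairing n (z r) \<tau>))"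
proof -
  have rh: "r - h \<in> {s..T}" using r h by auto
  have u: "res n (Z r) = J n (z r)" by (rule res_cong[OF good])
  have "e n r - e n (r - h) \<le> 2 * (Z r (J n (z r)) - Z (r - h) (J n (z r)))"
    using convex_bound[OF res_convex[OF Z_Hdual[OF rh] Z_Hdual[OF r] n]] unfolding e_def u .
  also have "\<dots> = 2 * ((LINT \<tau>|lb s (r - h). n * pairing n (z r) \<tau>) - (LINT \<tau>|lb s r. n * pairing n (z r) \<tau>))"
    using weak_eq_resolvent[OF z_Lp[OF r] n r] weak_eq_resolvent[OF z_Lp[OF r] n rh] by simp
  also have "(LINT \<tau>|lb s r. n * pairing n (z r) \<tau>) = (LINT \<tau>|lb s (r - h). n * pairing n (z r) \<tau>) + (LINT \<tau>|lb (r - h) r. n * pairing n (z r) \<tau>)"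
    by (rule lb_integral_combine)
      (use lb_integrable_subinterval[OF pairing_integrable[OF z_Lp[OF r] n], of s r] r h in auto)
  finally show ?thesis by simp
qed

text \<open>Exchanging \<open>z r\<close> for \<open>V j r\<close> costs two errors: one at the
  running time \<tau>, small with \<delta>, and one at the base time r, small for large j. Both
  directions are used, the first before averaging and the second afterwards.\<close>

lemma pairing_approx:
  assumes n: "n > 0" and r: "r \<in> {s..T}" and \<tau>: "\<tau> \<in> {s..T}" and \<delta>: "\<delta> > 0"
  shows "- 2 * (n * pairing n (z r) \<tau>) \<le> - 2 * (n * pairing n (V j r) \<tau>) + 2 * n * (c1 + c2) * \<delta> * (measure M (space M) + YN \<tau>)
       + 2 * n * (c1 + c2) * (\<delta> powr (- p) * (2 powr (p + 1) * (1 + 2 powr (p + 1)))) * VD j r" (is ?A)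
    "- 2 * (n * pairing n (V j r) \<tau>) \<le> - 2 * (n * pairing n (z r) \<tau>) + 2 * n * (c1 + c2) * \<delta> * (measure M (space M) + YN \<tau>)
       + 2 * n * (c1 + c2) * (\<delta> powr (- p) * (2 powr (p + 1) * (1 + 2 powr (p + 1)))) * VD j r" (is ?B)
proof -
  let ?R = "(c1 + c2) * (\<delta> * (measure M (space M) + YN \<tau>) + \<delta> powr (- p) * (2 powr (p + 1) * (1 + 2 powr (p + 1)) * VD j r))"
  have "\<bar>pairing n (z r) \<tau> - pairing n (V j r) \<tau>\<bar> \<le> ?R"
    unfolding pairing_diff[OF \<tau> z_Lp[OF r] V_Lp n] VD_def
    by (rule pairing_bound[OF \<tau> Lp_integrable_diff[OF p_ge(2) z_Lp[OF r] V_Lp] n \<delta>])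
  then have "2 * n * \<bar>pairing n (z r) \<tau> - pairing n (V j r) \<tau>\<bar> \<le> 2 * n * ?R" using n by (intro mult_left_mono) auto
  then have "\<bar>2 * n * (pairing n (z r) \<tau> - pairing n (V j r) \<tau>)\<bar> \<le> 2 * n * ?R" using n by (simp add: abs_mult)
  moreover have "2 * n * ?R = 2 * n * (c1 + c2) * \<delta> * (measure M (space M) + YN \<tau>)
       + 2 * n * (c1 + c2) * (\<delta> powr (- p) * (2 powr (p + 1) * (1 + 2 powr (p + 1)))) * VD j r"
  proof -
    have *: "2 * n * (c * (\<delta> * a + d * (b * v))) = 2 * n * c * \<delta> * a + 2 * n * c * (d * b) * v" for a b c d v :: real
      by (simp add: algebra_simps)
    show ?thesis by (rule *)
  qed
  moreover have "2 * n * (pairing n (z r) \<tau> - pairing n (V j r) \<tau>) = 2 * (n * pairing n (z r) \<tau>) - 2 * (n * pairing n (V j r) \<tau>)"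
    by (simp only: right_diff_distrib mult.assoc)
  ultimately show ?A ?B by linarith+
qed

lemma resolvent_dissipation:
  assumes n: "n > 0" and U: "integrable L U" "AE r in L. - 2 * (n * pairing n (z r) r) \<le> U r"
    and t: "s \<le> t1" "t1 \<le> t2" "t2 \<le> T"
  shows "e n t2 - e n t1 \<le> (LINT r|lb t1 t2. U r)"
proof -
  have strict: "e n t2 - e n t1 \<le> (LINT r|lb t1 t2. U r)" if t: "s < t1" "t1 \<le> t2" for t1
  proof -
    define G where "G = 2 * n * (c1 + c2) * (LINT \<tau>|L. measure M (space M) + YN \<tau>)"
    have "e n t2 - e n t1 \<le> (LINT r|lb t1 t2. U r) + 2 * (\<delta> * G)" if \<delta>: "\<delta> > 0" for \<delta>
    proof -
      define C where "C = 2 * n * (c1 + c2) * (\<delta> powr (- p) * (2 powr (p + 1) * (1 + 2 powr (p + 1))))"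
      define g where "g = (\<lambda>\<tau>. 2 * n * (c1 + c2) * \<delta> * (measure M (space M) + YN \<tau>))"
      have C0: "C \<ge> 0" unfolding C_def using n c_nonneg by (intro mult_nonneg_nonneg add_nonneg_nonneg) auto
      have gi: "integrable L g" unfolding g_def using YN_integrable by simp
      have g0: "0 \<le> g \<tau>" for \<tau> unfolding g_def YN_def using n c_nonneg \<delta> by (intro mult_nonneg_nonneg add_nonneg_nonneg) auto
      have Gg: "(LINT \<tau>|L. g \<tau>) = \<delta> * G" unfolding g_def G_def using YN_integrable by simp
      \<comment> \<open>The zero function joins the index set because \<open>V j\<close> takes this
        value outside the interval.\<close>
      have bound: "e n t2 - e n t1 \<le> (LINT r|lb t1 t2. U r) + 2 * (LINT r|L. g r) + 2 * (LINT r|L. C * VD j r)" for j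
      proof (rule increment_bound[where \<iota> = "V j" and I = "insert (\<lambda>x. 0) (V j ` {s..T})" and \<beta> = "\<lambda>f \<tau>. - 2 * (n * pairing n f \<tau>)" and s = s and T = T])
        show "continuous_on {s..T} (e n)" by (rule e_continuous[OF n])
        show "finite (insert (\<lambda>x. 0) (V j ` {s..T}))" using V_simple[of j] by (simp add: simple_function_def)
        show "V j r \<in> insert (\<lambda>x. 0) (V j ` {s..T})" for r by (cases "r \<in> {s..T}") (auto simp: V_def)
        show "{r \<in> {s..T}. V j r = i} \<in> sets lebesgue" for i
        proof -
          have "V j -` {i} \<inter> space L \<in> sets L" by (rule simple_functionD(2)[OF V_simple])
          moreover have "V j -` {i} \<inter> space L = {r \<in> {s..T}. V j r = i}" by auto
          ultimately show ?thesis by (simp add: sets_restrict_space_iff)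
        qed
        show "integrable L (\<lambda>\<tau>. - 2 * (n * pairing n i \<tau>))" if "i \<in> insert (\<lambda>x. 0) (V j ` {s..T})" for i
        proof -
          have "Lp (\<lambda>x. 0)" by (rule Lp_integrable_bounded[OF p_ge(3), where B = 0]) auto
          then have "Lp i" using that V_Lp by (elim insertE imageE) simp_all
          then show ?thesis by (intro Bochner_Integration.integrable_mult_right pairing_integrable n)
        qed
        show "integrable L (\<lambda>r. C * VD j r)" using VD_integrable by simp
        show "0 \<le> C * VD j r" for r using C0 by (simp add: VD_def)
        show "AE r in L. \<forall>h>0. h \<le> r - s \<longrightarrow>
          e n r - e n (r - h) \<le> (LINT \<tau>|lb (r - h) r. - 2 * (n * pairing n (V j r) \<tau>)) + (LINT \<tau>|lb (r - h) r. g \<tau>) + h * (C * VD j r)"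
          using Z_z AE_space[of L]
        proof eventually_elim
          case (elim r)
          then have r: "r \<in> {s..T}" by simp
          show ?case
          proof (intro allI impI)
            fix h assume h: "h > 0" "h \<le> r - s"
            let ?K = "lb (r - h) r"
            have sub: "integrable ?K u" if "integrable L u" for u :: "real \<Rightarrow> real"
              using lb_integrable_subinterval[OF that, of "r - h" r] r h by simp
            interpret K: finite_measure ?K by (intro finite_measure_lebesgue_on) auto
            have mK: "measure ?K (space ?K) = h" using h by (simp add: measure_restrict_space)
            have pz: "integrable ?K (\<lambda>\<tau>. - 2 * (n * pairing n (z r) \<tau>))"
              by (intro Bochner_Integration.integrable_mult_right sub[OF pairing_integrable[OF z_Lp[OF r] n]])
            have pV: "integrable ?K (\<lambda>\<tau>. - 2 * (n * pairing n (V j r) \<tau>))"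
              by (intro Bochner_Integration.integrable_mult_right sub[OF pairing_integrable[OF V_Lp[of j r] n]])
            note gK = sub[OF gi]
            have "e n r - e n (r - h) \<le> (LINT \<tau>|?K. - 2 * (n * pairing n (z r) \<tau>))" by (rule e_increment[OF n elim(1) r h])
            also have "\<dots> \<le> (LINT \<tau>|?K. - 2 * (n * pairing n (V j r) \<tau>) + g \<tau> + C * VD j r)"
            proof (rule integral_mono)
              fix \<tau> assume "\<tau> \<in> space ?K"
              then have "\<tau> \<in> {s..T}" using r h by auto
              from pairing_approx(1)[OF n r this \<delta>, of j]
              show "- 2 * (n * pairing n (z r) \<tau>) \<le> - 2 * (n * pairing n (V j r) \<tau>) + g \<tau> + C * VD j r" unfolding g_def C_def .
            qed (intro Bochner_Integration.integrable_add pz pV gK K.integrable_const)+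
            also have "\<dots> = (LINT \<tau>|?K. - 2 * (n * pairing n (V j r) \<tau>)) + (LINT \<tau>|?K. g \<tau>) + h * (C * VD j r)"
              by (simp only: Bochner_Integration.integral_add[OF Bochner_Integration.integrable_add[OF pV gK] K.integrable_const]
                  Bochner_Integration.integral_add[OF pV gK] lebesgue_integral_const mK real_scaleR_def)
            finally show "e n r - e n (r - h) \<le> (LINT \<tau>|?K. - 2 * (n * pairing n (V j r) \<tau>)) + (LINT \<tau>|?K. g \<tau>) + h * (C * VD j r)" .
          qed
        qed
        show "AE r in L. - 2 * (n * pairing n (V j r) r) \<le> U r + g r + C * VD j r"
          using U(2) AE_space[of L]
        proof eventually_elim
          case (elim r)
          then have r: "r \<in> {s..T}" by simp
          from order_trans[OF pairing_approx(2)[OF n r r \<delta>, of j] add_right_mono[OF add_right_mono[OF elim(1)]]]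
          show ?case unfolding g_def C_def .
        qed
      qed (use gi g0 U(1) t \<open>t2 \<le> T\<close> in auto)
      have "(\<lambda>j. (LINT r|lb t1 t2. U r) + 2 * (LINT r|L. g r) + 2 * (LINT r|L. C * VD j r)) \<leadsto>
          (LINT r|lb t1 t2. U r) + 2 * (LINT r|L. g r) + 2 * (C * 0)"
        unfolding integral_mult_right_zero by (intro tendsto_intros VD_tendsto)
      from LIMSEQ_le_const[OF this] bound show ?thesis by (auto simp: Gg)
    qed
    note d = this
    have "((\<lambda>\<delta>. (LINT r|lb t1 t2. U r) + 2 * (\<delta> * G)) \<longlongrightarrow> (LINT r|lb t1 t2. U r) + 2 * (0 * G)) (at_right 0)"
      by (intro tendsto_intros)
    then have "e n t2 - e n t1 \<le> (LINT r|lb t1 t2. U r) + 2 * (0 * G)"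
      by (rule tendsto_lowerbound) (use d in \<open>auto simp: eventually_at_right_less eventually_at_filter\<close>)
    then show ?thesis by simp
  qed
  consider "s < t1" | "t1 = s" "s < t2" | "t1 = t2" "t1 = s" using t by linarith
  then show ?thesis
  proof cases
    case 1
    then show ?thesis using strict t by simp
  next
    case 2
    \<comment> \<open>Backward averages need room to the left of \<open>t1\<close>, so the initial
      time is reached as a limit from the right.\<close>
    have Q: "continuous_on {s..T} (\<lambda>x. LINT r|lb s x. U r)" by (rule indefinite_integral_continuous_real[OF U(1)])
    have cmb: "(LINT r|lb x t2. U r) = (LINT r|lb s t2. U r) - (LINT r|lb s x. U r)" if "s \<le> x" "x \<le> t2" for x
      using lb_integral_combine[OF lb_integrable_subinterval[OF U(1), of s t2], of x] that t by simp
    have lim: "(f \<longlongrightarrow> f s) (at_right s)" if "continuous_on {s..T} f" for f :: "real \<Rightarrow> real"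
    proof -
      have "(f \<longlongrightarrow> f s) (at s within {s..T})" using that 2 t by (auto simp: continuous_on_def)
      then show ?thesis using 2 t by (simp add: at_within_Icc_at_right)
    qed
    have "((\<lambda>x. (LINT r|lb s t2. U r) - (LINT r|lb s x. U r) - (e n t2 - e n x)) \<longlongrightarrow>
       (LINT r|lb s t2. U r) - (LINT r|lb s s. U r) - (e n t2 - e n s)) (at_right s)"
      by (intro tendsto_diff tendsto_const lim[OF Q] lim[OF e_continuous[OF n]])
    moreover have "\<forall>\<^sub>F x in at_right s. 0 \<le> (LINT r|lb s t2. U r) - (LINT r|lb s x. U r) - (e n t2 - e n x)"
      unfolding eventually_at_right[OF 2(2)]
    proof (intro exI[of _ t2] conjI allI impI)
      fix x assume x: "s < x" "x < t2"
      show "0 \<le> (LINT r|lb s t2. U r) - (LINT r|lb s x. U r) - (e n t2 - e n x)"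
        using strict[of x] cmb[of x] x by simp
    qed (rule 2(2))
    ultimately have "0 \<le> (LINT r|lb s t2. U r) - (LINT r|lb s s. U r) - (e n t2 - e n s)"
      by (rule tendsto_lowerbound) simp
    then show ?thesis using cmb[of s] 2 by simp
  next
    case 3
    have "(LINT r|lb s s. U r) = (LINT r|lb s s. 0)"
      by (rule integral_cong_AE[OF _ _ AE_I'[of "{s}"]])
        (use lb_integrable_subinterval[OF U(1), of s s] 3 t in \<open>auto simp: null_sets_restrict_space\<close>)
    then show ?thesis using 3 by simp
  qed
qed

end

section \<open>From the regularised forms to the L^2 norm\<close>

lemma (in bounded_domain) J_eq_of_Heq:
  assumes "Heq \<Lambda> F (emb f)" "L2 f" "n > 0"
  shows "F (res n F) = ip f (J n f)"
proof -
  have "res n F = J n f" by (rule res_cong[OF assms(1)])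
  moreover have "F (J n f) = emb f (J n f)" using assms(1) J_H01[OF assms(2,3)] by (simp add: Heq_def)
  ultimately show ?thesis by (simp add: embH_ip)
qed

text \<open>The origin of \<open>p2\<close> in the noise is forgotten here. Dissipativity holds from
  a threshold \<open>n0\<close> on, which is enough for limits in n.\<close>

locale dissipative_path = porous_path +
  fixes \<alpha> n0 :: real and p2 :: "real \<Rightarrow> real" and f0 :: "'a \<Rightarrow> real"
  assumes sT: "s \<le> T" and \<alpha>: "\<alpha> \<ge> 0" and n0: "n0 > 0" and f0: "sq_integrable (lebesgue_on \<Lambda>) f0" and X0_f0: "Heq \<Lambda> X0 (emb f0)"
    and p2_cont: "continuous_on {s..T} p2" and p2_nonneg: "0 \<le> p2 r"
    and dissipative: "n \<ge> n0 \<Longrightarrow> r \<in> {s..T} \<Longrightarrow>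
      - 2 * (n * pairing n (z r) r) \<le> - \<alpha> * (L2norm (lebesgue_on \<Lambda>) (z r))\<^sup>2 + p2 r"
begin

lemma p2_int: "integrable L p2" by (rule continuous_imp_integrable_real[OF p2_cont])

definition C where "C = (nrm f0)\<^sup>2 + (LINT r|L. p2 r)"

lemma e_bound:
  assumes n: "n \<ge> n0" and t: "t \<in> {s..T}"
  shows "e n t \<le> C"
proof -
  have n': "n > 0" using n n0 by linarith
  have "Heq \<Lambda> (Z s) (emb f0)" using Z_initial[OF sT] X0_f0 by (simp add: Heq_def)
  from J_eq_of_Heq[OF this f0 n'] have "e n s \<le> (nrm f0)\<^sup>2" using ip_J_le[OF f0 n'] by (simp add: e_def)
  moreover have "e n t - e n s \<le> (LINT r|lb s t. p2 r)"
  proof (rule resolvent_dissipation[OF n' p2_int])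
    show "AE r in L. - 2 * (n * pairing n (z r) r) \<le> p2 r"
    proof (rule AE_I2)
      fix r assume "r \<in> space L"
      then have "- 2 * (n * pairing n (z r) r) \<le> - \<alpha> * (nrm (z r))\<^sup>2 + p2 r" using dissipative[OF n] by simp
      moreover have "0 \<le> \<alpha> * (nrm (z r))\<^sup>2" using \<alpha> by simp
      ultimately show "- 2 * (n * pairing n (z r) r) \<le> p2 r" by linarith
    qed
  qed (use t in auto)
  moreover have "(LINT r|lb s t. p2 r) \<le> (LINT r|L. p2 r)"
  proof -
    have "(LINT r|L. p2 r) = (LINT r|lb s t. p2 r) + (LINT r|lb t T. p2 r)"
      by (rule lb_integral_combine[OF p2_int]) (use t in auto)
    moreover have "0 \<le> (LINT r|lb t T. p2 r)" by (rule Bochner_Integration.integral_nonneg[OF p2_nonneg])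
    ultimately show ?thesis by linarith
  qed
  ultimately show ?thesis unfolding C_def by linarith
qed

lemma eventually_ge_n0: "\<exists>N. \<forall>k\<ge>N. n0 \<le> real (Suc k)"
proof -
  obtain N where "n0 \<le> real N" using real_arch_simple by blast
  then show ?thesis by (intro exI[of _ N]) auto
qed

lemma Z_in_L2:
  assumes "t \<in> {s..T}"
  shows "\<exists>f. L2 f \<and> Heq \<Lambda> (Z t) (emb f)"
proof -
  obtain N where N: "\<And>k. k \<ge> N \<Longrightarrow> n0 \<le> real (Suc k)" using eventually_ge_n0 by blast
  show ?thesis by (rule res_bounded_imp_L2[OF Z_Hdual[OF assms]]) (use e_bound[OF N assms] in \<open>auto simp: e_def\<close>)
qed

section \<open>The L^2 representative at every time\<close>

context
  fixes f :: "real \<Rightarrow> 'a \<Rightarrow> real"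
  assumes f: "\<And>t. t \<in> {s..T} \<Longrightarrow> L2 (f t)" "\<And>t. t \<in> {s..T} \<Longrightarrow> Heq \<Lambda> (Z t) (emb (f t))"
begin

lemma e_eq: "t \<in> {s..T} \<Longrightarrow> n > 0 \<Longrightarrow> e n t = ip (f t) (J n (f t))"
  unfolding e_def by (rule J_eq_of_Heq[OF f(2,1)])

lemma e_tendsto: "t \<in> {s..T} \<Longrightarrow> (\<lambda>k. e (real (Suc k)) t) \<leadsto> (nrm (f t))\<^sup>2"
  using ip_J_tendsto[OF f(1)] by (simp add: e_eq del: of_nat_Suc)

lemma f_bound:
  assumes t: "t \<in> {s..T}"
  shows "(nrm (f t))\<^sup>2 \<le> C"
proof -
  obtain N where N: "\<And>k. k \<ge> N \<Longrightarrow> n0 \<le> real (Suc k)" using eventually_ge_n0 by blast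
  show ?thesis by (rule LIMSEQ_le_const2[OF e_tendsto[OF t]]) (use e_bound[OF N t] in blast)
qed

lemma f_norm_integrable: "integrable L (\<lambda>t. (nrm (f t))\<^sup>2)"
proof (rule integrable_lebesgue_on_bounded_interval)
  show "(\<lambda>t. (nrm (f t))\<^sup>2) \<in> borel_measurable L"
  proof (rule AE_limit_measurable)
    show "e (real (Suc k)) \<in> borel_measurable L" for k
      by (rule continuous_imp_measurable_on_sets_lebesgue[OF e_continuous]) auto
    show "AE t in L. (\<lambda>k. e (real (Suc k)) t) \<leadsto> (nrm (f t))\<^sup>2" by (rule AE_I2) (simp add: e_tendsto del: of_nat_Suc)
  qed auto
  show "integrable L (\<lambda>t. C)" by simp
qed (use f_bound in auto)

text \<open>Dissipativity is stated for \<open>z\<close>; agreement at almost every time transfers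
  it to \<open>f\<close>, which represents \<open>Z\<close> at every time.\<close>

lemma f_eq_z: "AE t in L. nrm (z t) = nrm (f t)"
  using Z_z AE_space[of L]
proof eventually_elim
  case (elim t)
  then have t: "t \<in> {s..T}" by simp
  note zs = Lp_integrable_sq[OF z_Lp[OF t] p_ge(1)]
  have "AE x in M. z t x = f t x"
  proof (rule embH_eqD[OF zs f(1)[OF t]])
    fix v assume "v \<in> H0"
    then show "ip (z t) v = ip (f t) v" using elim(1) f(2)[OF t] by (simp add: Heq_def embH_ip)
  qed
  then show ?case using zs f(1)[OF t] by (intro L2norm_cong_AE) (auto simp: sq_integrable_def)
qed

text \<open>At \<open>t1\<close> the forms are below the squared L^2 norm for every n, so the limit
  has to be taken at \<open>t2\<close> only.\<close>

lemma L2_dissipation: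
  assumes t: "s \<le> t1" "t1 \<le> t2" "t2 \<le> T"
  shows "(nrm (f t2))\<^sup>2 \<le> (nrm (f t1))\<^sup>2 - \<alpha> * (LINT r|lb t1 t2. (nrm (f r))\<^sup>2) + (LINT r|lb t1 t2. p2 r)"
proof -
  obtain N where N: "\<And>k. k \<ge> N \<Longrightarrow> n0 \<le> real (Suc k)" using eventually_ge_n0 by blast
  let ?I = "LINT r|lb t1 t2. - \<alpha> * (nrm (f r))\<^sup>2 + p2 r"
  have "e (real (Suc k)) t2 \<le> (nrm (f t1))\<^sup>2 + ?I" if k: "k \<ge> N" for k
  proof -
    have "e (real (Suc k)) t2 - e (real (Suc k)) t1 \<le> ?I"
    proof (rule resolvent_dissipation)
      show "integrable L (\<lambda>r. - \<alpha> * (nrm (f r))\<^sup>2 + p2 r)" using f_norm_integrable p2_int by simp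
      show "AE r in L. - 2 * (real (Suc k) * pairing (real (Suc k)) (z r) r) \<le> - \<alpha> * (nrm (f r))\<^sup>2 + p2 r"
        using f_eq_z AE_space[of L]
      proof eventually_elim
        case (elim r)
        from dissipative[OF N[OF k], of r] elim(2) show ?case unfolding elim(1) by simp
      qed
    qed (use t in auto)
    moreover have "e (real (Suc k)) t1 \<le> (nrm (f t1))\<^sup>2"
      using ip_J_le[OF f(1), of t1 "real (Suc k)"] e_eq[of t1 "real (Suc k)"] t by simp
    ultimately show ?thesis by linarith
  qed
  then have "(nrm (f t2))\<^sup>2 \<le> (nrm (f t1))\<^sup>2 + ?I"
    by (intro LIMSEQ_le_const2[OF e_tendsto]) (use t in auto)
  moreover have "?I = - \<alpha> * (LINT r|lb t1 t2. (nrm (f r))\<^sup>2) + (LINT r|lb t1 t2. p2 r)"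
    using lb_integrable_subinterval[OF f_norm_integrable t(1,3)] lb_integrable_subinterval[OF p2_int t(1,3)] by simp
  ultimately show ?thesis by simp
qed

lemma right_continuous_L2:
  assumes t: "s \<le> t" "t < T"
  shows "((\<lambda>r. nrm (\<lambda>x. f r x - f t x)) \<longlongrightarrow> 0) (at_right t)"
proof -
  have tI: "t \<in> {s..T}" using t by auto
  have C0: "0 \<le> C" using f_bound[OF tI] zero_le_power2[of "nrm (f t)"] by linarith
  have nb: "nrm (f r) \<le> sqrt C" if "r \<in> {s..T}" for r using real_le_rsqrt[OF f_bound[OF that]] .
  define N where "N = (\<lambda>r. Hnorm \<Lambda> (\<lambda>u. Z r u - Z t u))"
  have at: "at t within {t..T} \<le> at t within {s..T}" using t by (intro at_le) auto
  have atr: "at t within {t..T} = at_right t" by (rule at_within_Icc_at_right[OF t(2)])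
  have N0: "(N \<longlongrightarrow> 0) (at_right t)"
    using tendsto_mono[OF at Z_cont[OF tI]] unfolding N_def atr .
  have "continuous_on {t..T} (\<lambda>r. LINT \<tau>|lb t r. p2 \<tau>)"
    by (rule indefinite_integral_continuous_real[OF lb_integrable_subinterval[OF p2_int]]) (use t in auto)
  then have "((\<lambda>r. LINT \<tau>|lb t r. p2 \<tau>) \<longlongrightarrow> (LINT \<tau>|lb t t. p2 \<tau>)) (at_right t)"
    unfolding atr[symmetric] by (rule continuous_on_def[THEN iffD1, rule_format]) (use t in simp)
  moreover have "(LINT \<tau>|lb t t. p2 \<tau>) = (LINT \<tau>|lb t t. 0)"
    by (rule integral_cong_AE[OF _ _ AE_I'[of "{t}"]])
      (use lb_integrable_subinterval[OF p2_int, of t t] t in \<open>auto simp: null_sets_restrict_space\<close>)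
  ultimately have I0: "((\<lambda>r. LINT \<tau>|lb t r. p2 \<tau>) \<longlongrightarrow> 0) (at_right t)" by simp
  have near: "\<forall>\<^sub>F r in at_right t. r \<in> {t<..T}"
    unfolding eventually_at_right[OF t(2)] by (rule exI[of _ T]) (use t in auto)
  have "((\<lambda>r. (nrm (\<lambda>x. f r x - f t x))\<^sup>2) \<longlongrightarrow> 0) (at_right t)"
  proof (rule tendstoI)
    fix \<epsilon> :: real assume \<epsilon>: "\<epsilon> > 0"
    obtain w where w: "\<And>k::nat. w k \<in> H0" "(\<lambda>k. nrm (\<lambda>x. w k x - f t x)) \<leadsto> 0"
      using H01_dense[OF f(1)[OF tI]] by blast
    \<comment> \<open>Continuity of \<open>Z\<close> is known against elements of H_0^1, so
      \<open>f t\<close> is replaced by \<open>w k\<close>. The factor is 2 from the expansion of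
      the square times the bound 2 sqrt C for the norm of the increment.\<close>
    have "(\<lambda>k. 4 * sqrt C * nrm (\<lambda>x. w k x - f t x)) \<leadsto> 0" by (rule tendsto_mult_right_zero[OF w(2)])
    from order_tendstoD(2)[OF this, of "\<epsilon> / 2"] \<epsilon> obtain k where k: "4 * sqrt C * nrm (\<lambda>x. w k x - f t x) < \<epsilon> / 2"
      by (auto simp: eventually_sequentially)
    have "((\<lambda>r. (LINT \<tau>|lb t r. p2 \<tau>) + 2 * (N r * hnrm (w k))) \<longlongrightarrow> 0 + 2 * (0 * hnrm (w k))) (at_right t)"
      by (intro tendsto_intros I0 N0)
    from order_tendstoD(2)[OF this, of "\<epsilon> / 2"] \<epsilon>
    have "\<forall>\<^sub>F r in at_right t. (LINT \<tau>|lb t r. p2 \<tau>) + 2 * (N r * hnrm (w k)) < \<epsilon> / 2" by simp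
    with near show "\<forall>\<^sub>F r in at_right t. dist ((nrm (\<lambda>x. f r x - f t x))\<^sup>2) 0 < \<epsilon>"
    proof eventually_elim
      case (elim r)
      then have r: "r \<in> {s..T}" "t \<le> r" "r \<le> T" using t by auto
      note fr = f(1)[OF r(1)] and ft = f(1)[OF tI] and wk = H01_L2[OF w(1)[of k]]
      note d = L2_diff[OF fr ft]
      have "f r = (\<lambda>x. (f r x - f t x) + f t x)" by simp
      then have "(nrm (f r))\<^sup>2 = (nrm (\<lambda>x. f r x - f t x))\<^sup>2 + 2 * ip (\<lambda>x. f r x - f t x) (f t) + (nrm (f t))\<^sup>2"
        using L2norm_add_sq[OF d ft] by (simp add: ip_def)
      moreover have "(nrm (f r))\<^sup>2 \<le> (nrm (f t))\<^sup>2 + (LINT \<tau>|lb t r. p2 \<tau>)"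
      proof -
        have "0 \<le> \<alpha> * (LINT \<tau>|lb t r. (nrm (f \<tau>))\<^sup>2)" using \<alpha> by (intro mult_nonneg_nonneg Bochner_Integration.integral_nonneg) auto
        then show ?thesis using L2_dissipation[OF t(1) r(2,3)] by linarith
      qed
      moreover have "ip (\<lambda>x. f r x - f t x) (f t) = ip (\<lambda>x. f r x - f t x) (w k) - ip (\<lambda>x. f r x - f t x) (\<lambda>x. w k x - f t x)"
        using ip_diff_right[OF wk ft d] by simp
      moreover have "\<bar>ip (\<lambda>x. f r x - f t x) (w k)\<bar> \<le> N r * hnrm (w k)"
      proof -
        have "ip (\<lambda>x. f r x - f t x) (w k) = Z r (w k) - Z t (w k)"
          using ip_diff_left[OF fr ft wk] f(2)[OF r(1)] f(2)[OF tI] w(1)[of k] by (simp add: Heq_def embH_ip)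
        then show ?thesis using Hnorm_bound(1)[OF Hdual_diff[OF Z_Hdual[OF r(1)] Z_Hdual[OF tI]] w(1)[of k]] by (simp add: N_def)
      qed
      moreover have "\<bar>ip (\<lambda>x. f r x - f t x) (\<lambda>x. w k x - f t x)\<bar> \<le> 2 * sqrt C * nrm (\<lambda>x. w k x - f t x)"
      proof (rule order_trans[OF ip_bound[OF d L2_diff[OF wk ft]]], rule mult_right_mono)
        have "nrm (\<lambda>x. f r x + (- 1) * f t x) \<le> nrm (f r) + nrm (\<lambda>x. (- 1) * f t x)"
          by (rule L2norm_triangle[OF fr L2_cmult[OF ft]])
        also have "nrm (\<lambda>x. (- 1) * f t x) = nrm (f t)" unfolding L2norm_cmult by simp
        finally show "nrm (\<lambda>x. f r x - f t x) \<le> 2 * sqrt C" using nb[OF r(1)] nb[OF tI] by simp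
      qed simp
      ultimately have "(nrm (\<lambda>x. f r x - f t x))\<^sup>2 < \<epsilon>" using elim(2) k by linarith
      then show ?case by simp
    qed
  qed
  from tendsto_real_sqrt[OF this] show ?thesis by simp
qed

end

end

section \<open>The root function of the nonlinearity\<close>

lemma \<zeta>_continuous:
  fixes \<Phi> \<zeta> :: "real \<Rightarrow> real"
  assumes \<Phi>: "continuous_on UNIV \<Phi>" and \<zeta>: "\<And>s t. (\<zeta> t - \<zeta> s)\<^sup>2 \<le> (\<Phi> t - \<Phi> s) * (t - s)"
  shows "continuous_on UNIV \<zeta>"
proof (rule continuous_at_imp_continuous_on, rule ballI)
  fix x
  have "isCont \<Phi> x" using \<Phi> by (simp add: continuous_on_eq_continuous_at)
  then have "((\<lambda>t. sqrt ((\<Phi> t - \<Phi> x) * (t - x))) \<longlongrightarrow> sqrt ((\<Phi> x - \<Phi> x) * (x - x))) (at x)"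
    unfolding isCont_def by (intro tendsto_intros)
  then have "((\<lambda>t. sqrt ((\<Phi> t - \<Phi> x) * (t - x))) \<longlongrightarrow> 0) (at x)" by simp
  moreover have "norm (\<zeta> t - \<zeta> x) \<le> sqrt ((\<Phi> t - \<Phi> x) * (t - x))" for t
    unfolding real_norm_def by (rule real_le_rsqrt) (simp only: power2_abs \<zeta>)
  ultimately have "((\<lambda>t. \<zeta> t - \<zeta> x) \<longlongrightarrow> 0) (at x)"
    by (rule Lim_null_comparison[OF always_eventually[OF allI], rotated])
  then show "isCont \<zeta> x" unfolding isCont_def by (rule LIM_zero_cancel)
qed

text \<open>The second conclusion is Cauchy-Schwarz for the integral of the root of \<Phi>': with k
  the mean slope of \<zeta>, the function \<Phi> - 2 k \<zeta> + k^2 x has derivative (sqrt \<Phi>'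
  - k)^2. The third uses \<Phi>' \<le> H s + H t between s and t, so that sqrt(H s + H t) \<zeta> -
  \<Phi> is nondecreasing there.\<close>

lemma hypothesis_II_root:
  fixes \<Phi> \<zeta> :: "real \<Rightarrow> real"
  assumes D: "\<And>r. \<Phi> differentiable (at r)" "continuous_on UNIV (deriv \<Phi>)"
    and mono: "\<And>s t. (\<Phi> t - \<Phi> s) * (t - s) \<ge> 0"
    and c: "c1' \<ge> 0" "\<And>s. deriv \<Phi> s \<le> c1' * (\<bar>s\<bar> powr (p - 1) + 1)" and p: "p \<ge> 1"
    and \<zeta>_def: "\<And>s. \<zeta> s = (LBINT r=ereal 0..ereal s. sqrt (deriv \<Phi> r))"
    and H_def: "\<And>s. H s = 2 * c1' * (1 + \<bar>s\<bar>) powr (p - 1)"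
  shows "\<zeta> 0 = 0" "(\<zeta> t - \<zeta> s)\<^sup>2 \<le> (\<Phi> t - \<Phi> s) * (t - s)" "(\<Phi> s - \<Phi> t)\<^sup>2 \<le> (H s + H t) * (\<zeta> s - \<zeta> t)\<^sup>2"
proof -
  have d\<Phi>: "(\<Phi> has_real_derivative deriv \<Phi> x) (at x)" for x
    using D(1)[of x] by (simp add: DERIV_deriv_iff_real_differentiable)
  have "mono \<Phi>"
  proof (rule monoI)
    fix s t :: real assume "s \<le> t"
    then show "\<Phi> s \<le> \<Phi> t" using mono[of t s] by (cases "s = t") (auto simp: zero_le_mult_iff)
  qed
  then have d0: "0 \<le> deriv \<Phi> x" for x
    by (intro mono_on_imp_deriv_nonneg[OF _ d\<Phi>, of UNIV]) auto
  have d\<zeta>: "(\<zeta> has_real_derivative sqrt (deriv \<Phi> x)) (at x)" for x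
  proof -
    let ?a = "- \<bar>x\<bar> - 1" and ?b = "\<bar>x\<bar> + 1"
    have "((\<lambda>u. LBINT y=ereal 0..ereal u. sqrt (deriv \<Phi> y)) has_vector_derivative sqrt (deriv \<Phi> x)) (at x within {?a..?b})"
      by (rule interval_integral_FTC2) (auto intro!: continuous_on_real_sqrt continuous_on_subset[OF D(2)])
    then have "(\<zeta> has_vector_derivative sqrt (deriv \<Phi> x)) (at x within {?a..?b})" by (simp add: \<zeta>_def[abs_def])
    then have "(\<zeta> has_vector_derivative sqrt (deriv \<Phi> x)) (at x within {?a<..<?b})"
      by (rule has_vector_derivative_within_subset) auto
    moreover have "at x within {?a<..<?b} = at x" by (rule at_within_open) auto
    ultimately show ?thesis unfolding has_real_derivative_iff_has_vector_derivative by (simp only:)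
  qed
  show "\<zeta> 0 = 0" by (simp add: \<zeta>_def)
  have upper: "(\<zeta> t - \<zeta> s)\<^sup>2 \<le> (\<Phi> t - \<Phi> s) * (t - s)" if "s < t" for s t
  proof -
    define k where "k = (\<zeta> t - \<zeta> s) / (t - s)"
    have "\<Phi> s - 2 * k * \<zeta> s + k\<^sup>2 * s \<le> \<Phi> t - 2 * k * \<zeta> t + k\<^sup>2 * t"
    proof (rule DERIV_nonneg_imp_nondecreasing[of s t "\<lambda>x. \<Phi> x - 2 * k * \<zeta> x + k\<^sup>2 * x"])
      fix x
      have "((\<lambda>x. \<Phi> x - 2 * k * \<zeta> x + k\<^sup>2 * x) has_real_derivative deriv \<Phi> x - 2 * k * sqrt (deriv \<Phi> x) + k\<^sup>2 * 1) (at x)"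
        by (intro DERIV_add DERIV_diff DERIV_cmult DERIV_ident d\<Phi> d\<zeta>)
      moreover have "deriv \<Phi> x - 2 * k * sqrt (deriv \<Phi> x) + k\<^sup>2 * 1 = (sqrt (deriv \<Phi> x) - k)\<^sup>2"
        using d0[of x] by (simp add: power2_diff)
      ultimately show "\<exists>y. ((\<lambda>x. \<Phi> x - 2 * k * \<zeta> x + k\<^sup>2 * x) has_real_derivative y) (at x) \<and> 0 \<le> y" by (metis zero_le_power2)
    qed (use that in simp)
    then have "0 \<le> ((\<Phi> t - \<Phi> s) - 2 * k * (\<zeta> t - \<zeta> s) + k\<^sup>2 * (t - s)) * (t - s)"
      using that by (intro mult_nonneg_nonneg) (auto simp: algebra_simps)
    also have "\<dots> = (\<Phi> t - \<Phi> s) * (t - s) - 2 * (k * (t - s)) * (\<zeta> t - \<zeta> s) + (k * (t - s))\<^sup>2"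
      by (simp add: algebra_simps power2_eq_square)
    also have "k * (t - s) = \<zeta> t - \<zeta> s" using that by (simp add: k_def)
    finally show ?thesis unfolding power2_eq_square mult.assoc by linarith
  qed
  show "(\<zeta> t - \<zeta> s)\<^sup>2 \<le> (\<Phi> t - \<Phi> s) * (t - s)"
  proof (cases s t rule: linorder_cases)
    case greater
    have "(\<zeta> t - \<zeta> s)\<^sup>2 = (\<zeta> s - \<zeta> t)\<^sup>2" by (rule power2_commute)
    also have "\<dots> \<le> (\<Phi> s - \<Phi> t) * (s - t)" by (rule upper[OF greater])
    finally show ?thesis by (simp add: algebra_simps)
  qed (use upper in auto)
  have H0: "0 \<le> H s" for s unfolding H_def using c(1) by simp
  have lower: "(\<Phi> t - \<Phi> s)\<^sup>2 \<le> (H s + H t) * (\<zeta> t - \<zeta> s)\<^sup>2" if "s < t" for s t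
  proof -
    let ?k = "sqrt (H s + H t)"
    have "?k * \<zeta> s - \<Phi> s \<le> ?k * \<zeta> t - \<Phi> t"
    proof (rule DERIV_nonneg_imp_nondecreasing[of s t "\<lambda>x. ?k * \<zeta> x - \<Phi> x"])
      fix x assume x: "s \<le> x" "x \<le> t"
      have "\<bar>x\<bar> powr (p - 1) \<le> (1 + \<bar>x\<bar>) powr (p - 1)" "1 \<le> (1 + \<bar>x\<bar>) powr (p - 1)"
        using p by (auto intro: powr_mono2 ge_one_powr_ge_zero)
      then have "c1' * (\<bar>x\<bar> powr (p - 1) + 1) \<le> c1' * (2 * (1 + \<bar>x\<bar>) powr (p - 1))" using c(1) by (intro mult_left_mono) auto
      also have "\<dots> = H x" by (simp add: H_def)
      \<comment> \<open>\<open>H\<close> increases with the absolute value, and a point between s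
        and t is in absolute value no larger than one of them.\<close>
      also have "\<dots> \<le> H s + H t"
      proof (cases "\<bar>x\<bar> \<le> \<bar>s\<bar>")
        case True
        then have "H x \<le> H s" unfolding H_def using c(1) p by (intro mult_left_mono powr_mono2) auto
        then show ?thesis using H0[of t] by linarith
      next
        case False
        then have "\<bar>x\<bar> \<le> \<bar>t\<bar>" using x by linarith
        then have "H x \<le> H t" unfolding H_def using c(1) p by (intro mult_left_mono powr_mono2) auto
        then show ?thesis using H0[of s] by linarith
      qed
      finally have "deriv \<Phi> x \<le> H s + H t" using c(2)[of x] by linarith
      then have "sqrt (deriv \<Phi> x) * sqrt (deriv \<Phi> x) \<le> ?k * sqrt (deriv \<Phi> x)"
        using d0[of x] by (intro mult_right_mono) auto
      then have "0 \<le> ?k * sqrt (deriv \<Phi> x) - deriv \<Phi> x" using d0[of x] by simp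
      moreover have "((\<lambda>x. ?k * \<zeta> x - \<Phi> x) has_real_derivative ?k * sqrt (deriv \<Phi> x) - deriv \<Phi> x) (at x)"
        by (intro DERIV_diff DERIV_cmult d\<Phi> d\<zeta>)
      ultimately show "\<exists>y. ((\<lambda>x. ?k * \<zeta> x - \<Phi> x) has_real_derivative y) (at x) \<and> 0 \<le> y" by blast
    qed (use that in simp)
    then have "\<Phi> t - \<Phi> s \<le> ?k * (\<zeta> t - \<zeta> s)" by (simp add: algebra_simps)
    moreover have "0 \<le> \<Phi> t - \<Phi> s" using \<open>mono \<Phi>\<close> that by (simp add: mono_def)
    ultimately have "(\<Phi> t - \<Phi> s)\<^sup>2 \<le> (?k * (\<zeta> t - \<zeta> s))\<^sup>2" by (rule power_mono)
    then show ?thesis using H0[of s] H0[of t] by (simp add: power_mult_distrib)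
  qed
  show "(\<Phi> s - \<Phi> t)\<^sup>2 \<le> (H s + H t) * (\<zeta> s - \<zeta> t)\<^sup>2"
  proof (cases s t rule: linorder_cases)
    case less
    from lower[OF this] show ?thesis by (simp only: power2_commute[of "\<Phi> s"] power2_commute[of "\<zeta> s"])
  next
    case greater
    from lower[OF this] show ?thesis by (simp add: add.commute)
  qed simp
qed

section \<open>Bounds in terms of the noise\<close>

definition comb :: "('m::finite \<Rightarrow> 'a \<Rightarrow> real) \<Rightarrow> real ^ 'm \<Rightarrow> 'a \<Rightarrow> real" where
  "comb \<phi> c = (\<lambda>x. \<Sum>j\<in>UNIV. c $ j * \<phi> j x)"

lemma QW_comb: "QW \<phi> \<omega> t = comb \<phi> (\<omega> t)" by (simp add: QW_def comb_def)

lemma comb_add: "comb \<phi> (b + c) x = comb \<phi> b x + comb \<phi> c x"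
  by (simp add: comb_def distrib_right sum.distrib)

lemma comb_scale: "comb \<phi> (r *\<^sub>R c) x = r * comb \<phi> c x"
  by (simp add: comb_def sum_distrib_left mult.assoc)

lemma comb_abs_le:
  fixes c :: "real ^ 'm"
  assumes "\<And>j. \<bar>b j\<bar> \<le> B j"
  shows "\<bar>\<Sum>j\<in>UNIV. c $ j * b j\<bar> \<le> norm c * (\<Sum>j\<in>UNIV. B j)"
proof -
  have "\<bar>\<Sum>j\<in>UNIV. c $ j * b j\<bar> \<le> (\<Sum>j\<in>UNIV. \<bar>c $ j * b j\<bar>)" by (rule sum_abs)
  also have "\<dots> \<le> (\<Sum>j\<in>UNIV. norm c * B j)"
    unfolding abs_mult by (intro sum_mono mult_mono component_le_norm_cart assms) auto
  finally show ?thesis by (simp add: sum_distrib_left)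
qed

context bounded_domain
begin

lemma continuous_AE_zero:
  assumes h: "continuous_on UNIV h" and z: "AE x in M. h x = (0::real)" and x: "x \<in> \<Lambda>"
  shows "h x = 0"
proof (rule ccontr)
  assume "h x \<noteq> 0"
  define U where "U = {y \<in> \<Lambda>. h y \<noteq> 0}"
  have "open {y. h y \<noteq> 0}" by (intro open_Collect_neq h continuous_intros)
  moreover have "U = \<Lambda> \<inter> {y. h y \<noteq> 0}" by (auto simp: U_def)
  ultimately have "open U" using open_\<Lambda> by auto
  have "AE y in lebesgue. y \<notin> U"
    using z open_\<Lambda> by (auto simp: U_def AE_restrict_space_iff elim: eventually_mono)
  then have "negligible U" using \<open>open U\<close> by (simp add: negligible_iff_null_sets AE_iff_null_sets)
  then show False using open_not_negligible[OF \<open>open U\<close>] x \<open>h x \<noteq> 0\<close> by (auto simp: U_def)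
qed

context
  fixes \<phi> :: "'m::finite \<Rightarrow> 'a \<Rightarrow> real"
  assumes \<phi>: "\<And>j. \<phi> j \<in> C0k (Suc 0) \<Lambda>"
begin

lemma \<phi>_continuous: "continuous_on UNIV (\<phi> j)"
  using C0k1_differentiable[OF \<phi>] by (auto intro!: continuous_at_imp_continuous_on differentiable_imp_continuous_within)

lemma \<phi>_sq: "L2 (\<phi> j)" by (rule continuous_L2[OF \<phi>_continuous])

lemma comb_continuous: "continuous_on UNIV (comb \<phi> c)"
  unfolding comb_def by (intro continuous_intros \<phi>_continuous)

lemma comb_sq: "L2 (comb \<phi> c)" by (rule continuous_L2[OF comb_continuous])

lemma comb_bound:
  obtains B where "B \<ge> 0" "\<And>c x. \<bar>comb \<phi> c x\<bar> \<le> norm c * B" "\<And>c x y. \<bar>comb \<phi> c x - comb \<phi> c y\<bar> \<le> norm c * B * norm (x - y)"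
proof -
  have "\<exists>B. B \<ge> 0 \<and> (\<forall>x. \<bar>\<phi> j x\<bar> \<le> B) \<and> (\<forall>x y. \<bar>\<phi> j x - \<phi> j y\<bar> \<le> B * norm (x - y))" for j
    using C0k1_bounded[OF \<phi>[of j]] by metis
  then obtain B where B: "\<And>j. B j \<ge> 0" "\<And>j x. \<bar>\<phi> j x\<bar> \<le> B j" "\<And>j x y. \<bar>\<phi> j x - \<phi> j y\<bar> \<le> B j * norm (x - y)"
    by metis
  show ?thesis
  proof (rule that[of "\<Sum>j\<in>UNIV. B j"])
    show "0 \<le> (\<Sum>j\<in>UNIV. B j)" by (intro sum_nonneg B(1))
    show "\<bar>comb \<phi> c x\<bar> \<le> norm c * (\<Sum>j\<in>UNIV. B j)" for c x unfolding comb_def by (rule comb_abs_le[OF B(2)])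
    fix c x y
    have "comb \<phi> c x - comb \<phi> c y = (\<Sum>j\<in>UNIV. c $ j * (\<phi> j x - \<phi> j y))"
      by (simp add: comb_def sum_subtractf right_diff_distrib)
    also have "\<bar>\<dots>\<bar> \<le> norm c * (\<Sum>j\<in>UNIV. B j * norm (x - y))" by (rule comb_abs_le[OF B(3)])
    finally show "\<bar>comb \<phi> c x - comb \<phi> c y\<bar> \<le> norm c * (\<Sum>j\<in>UNIV. B j) * norm (x - y)"
      by (simp add: sum_distrib_right mult.assoc)
  qed
qed

text \<open>A quadratic polynomial in the coefficients, given by the Gram matrix of the functions
  \<open>\<phi> j\<close>.\<close>

lemma comb_norm_continuous: "continuous_on UNIV (\<lambda>c. (nrm (comb \<phi> c))\<^sup>2)"
proof -
  have i: "intM (\<lambda>x. (c $ i * \<phi> i x) * (c $ j * \<phi> j x))" for i j c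
    by (rule L2_mult[OF L2_cmult[OF \<phi>_sq] L2_cmult[OF \<phi>_sq]])
  have "(nrm (comb \<phi> c))\<^sup>2 = (\<Sum>i\<in>UNIV. \<Sum>j\<in>UNIV. c $ i * c $ j * ip (\<phi> i) (\<phi> j))" for c
  proof -
    have c: "(LINT x|M. (c $ i * \<phi> i x) * (c $ j * \<phi> j x)) = c $ i * c $ j * ip (\<phi> i) (\<phi> j)" for i j
    proof -
      have "(LINT x|M. (c $ i * \<phi> i x) * (c $ j * \<phi> j x)) = (LINT x|M. (c $ i * c $ j) * (\<phi> i x * \<phi> j x))"
        by (simp only: mult_ac)
      then show ?thesis by (simp only: integral_mult_right_zero ip_def)
    qed
    have "(nrm (comb \<phi> c))\<^sup>2 = (LINT x|M. (\<Sum>i\<in>UNIV. \<Sum>j\<in>UNIV. (c $ i * \<phi> i x) * (c $ j * \<phi> j x)))"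
      unfolding ip_self[symmetric] ip_def comb_def sum_product ..
    also have "\<dots> = (\<Sum>i\<in>UNIV. (LINT x|M. (\<Sum>j\<in>UNIV. (c $ i * \<phi> i x) * (c $ j * \<phi> j x))))"
      by (rule Bochner_Integration.integral_sum) (intro Bochner_Integration.integrable_sum i)
    also have "\<dots> = (\<Sum>i\<in>UNIV. \<Sum>j\<in>UNIV. (LINT x|M. (c $ i * \<phi> i x) * (c $ j * \<phi> j x)))"
      by (intro sum.cong refl Bochner_Integration.integral_sum i)
    also have "\<dots> = (\<Sum>i\<in>UNIV. \<Sum>j\<in>UNIV. c $ i * c $ j * ip (\<phi> i) (\<phi> j))" unfolding c ..
    finally show ?thesis .
  qed
  then show ?thesis by (simp only:) (intro continuous_intros)
qed

text \<open>The Wiener path enters only through \<open>comb \<phi> (\<omega> t)\<close>, and for linearly dependent \<open>\<phi>\<close> the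
  coefficients are not controlled by it; orthogonally to the relations they are.\<close>

lemma comb_norm_equiv:
  obtains A where "A \<ge> 0" "\<And>c. \<exists>c'. comb \<phi> c' = comb \<phi> c \<and> norm c' \<le> A * nrm (comb \<phi> c)"
proof -
  let ?Q = "\<lambda>c. (nrm (comb \<phi> c))\<^sup>2"
  define K where "K = {c. \<forall>x. comb \<phi> c x = 0}"
  have K0: "subspace K" unfolding subspace_def K_def by (simp add: comb_add comb_scale) (simp add: comb_def)
  have zero: "c \<in> K" if "nrm (comb \<phi> c) = 0" for c
    unfolding K_def
  proof (intro CollectI allI)
    fix x
    show "comb \<phi> c x = 0"
    proof (cases "x \<in> \<Lambda>")
      case True
      then show ?thesis by (rule continuous_AE_zero[OF comb_continuous L2norm_eq_0D[OF comb_sq that]])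
    next
      case False
      have "\<phi> j x = 0" for j
      proof -
        have "compactly_supported_in \<Lambda> (\<phi> j)" using \<phi>[of j] by (simp add: C0k_def)
        then show ?thesis using False closure_subset[of "{x. \<phi> j x \<noteq> 0}"] by (auto simp: compactly_supported_in_def)
      qed
      then show ?thesis by (simp add: comb_def)
    qed
  qed
  let ?S = "K\<^sup>\<bottom> \<inter> sphere 0 1"
  have cS: "compact ?S" by (intro closed_Int_compact closed_subspace subspace_orthogonal_comp compact_sphere)
  \<comment> \<open>The seminorm is continuous and positive on the compact unit sphere of the
    orthogonal complement, so it has a positive minimum; if that sphere is empty, any value will
    do.\<close>
  obtain q where q: "q > 0" "\<And>y. y \<in> ?S \<Longrightarrow> q \<le> ?Q y"
  proof (cases "?S = {}")
    case True
    then show ?thesis using that[of 1] by auto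
  next
    case False
    from continuous_attains_inf[OF cS False continuous_on_subset[OF comb_norm_continuous]]
    obtain y where y: "y \<in> ?S" "\<And>w. w \<in> ?S \<Longrightarrow> ?Q y \<le> ?Q w" by auto
    have "?Q y \<noteq> 0"
    proof
      assume "?Q y = 0"
      then have "y \<in> K" by (intro zero) simp
      then have "y \<bullet> y = 0" using y(1) by (auto simp: orthogonal_comp_def orthogonal_def)
      then show False using y(1) by simp
    qed
    then have "?Q y > 0" by (simp add: zero_less_power2)
    then show ?thesis using that y by blast
  qed
  show ?thesis
  proof (rule that[of "1 / sqrt q"])
    show "0 \<le> 1 / sqrt q" using q(1) by simp
    fix c
    \<comment> \<open>The component \<open>z\<close> orthogonal to the relations represents the same
      function as \<open>c\<close>, with controlled coefficients.\<close>
    obtain k z where kz: "k \<in> span K" "\<And>w. w \<in> span K \<Longrightarrow> orthogonal z w" "c = k + z"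
      using orthogonal_subspace_decomp_exists[of K c] by blast
    have k: "k \<in> K" using kz(1) K0 by (simp add: span_eq_iff[THEN iffD2])
    have z: "z \<in> K\<^sup>\<bottom>" using kz(2) span_base by (auto simp: orthogonal_comp_def orthogonal_commute)
    have eq: "comb \<phi> z = comb \<phi> c" using k by (auto simp: kz(3) comb_add K_def)
    have "norm z * sqrt q \<le> nrm (comb \<phi> z)"
    proof (cases "z = 0")
      case False
      let ?y = "(1 / norm z) *\<^sub>R z"
      have "?y \<in> ?S" using False subspace_scale[OF subspace_orthogonal_comp z] by simp
      from q(2)[OF this] have "q \<le> (nrm (\<lambda>x. (1 / norm z) * comb \<phi> z x))\<^sup>2" by (simp add: comb_scale[abs_def])
      also have "nrm (\<lambda>x. (1 / norm z) * comb \<phi> z x) = nrm (comb \<phi> z) / norm z" unfolding L2norm_cmult by simp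
      finally have "sqrt q \<le> nrm (comb \<phi> z) / norm z" by (intro real_le_lsqrt) (use q(1) in auto)
      then show ?thesis using False by (simp add: field_simps)
    qed simp
    then have "norm z \<le> 1 / sqrt q * nrm (comb \<phi> z)" using q(1) by (simp add: field_simps)
    then show "\<exists>c'. comb \<phi> c' = comb \<phi> c \<and> norm c' \<le> 1 / sqrt q * nrm (comb \<phi> c)" using eq by auto
  qed
qed

end

end

section \<open>Constants that are uniform in the coefficients of the noise\<close>

context porous
begin

text \<open>The coefficients are replaced by equivalent ones of controlled size, so that the number
  \<open>m\<close> demanded by the key estimate becomes a multiple of the L^2 norm of the noise. The
  same norm then also bounds its supremum.\<close>

lemma dissipation_constant:
  fixes \<phi> :: "'m::finite \<Rightarrow> 'a \<Rightarrow> real"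
  assumes \<phi>: "\<And>j. \<phi> j \<in> C0k (Suc 0) \<Lambda>" and \<alpha>: "\<alpha> > 0" "p = 1 \<Longrightarrow> \<alpha> \<le> a * lam / 2" and B: "B \<ge> 0" and E0: "E0 \<ge> 0"
    and \<Psi>: "\<And>m. continuous_on UNIV (\<Psi> m)" "\<And>m y. m \<ge> 0 \<Longrightarrow> \<Psi> m y \<le> lam * a / 8 * \<bar>y\<bar> powr (p + 1) + E0 * (1 + m\<^sup>2) ^ Suc k"
    and key: "\<And>c m n Y. norm c * B \<le> m \<Longrightarrow> n > 0 \<Longrightarrow> Y \<in> BM \<Longrightarrow> bounded (Y ` \<Lambda>) \<Longrightarrow>
       3/4 * \<zeta>E n Y - (LINT x|M. \<Psi> m (Y x))
        \<le> \<Phi>E n Y (comb \<phi> c)"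
  obtains K where "K \<ge> 0" "\<And>c n Y. n \<ge> 5 * lam \<Longrightarrow> Lp Y \<Longrightarrow>
     - 2 * \<Phi>E n Y (comb \<phi> c)
       \<le> - \<alpha> * (nrm (\<lambda>x. Y x - comb \<phi> c x))\<^sup>2 + K * (1 + (nrm (comb \<phi> c))\<^sup>2) ^ Suc k"
proof -
  obtain K where K: "K \<ge> 0" "\<And>m g n Y \<Psi>. m \<ge> 0 \<Longrightarrow> g \<in> BM \<Longrightarrow> (\<And>x. x \<in> \<Lambda> \<Longrightarrow> \<bar>g x\<bar> \<le> m) \<Longrightarrow>
     n \<ge> 5 * lam \<Longrightarrow> Lp Y \<Longrightarrow> continuous_on UNIV \<Psi> \<Longrightarrow>
     (\<And>y. \<Psi> y \<le> lam * a / 8 * \<bar>y\<bar> powr (p + 1) + E0 * (1 + m\<^sup>2) ^ Suc k) \<Longrightarrow>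
     (\<And>Y. Y \<in> BM \<Longrightarrow> bounded (Y ` \<Lambda>) \<Longrightarrow>
       3/4 * \<zeta>E n Y - (LINT x|M. \<Psi> (Y x))
        \<le> \<Phi>E n Y g) \<Longrightarrow>
     - 2 * \<Phi>E n Y g
       \<le> - \<alpha> * (nrm (\<lambda>x. Y x - g x))\<^sup>2 + K * (1 + m\<^sup>2) ^ Suc k"
    using key_final[OF \<alpha> E0, of k] by blast
  obtain A where A: "A \<ge> 0" "\<And>c. \<exists>c'. comb \<phi> c' = comb \<phi> c \<and> norm c' \<le> A * nrm (comb \<phi> c)"
    using comb_norm_equiv[of \<phi>, OF \<phi>] by blast
  obtain B1 where B1: "B1 \<ge> 0" "\<And>c x. \<bar>comb \<phi> c x\<bar> \<le> norm c * B1"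
    using comb_bound[of \<phi>, OF \<phi>] by metis
  let ?D = "A * (B + B1)"
  have D0: "0 \<le> ?D" using A(1) B B1(1) by simp
  show ?thesis
  proof (rule that[of "K * (1 + ?D\<^sup>2) ^ Suc k"])
    show "0 \<le> K * (1 + ?D\<^sup>2) ^ Suc k" using K(1) by simp
    fix c n Y assume n: "n \<ge> 5 * lam" and Y: "Lp Y"
    obtain c' where c': "comb \<phi> c' = comb \<phi> c" "norm c' \<le> A * nrm (comb \<phi> c)" using A(2) by blast
    let ?N = "nrm (comb \<phi> c)"
    \<comment> \<open>\<open>B\<close> is the size demanded by the key estimate and
      \<open>B1\<close> belongs to the supremum; one \<open>m\<close> serves both.\<close>
    define m where "m = ?D * ?N"
    have m0: "m \<ge> 0" using D0 by (simp add: m_def)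
    have le: "norm c' * (B + B1) \<le> m"
      using mult_right_mono[OF c'(2), of "B + B1"] B B1(1) by (simp add: m_def mult_ac)
    then have leB: "norm c' * B \<le> m" "norm c' * B1 \<le> m"
      using mult_nonneg_nonneg[OF norm_ge_zero[of c'] B] mult_nonneg_nonneg[OF norm_ge_zero[of c'] B1(1)]
      by (auto simp: distrib_left)
    have n0: "n > 0" using n lam_pos by linarith
    have "- 2 * \<Phi>E n Y (comb \<phi> c')
       \<le> - \<alpha> * (nrm (\<lambda>x. Y x - comb \<phi> c' x))\<^sup>2 + K * (1 + m\<^sup>2) ^ Suc k"
    proof (rule K(2)[OF m0 _ _ n Y \<Psi>(1)[of m] \<Psi>(2)[OF m0]])
      show "comb \<phi> c' \<in> BM" by (rule continuous_measurable_M[OF comb_continuous[of \<phi>, OF \<phi>]])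
      show "\<bar>comb \<phi> c' x\<bar> \<le> m" for x using B1(2)[of c' x] leB(2) by linarith
    qed (rule key[OF leB(1) n0])
    \<comment> \<open>Separates the constant from the noise: 1 + D^2 N^2 is at most the product of 1
      + D^2 and 1 + N^2.\<close>
    moreover have "K * (1 + m\<^sup>2) ^ Suc k \<le> K * ((1 + ?D\<^sup>2) * (1 + ?N\<^sup>2)) ^ Suc k"
    proof (intro mult_left_mono power_mono K(1))
      have "m\<^sup>2 = ?D\<^sup>2 * ?N\<^sup>2" unfolding m_def by (rule power_mult_distrib)
      moreover have "(1 + d) * (1 + e) = 1 + d * e + (d + e)" for d e :: real by (simp add: algebra_simps)
      moreover have "0 \<le> ?D\<^sup>2 + ?N\<^sup>2" by simp
      ultimately show "1 + m\<^sup>2 \<le> (1 + ?D\<^sup>2) * (1 + ?N\<^sup>2)" by simp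
      show "0 \<le> 1 + m\<^sup>2" by simp
    qed
    moreover have "K * ((1 + ?D\<^sup>2) * (1 + ?N\<^sup>2)) ^ Suc k = K * (1 + ?D\<^sup>2) ^ Suc k * (1 + ?N\<^sup>2) ^ Suc k"
      by (simp only: power_mult_distrib mult.assoc)
    ultimately show "- 2 * \<Phi>E n Y (comb \<phi> c)
       \<le> - \<alpha> * (nrm (\<lambda>x. Y x - comb \<phi> c x))\<^sup>2 + K * (1 + ?D\<^sup>2) ^ Suc k * (1 + ?N\<^sup>2) ^ Suc k"
      unfolding c'(1) by linarith
  qed
qed

text \<open>Here the noise term is \<open>m * \<bar>\<Phi> y\<bar>\<close>, with \<open>m\<close>
  from the uniform bounds on n (\<phi> - J n \<phi>), which pass to combinations by
  linearity.\<close>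

lemma dissipation_constant_I:
  fixes \<phi> :: "'m::finite \<Rightarrow> 'a \<Rightarrow> real"
  assumes \<phi>: "\<And>j. \<phi> j \<in> C0k 2 \<Lambda>" and \<alpha>: "\<alpha> > 0" "p = 1 \<Longrightarrow> \<alpha> \<le> a * lam / 2" and k: "p + 1 \<le> real (Suc k)"
  obtains K where "K \<ge> 0" "\<And>c n Y. n \<ge> 5 * lam \<Longrightarrow> Lp Y \<Longrightarrow>
     - 2 * \<Phi>E n Y (comb \<phi> c)
       \<le> - \<alpha> * (nrm (\<lambda>x. Y x - comb \<phi> c x))\<^sup>2 + K * (1 + (nrm (comb \<phi> c))\<^sup>2) ^ Suc k"
proof -
  have \<phi>1: "\<phi> j \<in> C0k (Suc 0) \<Lambda>" for j by (rule C0k_le[OF \<phi>]) simp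
  have "\<exists>B. B \<ge> 0 \<and> (\<forall>n>0. AE x in M. \<bar>n * (\<phi> j x - J n (\<phi> j) x)\<bar> \<le> B)" for j
    using J_C2_bound[OF \<phi>[of j]] by metis
  then obtain B where B: "\<And>j. B j \<ge> 0" "\<And>j n. n > 0 \<Longrightarrow> AE x in M. \<bar>n * (\<phi> j x - J n (\<phi> j) x)\<bar> \<le> B j" by metis
  have d: "lam * a / 8 > 0" using lam_pos a_pos by simp
  obtain E0 where E0: "E0 \<ge> 0" "\<And>m y. m \<ge> 0 \<Longrightarrow> m * \<bar>\<Phi> y\<bar> \<le> lam * a / 8 * \<bar>y\<bar> powr (p + 1) + E0 * (1 + m\<^sup>2) ^ Suc k"
    using absorb_I[OF d k] by blast
  show ?thesis
  proof (rule dissipation_constant[of \<phi> \<alpha> "\<Sum>j\<in>UNIV. B j" E0 "\<lambda>m y. m * \<bar>\<Phi> y\<bar>" k, OF \<phi>1 \<alpha> _ E0(1) _ E0(2) _ that])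
    show "0 \<le> (\<Sum>j\<in>UNIV. B j)" by (intro sum_nonneg B(1))
    show "continuous_on UNIV (\<lambda>y. m * \<bar>\<Phi> y\<bar>)" for m by (intro continuous_intros \<Phi>_cont)
    fix c :: "real ^ 'm" and m n :: real and Y :: "'a \<Rightarrow> real"
    assume m: "norm c * (\<Sum>j\<in>UNIV. B j) \<le> m" and n: "n > 0" and Y: "Y \<in> BM" "bounded (Y ` \<Lambda>)"
    have "AE x in M. \<forall>j. \<bar>n * (\<phi> j x - J n (\<phi> j) x)\<bar> \<le> B j" using B(2)[OF n] by (simp add: AE_all_countable)
    with J_sum[where I = UNIV and c = "\<lambda>j. c $ j" and f = \<phi>, OF \<phi>_sq[of \<phi>, OF \<phi>1] n]
    have "AE x in M. \<bar>n * (comb \<phi> c x - J n (comb \<phi> c) x)\<bar> \<le> m"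
    proof eventually_elim
      case (elim x)
      have "n * (comb \<phi> c x - J n (comb \<phi> c) x) = (\<Sum>j\<in>UNIV. c $ j * (n * (\<phi> j x - J n (\<phi> j) x)))"
        using elim(1) by (simp add: comb_def sum_subtractf[symmetric] sum_distrib_left right_diff_distrib mult_ac)
      also have "\<bar>\<dots>\<bar> \<le> norm c * (\<Sum>j\<in>UNIV. B j)" by (rule comb_abs_le) (use elim(2) in blast)
      finally show ?case using m by linarith
    qed
    note key = key_I[OF n Y comb_sq[of \<phi>, OF \<phi>1] this]
    obtain b where "\<And>x. x \<in> \<Lambda> \<Longrightarrow> \<bar>Y x\<bar> \<le> b" using Y(2) by (auto simp: bounded_iff)
    have \<zeta>Y: "bounded ((\<lambda>x. \<zeta> (Y x)) ` \<Lambda>)"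
    proof -
      have "bounded (\<zeta> ` closure (Y ` \<Lambda>))"
        using Y(2) by (intro compact_imp_bounded compact_continuous_image continuous_on_subset[OF \<zeta>_cont]) auto
      then show ?thesis by (rule bounded_subset) (auto intro: closure_subset[THEN subsetD])
    qed
    then obtain b where b: "\<And>x. x \<in> \<Lambda> \<Longrightarrow> \<bar>\<zeta> (Y x)\<bar> \<le> b" by (auto simp: bounded_iff)
    have \<zeta>s: "L2 (\<lambda>x. \<zeta> (Y x))"
      by (rule Lp_integrable_sq[OF Lp_integrable_bounded[OF _ measurable_comp_\<Phi>\<zeta>(2)[OF Y(1)] b, of 2]]) auto
    \<comment> \<open>Nonnegativity of the form allows the coefficient 1 of \<open>\<zeta>E\<close>
      to be lowered to 3/4, the value shared by both hypotheses.\<close>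
    have "0 \<le> ip (\<lambda>x. \<zeta> (Y x)) (\<lambda>x. \<zeta> (Y x) - J n (\<lambda>x. \<zeta> (Y x)) x)"
      using ip_diff_right[OF \<zeta>s J_L2[OF \<zeta>s n] \<zeta>s] ip_J_le[OF \<zeta>s n] by (simp add: ip_self)
    then have "0 \<le> \<zeta>E n Y" using n by simp
    then show "3/4 * \<zeta>E n Y - (LINT x|M. m * \<bar>\<Phi> (Y x)\<bar>)
      \<le> \<Phi>E n Y (comb \<phi> c)"
      using key by linarith
  qed
qed

text \<open>The noise term combines the Lipschitz bound with the killing bound on the common
  support. As \<open>H\<close> grows like |y|^{p-1}, it stays of lower order than |y|^{p+1}.\<close>

lemma dissipation_constant_II:
  fixes \<phi> :: "'m::finite \<Rightarrow> 'a \<Rightarrow> real"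
  assumes \<phi>: "\<And>j. \<phi> j \<in> C0k (Suc 0) \<Lambda>" and \<alpha>: "\<alpha> > 0" "p = 1 \<Longrightarrow> \<alpha> \<le> a * lam / 2" and k: "p + 1 \<le> real (Suc k)"
    and H: "c1' \<ge> 0" "\<And>s. H s = 2 * c1' * (1 + \<bar>s\<bar>) powr (p - 1)" "\<And>s t. (\<Phi> s - \<Phi> t)\<^sup>2 \<le> (H s + H t) * (\<zeta> s - \<zeta> t)\<^sup>2"
  obtains K where "K \<ge> 0" "\<And>c n Y. n \<ge> 5 * lam \<Longrightarrow> Lp Y \<Longrightarrow>
     - 2 * \<Phi>E n Y (comb \<phi> c)
       \<le> - \<alpha> * (nrm (\<lambda>x. Y x - comb \<phi> c x))\<^sup>2 + K * (1 + (nrm (comb \<phi> c))\<^sup>2) ^ Suc k"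
proof -
  have Hc: "continuous_on UNIV H" unfolding H(2)[abs_def] by (intro continuous_intros) auto
  \<comment> \<open>There are finitely many functions \<open>\<phi> j\<close>, so one compact set
    contains the supports of all their combinations.\<close>
  define C where "C = (\<Union>j. closure {x. \<phi> j x \<noteq> 0})"
  have C: "compact C" "C \<subseteq> \<Lambda>" "\<And>c x. x \<notin> C \<Longrightarrow> comb \<phi> c x = 0"
  proof -
    have s: "compactly_supported_in \<Lambda> (\<phi> j)" for j using \<phi>[of j] by (simp add: C0k_def)
    show "compact C" unfolding C_def by (rule compact_UN) (use s in \<open>auto simp: compactly_supported_in_def\<close>)
    show "C \<subseteq> \<Lambda>" unfolding C_def using s by (auto simp: compactly_supported_in_def)
    show "comb \<phi> c x = 0" if "x \<notin> C" for c x
    proof -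
      have "\<phi> j x = 0" for j using that closure_subset[of "{x. \<phi> j x \<noteq> 0}"] by (auto simp: C_def)
      then show ?thesis by (simp add: comb_def)
    qed
  qed
  obtain R where R: "R \<ge> 0" "\<And>n. n > 0 \<Longrightarrow> AE x in M. x \<in> C \<longrightarrow> n * (1 - J1 n x) \<le> R"
    using J1_killing_bound[OF C(1,2)] by blast
  obtain B where B: "B \<ge> 0" "\<And>c x. \<bar>comb \<phi> c x\<bar> \<le> norm c * B" "\<And>c x y. \<bar>comb \<phi> c x - comb \<phi> c y\<bar> \<le> norm c * B * norm (x - y)"
    using comb_bound[of \<phi>, OF \<phi>] by metis
  have d: "lam * a / 8 > 0" using lam_pos a_pos by simp
  define A where "A = (R + 2 * DIM('a)) * (2 * c1')"
  have A: "A \<ge> 0" unfolding A_def using R(1) H(1) by simp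
  obtain E0 where E0: "E0 \<ge> 0" "\<And>m y. m \<ge> 0 \<Longrightarrow> A * m\<^sup>2 * ((1 + \<bar>y\<bar>) powr (p - 1) + 1) \<le> lam * a / 8 * \<bar>y\<bar> powr (p + 1) + E0 * (1 + m\<^sup>2) ^ Suc k"
    using absorb_II[OF d k A] by blast
  show ?thesis
  proof (rule dissipation_constant[of \<phi> \<alpha> B E0 "\<lambda>m y. (R + 2 * DIM('a)) * m\<^sup>2 * (H y + H 0)" k, OF \<phi> \<alpha> B(1) E0(1) _ _ _ that])
    show "continuous_on UNIV (\<lambda>y. (R + 2 * DIM('a)) * m\<^sup>2 * (H y + H 0))" for m by (intro continuous_intros Hc)
    show "(R + 2 * DIM('a)) * m\<^sup>2 * (H y + H 0) \<le> lam * a / 8 * \<bar>y\<bar> powr (p + 1) + E0 * (1 + m\<^sup>2) ^ Suc k" if "m \<ge> 0" for m y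
    proof -
      have "(R + 2 * DIM('a)) * m\<^sup>2 * (H y + H 0) = A * m\<^sup>2 * ((1 + \<bar>y\<bar>) powr (p - 1) + 1)"
        unfolding A_def H(2) by (simp add: algebra_simps)
      then show ?thesis using E0(2)[OF that, of y] by (simp only:)
    qed
    fix c :: "real ^ 'm" and m n :: real and Y :: "'a \<Rightarrow> real"
    assume m: "norm c * B \<le> m" and n: "n > 0" and Y: "Y \<in> BM" "bounded (Y ` \<Lambda>)"
    show "3/4 * \<zeta>E n Y - (LINT x|M. (R + 2 * DIM('a)) * m\<^sup>2 * (H (Y x) + H 0))
      \<le> \<Phi>E n Y (comb \<phi> c)"
    proof (rule key_II[OF n Y Hc _ H(3) comb_continuous[of \<phi>, OF \<phi>] _ _ C(3) R(1) R(2)[OF n]])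
      show "0 \<le> H s" for s unfolding H(2) using H(1) by simp
      show "\<bar>comb \<phi> c x\<bar> \<le> m" for x using B(2)[of c x] m by linarith
      show "\<bar>comb \<phi> c x - comb \<phi> c y\<bar> \<le> m * norm (x - y)" for x y
        using B(3)[of c x y] mult_right_mono[OF m norm_ge_zero[of "x - y"]] by linarith
    qed
  qed
qed

text \<open>The result for bounded intervals is applied on every [s, T]. Representatives are unique
  only up to null sets, so one is chosen for each time beforehand, and all intervals refer to this
  single choice.\<close>

lemma solution_L2:
  fixes \<phi> :: "'m::finite \<Rightarrow> 'a \<Rightarrow> real"
  assumes \<phi>: "\<And>j. \<phi> j \<in> C0k (Suc 0) \<Lambda>" and \<omega>: "continuous_on UNIV \<omega>" and x: "L2 x"
    and sol: "pathwise_solution \<Lambda> p \<Phi> \<phi> s (emb x) \<omega> Z" and \<alpha>: "\<alpha> \<ge> 0"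
    and p2_cont: "continuous_on UNIV p2" and p2_nonneg: "\<And>t. 0 \<le> p2 t"
    and diss: "\<And>t n Y. n \<ge> 5 * lam \<Longrightarrow> Lp Y \<Longrightarrow>
     - 2 * (n * ip (\<lambda>x. \<Phi> (Y x)) (\<lambda>x. (Y x - comb \<phi> (\<omega> t) x) - J n (\<lambda>x. Y x - comb \<phi> (\<omega> t) x) x))
       \<le> - \<alpha> * (nrm (\<lambda>x. Y x - comb \<phi> (\<omega> t) x))\<^sup>2 + p2 t"
  shows "\<exists>z. (\<forall>t\<ge>s. z t \<in> Lq 2 \<Lambda> \<and> Heq \<Lambda> (Z t) (emb (z t))) \<and>
       (\<forall>t1 t2. s \<le> t1 \<longrightarrow> t1 \<le> t2 \<longrightarrow>
          integrable (lb t1 t2) (\<lambda>r. (Lq_norm 2 \<Lambda> (z r))\<^sup>2) \<and>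
          (Lq_norm 2 \<Lambda> (z t2))\<^sup>2
            \<le> (Lq_norm 2 \<Lambda> (z t1))\<^sup>2
              - \<alpha> * (LINT r|lb t1 t2. (Lq_norm 2 \<Lambda> (z r))\<^sup>2)
              + (LINT r|lb t1 t2. p2 r)) \<and>
       (\<forall>t\<ge>s. ((\<lambda>r. Lq_norm 2 \<Lambda> (\<lambda>\<xi>. z r \<xi> - z t \<xi>)) \<longlongrightarrow> 0) (at_right t))"
proof -
  have Z: "\<And>t. t \<ge> s \<Longrightarrow> Z t \<in> HD"
    "\<And>t. t \<ge> s \<Longrightarrow> ((\<lambda>r. Hnorm \<Lambda> (\<lambda>u. Z r u - Z t u)) \<longlongrightarrow> 0) (at t within {s..})"
    using sol by (auto simp: pathwise_solution_def)
  obtain z where z: "z \<in> Lq_loc_Lq (p + 1) \<Lambda> s" "AE t in lebesgue_on {s..}. Heq \<Lambda> (Z t) (emb (z t))"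
    "\<And>v t. v \<in> Lq (p + 1) \<Lambda> \<Longrightarrow> t \<ge> s \<Longrightarrow>
       Hinner \<Lambda> (Z t) (emb v)
           = Hinner \<Lambda> (\<lambda>u. emb x u - emb (QW \<phi> \<omega> s) u) (emb v)
             - (LINT r|lb s t. LINT \<xi>|lebesgue_on \<Lambda>. \<Phi> (z r \<xi> + QW \<phi> \<omega> r \<xi>) * v \<xi>)"
    using sol unfolding pathwise_solution_def by blast
  obtain S where S: "\<And>j::nat. simple_function (lebesgue_on {s..}) (S j)" "\<And>j t. t \<ge> s \<Longrightarrow> S j t \<in> Lq (p + 1) \<Lambda>"
    "AE t in lebesgue_on {s..}. (\<lambda>j. Lq_norm (p + 1) \<Lambda> (\<lambda>\<xi>. S j t \<xi> - z t \<xi>)) \<leadsto> 0"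
    using z(1) unfolding Lq_loc_Lq_def by blast
  have zL: "\<And>t. t \<ge> s \<Longrightarrow> z t \<in> Lq (p + 1) \<Lambda>" "\<And>T. T \<ge> s \<Longrightarrow> integrable (lb s T) (\<lambda>t. Lq_norm (p + 1) \<Lambda> (z t) powr (p + 1))"
    using z(1) unfolding Lq_loc_Lq_def by auto
  have powr_norm: "Lq_norm (p + 1) \<Lambda> f powr (p + 1) = (LINT x|M. \<bar>f x\<bar> powr (p + 1))" for f :: "'a \<Rightarrow> real"
  proof -
    have "0 \<le> (LINT x|M. \<bar>f x\<bar> powr (p + 1))" by simp
    then show ?thesis using p1 by (simp add: Lq_norm_def powr_powr)
  qed
  obtain B where B: "B \<ge> 0" "\<And>c x. \<bar>comb \<phi> c x\<bar> \<le> norm c * B" using comb_bound[of \<phi>, OF \<phi>] by metis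
  let ?f0 = "\<lambda>\<xi>. x \<xi> - comb \<phi> (\<omega> s) \<xi>" and ?X0 = "\<lambda>u. emb x u - emb (QW \<phi> \<omega> s) u"
  note cs = comb_sq[of \<phi>, OF \<phi>]
  have path: "\<exists>b. dissipative_path \<Lambda> lam p a c c1 c2 \<Phi> \<zeta> s T b (QW \<phi> \<omega>) z S Z ?X0 \<alpha> (5 * lam) p2 ?f0" if T: "s \<le> T" for T
  proof -
    have "bounded (\<omega> ` {s..T})" by (intro compact_imp_bounded compact_continuous_image continuous_on_subset[OF \<omega>]) auto
    then obtain b where b: "\<And>t. t \<in> {s..T} \<Longrightarrow> norm (\<omega> t) \<le> b" unfolding bounded_iff by (metis imageI)
    interpret P: porous_path \<Lambda> lam p a c c1 c2 \<Phi> \<zeta> s T "b * B" "QW \<phi> \<omega>" z S Z ?X0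
    proof unfold_locales
      show "continuous_on UNIV (QW \<phi> \<omega> \<tau>)" for \<tau> unfolding QW_comb by (rule comb_continuous[of \<phi>, OF \<phi>])
      show "continuous_on UNIV (\<lambda>\<tau>. QW \<phi> \<omega> \<tau> \<xi>)" for \<xi> unfolding QW_def by (intro continuous_intros \<omega>)
      show "\<bar>QW \<phi> \<omega> \<tau> \<xi>\<bar> \<le> b * B" if "\<tau> \<in> {s..T}" for \<tau> \<xi>
        unfolding QW_comb by (rule order_trans[OF B(2) mult_right_mono[OF b[OF that] B(1)]])
      show "Lp (z \<tau>)" if "\<tau> \<in> {s..T}" for \<tau> using zL(1)[of \<tau>] that by (simp add: Lp_integrable_Lq)
      show "simple_function (lb s T) (S j)" for j
        by (rule simple_function_lebesgue_on_subset[OF S(1)]) auto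
      show "Lp (S j \<tau>)" if "\<tau> \<in> {s..T}" for \<tau> j using S(2)[of \<tau>] that by (simp add: Lp_integrable_Lq)
      have "AE \<tau> in lb s T. (\<lambda>j. Lq_norm (p + 1) \<Lambda> (\<lambda>\<xi>. S j \<tau> \<xi> - z \<tau> \<xi>)) \<leadsto> 0"
        by (rule AE_lebesgue_on_subset[OF S(3)]) auto
      then show "AE \<tau> in lb s T. (\<lambda>j. LINT x|M. \<bar>S j \<tau> x - z \<tau> x\<bar> powr (p + 1)) \<leadsto> 0"
      proof eventually_elim
        case (elim \<tau>)
        have "(\<lambda>j. Lq_norm (p + 1) \<Lambda> (\<lambda>\<xi>. S j \<tau> \<xi> - z \<tau> \<xi>) powr (p + 1)) \<leadsto> 0"
          by (rule tendsto_zero_powrI[OF elim tendsto_const]) (use p1 in \<open>auto simp: Lq_norm_def\<close>)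
        then show ?case by (simp only: powr_norm)
      qed
      show "integrable (lb s T) (\<lambda>\<tau>. LINT x|M. \<bar>z \<tau> x\<bar> powr (p + 1))" using zL(2)[OF T] by (simp only: powr_norm)
      show "Z \<tau> \<in> HD" if "\<tau> \<in> {s..T}" for \<tau> using Z(1) that by simp
      show "?X0 \<in> HD" unfolding QW_comb by (rule Hdual_diff[OF embH_Hdual[OF x] embH_Hdual[OF cs]])
      show "((\<lambda>r. Hnorm \<Lambda> (\<lambda>u. Z r u - Z \<tau> u)) \<longlongrightarrow> 0) (at \<tau> within {s..T})" if "\<tau> \<in> {s..T}" for \<tau>
        by (rule tendsto_mono[OF at_le Z(2)]) (use that in auto)
      show "AE \<tau> in lb s T. Heq \<Lambda> (Z \<tau>) (emb (z \<tau>))" by (rule AE_lebesgue_on_subset[OF z(2)]) auto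
      show "Hinner \<Lambda> (Z \<tau>) (emb v) = Hinner \<Lambda> ?X0 (emb v)
        - (LINT r|lebesgue_on {s..\<tau>}. LINT x|lebesgue_on \<Lambda>. \<Phi> (z r x + QW \<phi> \<omega> r x) * v x)"
        if "Lp v" "\<tau> \<in> {s..T}" for v \<tau>
        by (rule z(3)) (use that in \<open>auto simp: Lp_integrable_Lq\<close>)
    qed
    have "dissipative_path \<Lambda> lam p a c c1 c2 \<Phi> \<zeta> s T (b * B) (QW \<phi> \<omega>) z S Z ?X0 \<alpha> (5 * lam) p2 ?f0"
    proof unfold_locales
      show "s \<le> T" "\<alpha> \<ge> 0" by fact+
      show "5 * lam > 0" using lam_pos by simp
      show "L2 ?f0" by (rule L2_diff[OF x cs])
      show "Heq \<Lambda> ?X0 (emb ?f0)" unfolding Heq_def embH_ip QW_comb using ip_diff_left[OF x cs H01_L2] by simp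
      show "continuous_on {s..T} p2" by (rule continuous_on_subset[OF p2_cont]) auto
      show "0 \<le> p2 r" for r by (rule p2_nonneg)
      show "- 2 * (n * P.pairing n (z r) r) \<le> - \<alpha> * (nrm (z r))\<^sup>2 + p2 r" if "n \<ge> 5 * lam" "r \<in> {s..T}" for n r
      proof -
        have "(\<lambda>x. P.Y r x - comb \<phi> (\<omega> r) x) = z r" by (simp add: P.Y_def QW_comb)
        moreover have "P.Y r x - comb \<phi> (\<omega> r) x = z r x" for x by (simp add: P.Y_def QW_comb)
        ultimately show ?thesis using diss[OF that(1) P.Y_Lp[OF that(2)], of r] unfolding P.pairing_def by (simp only:)
      qed
    qed
    then show ?thesis by blast
  qed
  have "\<exists>f. L2 f \<and> Heq \<Lambda> (Z t) (emb f)" if t: "t \<ge> s" for t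
  proof -
    from path[OF t] obtain b where "dissipative_path \<Lambda> lam p a c c1 c2 \<Phi> \<zeta> s t b (QW \<phi> \<omega>) z S Z ?X0 \<alpha> (5 * lam) p2 ?f0" by blast
    then interpret P: dissipative_path \<Lambda> lam p a c c1 c2 \<Phi> \<zeta> s t b "QW \<phi> \<omega>" z S Z ?X0 \<alpha> "5 * lam" p2 ?f0 .
    show ?thesis by (rule P.Z_in_L2) (use t in simp)
  qed
  then obtain f where f: "\<And>t. t \<ge> s \<Longrightarrow> L2 (f t)" "\<And>t. t \<ge> s \<Longrightarrow> Heq \<Lambda> (Z t) (emb (f t))" by metis
  have ineq: "integrable (lb t1 t2) (\<lambda>r. (nrm (f r))\<^sup>2) \<and>
      (nrm (f t2))\<^sup>2 \<le> (nrm (f t1))\<^sup>2 - \<alpha> * (LINT r|lb t1 t2. (nrm (f r))\<^sup>2) + (LINT r|lb t1 t2. p2 r)"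
    if t: "s \<le> t1" "t1 \<le> t2" for t1 t2
  proof -
    have st2: "s \<le> t2" using t by linarith
    from path[OF this] obtain b where "dissipative_path \<Lambda> lam p a c c1 c2 \<Phi> \<zeta> s t2 b (QW \<phi> \<omega>) z S Z ?X0 \<alpha> (5 * lam) p2 ?f0" by blast
    then interpret P: dissipative_path \<Lambda> lam p a c c1 c2 \<Phi> \<zeta> s t2 b "QW \<phi> \<omega>" z S Z ?X0 \<alpha> "5 * lam" p2 ?f0 .
    have f': "\<And>t. t \<in> {s..t2} \<Longrightarrow> L2 (f t)" "\<And>t. t \<in> {s..t2} \<Longrightarrow> Heq \<Lambda> (Z t) (emb (f t))" using f by auto
    show ?thesis
      using P.L2_dissipation[of f, OF f' t order_refl] lb_integrable_subinterval[OF P.f_norm_integrable[of f, OF f'] t(1) order_refl] by blast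
  qed
  have right: "((\<lambda>r. nrm (\<lambda>\<xi>. f r \<xi> - f t \<xi>)) \<longlongrightarrow> 0) (at_right t)" if t: "t \<ge> s" for t
  proof -
    \<comment> \<open>Right continuity at t needs an interval that extends beyond t.\<close>
    have sT: "s \<le> t + 1" using t by linarith
    from path[OF this] obtain b where "dissipative_path \<Lambda> lam p a c c1 c2 \<Phi> \<zeta> s (t + 1) b (QW \<phi> \<omega>) z S Z ?X0 \<alpha> (5 * lam) p2 ?f0" by blast
    then interpret P: dissipative_path \<Lambda> lam p a c c1 c2 \<Phi> \<zeta> s "t + 1" b "QW \<phi> \<omega>" z S Z ?X0 \<alpha> "5 * lam" p2 ?f0 .
    show ?thesis by (rule P.right_continuous_L2[of f]) (use f t in auto)
  qed
  show ?thesis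
    using f ineq right by (intro exI[of _ f]) (simp add: Lq2_iff Lq_norm2)
qed

end

theorem theorem3p1:
  fixes \<Lambda> :: "'a::euclidean_space set"
    and \<phi> :: "'m::finite \<Rightarrow> 'a \<Rightarrow> real"
    and \<Phi> :: "real \<Rightarrow> real"
    and P :: "(real \<Rightarrow> real ^ 'm) measure"
    and \<Omega>0 :: "(real \<Rightarrow> real ^ 'm) set"
    and Z :: "real \<Rightarrow> real \<Rightarrow> 'a functional \<Rightarrow> (real \<Rightarrow> real ^ 'm) \<Rightarrow> 'a functional"
    and p a c c1 c2 lam1 \<alpha> :: real
  assumes "open \<Lambda>" and "bounded \<Lambda>"
    and "poincare_constant \<Lambda> lam1"
    and "nonlinearity p a c c1 c2 \<Phi>"
    and "\<And>j. \<phi> j \<in> C0k 1 \<Lambda>"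
    and "two_sided_wiener_measure P"
    and "good_noise_set \<Lambda> \<phi> P \<Omega>0"
    and "\<And>s x \<omega>. x \<in> Hdual \<Lambda> \<Longrightarrow> \<omega> \<in> path_space \<Longrightarrow>
           pathwise_solution \<Lambda> p \<Phi> \<phi> s x \<omega> (\<lambda>t. Z t s x \<omega>)"
    and "hypothesis_I \<Lambda> \<phi> p a c \<Phi> \<or> hypothesis_II \<Lambda> \<phi> p a c \<Phi>"
    and "\<alpha> > 0"
    and "p = 1 \<Longrightarrow> \<alpha> \<le> a * lam1 / 2"
  shows "\<exists>p2 :: real \<Rightarrow> (real \<Rightarrow> real ^ 'm) \<Rightarrow> real.
    (\<forall>t. p2 t \<in> borel_measurable (completion P)) \<and>
    (\<forall>\<omega>\<in>path_space. continuous_on UNIV (\<lambda>t. p2 t \<omega>) \<and> poly_growth (\<lambda>t. p2 t \<omega>)) \<and>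
    (\<forall>x\<in>Lq 2 \<Lambda>. \<forall>\<omega>\<in>\<Omega>0. \<forall>s. \<exists>z :: real \<Rightarrow> 'a \<Rightarrow> real.
       (\<forall>t\<ge>s. z t \<in> Lq 2 \<Lambda> \<and> Heq \<Lambda> (Z t s (embH \<Lambda> x) \<omega>) (embH \<Lambda> (z t))) \<and>
       (\<forall>t1 t2. s \<le> t1 \<longrightarrow> t1 \<le> t2 \<longrightarrow>
          integrable (lebesgue_on {t1..t2}) (\<lambda>r. (Lq_norm 2 \<Lambda> (z r))\<^sup>2) \<and>
          (Lq_norm 2 \<Lambda> (z t2))\<^sup>2
            \<le> (Lq_norm 2 \<Lambda> (z t1))\<^sup>2
              - \<alpha> * (LINT r|lebesgue_on {t1..t2}. (Lq_norm 2 \<Lambda> (z r))\<^sup>2)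
              + (LINT r|lebesgue_on {t1..t2}. p2 r \<omega>)) \<and>
       (\<forall>t\<ge>s. ((\<lambda>r. Lq_norm 2 \<Lambda> (\<lambda>\<xi>. z r \<xi> - z t \<xi>)) \<longlongrightarrow> 0) (at_right t)))"
proof -
  interpret bounded_domain \<Lambda> lam1 by unfold_locales (use assms(1-3) in auto)
  have \<phi>: "\<phi> j \<in> C0k (Suc 0) \<Lambda>" for j using assms(5)[of j] by simp
  have nl: "1 \<le> p" "0 < a" "0 \<le> c" "0 \<le> c1" "0 \<le> c2" "continuous_on UNIV \<Phi>" "\<Phi> 0 = 0"
    "\<And>s t. (\<Phi> t - \<Phi> s) * (t - s) \<ge> 0" "\<And>s. \<bar>\<Phi> s\<bar> \<le> c1 * \<bar>s\<bar> powr p + c2"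
    using assms(4) by (auto simp: nonlinearity_def)
  obtain k where "p + 1 \<le> real k" using real_arch_simple by blast
  then have k: "p + 1 \<le> real (Suc k)" by simp
  \<comment> \<open>The constant is uniform in the coefficient vector \<open>b\<close>, which at
    time t will be \<open>\<omega> t\<close>; so one function of the value of the path serves all
    times, paths and initial data.\<close>
  have "\<exists>\<zeta> K. porous \<Lambda> lam1 p a c c1 c2 \<Phi> \<zeta> \<and> K \<ge> 0 \<and> (\<forall>b n Y. n \<ge> 5 * lam1 \<longrightarrow> Lp_integrable (p + 1) Y \<longrightarrow>
     - 2 * (n * ip (\<lambda>x. \<Phi> (Y x)) (\<lambda>x. (Y x - comb \<phi> b x) - J n (\<lambda>x. Y x - comb \<phi> b x) x))
       \<le> - \<alpha> * (L2norm M (\<lambda>x. Y x - comb \<phi> b x))\<^sup>2 + K * (1 + (L2norm M (comb \<phi> b))\<^sup>2) ^ Suc k)"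
    using assms(9)
  proof
    assume h: "hypothesis_I \<Lambda> \<phi> p a c \<Phi>"
    then obtain \<zeta> where \<zeta>: "\<zeta> 0 = 0" "\<And>s t. (\<zeta> t - \<zeta> s)\<^sup>2 \<le> (\<Phi> t - \<Phi> s) * (t - s)" "\<And>s. a * \<bar>s\<bar> powr (p + 1) - c \<le> (\<zeta> s)\<^sup>2"
      by (auto simp: hypothesis_I_def)
    interpret P: porous \<Lambda> lam1 p a c c1 c2 \<Phi> \<zeta>
      by unfold_locales (fact nl \<zeta> \<zeta>_continuous[OF nl(6) \<zeta>(2)])+
    have "\<phi> j \<in> C0k 2 \<Lambda>" for j using h by (simp add: hypothesis_I_def)
    from P.dissipation_constant_I[of \<phi>, OF this assms(10,11) k] obtain K where "K \<ge> 0" "\<And>b n Y. n \<ge> 5 * lam1 \<Longrightarrow> Lp_integrable (p + 1) Y \<Longrightarrow>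
     - 2 * (n * ip (\<lambda>x. \<Phi> (Y x)) (\<lambda>x. (Y x - comb \<phi> b x) - J n (\<lambda>x. Y x - comb \<phi> b x) x))
       \<le> - \<alpha> * (L2norm M (\<lambda>x. Y x - comb \<phi> b x))\<^sup>2 + K * (1 + (L2norm M (comb \<phi> b))\<^sup>2) ^ Suc k"
      by blast
    then show ?thesis using P.porous_axioms by (intro exI[of _ \<zeta>] exI[of _ K] conjI allI impI)
  next
    assume h: "hypothesis_II \<Lambda> \<phi> p a c \<Phi>"
    then obtain c1' where c1': "c1' \<ge> 0" "\<And>s. deriv \<Phi> s \<le> c1' * (\<bar>s\<bar> powr (p - 1) + 1)" by (auto simp: hypothesis_II_def)
    define \<zeta> where "\<zeta> = (\<lambda>s. LBINT r=ereal 0..ereal s. sqrt (deriv \<Phi> r))"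
    \<comment> \<open>\<open>1 + \<bar>s\<bar>\<close> in place of \<open>\<bar>s\<bar>\<close>
      keeps \<open>H\<close> continuous for p = 1, since \<open>\<bar>s\<bar> powr 0\<close> is 0 at
      the origin and 1 elsewhere.\<close>
    define H where "H = (\<lambda>s. 2 * c1' * (1 + \<bar>s\<bar>) powr (p - 1))"
    have D: "\<And>r. \<Phi> differentiable (at r)" "continuous_on UNIV (deriv \<Phi>)"
      and co: "\<And>s. a * \<bar>s\<bar> powr (p + 1) - c \<le> (\<zeta> s)\<^sup>2"
      using h by (auto simp: hypothesis_II_def \<zeta>_def)
    note \<zeta> = hypothesis_II_root[of \<Phi> c1' p \<zeta> H, OF D nl(8) c1' nl(1) fun_cong[OF \<zeta>_def] fun_cong[OF H_def]]
    interpret P: porous \<Lambda> lam1 p a c c1 c2 \<Phi> \<zeta>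
      by unfold_locales (fact nl \<zeta> co \<zeta>_continuous[OF nl(6) \<zeta>(2)])+
    from P.dissipation_constant_II[of \<phi>, OF \<phi> assms(10,11) k c1'(1) fun_cong[OF H_def] \<zeta>(3)] obtain K where "K \<ge> 0" "\<And>b n Y. n \<ge> 5 * lam1 \<Longrightarrow> Lp_integrable (p + 1) Y \<Longrightarrow>
     - 2 * (n * ip (\<lambda>x. \<Phi> (Y x)) (\<lambda>x. (Y x - comb \<phi> b x) - J n (\<lambda>x. Y x - comb \<phi> b x) x))
       \<le> - \<alpha> * (L2norm M (\<lambda>x. Y x - comb \<phi> b x))\<^sup>2 + K * (1 + (L2norm M (comb \<phi> b))\<^sup>2) ^ Suc k"
      by blast
    then show ?thesis using P.porous_axioms by (intro exI[of _ \<zeta>] exI[of _ K] conjI allI impI)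
  qed
  then obtain \<zeta> K where por: "porous \<Lambda> lam1 p a c c1 c2 \<Phi> \<zeta>" and K: "K \<ge> 0"
    "\<And>b n Y. n \<ge> 5 * lam1 \<Longrightarrow> Lp_integrable (p + 1) Y \<Longrightarrow>
     - 2 * (n * ip (\<lambda>x. \<Phi> (Y x)) (\<lambda>x. (Y x - comb \<phi> b x) - J n (\<lambda>x. Y x - comb \<phi> b x) x))
       \<le> - \<alpha> * (L2norm M (\<lambda>x. Y x - comb \<phi> b x))\<^sup>2 + K * (1 + (L2norm M (comb \<phi> b))\<^sup>2) ^ Suc k"
    by blast
  interpret P: porous \<Lambda> lam1 p a c c1 c2 \<Phi> \<zeta> by (rule por)
  define F where "F = (\<lambda>b. K * (1 + (L2norm M (comb \<phi> b))\<^sup>2) ^ Suc k)"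
  \<comment> \<open>The value 0 off \<open>\<Omega>0\<close> gives polynomial growth for every path,
    not just for the good ones. Measurability then refers to the completion, in which
    \<open>\<Omega>0\<close> is measurable.\<close>
  define p2 where "p2 = (\<lambda>t \<omega>. if \<omega> \<in> \<Omega>0 then F (\<omega> t) else 0)"
  have Fc: "continuous_on UNIV F" unfolding F_def by (intro continuous_intros comb_norm_continuous[of \<phi>, OF \<phi>])
  have F0: "0 \<le> F b" for b using K(1) by (simp add: F_def)
  have P: "space P = path_space" "sets P = sigma_sets path_space {{\<omega> \<in> path_space. \<omega> t \<in> B} | t B. B \<in> sets borel}"
    using assms(6) by (auto simp: two_sided_wiener_measure_def)
  have \<Omega>0: "\<Omega>0 \<in> sets (completion P)" and
    growth: "\<And>\<omega>. \<omega> \<in> \<Omega>0 \<Longrightarrow> poly_growth (\<lambda>t. Lq_norm 2 \<Lambda> (QW \<phi> \<omega> t) powr 2)"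
    using assms(7) by (auto simp: good_noise_set_def)
  have \<Omega>0_path: "\<Omega>0 \<subseteq> path_space" using sets.sets_into_space[OF \<Omega>0] P(1) by simp
  show ?thesis
  proof (intro exI[of _ p2] conjI allI ballI)
    fix t
    have ev: "(\<lambda>\<omega>. \<omega> t) \<in> measurable P borel"
    proof (rule measurableI)
      fix A :: "(real ^ 'm) set" assume "A \<in> sets borel"
      then have "{\<omega> \<in> path_space. \<omega> t \<in> A} \<in> sets P" unfolding P(2) by (intro sigma_sets.Basic) blast
      moreover have "(\<lambda>\<omega>. \<omega> t) -` A \<inter> space P = {\<omega> \<in> path_space. \<omega> t \<in> A}" using P(1) by auto
      ultimately show "(\<lambda>\<omega>. \<omega> t) -` A \<inter> space P \<in> sets P" by simp
    qed simp
    have "(\<lambda>\<omega>. F (\<omega> t)) \<in> borel_measurable P"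
      by (rule measurable_compose[OF ev borel_measurable_continuous_onI[OF Fc]])
    then have "(\<lambda>\<omega>. F (\<omega> t)) \<in> borel_measurable (completion P)" by (rule measurable_completion)
    then show "p2 t \<in> borel_measurable (completion P)"
      unfolding p2_def by (intro measurable_If_set borel_measurable_const) (use \<Omega>0 in auto)
  next
    fix \<omega> :: "real \<Rightarrow> real ^ 'm" assume \<omega>: "\<omega> \<in> path_space"
    then have \<omega>c: "continuous_on UNIV \<omega>" by (simp add: path_space_def)
    show "continuous_on UNIV (\<lambda>t. p2 t \<omega>)"
      unfolding p2_def using continuous_on_compose2[OF Fc \<omega>c] by (cases "\<omega> \<in> \<Omega>0") auto
    show "poly_growth (\<lambda>t. p2 t \<omega>)"
    proof (cases "\<omega> \<in> \<Omega>0")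
      case True
      have "Lq_norm 2 \<Lambda> (QW \<phi> \<omega> t) powr 2 = (L2norm M (comb \<phi> (\<omega> t)))\<^sup>2" for t
        by (simp add: Lq_norm2 QW_comb)
      with growth[OF True] obtain n where n: "(\<lambda>t. (L2norm M (comb \<phi> (\<omega> t)))\<^sup>2) \<in> O[at_infinity](\<lambda>t. t ^ n)"
        by (auto simp: poly_growth_def)
      \<comment> \<open>The summand 1 inside the power has to be dominated as well; for |t| \<ge> 1
        it is at most |t|^n.\<close>
      have one: "(\<lambda>_. 1) \<in> O[at_infinity](\<lambda>t::real. t ^ n)"
      proof (rule bigoI[where c = 1])
        show "\<forall>\<^sub>F t::real in at_infinity. norm (1::real) \<le> 1 * norm (t ^ n)"
          unfolding eventually_at_infinity by (rule exI[of _ 1]) (auto simp: power_abs intro: one_le_power)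
      qed
      have "(\<lambda>_. K) \<in> O[at_infinity](\<lambda>_::real. 1 :: real)" by simp
      from landau_o.big_mult[OF this landau_o.big_power[OF sum_in_bigo(1)[OF one n], of "Suc k"]]
      have "(\<lambda>t. K * (1 + (L2norm M (comb \<phi> (\<omega> t)))\<^sup>2) ^ Suc k) \<in> O[at_infinity](\<lambda>t. t ^ (n * Suc k))"
        by (simp only: mult_1 power_mult)
      then show ?thesis unfolding poly_growth_def p2_def F_def if_P[OF True] by blast
    next
      case False
      then show ?thesis by (simp add: poly_growth_def p2_def)
    qed
  next
    fix x :: "'a \<Rightarrow> real" and \<omega> s assume x: "x \<in> Lq 2 \<Lambda>" and \<omega>: "\<omega> \<in> \<Omega>0"
    have \<omega>p: "\<omega> \<in> path_space" using \<omega> \<Omega>0_path by auto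
    then have \<omega>c: "continuous_on UNIV \<omega>" by (simp add: path_space_def)
    have xs: "sq_integrable M x" using x by (simp add: Lq2_iff)
    have p2: "(\<lambda>t. p2 t \<omega>) = (\<lambda>t. F (\<omega> t))" using \<omega> by (simp add: p2_def)
    show "\<exists>z. (\<forall>t\<ge>s. z t \<in> Lq 2 \<Lambda> \<and> Heq \<Lambda> (Z t s (embH \<Lambda> x) \<omega>) (embH \<Lambda> (z t))) \<and>
       (\<forall>t1 t2. s \<le> t1 \<longrightarrow> t1 \<le> t2 \<longrightarrow>
          integrable (lb t1 t2) (\<lambda>r. (Lq_norm 2 \<Lambda> (z r))\<^sup>2) \<and>
          (Lq_norm 2 \<Lambda> (z t2))\<^sup>2
            \<le> (Lq_norm 2 \<Lambda> (z t1))\<^sup>2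
              - \<alpha> * (LINT r|lb t1 t2. (Lq_norm 2 \<Lambda> (z r))\<^sup>2)
              + (LINT r|lb t1 t2. p2 r \<omega>)) \<and>
       (\<forall>t\<ge>s. ((\<lambda>r. Lq_norm 2 \<Lambda> (\<lambda>\<xi>. z r \<xi> - z t \<xi>)) \<longlongrightarrow> 0) (at_right t))"
    proof (rule P.solution_L2[of \<phi> \<omega> x s "\<lambda>t. Z t s (embH \<Lambda> x) \<omega>" \<alpha> "\<lambda>t. p2 t \<omega>", OF \<phi> \<omega>c xs])
      show "pathwise_solution \<Lambda> p \<Phi> \<phi> s (embH \<Lambda> x) \<omega> (\<lambda>t. Z t s (embH \<Lambda> x) \<omega>)"
        by (rule assms(8)[OF embH_Hdual[OF xs] \<omega>p])
      show "continuous_on UNIV (\<lambda>t. p2 t \<omega>)" unfolding p2 by (rule continuous_on_compose2[OF Fc \<omega>c]) simp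
      show "0 \<le> \<alpha>" using assms(10) by simp
      show "0 \<le> p2 t \<omega>" for t using F0 by (simp add: p2_def)
      show "- 2 * (n * ip (\<lambda>x. \<Phi> (Y x)) (\<lambda>x. (Y x - comb \<phi> (\<omega> t) x) - J n (\<lambda>x. Y x - comb \<phi> (\<omega> t) x) x))
          \<le> - \<alpha> * (L2norm M (\<lambda>x. Y x - comb \<phi> (\<omega> t) x))\<^sup>2 + p2 t \<omega>"
        if "5 * lam1 \<le> n" "Lp_integrable (p + 1) Y" for t n Y
        using K(2)[OF that, of "\<omega> t"] \<omega> unfolding p2_def F_def by (simp only: if_True)
    qed
  qed
qed

end
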